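(* Let $k$ be a commutative ring, $A$ a dg algebra over $k$, $n\ge 0$, and $A_n$ a cdg deformation of $A$ of order $n$ over $R_n=k[t]/(t^{n+1})$. For $0\le i\le n$ let $\mathcal T_i\subseteq D^n(A_n)$ be the full subcategory of modules $M$ such that $\mathrm{Gr}_t^j(M)=t^jM/t^{j+1}M$ is acyclic for all $j\ne i$, $0\le j\le n$. Then $D^n(A_n)$ admits a semiorthogonal decomposition $$D^n(A_n)=\langle\mathcal T_0,\mathcal T_1,\dots,\mathcal T_n\rangle,$$ and for each $i$ the functor $\mathrm{Gr}_t^i(-):D^n(A_n)\to D(A)$ restricts to an equivalence $\mathcal T_i\xrightarrow{\sim}D(A)$.
   Context: Graded objects are $\mathbb Z$-graded with cohomological differentials; algebras are associative and unital. A cdg algebra over a commutative ring $R$ is a graded $R$-algebra $\mathcal A$ with a degree $1$ derivation $d$ and a curvature $c\in\mathcal A^2$ with $d(c)=0$, $d^2=[c,-]$; a dg algebra is a cdg algebra with $c=0$. A (left) cdg $\mathcal A$-module is a graded left $\mathcal A$-module $M$ with a degree $1$ derivation $d_M$ over $d$ with $d_M^2m=cm$. The cdg modules form a dg category $\mathcal A\text{-Mod}$: the degree $p$ morphisms are the degree $p$ graded $\mathcal A$-linear maps, with differential $(df)(m)=d_N(f(m))-(-1)^pf(d_Mm)$. $\mathrm{Hot}(\mathcal A)=H^0(\mathcal A\text{-Mod})$ is triangulated. $D(A)$ is the usual derived category of the dg algebra $A$. A cdg deformation $A_n$ of order $n$ is a cdg algebra structure over $R_n=k[t]/(t^{n+1})$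 on $A\otimes_kR_n=A[t]/(t^{n+1})$ reducing modulo $t$ to the dg algebra $A$. For an $A_n$-module (left cdg module) $M$, $\mathrm{Gr}_t^i(M)=t^iM/t^{i+1}M$, $0\le i\le n$, is a dg $A$-module; $M$ is $n$-acyclic if all of these are acyclic. $D^n(A_n)$ is the Verdier quotient of $\mathrm{Hot}(A_n)$ by the $n$-acyclic modules; the functors $\mathrm{Gr}_t^i$ descend to $D^n(A_n)\to D(A)$. A semiorthogonal decomposition $\mathcal T=\langle\mathcal S_0,\dots,\mathcal S_n\rangle$ consists of full triangulated subcategories such that $\mathrm{Hom}_{\mathcal T}(S_j,S_i)=0$ for $S_j\in\mathcal S_j$, $S_i\in\mathcal S_i$, $j>i$, and every $X\in\mathcal T$ admits a chain $0=X_{n+1}\to X_n\to\dots\to X_0=X$ with the cone of $X_{i+1}\to X_i$ in $\mathcal S_i$ for all $i$. *)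

theory Defs
  imports "HOL-Algebra.Module" "HOL-Algebra.AbelCoset" "HOL-Library.Equipollence"
begin

section \<open>Curved dg algebras and their modules\<close>

text \<open>
  A graded \<open>R\<close>-module is a family of \<open>R\<close>-modules indexed by the integers; all operations below
  take the degrees of their arguments as explicit parameters.  The ring fields \<open>mult\<close> and \<open>one\<close>
  that the library's module record inherits are never used.
\<close>

definition gsgn :: "('r, 'm) module \<Rightarrow> int \<Rightarrow> 'm \<Rightarrow> 'm" where
  "gsgn G p x = (if even p then x else \<ominus>\<^bsub>G\<^esub> x)"

record ('r, 'a) cdg_alg =
  agr :: "int \<Rightarrow> ('r, 'a) module"
  amult :: "int \<Rightarrow> int \<Rightarrow> 'a \<Rightarrow> 'a \<Rightarrow> 'a"
  aone :: 'a
  adiff :: "int \<Rightarrow> 'a \<Rightarrow> 'a"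
  curv :: 'a

locale cdg_algebra =
  fixes R :: "'r ring" and A :: "('r, 'a) cdg_alg"
  assumes base: "cring R"
    and graded: "module R (agr A i)"
    and mult_closed: "\<lbrakk>a \<in> carrier (agr A i); b \<in> carrier (agr A j)\<rbrakk>
      \<Longrightarrow> amult A i j a b \<in> carrier (agr A (i + j))"
    and mult_add_left: "\<lbrakk>a \<in> carrier (agr A i); a' \<in> carrier (agr A i); b \<in> carrier (agr A j)\<rbrakk>
      \<Longrightarrow> amult A i j (a \<oplus>\<^bsub>agr A i\<^esub> a') b = amult A i j a b \<oplus>\<^bsub>agr A (i + j)\<^esub> amult A i j a' b"
    and mult_add_right: "\<lbrakk>a \<in> carrier (agr A i); b \<in> carrier (agr A j); b' \<in> carrier (agr A j)\<rbrakk>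
      \<Longrightarrow> amult A i j a (b \<oplus>\<^bsub>agr A j\<^esub> b') = amult A i j a b \<oplus>\<^bsub>agr A (i + j)\<^esub> amult A i j a b'"
    and mult_smult_left: "\<lbrakk>r \<in> carrier R; a \<in> carrier (agr A i); b \<in> carrier (agr A j)\<rbrakk>
      \<Longrightarrow> amult A i j (r \<odot>\<^bsub>agr A i\<^esub> a) b = r \<odot>\<^bsub>agr A (i + j)\<^esub> amult A i j a b"
    and mult_smult_right: "\<lbrakk>r \<in> carrier R; a \<in> carrier (agr A i); b \<in> carrier (agr A j)\<rbrakk>
      \<Longrightarrow> amult A i j a (r \<odot>\<^bsub>agr A j\<^esub> b) = r \<odot>\<^bsub>agr A (i + j)\<^esub> amult A i j a b"
    and mult_assoc: "\<lbrakk>a \<in> carrier (agr A i); b \<in> carrier (agr A j); c \<in> carrier (agr A l)\<rbrakk>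
      \<Longrightarrow> amult A (i + j) l (amult A i j a b) c = amult A i (j + l) a (amult A j l b c)"
    and one_closed: "aone A \<in> carrier (agr A 0)"
    and one_left: "a \<in> carrier (agr A i) \<Longrightarrow> amult A 0 i (aone A) a = a"
    and one_right: "a \<in> carrier (agr A i) \<Longrightarrow> amult A i 0 a (aone A) = a"
    and diff_closed: "a \<in> carrier (agr A i) \<Longrightarrow> adiff A i a \<in> carrier (agr A (i + 1))"
    and diff_add: "\<lbrakk>a \<in> carrier (agr A i); b \<in> carrier (agr A i)\<rbrakk>
      \<Longrightarrow> adiff A i (a \<oplus>\<^bsub>agr A i\<^esub> b) = adiff A i a \<oplus>\<^bsub>agr A (i + 1)\<^esub> adiff A i b"
    and diff_smult: "\<lbrakk>r \<in> carrier R; a \<in> carrier (agr A i)\<rbrakk>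
      \<Longrightarrow> adiff A i (r \<odot>\<^bsub>agr A i\<^esub> a) = r \<odot>\<^bsub>agr A (i + 1)\<^esub> adiff A i a"
    and leibniz: "\<lbrakk>a \<in> carrier (agr A i); b \<in> carrier (agr A j)\<rbrakk>
      \<Longrightarrow> adiff A (i + j) (amult A i j a b) =
          amult A (i + 1) j (adiff A i a) b
            \<oplus>\<^bsub>agr A (i + j + 1)\<^esub> gsgn (agr A (i + j + 1)) i (amult A i (j + 1) a (adiff A j b))"
    and curv_closed: "curv A \<in> carrier (agr A 2)"
    and diff_curv: "adiff A 2 (curv A) = \<zero>\<^bsub>agr A 3\<^esub>"
    and diff_diff: "a \<in> carrier (agr A i)
      \<Longrightarrow> adiff A (i + 1) (adiff A i a) =
          amult A 2 i (curv A) a \<ominus>\<^bsub>agr A (i + 2)\<^esub> amult A i 2 a (curv A)"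

definition dg_algebra :: "'r ring \<Rightarrow> ('r, 'a) cdg_alg \<Rightarrow> bool" where
  "dg_algebra R A \<longleftrightarrow> cdg_algebra R A \<and> curv A = \<zero>\<^bsub>agr A 2\<^esub>"

record ('r, 'a, 'm) cdg_mod =
  mgr :: "int \<Rightarrow> ('r, 'm) module"
  mact :: "int \<Rightarrow> int \<Rightarrow> 'a \<Rightarrow> 'm \<Rightarrow> 'm"
  mdiff :: "int \<Rightarrow> 'm \<Rightarrow> 'm"

locale cdg_module =
  fixes R :: "'r ring" and A :: "('r, 'a) cdg_alg" and M :: "('r, 'a, 'm) cdg_mod"
  assumes graded: "module R (mgr M i)"
    and act_closed: "\<lbrakk>a \<in> carrier (agr A i); m \<in> carrier (mgr M j)\<rbrakk>
      \<Longrightarrow> mact M i j a m \<in> carrier (mgr M (i + j))"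
    and act_add_left: "\<lbrakk>a \<in> carrier (agr A i); a' \<in> carrier (agr A i); m \<in> carrier (mgr M j)\<rbrakk>
      \<Longrightarrow> mact M i j (a \<oplus>\<^bsub>agr A i\<^esub> a') m = mact M i j a m \<oplus>\<^bsub>mgr M (i + j)\<^esub> mact M i j a' m"
    and act_add_right: "\<lbrakk>a \<in> carrier (agr A i); m \<in> carrier (mgr M j); m' \<in> carrier (mgr M j)\<rbrakk>
      \<Longrightarrow> mact M i j a (m \<oplus>\<^bsub>mgr M j\<^esub> m') = mact M i j a m \<oplus>\<^bsub>mgr M (i + j)\<^esub> mact M i j a m'"
    and act_smult_left: "\<lbrakk>r \<in> carrier R; a \<in> carrier (agr A i); m \<in> carrier (mgr M j)\<rbrakk>
      \<Longrightarrow> mact M i j (r \<odot>\<^bsub>agr A i\<^esub> a) m = r \<odot>\<^bsub>mgr M (i + j)\<^esub> mact M i j a m"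
    and act_smult_right: "\<lbrakk>r \<in> carrier R; a \<in> carrier (agr A i); m \<in> carrier (mgr M j)\<rbrakk>
      \<Longrightarrow> mact M i j a (r \<odot>\<^bsub>mgr M j\<^esub> m) = r \<odot>\<^bsub>mgr M (i + j)\<^esub> mact M i j a m"
    and act_assoc: "\<lbrakk>a \<in> carrier (agr A i); b \<in> carrier (agr A j); m \<in> carrier (mgr M l)\<rbrakk>
      \<Longrightarrow> mact M (i + j) l (amult A i j a b) m = mact M i (j + l) a (mact M j l b m)"
    and act_one: "m \<in> carrier (mgr M i) \<Longrightarrow> mact M 0 i (aone A) m = m"
    and diff_closed: "m \<in> carrier (mgr M i) \<Longrightarrow> mdiff M i m \<in> carrier (mgr M (i + 1))"
    and diff_add: "\<lbrakk>m \<in> carrier (mgr M i); m' \<in> carrier (mgr M i)\<rbrakk>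
      \<Longrightarrow> mdiff M i (m \<oplus>\<^bsub>mgr M i\<^esub> m') = mdiff M i m \<oplus>\<^bsub>mgr M (i + 1)\<^esub> mdiff M i m'"
    and leibniz: "\<lbrakk>a \<in> carrier (agr A i); m \<in> carrier (mgr M j)\<rbrakk>
      \<Longrightarrow> mdiff M (i + j) (mact M i j a m) =
          mact M (i + 1) j (adiff A i a) m
            \<oplus>\<^bsub>mgr M (i + j + 1)\<^esub> gsgn (mgr M (i + j + 1)) i (mact M i (j + 1) a (mdiff M j m))"
    and diff_diff: "m \<in> carrier (mgr M i)
      \<Longrightarrow> mdiff M (i + 1) (mdiff M i m) = mact M 2 i (curv A) m"

definition acyclic_mod :: "('r, 'a, 'm) cdg_mod \<Rightarrow> bool" where
  "acyclic_mod M \<longleftrightarrow> (\<forall>i. \<forall>m\<in>carrier (mgr M i). mdiff M i m = \<zero>\<^bsub>mgr M (i + 1)\<^esub>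
     \<longrightarrow> (\<exists>m'\<in>carrier (mgr M (i - 1)). mdiff M (i - 1) m' = m))"


section \<open>The dg category of cdg modules and its homotopy classes\<close>

text \<open>
  Degree \<open>p\<close> morphisms are graded \<open>A\<close>-linear with the Koszul sign \<open>f(am) = (-1)\<^sup>p\<^sup>i a f(m)\<close>
  for \<open>a\<close> of degree \<open>i\<close>.  Maps are considered only on the carriers; values elsewhere disappear
  on passing to homotopy classes.
\<close>

definition ghom :: "('r, 'a) cdg_alg \<Rightarrow> int \<Rightarrow> ('r, 'a, 'm) cdg_mod \<Rightarrow> ('r, 'a, 'n) cdg_mod
    \<Rightarrow> (int \<Rightarrow> 'm \<Rightarrow> 'n) set" where
  "ghom A p M N = {f.
     (\<forall>i. \<forall>m\<in>carrier (mgr M i). f i m \<in> carrier (mgr N (i + p))) \<and>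
     (\<forall>i. \<forall>m\<in>carrier (mgr M i). \<forall>m'\<in>carrier (mgr M i).
        f i (m \<oplus>\<^bsub>mgr M i\<^esub> m') = f i m \<oplus>\<^bsub>mgr N (i + p)\<^esub> f i m') \<and>
     (\<forall>i j. \<forall>a\<in>carrier (agr A i). \<forall>m\<in>carrier (mgr M j).
        f (i + j) (mact M i j a m)
          = gsgn (mgr N (i + j + p)) (p * i) (mact N i (j + p) a (f j m)))}"

definition dhom :: "int \<Rightarrow> ('r, 'a, 'm) cdg_mod \<Rightarrow> ('r, 'a, 'n) cdg_mod
    \<Rightarrow> (int \<Rightarrow> 'm \<Rightarrow> 'n) \<Rightarrow> int \<Rightarrow> 'm \<Rightarrow> 'n" where
  "dhom p M N f = (\<lambda>i m. mdiff N (i + p) (f i m)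
     \<ominus>\<^bsub>mgr N (i + p + 1)\<^esub> gsgn (mgr N (i + p + 1)) p (f (i + 1) (mdiff M i m)))"

definition closed0 :: "('r, 'a) cdg_alg \<Rightarrow> ('r, 'a, 'm) cdg_mod \<Rightarrow> ('r, 'a, 'n) cdg_mod
    \<Rightarrow> (int \<Rightarrow> 'm \<Rightarrow> 'n) set" where
  "closed0 A M N = {f \<in> ghom A 0 M N.
     \<forall>i. \<forall>m\<in>carrier (mgr M i). dhom 0 M N f i m = \<zero>\<^bsub>mgr N (i + 1)\<^esub>}"

definition htpy_rel :: "('r, 'a) cdg_alg \<Rightarrow> ('r, 'a, 'm) cdg_mod \<Rightarrow> ('r, 'a, 'n) cdg_mod
    \<Rightarrow> (int \<Rightarrow> 'm \<Rightarrow> 'n) rel" where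
  "htpy_rel A M N = {(f, g). f \<in> closed0 A M N \<and> g \<in> closed0 A M N \<and>
     (\<exists>h\<in>ghom A (- 1) M N. \<forall>i. \<forall>m\<in>carrier (mgr M i).
        g i m = f i m \<oplus>\<^bsub>mgr N i\<^esub> dhom (- 1) M N h i m)}"

abbreviation hcls :: "('r, 'a) cdg_alg \<Rightarrow> ('r, 'a, 'm) cdg_mod \<Rightarrow> ('r, 'a, 'n) cdg_mod
    \<Rightarrow> (int \<Rightarrow> 'm \<Rightarrow> 'n) \<Rightarrow> (int \<Rightarrow> 'm \<Rightarrow> 'n) set" where
  "hcls A M N f \<equiv> htpy_rel A M N `` {f}"

definition shift_mod :: "('r, 'a, 'm) cdg_mod \<Rightarrow> ('r, 'a, 'm) cdg_mod" where
  "shift_mod M = \<lparr>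
     mgr = (\<lambda>i. mgr M (i + 1)),
     mact = (\<lambda>i j a m. gsgn (mgr M (i + j + 1)) i (mact M i (j + 1) a m)),
     mdiff = (\<lambda>i m. \<ominus>\<^bsub>mgr M (i + 2)\<^esub> mdiff M (i + 1) m)\<rparr>"

text \<open>The underlying graded module of the cone of \<open>f: M \<rightarrow> N\<close> is the sum of \<open>N\<close> and \<open>M[1]\<close>.\<close>

definition cone_mod :: "('r, 'a, 'm) cdg_mod \<Rightarrow> ('r, 'a, 'n) cdg_mod \<Rightarrow> (int \<Rightarrow> 'm \<Rightarrow> 'n)
    \<Rightarrow> ('r, 'a, 'n \<times> 'm) cdg_mod" where
  "cone_mod M N f = \<lparr>
     mgr = (\<lambda>i. \<lparr>
       carrier = carrier (mgr N i) \<times> carrier (mgr M (i + 1)),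
       mult = undefined, one = undefined,
       zero = (\<zero>\<^bsub>mgr N i\<^esub>, \<zero>\<^bsub>mgr M (i + 1)\<^esub>),
       add = (\<lambda>(y, x) (y', x'). (y \<oplus>\<^bsub>mgr N i\<^esub> y', x \<oplus>\<^bsub>mgr M (i + 1)\<^esub> x')),
       smult = (\<lambda>r (y, x). (r \<odot>\<^bsub>mgr N i\<^esub> y, r \<odot>\<^bsub>mgr M (i + 1)\<^esub> x))\<rparr>),
     mact = (\<lambda>i j a (y, x). (mact N i j a y, mact (shift_mod M) i j a x)),
     mdiff = (\<lambda>i (y, x). (mdiff N i y \<oplus>\<^bsub>mgr N (i + 1)\<^esub> f (i + 1) x, mdiff (shift_mod M) i x))\<rparr>"


section \<open>Categories with shift and distinguished triangles\<close>

text \<open>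
  Hom sets of different pairs of objects need not be disjoint, so composition and the action of
  functors on morphisms take the objects as arguments.  \<open>Comp C X Y Z g f\<close> is \<open>g\<close> after \<open>f\<close>.
\<close>

record ('o, 'h) cat =
  Obj :: "'o set"
  Hom :: "'o \<Rightarrow> 'o \<Rightarrow> 'h set"
  Comp :: "'o \<Rightarrow> 'o \<Rightarrow> 'o \<Rightarrow> 'h \<Rightarrow> 'h \<Rightarrow> 'h"
  Idm :: "'o \<Rightarrow> 'h"

locale is_cat =
  fixes C :: "('o, 'h, 'z) cat_scheme"
  assumes id_hom: "X \<in> Obj C \<Longrightarrow> Idm C X \<in> Hom C X X"
    and comp_hom: "\<lbrakk>X \<in> Obj C; Y \<in> Obj C; Z \<in> Obj C; f \<in> Hom C X Y; g \<in> Hom C Y Z\<rbrakk>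
      \<Longrightarrow> Comp C X Y Z g f \<in> Hom C X Z"
    and comp_id: "\<lbrakk>X \<in> Obj C; Y \<in> Obj C; f \<in> Hom C X Y\<rbrakk> \<Longrightarrow> Comp C X X Y f (Idm C X) = f"
    and id_comp: "\<lbrakk>X \<in> Obj C; Y \<in> Obj C; f \<in> Hom C X Y\<rbrakk> \<Longrightarrow> Comp C X Y Y (Idm C Y) f = f"
    and comp_assoc: "\<lbrakk>X \<in> Obj C; Y \<in> Obj C; Z \<in> Obj C; W \<in> Obj C;
        f \<in> Hom C X Y; g \<in> Hom C Y Z; h \<in> Hom C Z W\<rbrakk>
      \<Longrightarrow> Comp C X Z W h (Comp C X Y Z g f) = Comp C X Y W (Comp C Y Z W h g) f"

definition iso_in :: "('o, 'h, 'z) cat_scheme \<Rightarrow> 'o \<Rightarrow> 'o \<Rightarrow> 'h \<Rightarrow> bool" where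
  "iso_in C X Y f \<longleftrightarrow> f \<in> Hom C X Y \<and>
     (\<exists>g\<in>Hom C Y X. Comp C X Y X g f = Idm C X \<and> Comp C Y X Y f g = Idm C Y)"

definition full_sub :: "('o, 'h, 'z) cat_scheme \<Rightarrow> 'o set \<Rightarrow> ('o, 'h) cat" where
  "full_sub C S = \<lparr>Obj = Obj C \<inter> S, Hom = Hom C, Comp = Comp C, Idm = Idm C\<rparr>"

record ('o, 'h, 'p, 'q) func =
  FO :: "'o \<Rightarrow> 'p"
  FM :: "'o \<Rightarrow> 'o \<Rightarrow> 'h \<Rightarrow> 'q"

locale is_func = dom: is_cat C + cod: is_cat D
  for C :: "('o, 'h, 'y) cat_scheme" and D :: "('p, 'q, 'z) cat_scheme" +
  fixes F :: "('o, 'h, 'p, 'q) func"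
  assumes obj: "X \<in> Obj C \<Longrightarrow> FO F X \<in> Obj D"
    and hom: "\<lbrakk>X \<in> Obj C; Y \<in> Obj C; f \<in> Hom C X Y\<rbrakk> \<Longrightarrow> FM F X Y f \<in> Hom D (FO F X) (FO F Y)"
    and ident: "X \<in> Obj C \<Longrightarrow> FM F X X (Idm C X) = Idm D (FO F X)"
    and comp: "\<lbrakk>X \<in> Obj C; Y \<in> Obj C; Z \<in> Obj C; f \<in> Hom C X Y; g \<in> Hom C Y Z\<rbrakk>
      \<Longrightarrow> FM F X Z (Comp C X Y Z g f)
          = Comp D (FO F X) (FO F Y) (FO F Z) (FM F Y Z g) (FM F X Y f)"

definition id_func :: "('o, 'h, 'o, 'h) func" where
  "id_func = \<lparr>FO = (\<lambda>X. X), FM = (\<lambda>X Y f. f)\<rparr>"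

definition comp_func :: "('p, 'q, 'r, 's) func \<Rightarrow> ('o, 'h, 'p, 'q) func \<Rightarrow> ('o, 'h, 'r, 's) func" where
  "comp_func G F = \<lparr>FO = (\<lambda>X. FO G (FO F X)), FM = (\<lambda>X Y f. FM G (FO F X) (FO F Y) (FM F X Y f))\<rparr>"

definition naturally_isomorphic :: "('o, 'h, 'y) cat_scheme \<Rightarrow> ('p, 'q, 'z) cat_scheme
    \<Rightarrow> ('o, 'h, 'p, 'q) func \<Rightarrow> ('o, 'h, 'p, 'q) func \<Rightarrow> bool" where
  "naturally_isomorphic C D F G \<longleftrightarrow> (\<exists>\<eta>.
     (\<forall>X\<in>Obj C. iso_in D (FO F X) (FO G X) (\<eta> X)) \<and>
     (\<forall>X\<in>Obj C. \<forall>Y\<in>Obj C. \<forall>f\<in>Hom C X Y.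
        Comp D (FO F X) (FO F Y) (FO G Y) (\<eta> Y) (FM F X Y f)
          = Comp D (FO F X) (FO G X) (FO G Y) (FM G X Y f) (\<eta> X)))"

definition cat_equivalence :: "('o, 'h, 'y) cat_scheme \<Rightarrow> ('p, 'q, 'z) cat_scheme
    \<Rightarrow> ('o, 'h, 'p, 'q) func \<Rightarrow> bool" where
  "cat_equivalence C D F \<longleftrightarrow> is_func C D F \<and>
     (\<exists>G. is_func D C G \<and> naturally_isomorphic C C (comp_func G F) id_func
        \<and> naturally_isomorphic D D (comp_func F G) id_func)"

record ('o, 'h) shift_cat = "('o, 'h) cat" +
  Zerom :: "'o \<Rightarrow> 'o \<Rightarrow> 'h"
  Sh :: "'o \<Rightarrow> 'o"
  Shm :: "'o \<Rightarrow> 'o \<Rightarrow> 'h \<Rightarrow> 'h"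

text \<open>A sextuple \<open>(X, Y, Z, u, v, w)\<close> stands for a triangle \<open>X \<rightarrow> Y \<rightarrow> Z \<rightarrow> X[1]\<close>.\<close>

type_synonym ('o, 'h) triangle = "'o \<times> 'o \<times> 'o \<times> 'h \<times> 'h \<times> 'h"

record ('o, 'h) tri_cat = "('o, 'h) shift_cat" +
  Dist :: "('o, 'h) triangle set"

definition triangle_in :: "('o, 'h, 'z) shift_cat_scheme \<Rightarrow> ('o, 'h) triangle \<Rightarrow> bool" where
  "triangle_in C = (\<lambda>(X, Y, Z, u, v, w). X \<in> Obj C \<and> Y \<in> Obj C \<and> Z \<in> Obj C \<and>
     u \<in> Hom C X Y \<and> v \<in> Hom C Y Z \<and> w \<in> Hom C Z (Sh C X))"

definition triangle_iso :: "('o, 'h, 'z) shift_cat_scheme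
    \<Rightarrow> ('o, 'h) triangle \<Rightarrow> ('o, 'h) triangle \<Rightarrow> bool" where
  "triangle_iso C = (\<lambda>(X, Y, Z, u, v, w) (X', Y', Z', u', v', w').
     \<exists>a b c. iso_in C X X' a \<and> iso_in C Y Y' b \<and> iso_in C Z Z' c \<and>
       Comp C X Y Y' b u = Comp C X X' Y' u' a \<and>
       Comp C Y Z Z' c v = Comp C Y Y' Z' v' b \<and>
       Comp C Z (Sh C X) (Sh C X') (Shm C X X' a) w = Comp C Z Z' (Sh C X') w' c)"

definition iso_closure :: "('o, 'h, 'z) shift_cat_scheme
    \<Rightarrow> ('o, 'h) triangle set \<Rightarrow> ('o, 'h) triangle set" where
  "iso_closure C D = {T. triangle_in C T \<and> (\<exists>T'\<in>D. triangle_in C T' \<and> triangle_iso C T T')}"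

definition is_zero :: "('o, 'h, 'z) shift_cat_scheme \<Rightarrow> 'o \<Rightarrow> bool" where
  "is_zero C X \<longleftrightarrow> X \<in> Obj C \<and> Idm C X = Zerom C X X"

definition triangulated_sub :: "('o, 'h, 'z) tri_cat_scheme \<Rightarrow> 'o set \<Rightarrow> bool" where
  "triangulated_sub T S \<longleftrightarrow> S \<subseteq> Obj T \<and> (\<exists>X\<in>S. is_zero T X) \<and>
     (\<forall>X\<in>S. \<forall>Y\<in>Obj T. (\<exists>f. iso_in T X Y f) \<longrightarrow> Y \<in> S) \<and>
     (\<forall>X\<in>Obj T. Sh T X \<in> S \<longleftrightarrow> X \<in> S) \<and>
     (\<forall>X Y Z u v w. (X, Y, Z, u, v, w) \<in> Dist T \<longrightarrow> X \<in> S \<longrightarrow> Y \<in> S \<longrightarrow> Z \<in> S)"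

definition semiorthogonal_decomposition ::
    "('o, 'h, 'z) tri_cat_scheme \<Rightarrow> nat \<Rightarrow> (nat \<Rightarrow> 'o set) \<Rightarrow> bool" where
  "semiorthogonal_decomposition T n S \<longleftrightarrow>
     (\<forall>i\<le>n. triangulated_sub T (S i)) \<and>
     (\<forall>i j. i < j \<and> j \<le> n \<longrightarrow> (\<forall>X\<in>S j. \<forall>Y\<in>S i. Hom T X Y = {Zerom T X Y})) \<and>
     (\<forall>X\<in>Obj T. \<exists>Xs fs. Xs 0 = X \<and> is_zero T (Xs (n + 1)) \<and>
        (\<forall>i\<le>n. \<exists>Z\<in>S i. \<exists>v w. (Xs (i + 1), Xs i, Z, fs i, v, w) \<in> Dist T))"


section \<open>Verdier quotients\<close>

text \<open>
  Morphisms \<open>X \<rightarrow> Y\<close> of \<open>T/N\<close> are classes of roofs \<open>X \<leftarrow> Z \<rightarrow> Y\<close>, encoded as \<open>(Z, s, f)\<close>, whose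
  left leg \<open>s\<close> has its cone in \<open>N\<close>; two roofs are identified when they have a common refinement.
\<close>

definition cone_in :: "('o, 'h, 'z) tri_cat_scheme \<Rightarrow> 'o set \<Rightarrow> 'o \<Rightarrow> 'o \<Rightarrow> 'h set" where
  "cone_in T N X Y = {f \<in> Hom T X Y. \<exists>Z\<in>N. \<exists>v w. (X, Y, Z, f, v, w) \<in> Dist T}"

type_synonym ('o, 'h) roof = "'o \<times> 'h \<times> 'h"

definition roofs :: "('o, 'h, 'z) tri_cat_scheme \<Rightarrow> 'o set \<Rightarrow> 'o \<Rightarrow> 'o \<Rightarrow> ('o, 'h) roof set" where
  "roofs T N X Y = {(Z, s, f). Z \<in> Obj T \<and> s \<in> cone_in T N Z X \<and> f \<in> Hom T Z Y}"

definition roof_rel :: "('o, 'h, 'z) tri_cat_scheme \<Rightarrow> 'o set \<Rightarrow> 'o \<Rightarrow> 'o \<Rightarrow> ('o, 'h) roof rel" where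
  "roof_rel T N X Y = {((Z, s, f), (Z', s', f')).
     (Z, s, f) \<in> roofs T N X Y \<and> (Z', s', f') \<in> roofs T N X Y \<and>
     (\<exists>W\<in>Obj T. \<exists>p\<in>Hom T W Z. \<exists>q\<in>Hom T W Z'.
        Comp T W Z X s p = Comp T W Z' X s' q \<and>
        Comp T W Z X s p \<in> cone_in T N W X \<and>
        Comp T W Z Y f p = Comp T W Z' Y f' q)}"

definition roof_comp :: "('o, 'h, 'z) tri_cat_scheme \<Rightarrow> 'o set \<Rightarrow> 'o \<Rightarrow> 'o \<Rightarrow> 'o
    \<Rightarrow> ('o, 'h) roof set \<Rightarrow> ('o, 'h) roof set \<Rightarrow> ('o, 'h) roof set" where
  "roof_comp T N X Y V G F = \<Union>{roof_rel T N X V `` {(P, Comp T P Z X s p, Comp T P W V g q)}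
     | P p q Z s f W t g. (Z, s, f) \<in> F \<and> (W, t, g) \<in> G \<and> P \<in> Obj T \<and>
         p \<in> cone_in T N P Z \<and> q \<in> Hom T P W \<and> Comp T P Z Y f p = Comp T P W Y t q}"

definition quot_mor :: "('o, 'h, 'z) tri_cat_scheme \<Rightarrow> 'o set \<Rightarrow> 'o \<Rightarrow> 'o \<Rightarrow> 'h \<Rightarrow> ('o, 'h) roof set" where
  "quot_mor T N X Y f = roof_rel T N X Y `` {(X, Idm T X, f)}"

definition verdier_shift_cat :: "('o, 'h, 'z) tri_cat_scheme \<Rightarrow> 'o set
    \<Rightarrow> ('o, ('o, 'h) roof set) shift_cat" where
  "verdier_shift_cat T N = \<lparr>
     Obj = Obj T,
     Hom = (\<lambda>X Y. roofs T N X Y // roof_rel T N X Y),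
     Comp = roof_comp T N,
     Idm = (\<lambda>X. quot_mor T N X X (Idm T X)),
     Zerom = (\<lambda>X Y. quot_mor T N X Y (Zerom T X Y)),
     Sh = Sh T,
     Shm = (\<lambda>X Y F. \<Union>(Z, s, f)\<in>F.
       roof_rel T N (Sh T X) (Sh T Y) `` {(Sh T Z, Shm T Z X s, Shm T Z Y f)})\<rparr>"

definition verdier :: "('o, 'h, 'z) tri_cat_scheme \<Rightarrow> 'o set
    \<Rightarrow> ('o, ('o, 'h) roof set) tri_cat" where
  "verdier T N = shift_cat.extend (verdier_shift_cat T N) (tri_cat.fields
     (iso_closure (verdier_shift_cat T N)
       {(X, Y, Z, quot_mor T N X Y u, quot_mor T N Y Z v, quot_mor T N Z (Sh T X) w)
         | X Y Z u v w. (X, Y, Z, u, v, w) \<in> Dist T}))"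

text \<open>The functor between Verdier quotients induced by a functor that maps \<open>N\<close> into \<open>N'\<close>.\<close>

definition verdier_func :: "('p, 'q, 'z) tri_cat_scheme \<Rightarrow> 'p set \<Rightarrow> ('o, 'h, 'p, 'q) func
    \<Rightarrow> ('o, ('o, 'h) roof set, 'p, ('p, 'q) roof set) func" where
  "verdier_func T' N' F = \<lparr>
     FO = FO F,
     FM = (\<lambda>X Y G. \<Union>(Z, s, f)\<in>G.
       roof_rel T' N' (FO F X) (FO F Y) `` {(FO F Z, FM F Z X s, FM F Z Y f)})\<rparr>"


section \<open>The homotopy category and the derived category\<close>

text \<open>
  The type \<open>'m\<close> is the universe: objects are the cdg modules whose elements are taken from \<open>'m\<close>.
  It is closed under cones, free modules and the like once it is infinite and at least as large as
  the graded pieces of the algebra.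
\<close>

definition Hot_shift_cat :: "'r ring \<Rightarrow> ('r, 'a) cdg_alg
    \<Rightarrow> (('r, 'a, 'm) cdg_mod, (int \<Rightarrow> 'm \<Rightarrow> 'm) set) shift_cat" where
  "Hot_shift_cat R A = \<lparr>
     Obj = {M. cdg_module R A M},
     Hom = (\<lambda>M N. closed0 A M N // htpy_rel A M N),
     Comp = (\<lambda>L M N G F. \<Union>g\<in>G. \<Union>f\<in>F. hcls A L N (\<lambda>i x. g i (f i x))),
     Idm = (\<lambda>M. hcls A M M (\<lambda>i x. x)),
     Zerom = (\<lambda>M N. hcls A M N (\<lambda>i x. \<zero>\<^bsub>mgr N i\<^esub>)),
     Sh = shift_mod,
     Shm = (\<lambda>M N F. \<Union>f\<in>F. hcls A (shift_mod M) (shift_mod N) (\<lambda>i. f (i + 1)))\<rparr>"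

text \<open>
  The cone of \<open>f\<close> lives on pairs; \<open>C\<close> is a copy of it inside the universe, identified with it by
  the mutually inverse closed isomorphisms \<open>\<phi>\<close> and \<open>\<psi>\<close>.
\<close>

definition standard_triangles :: "'r ring \<Rightarrow> ('r, 'a) cdg_alg
    \<Rightarrow> (('r, 'a, 'm) cdg_mod, (int \<Rightarrow> 'm \<Rightarrow> 'm) set) triangle set" where
  "standard_triangles R A =
     {(M, N, C, hcls A M N f,
        hcls A N C (\<lambda>i y. \<phi> i (y, \<zero>\<^bsub>mgr M (i + 1)\<^esub>)),
        hcls A C (shift_mod M) (\<lambda>i z. snd (\<psi> i z)))
      | M N C f \<phi> \<psi>. cdg_module R A M \<and> cdg_module R A N \<and> cdg_module R A C \<and>
          f \<in> closed0 A M N \<and>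
          \<phi> \<in> closed0 A (cone_mod M N f) C \<and> \<psi> \<in> closed0 A C (cone_mod M N f) \<and>
          (\<forall>i. \<forall>x\<in>carrier (mgr (cone_mod M N f) i). \<psi> i (\<phi> i x) = x) \<and>
          (\<forall>i. \<forall>z\<in>carrier (mgr C i). \<phi> i (\<psi> i z) = z)}"

definition Hot :: "'r ring \<Rightarrow> ('r, 'a) cdg_alg
    \<Rightarrow> (('r, 'a, 'm) cdg_mod, (int \<Rightarrow> 'm \<Rightarrow> 'm) set) tri_cat" where
  "Hot R A = shift_cat.extend (Hot_shift_cat R A)
     (tri_cat.fields (iso_closure (Hot_shift_cat R A) (standard_triangles R A)))"

type_synonym ('r, 'a, 'm) der_hom = "(('r, 'a, 'm) cdg_mod, (int \<Rightarrow> 'm \<Rightarrow> 'm) set) roof set"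

definition acyclics :: "'r ring \<Rightarrow> ('r, 'a) cdg_alg \<Rightarrow> ('r, 'a, 'm) cdg_mod set" where
  "acyclics R A = {M. cdg_module R A M \<and> acyclic_mod M}"

definition Der :: "'r ring \<Rightarrow> ('r, 'a) cdg_alg
    \<Rightarrow> (('r, 'a, 'm) cdg_mod, ('r, 'a, 'm) der_hom) tri_cat" where
  "Der R A = verdier (Hot R A) (acyclics R A)"


section \<open>Deformations over truncated polynomial rings\<close>

text \<open>
  An element of \<open>k[t]/(t\<^sup>n\<^sup>+\<^sup>1)\<close> or of \<open>M[t]/(t\<^sup>n\<^sup>+\<^sup>1)\<close> is its coefficient function on \<open>{..n}\<close>.
\<close>

definition trunc_poly :: "'k ring \<Rightarrow> nat \<Rightarrow> (nat \<Rightarrow> 'k) ring" where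
  "trunc_poly k n = \<lparr>
     carrier = {..n} \<rightarrow>\<^sub>E carrier k,
     mult = (\<lambda>p q. \<lambda>l\<in>{..n}. \<Oplus>\<^bsub>k\<^esub>i\<in>{..l}. p i \<otimes>\<^bsub>k\<^esub> q (l - i)),
     one = (\<lambda>l\<in>{..n}. if l = 0 then \<one>\<^bsub>k\<^esub> else \<zero>\<^bsub>k\<^esub>),
     zero = (\<lambda>l\<in>{..n}. \<zero>\<^bsub>k\<^esub>),
     add = (\<lambda>p q. \<lambda>l\<in>{..n}. p l \<oplus>\<^bsub>k\<^esub> q l)\<rparr>"

definition tvar :: "'k ring \<Rightarrow> nat \<Rightarrow> nat \<Rightarrow> 'k" where
  "tvar k n = (\<lambda>l\<in>{..n}. if l = 1 then \<one>\<^bsub>k\<^esub> else \<zero>\<^bsub>k\<^esub>)"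

definition trunc_mod :: "nat \<Rightarrow> ('k, 'm) module \<Rightarrow> (nat \<Rightarrow> 'k, nat \<Rightarrow> 'm) module" where
  "trunc_mod n M = \<lparr>
     carrier = {..n} \<rightarrow>\<^sub>E carrier M,
     mult = undefined, one = undefined,
     zero = (\<lambda>l\<in>{..n}. \<zero>\<^bsub>M\<^esub>),
     add = (\<lambda>x y. \<lambda>l\<in>{..n}. x l \<oplus>\<^bsub>M\<^esub> y l),
     smult = (\<lambda>r x. \<lambda>l\<in>{..n}. \<Oplus>\<^bsub>M\<^esub>i\<in>{..l}. r i \<odot>\<^bsub>M\<^esub> x (l - i))\<rparr>"

definition const_poly :: "nat \<Rightarrow> 'x \<Rightarrow> 'x \<Rightarrow> nat \<Rightarrow> 'x" where
  "const_poly n z x = (\<lambda>l\<in>{..n}. if l = 0 then x else z)"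

text \<open>Reduction modulo \<open>t\<close> is evaluation of coefficient functions at \<open>0\<close>.\<close>

locale cdg_deformation = cdg_algebra "trunc_poly k n" A\<^sub>n
  for k :: "'k ring" and A :: "('k, 'a) cdg_alg" and n :: nat
    and A\<^sub>n :: "(nat \<Rightarrow> 'k, nat \<Rightarrow> 'a) cdg_alg" +
  assumes underlying: "agr A\<^sub>n i = trunc_mod n (agr A i)"
    and red_mult: "\<lbrakk>x \<in> carrier (agr A\<^sub>n i); y \<in> carrier (agr A\<^sub>n j)\<rbrakk>
      \<Longrightarrow> amult A\<^sub>n i j x y 0 = amult A i j (x 0) (y 0)"
    and red_one: "aone A\<^sub>n 0 = aone A"
    and red_diff: "x \<in> carrier (agr A\<^sub>n i) \<Longrightarrow> adiff A\<^sub>n i x 0 = adiff A i (x 0)"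
    and red_curv: "curv A\<^sub>n 0 = curv A"

type_synonym ('k, 'a, 'm) def_mod = "(nat \<Rightarrow> 'k, nat \<Rightarrow> 'a, 'm) cdg_mod"

definition tpart :: "'k ring \<Rightarrow> nat \<Rightarrow> ('k, 'a, 'm) def_mod \<Rightarrow> nat \<Rightarrow> int \<Rightarrow> 'm set" where
  "tpart k n M i j =
     (\<lambda>m. (tvar k n [^]\<^bsub>trunc_poly k n\<^esub> i) \<odot>\<^bsub>mgr M j\<^esub> m) ` carrier (mgr M j)"

text \<open>
  \<open>Gr_mod k A n i M\<close> is the quotient of \<open>t\<^sup>i M\<close> by \<open>t\<^sup>i\<^sup>+\<^sup>1 M\<close>, with cosets as elements.
  Elements of \<open>k\<close> and \<open>A\<close> act through their constant lifts; every lift induces the same operation.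
\<close>

definition Gr_mod :: "'k ring \<Rightarrow> ('k, 'a) cdg_alg \<Rightarrow> nat \<Rightarrow> nat \<Rightarrow> ('k, 'a, 'm) def_mod
    \<Rightarrow> ('k, 'a, 'm set) cdg_mod" where
  "Gr_mod k A n i M = \<lparr>
     mgr = (\<lambda>j. \<lparr>
       carrier = (\<lambda>x. tpart k n M (i + 1) j +>\<^bsub>mgr M j\<^esub> x) ` tpart k n M i j,
       mult = undefined, one = undefined,
       zero = tpart k n M (i + 1) j,
       add = (\<lambda>X Y. X <+>\<^bsub>mgr M j\<^esub> Y),
       smult = (\<lambda>r X. \<Union>x\<in>X.
         tpart k n M (i + 1) j +>\<^bsub>mgr M j\<^esub> (const_poly n \<zero>\<^bsub>k\<^esub> r \<odot>\<^bsub>mgr M j\<^esub> x))\<rparr>),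
     mact = (\<lambda>l j a X. \<Union>x\<in>X.
       tpart k n M (i + 1) (l + j) +>\<^bsub>mgr M (l + j)\<^esub> mact M l j (const_poly n \<zero>\<^bsub>agr A l\<^esub> a) x),
     mdiff = (\<lambda>j X. \<Union>x\<in>X. tpart k n M (i + 1) (j + 1) +>\<^bsub>mgr M (j + 1)\<^esub> mdiff M j x)\<rparr>"

definition Gr_map :: "'k ring \<Rightarrow> nat \<Rightarrow> nat \<Rightarrow> ('k, 'a, 'm) def_mod
    \<Rightarrow> (int \<Rightarrow> 'm \<Rightarrow> 'm) \<Rightarrow> int \<Rightarrow> 'm set \<Rightarrow> 'm set" where
  "Gr_map k n i N f = (\<lambda>j X. \<Union>x\<in>X. tpart k n N (i + 1) j +>\<^bsub>mgr N j\<^esub> f j x)"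

definition n_acyclics :: "'k ring \<Rightarrow> ('k, 'a) cdg_alg \<Rightarrow> nat
    \<Rightarrow> (nat \<Rightarrow> 'k, nat \<Rightarrow> 'a) cdg_alg \<Rightarrow> ('k, 'a, 'm) def_mod set" where
  "n_acyclics k A n A\<^sub>n = {M. cdg_module (trunc_poly k n) A\<^sub>n M \<and>
     (\<forall>i\<le>n. acyclic_mod (Gr_mod k A n i M))}"

definition nDer :: "'k ring \<Rightarrow> ('k, 'a) cdg_alg \<Rightarrow> nat \<Rightarrow> (nat \<Rightarrow> 'k, nat \<Rightarrow> 'a) cdg_alg
    \<Rightarrow> (('k, 'a, 'm) def_mod, (nat \<Rightarrow> 'k, nat \<Rightarrow> 'a, 'm) der_hom) tri_cat" where
  "nDer k A n A\<^sub>n = verdier (Hot (trunc_poly k n) A\<^sub>n) (n_acyclics k A n A\<^sub>n)"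

definition only_Gr :: "'k ring \<Rightarrow> ('k, 'a) cdg_alg \<Rightarrow> nat \<Rightarrow> (nat \<Rightarrow> 'k, nat \<Rightarrow> 'a) cdg_alg
    \<Rightarrow> nat \<Rightarrow> ('k, 'a, 'm) def_mod set" where
  "only_Gr k A n A\<^sub>n i = {M \<in> Obj (nDer k A n A\<^sub>n).
     \<forall>j\<le>n. j \<noteq> i \<longrightarrow> acyclic_mod (Gr_mod k A n j M)}"

text \<open>
  \<open>Gr_mod\<close> has its elements in \<open>'m set\<close>.  To obtain a functor between categories over the same
  universe \<open>'m\<close>, its structure is transported along the injection that sends a coset to a chosen
  representative.
\<close>

definition transport :: "('x \<Rightarrow> 'm) \<Rightarrow> ('r, 'a, 'x) cdg_mod \<Rightarrow> ('r, 'a, 'm) cdg_mod" where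
  "transport \<phi> M = (let \<psi> = (\<lambda>j. inv_into (carrier (mgr M j)) \<phi>) in \<lparr>
     mgr = (\<lambda>j. \<lparr>
       carrier = \<phi> ` carrier (mgr M j),
       mult = undefined, one = undefined,
       zero = \<phi> \<zero>\<^bsub>mgr M j\<^esub>,
       add = (\<lambda>x y. \<phi> (\<psi> j x \<oplus>\<^bsub>mgr M j\<^esub> \<psi> j y)),
       smult = (\<lambda>r x. \<phi> (r \<odot>\<^bsub>mgr M j\<^esub> \<psi> j x))\<rparr>),
     mact = (\<lambda>l j a x. \<phi> (mact M l j a (\<psi> j x))),
     mdiff = (\<lambda>j x. \<phi> (mdiff M j (\<psi> j x)))\<rparr>)"

definition coset_rep :: "'m set \<Rightarrow> 'm" where
  "coset_rep X = (SOME x. x \<in> X)"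

definition Gr_Hot :: "'k ring \<Rightarrow> ('k, 'a) cdg_alg \<Rightarrow> nat \<Rightarrow> nat
    \<Rightarrow> (('k, 'a, 'm) def_mod, (int \<Rightarrow> 'm \<Rightarrow> 'm) set,
        ('k, 'a, 'm) cdg_mod, (int \<Rightarrow> 'm \<Rightarrow> 'm) set) func" where
  "Gr_Hot k A n i = (let G = (\<lambda>M. transport coset_rep (Gr_mod k A n i M)) in \<lparr>
     FO = G,
     FM = (\<lambda>M N F. \<Union>f\<in>F. hcls A (G M) (G N)
       (\<lambda>j x. coset_rep (Gr_map k n i N f j
          (inv_into (carrier (mgr (Gr_mod k A n i M) j)) coset_rep x))))\<rparr>)"

definition Gr :: "'k ring \<Rightarrow> ('k, 'a) cdg_alg \<Rightarrow> nat \<Rightarrow> nat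
    \<Rightarrow> (('k, 'a, 'm) def_mod, (nat \<Rightarrow> 'k, nat \<Rightarrow> 'a, 'm) der_hom,
        ('k, 'a, 'm) cdg_mod, ('k, 'a, 'm) der_hom) func" where
  "Gr k A n i = verdier_func (Hot k A) (acyclics k A) (Gr_Hot k A n i)"

end

theory Submission
  imports Defs
begin

text \<open>
  Write \<open>\<tau>\<^sub>j M\<close> for the multiples of \<open>t\<^sup>j\<close>.  Acyclicity of the graded pieces and quasi-isomorphisms
  on them are expressed by elements of \<open>M\<close> itself; a morphism has an \<open>n\<close>-acyclic cone iff it is a
  quasi-isomorphism on every graded piece, and homotopy fibres of maps to acyclic modules give the
  calculus of fractions.  The same arguments with \<open>n = 0\<close> apply to \<open>D(A)\<close>.

  The decomposition comes from the fibres of \<open>X \<rightarrow> X / \<tau>\<^sub>i\<^sub>+\<^sub>1 X\<close>; orthogonality holds because a map to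
  a module killed by \<open>t\<^sup>i\<^sup>+\<^sup>1\<close> factors through the quotient of its source by \<open>\<tau>\<^sub>i\<^sub>+\<^sub>1\<close>.

  For the equivalence, let \<open>\<epsilon> : G \<rightarrow> N\<close> be a surjection from a free contractible cdg module over the
  deformation to a dg module over \<open>A\<close>, and let \<open>\<Gamma> = G / t\<^sup>i ker \<epsilon>\<close>.  Then \<open>t\<^sup>i\<^sup>+\<^sup>1 \<Gamma> = 0\<close>, the \<open>i\<close>-th graded
  piece of \<open>\<Gamma>\<close> is \<open>N\<close>, and the lower pieces are those of \<open>G\<close>, hence acyclic.  If \<open>t\<^sup>i\<^sup>+\<^sup>1 Y = 0\<close>, every
  homogeneous linear map from \<open>N\<close> to the \<open>i\<close>-th graded piece of \<open>Y\<close> lifts to \<open>\<Gamma> \<rightarrow> Y\<close> because \<open>G\<close> is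
  free.  Lifting maps gives fullness, lifting homotopies gives faithfulness.
\<close>

section \<open>Localisation by a right calculus of fractions\<close>

text \<open>Curvature leaves a module over the deformation without cohomology: only its graded
  pieces are complexes. Hence maps are tested piece by piece, and freeness requires a generator d e
  besides e. Right fractions fit because homotopy fibres supply maps into a given module. No adjoint
  functor is constructed. \<Gamma> depends on chosen lifts and is functorial only after
  localisation, so the proof establishes lifting and uniqueness properties of \<Gamma> and an
  abstract criterion turns them into an equivalence. Two obstacles shape this. A module whose only
  non-acyclic piece is the i-th need not be killed by t^(i+1), as lifting demands; truncation
  replaces it by an isomorphic one that is. Moreover a lifted homotopy covers the given one only on
  the i-th piece, so a difference remains which is zero in the localisation because it factors
  through \<Gamma> / t^i \<Gamma>, all of whose pieces are acyclic. Freeness enters twice: for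
  lifting, and because t^i g = 0 with i <= n forces \<epsilon>(g) = 0, so that t^i G / t^i ker
  \<epsilon> is N.\<close>

locale fractions = is_cat T
  for T :: "('o, 'h, 'z) tri_cat_scheme" +
  fixes N :: "'o set"
  assumes W_id: "X \<in> Obj T \<Longrightarrow> Idm T X \<in> cone_in T N X X"
    and W_comp: "\<lbrakk>X \<in> Obj T; Y \<in> Obj T; Z \<in> Obj T; f \<in> cone_in T N X Y; g \<in> cone_in T N Y Z\<rbrakk>
      \<Longrightarrow> Comp T X Y Z g f \<in> cone_in T N X Z"
    and W_cancel: "\<lbrakk>X \<in> Obj T; Y \<in> Obj T; Z \<in> Obj T; f \<in> Hom T X Y; g \<in> cone_in T N Y Z;
        Comp T X Y Z g f \<in> cone_in T N X Z\<rbrakk> \<Longrightarrow> f \<in> cone_in T N X Y"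
    and ore: "\<lbrakk>X \<in> Obj T; Y \<in> Obj T; Z \<in> Obj T; f \<in> Hom T X Z; s \<in> cone_in T N Y Z\<rbrakk>
      \<Longrightarrow> \<exists>P\<in>Obj T. \<exists>p\<in>cone_in T N P X. \<exists>q\<in>Hom T P Y. Comp T P X Z f p = Comp T P Y Z s q"
    and cancel: "\<lbrakk>X \<in> Obj T; Y \<in> Obj T; Z \<in> Obj T; f \<in> Hom T X Y; g \<in> Hom T X Y;
        s \<in> cone_in T N Y Z; Comp T X Y Z s f = Comp T X Y Z s g\<rbrakk>
      \<Longrightarrow> \<exists>P\<in>Obj T. \<exists>p\<in>cone_in T N P X. Comp T P X Y f p = Comp T P X Y g p"
begin

abbreviation W where "W \<equiv> cone_in T N"
abbreviation c where "c \<equiv> Comp T"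
abbreviation rc where "rc X Y R \<equiv> roof_rel T N X Y `` {R}"

lemma W_hom [simp, dest]: "f \<in> W X Y \<Longrightarrow> f \<in> Hom T X Y"
  by (simp add: cone_in_def)

declare comp_hom [simp] id_hom [simp] W_id [simp] W_comp [simp] comp_id [simp] id_comp [simp]

lemma assoc: "\<lbrakk>X \<in> Obj T; Y \<in> Obj T; Z \<in> Obj T; V \<in> Obj T;
    f \<in> Hom T X Y; g \<in> Hom T Y Z; h \<in> Hom T Z V\<rbrakk>
  \<Longrightarrow> c X Y V (c Y Z V h g) f = c X Z V h (c X Y Z g f)"
  by (rule comp_assoc[symmetric])

lemma square_ext:
  assumes "X \<in> Obj T" "Y \<in> Obj T" "Y' \<in> Obj T" "Z \<in> Obj T" "V \<in> Obj T"
    "p \<in> Hom T X Y" "f \<in> Hom T Y Z" "q \<in> Hom T X Y'" "g \<in> Hom T Y' Z" "r \<in> Hom T V X"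
    "c X Y Z f p = c X Y' Z g q"
  shows "c V Y Z f (c V X Y p r) = c V Y' Z g (c V X Y' q r)"
  using assms by (metis comp_assoc)

lemma roof_iff [simp]:
  "(Z, s, f) \<in> roofs T N X Y \<longleftrightarrow> Z \<in> Obj T \<and> s \<in> W Z X \<and> f \<in> Hom T Z Y"
  by (simp add: roofs_def)

lemma roof_relI:
  assumes "X \<in> Obj T" "Y \<in> Obj T" "Z \<in> Obj T" "Z' \<in> Obj T"
    "s \<in> W Z X" "f \<in> Hom T Z Y" "s' \<in> W Z' X" "f' \<in> Hom T Z' Y"
    "V \<in> Obj T" "p \<in> W V Z" "q \<in> Hom T V Z'"
    "c V Z X s p = c V Z' X s' q" "c V Z Y f p = c V Z' Y f' q"
  shows "((Z, s, f), (Z', s', f')) \<in> roof_rel T N X Y"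
proof -
  have "c V Z X s p \<in> W V X" by (rule W_comp) (use assms in auto)
  then show ?thesis
    unfolding roof_rel_def using assms by (simp del: W_comp) (metis W_hom)
qed

text \<open>\<open>W_cancel\<close> puts both legs of a common refinement into \<open>W\<close>,
  although \<open>roof_rel\<close> asks this only of the composite. Refinements can therefore be
  refined further from either side.\<close>

lemma roof_relE:
  assumes "((Z, s, f), (Z', s', f')) \<in> roof_rel T N X Y" "X \<in> Obj T" "Y \<in> Obj T"
  obtains V p q where "Z \<in> Obj T" "Z' \<in> Obj T" "s \<in> W Z X" "f \<in> Hom T Z Y"
    "s' \<in> W Z' X" "f' \<in> Hom T Z' Y" "V \<in> Obj T" "p \<in> W V Z" "q \<in> W V Z'"
    "c V Z X s p = c V Z' X s' q" "c V Z Y f p = c V Z' Y f' q"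
proof -
  from assms(1) obtain V p q where *: "(Z, s, f) \<in> roofs T N X Y" "(Z', s', f') \<in> roofs T N X Y"
    "V \<in> Obj T" "p \<in> Hom T V Z" "q \<in> Hom T V Z'" "c V Z X s p = c V Z' X s' q"
    "c V Z X s p \<in> W V X" "c V Z Y f p = c V Z' Y f' q"
    unfolding roof_rel_def by blast
  then have "p \<in> W V Z" "q \<in> W V Z'"
    using W_cancel[of V Z X p s] W_cancel[of V Z' X q s'] assms(2,3) by auto
  then show thesis using * that by auto
qed

lemma roof_equiv:
  assumes X: "X \<in> Obj T" and Y: "Y \<in> Obj T"
  shows "equiv (roofs T N X Y) (roof_rel T N X Y)"
proof (rule equivI)
  show "roof_rel T N X Y \<subseteq> roofs T N X Y \<times> roofs T N X Y"
    unfolding roof_rel_def by auto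
  show "refl_on (roofs T N X Y) (roof_rel T N X Y)"
  proof (rule refl_onI)
    fix R assume "R \<in> roofs T N X Y"
    then obtain Z s f where R: "R = (Z, s, f)" "Z \<in> Obj T" "s \<in> W Z X" "f \<in> Hom T Z Y"
      by (cases R) auto
    show "(R, R) \<in> roof_rel T N X Y" unfolding R(1)
      by (rule roof_relI[of _ _ _ _ _ _ _ _ Z "Idm T Z" "Idm T Z"]) (use X Y R in auto)
  qed
  show "sym (roof_rel T N X Y)"
  proof (rule symI)
    fix R R' assume h: "(R, R') \<in> roof_rel T N X Y"
    obtain Z s f Z' s' f' where R: "R = (Z, s, f)" "R' = (Z', s', f')" by (metis prod_cases3)
    show "(R', R) \<in> roof_rel T N X Y" unfolding R
      by (rule roof_relE[OF h[unfolded R] X Y]) (metis roof_relI X Y W_hom)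
  qed
  show "trans (roof_rel T N X Y)"
  proof (rule transI)
    fix R1 R2 R3
    assume 1: "(R1, R2) \<in> roof_rel T N X Y" and 2: "(R2, R3) \<in> roof_rel T N X Y"
    obtain Z1 s1 f1 Z2 s2 f2 Z3 s3 f3
      where R: "R1 = (Z1, s1, f1)" "R2 = (Z2, s2, f2)" "R3 = (Z3, s3, f3)"
      by (metis prod_cases3)
    obtain V p q where a: "Z1 \<in> Obj T" "Z2 \<in> Obj T" "s1 \<in> W Z1 X" "f1 \<in> Hom T Z1 Y"
      "s2 \<in> W Z2 X" "f2 \<in> Hom T Z2 Y" "V \<in> Obj T" "p \<in> W V Z1" "q \<in> W V Z2"
      "c V Z1 X s1 p = c V Z2 X s2 q" "c V Z1 Y f1 p = c V Z2 Y f2 q"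
      using roof_relE[OF 1[unfolded R] X Y] by metis
    obtain V' p' q' where b: "Z3 \<in> Obj T" "s3 \<in> W Z3 X" "f3 \<in> Hom T Z3 Y"
      "V' \<in> Obj T" "p' \<in> W V' Z2" "q' \<in> W V' Z3"
      "c V' Z2 X s2 p' = c V' Z3 X s3 q'" "c V' Z2 Y f2 p' = c V' Z3 Y f3 q'"
      using roof_relE[OF 2[unfolded R] X Y] by metis
    \<comment> \<open>The two refinements meet in the middle roof \<open>Z2\<close>; the corner of
      the square over it refines the outer roofs as well.\<close>
    obtain P r r' where o: "P \<in> Obj T" "r \<in> W P V" "r' \<in> Hom T P V'"
      "c P V Z2 q r = c P V' Z2 p' r'"
      using ore[of V V' Z2 q p'] a b by auto
    have "c P Z1 X s1 (c P V Z1 p r) = c P Z2 X s2 (c P V Z2 q r)"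
      by (rule square_ext) (use a b o X Y in auto)
    also have "\<dots> = c P Z3 X s3 (c P V' Z3 q' r')"
      unfolding o by (rule square_ext) (use a b o X Y in auto)
    finally have s: "c P Z1 X s1 (c P V Z1 p r) = c P Z3 X s3 (c P V' Z3 q' r')" .
    have "c P Z1 Y f1 (c P V Z1 p r) = c P Z2 Y f2 (c P V Z2 q r)"
      by (rule square_ext) (use a b o X Y in auto)
    also have "\<dots> = c P Z3 Y f3 (c P V' Z3 q' r')"
      unfolding o by (rule square_ext) (use a b o X Y in auto)
    finally have f: "c P Z1 Y f1 (c P V Z1 p r) = c P Z3 Y f3 (c P V' Z3 q' r')" .
    show "(R1, R3) \<in> roof_rel T N X Y" unfolding R
      by (rule roof_relI[OF _ _ _ _ _ _ _ _ _ _ _ s f]) (use a b o X Y in auto)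
  qed
qed

lemma rc_eq_iff:
  assumes "X \<in> Obj T" "Y \<in> Obj T" "R \<in> roofs T N X Y" "R' \<in> roofs T N X Y"
  shows "rc X Y R = rc X Y R' \<longleftrightarrow> (R, R') \<in> roof_rel T N X Y"
  using eq_equiv_class_iff[OF roof_equiv] assms by metis

lemma rc_self:
  assumes "X \<in> Obj T" "Y \<in> Obj T" "R \<in> roofs T N X Y"
  shows "R \<in> rc X Y R"
  using equiv_class_self[OF roof_equiv] assms by metis

lemma rc_refine:
  assumes "X \<in> Obj T" "Y \<in> Obj T" "Z \<in> Obj T" "V \<in> Obj T" "s \<in> W Z X" "f \<in> Hom T Z Y" "u \<in> W V Z"
  shows "rc X Y (V, c V Z X s u, c V Z Y f u) = rc X Y (Z, s, f)"
proof -
  have "((V, c V Z X s u, c V Z Y f u), (Z, s, f)) \<in> roof_rel T N X Y"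
    by (rule roof_relI[of _ _ _ _ _ _ _ _ V "Idm T V" u]) (use assms in auto)
  then show ?thesis using assms by (subst rc_eq_iff) auto
qed

text \<open>Two squares for the same pair of roofs are matched over the left apex \<open>Z\<close>
  by \<open>ore\<close>. Their maps to \<open>U\<close> then agree only after composition with
  \<open>t\<close>, which \<open>cancel\<close> turns into agreement over a further refinement
  \<open>Q\<close>.\<close>

lemma rc_comp_unique:
  assumes "X \<in> Obj T" "Y \<in> Obj T" "V \<in> Obj T" "Z \<in> Obj T" "U \<in> Obj T" "P \<in> Obj T" "P' \<in> Obj T"
    "s \<in> W Z X" "f \<in> Hom T Z Y" "t \<in> W U Y" "g \<in> Hom T U V"
    "p \<in> W P Z" "q \<in> Hom T P U" "c P Z Y f p = c P U Y t q"
    "p' \<in> W P' Z" "q' \<in> Hom T P' U" "c P' Z Y f p' = c P' U Y t q'"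
  shows "rc X V (P, c P Z X s p, c P U V g q) = rc X V (P', c P' Z X s p', c P' U V g q')"
proof -
  obtain R r r' where o: "R \<in> Obj T" "r \<in> W R P" "r' \<in> Hom T R P'" "c R P Z p r = c R P' Z p' r'"
    using ore[of P P' Z p p'] assms by auto
  have "c R P' Z p' r' \<in> W R Z" using o assms by (metis W_comp)
  then have r': "r' \<in> W R P'" using W_cancel[of R P' Z r' p'] o assms by auto
  have "c R U Y t (c R P U q r) = c R Z Y f (c R P Z p r)"
    by (rule square_ext) (use o assms in auto)
  also have "\<dots> = c R U Y t (c R P' U q' r')"
    unfolding o by (rule square_ext) (use o assms in auto)
  finally obtain Q u where u: "Q \<in> Obj T" "u \<in> W Q R"
    "c Q R U (c R P U q r) u = c Q R U (c R P' U q' r') u"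
    using cancel[of R U Y "c R P U q r" "c R P' U q' r'" t] o assms by auto
  have eq1: "c Q P Z p (c Q R P r u) = c Q P' Z p' (c Q R P' r' u)"
    by (rule square_ext) (use o u assms in auto)
  have eq2: "c Q P U q (c Q R P r u) = c Q P' U q' (c Q R P' r' u)"
    using u o assms by (simp add: assoc)
  have "((P, c P Z X s p, c P U V g q), (P', c P' Z X s p', c P' U V g q')) \<in> roof_rel T N X V"
    by (rule roof_relI[of _ _ _ _ _ _ _ _ Q "c Q R P r u" "c Q R P' r' u"])
       (use assms o u r' eq1 eq2 in \<open>auto simp: assoc\<close>)
  then show ?thesis using assms by (subst rc_eq_iff) auto
qed

lemma rc_comp_refine:
  assumes "X \<in> Obj T" "Y \<in> Obj T" "V \<in> Obj T" "Z \<in> Obj T" "U \<in> Obj T" "Z' \<in> Obj T" "U' \<in> Obj T"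
    "s \<in> W Z X" "f \<in> Hom T Z Y" "t \<in> W U Y" "g \<in> Hom T U V" "u \<in> W Z' Z" "v \<in> W U' U"
    "P \<in> Obj T" "p \<in> W P Z'" "q \<in> Hom T P U'" "c P Z' Y (c Z' Z Y f u) p = c P U' Y (c U' U Y t v) q"
    "P' \<in> Obj T" "p' \<in> W P' Z" "q' \<in> Hom T P' U" "c P' Z Y f p' = c P' U Y t q'"
  shows "rc X V (P, c P Z' X (c Z' Z X s u) p, c P U' V (c U' U V g v) q)
    = rc X V (P', c P' Z X s p', c P' U V g q')"
proof -
  have "rc X V (P, c P Z X s (c P Z' Z u p), c P U V g (c P U' U v q))
    = rc X V (P', c P' Z X s p', c P' U V g q')"
    by (rule rc_comp_unique[of _ Y _ _ _ _ _ _ f t]) (use assms in \<open>auto simp: assoc\<close>)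
  then show ?thesis using assms by (simp add: assoc)
qed

text \<open>\<open>roof_comp\<close> is a union over all representatives and all Ore squares. It is
  a single class because any choice is compared with the given one over refinements of both roofs,
  by \<open>rc_comp_refine\<close>.\<close>

lemma roof_comp_rc:
  assumes "X \<in> Obj T" "Y \<in> Obj T" "V \<in> Obj T" "Z \<in> Obj T" "U \<in> Obj T" "P \<in> Obj T"
    "s \<in> W Z X" "f \<in> Hom T Z Y" "t \<in> W U Y" "g \<in> Hom T U V"
    "p \<in> W P Z" "q \<in> Hom T P U" "c P Z Y f p = c P U Y t q"
  shows "roof_comp T N X Y V (rc Y V (U, t, g)) (rc X Y (Z, s, f)) = rc X V (P, c P Z X s p, c P U V g q)"
proof -
  let ?C = "rc X V (P, c P Z X s p, c P U V g q)"
  let ?S = "{rc X V (P, c P Z' X s' p, c P U' V g' q)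
     | P p q Z' s' f' U' t' g'. (Z', s', f') \<in> rc X Y (Z, s, f) \<and> (U', t', g') \<in> rc Y V (U, t, g) \<and> P \<in> Obj T \<and>
         p \<in> W P Z' \<and> q \<in> Hom T P U' \<and> c P Z' Y f' p = c P U' Y t' q}"
  have all: "rc X V (P', c P' Z' X s' p', c P' U' V g' q') = ?C"
    if h: "((Z, s, f), (Z', s', f')) \<in> roof_rel T N X Y" "((U, t, g), (U', t', g')) \<in> roof_rel T N Y V"
      "P' \<in> Obj T" "p' \<in> W P' Z'" "q' \<in> Hom T P' U'" "c P' Z' Y f' p' = c P' U' Y t' q'"
    for P' p' q' Z' s' f' U' t' g'
  proof -
    obtain A a a' where A: "Z' \<in> Obj T" "s' \<in> W Z' X" "f' \<in> Hom T Z' Y" "A \<in> Obj T" "a \<in> W A Z" "a' \<in> W A Z'"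
      "c A Z X s a = c A Z' X s' a'" "c A Z Y f a = c A Z' Y f' a'"
      by (rule roof_relE[OF h(1) assms(1,2)]) metis
    obtain B b b' where B: "U' \<in> Obj T" "t' \<in> W U' Y" "g' \<in> Hom T U' V" "B \<in> Obj T" "b \<in> W B U" "b' \<in> W B U'"
      "c B U Y t b = c B U' Y t' b'" "c B U V g b = c B U' V g' b'"
      by (rule roof_relE[OF h(2) assms(2,3)]) metis
    obtain Q x y where Q: "Q \<in> Obj T" "x \<in> W Q A" "y \<in> Hom T Q B"
      "c Q A Y (c A Z Y f a) x = c Q B Y (c B U Y t b) y"
      using ore[of A B Y "c A Z Y f a" "c B U Y t b"] A B assms by auto
    have 1: "rc X V (Q, c Q A X (c A Z X s a) x, c Q B V (c B U V g b) y) = ?C"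
      by (rule rc_comp_refine[of _ Y _ _ _ _ _ _ f t]) (use assms A B Q in auto)
    have 2: "rc X V (Q, c Q A X (c A Z' X s' a') x, c Q B V (c B U' V g' b') y)
        = rc X V (P', c P' Z' X s' p', c P' U' V g' q')"
      by (rule rc_comp_refine[of _ Y _ _ _ _ _ _ f' t']) (use assms A B Q h in \<open>auto simp: assoc\<close>)
    show ?thesis using 1 2 A(7) B(8) by simp
  qed
  have "?S \<subseteq> {?C}"
  proof
    fix R assume "R \<in> ?S"
    then obtain P' p' q' Z' s' f' U' t' g' where R: "R = rc X V (P', c P' Z' X s' p', c P' U' V g' q')"
      "((Z, s, f), (Z', s', f')) \<in> roof_rel T N X Y" "((U, t, g), (U', t', g')) \<in> roof_rel T N Y V"
      "P' \<in> Obj T" "p' \<in> W P' Z'" "q' \<in> Hom T P' U'" "c P' Z' Y f' p' = c P' U' Y t' q'"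
      unfolding mem_Collect_eq Image_singleton_iff by (elim exE conjE) (rule that)
    show "R \<in> {?C}" unfolding R(1) all[OF R(2-)] by (rule singletonI)
  qed
  moreover have "?C \<in> ?S"
    unfolding mem_Collect_eq
    by (rule exI[of _ P], rule exI[of _ p], rule exI[of _ q], rule exI[of _ Z], rule exI[of _ s], rule exI[of _ f],
        rule exI[of _ U], rule exI[of _ t], rule exI[of _ g])
       (use assms rc_self[of X Y "(Z, s, f)"] rc_self[of Y V "(U, t, g)"] in simp)
  ultimately have "?S = {?C}" by (intro subset_antisym) (simp_all only: insert_subset empty_subsetI simp_thms)
  then show ?thesis unfolding roof_comp_def by simp
qed

abbreviation D where "D \<equiv> verdier T N"
abbreviation Q where "Q \<equiv> quot_mor T N"

lemma verdier_simps [simp]: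
  "Obj D = Obj T" "Hom D = (\<lambda>X Y. roofs T N X Y // roof_rel T N X Y)" "Comp D = roof_comp T N"
  "Idm D = (\<lambda>X. Q X X (Idm T X))" "Zerom D = (\<lambda>X Y. Q X Y (Zerom T X Y))" "Sh D = Sh T"
  by (simp_all add: verdier_def verdier_shift_cat_def shift_cat.extend_def tri_cat.fields_def)

lemma hom_rc:
  assumes "Z \<in> Obj T" "s \<in> W Z X" "f \<in> Hom T Z Y"
  shows "rc X Y (Z, s, f) \<in> Hom D X Y"
  using assms by (auto intro: quotientI)

lemma hom_rcE:
  assumes "F \<in> Hom D X Y"
  obtains Z s f where "F = rc X Y (Z, s, f)" "Z \<in> Obj T" "s \<in> W Z X" "f \<in> Hom T Z Y"
  using assms by (auto elim!: quotientE)

lemma comp_rc: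
  assumes "X \<in> Obj T" "Y \<in> Obj T" "V \<in> Obj T" "Z \<in> Obj T" "U \<in> Obj T" "P \<in> Obj T"
    "s \<in> W Z X" "f \<in> Hom T Z Y" "t \<in> W U Y" "g \<in> Hom T U V"
    "p \<in> W P Z" "q \<in> Hom T P U" "c P Z Y f p = c P U Y t q"
  shows "Comp D X Y V (rc Y V (U, t, g)) (rc X Y (Z, s, f)) = rc X V (P, c P Z X s p, c P U V g q)"
  using roof_comp_rc[OF assms] by simp

lemma quot_hom: "X \<in> Obj T \<Longrightarrow> Y \<in> Obj T \<Longrightarrow> f \<in> Hom T X Y \<Longrightarrow> Q X Y f \<in> Hom D X Y"
  unfolding quot_mor_def by (rule hom_rc) auto

lemma comp_quot_rc:
  assumes "X \<in> Obj T" "Y \<in> Obj T" "V \<in> Obj T" "Z \<in> Obj T" "s \<in> W Z X" "f \<in> Hom T Z Y" "g \<in> Hom T Y V"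
  shows "Comp D X Y V (Q Y V g) (rc X Y (Z, s, f)) = rc X V (Z, s, c Z Y V g f)"
  unfolding quot_mor_def
  using comp_rc[of X Y V Z Y Z s f "Idm T Y" g "Idm T Z" f] assms by simp

lemma quot_comp:
  assumes "X \<in> Obj T" "Y \<in> Obj T" "Z \<in> Obj T" "f \<in> Hom T X Y" "g \<in> Hom T Y Z"
  shows "Comp D X Y Z (Q Y Z g) (Q X Y f) = Q X Z (c X Y Z g f)"
  using comp_quot_rc[of X Y Z X "Idm T X" f g] assms by (simp add: quot_mor_def)

lemma verdier_is_cat: "is_cat D"
proof
  fix X Y F assume h: "X \<in> Obj D" "Y \<in> Obj D" "F \<in> Hom D X Y"
  obtain Z s f where F: "F = rc X Y (Z, s, f)" "Z \<in> Obj T" "s \<in> W Z X" "f \<in> Hom T Z Y"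
    using hom_rcE[OF h(3)] .
  show "Comp D X Y Y (Idm D Y) F = F"
    using h F comp_quot_rc[of X Y Y Z s f "Idm T Y"] by simp
  have "Comp D X X Y F (rc X X (X, Idm T X, Idm T X)) = F"
    using h F comp_rc[of X X Y X Z Z "Idm T X" "Idm T X" s f s "Idm T Z"] by simp
  then show "Comp D X X Y F (Idm D X) = F" by (simp add: quot_mor_def)
next
  fix X assume "X \<in> Obj D"
  then show "Idm D X \<in> Hom D X X" using quot_hom[of X X "Idm T X"] by simp
next
  fix X Y Z F G assume h: "X \<in> Obj D" "Y \<in> Obj D" "Z \<in> Obj D" "F \<in> Hom D X Y" "G \<in> Hom D Y Z"
  obtain A s f where F: "F = rc X Y (A, s, f)" "A \<in> Obj T" "s \<in> W A X" "f \<in> Hom T A Y"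
    using hom_rcE[OF h(4)] .
  obtain B t g where G: "G = rc Y Z (B, t, g)" "B \<in> Obj T" "t \<in> W B Y" "g \<in> Hom T B Z"
    using hom_rcE[OF h(5)] .
  obtain P p q where P: "P \<in> Obj T" "p \<in> W P A" "q \<in> Hom T P B" "c P A Y f p = c P B Y t q"
    using ore[of A B Y f t] F G h by auto
  have "Comp D X Y Z G F = rc X Z (P, c P A X s p, c P B Z g q)"
    unfolding F(1) G(1) by (rule comp_rc) (use F G P h in auto)
  also have "\<dots> \<in> Hom D X Z" by (rule hom_rc) (use F G P h in auto)
  finally show "Comp D X Y Z G F \<in> Hom D X Z" .
next
  fix X Y Z V F G H
  assume h: "X \<in> Obj D" "Y \<in> Obj D" "Z \<in> Obj D" "V \<in> Obj D"
    "F \<in> Hom D X Y" "G \<in> Hom D Y Z" "H \<in> Hom D Z V"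
  obtain A1 s1 f1 where F: "F = rc X Y (A1, s1, f1)" "A1 \<in> Obj T" "s1 \<in> W A1 X" "f1 \<in> Hom T A1 Y"
    using hom_rcE[OF h(5)] .
  obtain A2 s2 f2 where G: "G = rc Y Z (A2, s2, f2)" "A2 \<in> Obj T" "s2 \<in> W A2 Y" "f2 \<in> Hom T A2 Z"
    using hom_rcE[OF h(6)] .
  obtain A3 s3 f3 where H: "H = rc Z V (A3, s3, f3)" "A3 \<in> Obj T" "s3 \<in> W A3 Z" "f3 \<in> Hom T A3 V"
    using hom_rcE[OF h(7)] .
  have o: "X \<in> Obj T" "Y \<in> Obj T" "Z \<in> Obj T" "V \<in> Obj T" using h by auto
  obtain P p q where P: "P \<in> Obj T" "p \<in> W P A1" "q \<in> Hom T P A2" "c P A1 Y f1 p = c P A2 Y s2 q"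
    using ore[of A1 A2 Y f1 s2] F G o by auto
  obtain P' p' q' where P': "P' \<in> Obj T" "p' \<in> W P' A2" "q' \<in> Hom T P' A3" "c P' A2 Z f2 p' = c P' A3 Z s3 q'"
    using ore[of A2 A3 Z f2 s3] G H o by auto
  \<comment> \<open>A third square on top of those for the two pairs gives one apex \<open>R\<close>
    over which both bracketings are the same roof.\<close>
  obtain R r r' where R: "R \<in> Obj T" "r \<in> W R P" "r' \<in> Hom T R P'" "c R P A2 q r = c R P' A2 p' r'"
    using ore[of P P' A2 q p'] P P' G by auto
  have GF: "Comp D X Y Z G F = rc X Z (P, c P A1 X s1 p, c P A2 Z f2 q)"
    unfolding F(1) G(1) by (rule comp_rc) (use F G P o in auto)
  have HG: "Comp D Y Z V H G = rc Y V (P', c P' A2 Y s2 p', c P' A3 V f3 q')"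
    unfolding H(1) G(1) by (rule comp_rc) (use H G P' o in auto)
  have x: "c R A2 Z f2 (c R P A2 q r) = c R A3 Z s3 (c R P' A3 q' r')"
    unfolding R by (rule square_ext) (use F G H P P' R o in auto)
  have "Comp D X Z V H (Comp D X Y Z G F)
     = rc X V (R, c R P X (c P A1 X s1 p) r, c R A3 V f3 (c R P' A3 q' r'))"
    unfolding GF H(1) by (rule comp_rc) (use F G H P P' R o x in \<open>auto simp: assoc\<close>)
  also have "\<dots> = rc X V (R, c R A1 X s1 (c R P A1 p r), c R P' V (c P' A3 V f3 q') r')"
    using F G H P P' R o by (simp add: assoc)
  also have "\<dots> = Comp D X Y V (Comp D Y Z V H G) F"
  proof -
    have "c R A1 Y f1 (c R P A1 p r) = c R A2 Y s2 (c R P A2 q r)"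
      by (rule square_ext) (use F G P R o in auto)
    then show ?thesis unfolding HG F(1)
      by (subst comp_rc[of X Y V A1 P' R s1 f1 "c P' A2 Y s2 p'" "c P' A3 V f3 q'" "c R P A1 p r" r'])
        (use F G H P P' R o in \<open>auto simp: assoc\<close>)
  qed
  finally show "Comp D X Z V H (Comp D X Y Z G F) = Comp D X Y V (Comp D Y Z V H G) F" .
qed

lemma quot_eqI:
  assumes "X \<in> Obj T" "Y \<in> Obj T" "f \<in> Hom T X Y" "g \<in> Hom T X Y" "P \<in> Obj T" "p \<in> W P X"
    "c P X Y f p = c P X Y g p"
  shows "Q X Y f = Q X Y g"
proof -
  have "Q X Y f = rc X Y (P, c P X X (Idm T X) p, c P X Y f p)"
    unfolding quot_mor_def by (rule rc_refine[symmetric]) (use assms in auto)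
  also have "\<dots> = rc X Y (P, c P X X (Idm T X) p, c P X Y g p)" using assms by simp
  also have "\<dots> = Q X Y g"
    unfolding quot_mor_def by (rule rc_refine) (use assms in auto)
  finally show ?thesis .
qed

lemma rc_quot:
  assumes "X \<in> Obj T" "Y \<in> Obj T" "Z \<in> Obj T" "s \<in> W Z X" "f \<in> Hom T Z Y"
  shows "Comp D X Z Y (Q Z Y f) (rc X Z (Z, s, Idm T Z)) = rc X Y (Z, s, f)"
  using comp_quot_rc[of X Z Y Z s "Idm T Z" f] assms by simp

lemma quot_W_inverse:
  assumes "X \<in> Obj T" "Z \<in> Obj T" "s \<in> W Z X"
  shows "Comp D X Z X (Q Z X s) (rc X Z (Z, s, Idm T Z)) = Idm D X"
    "Comp D Z X Z (rc X Z (Z, s, Idm T Z)) (Q Z X s) = Idm D Z"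
proof -
  have "Comp D X Z X (Q Z X s) (rc X Z (Z, s, Idm T Z)) = rc X X (Z, c Z X X (Idm T X) s, c Z X X (Idm T X) s)"
    using rc_quot[of X X Z s s] assms by simp
  also have "\<dots> = Idm D X" using rc_refine[of X X X Z "Idm T X" "Idm T X" s] assms by (simp add: quot_mor_def)
  finally show "Comp D X Z X (Q Z X s) (rc X Z (Z, s, Idm T Z)) = Idm D X" .
  show "Comp D Z X Z (rc X Z (Z, s, Idm T Z)) (Q Z X s) = Idm D Z"
    using comp_rc[of Z X Z Z Z Z "Idm T Z" s s "Idm T Z" "Idm T Z" "Idm T Z"] assms
    by (simp add: quot_mor_def)
qed

lemma quot_W_iso:
  assumes "X \<in> Obj T" "Z \<in> Obj T" "s \<in> W Z X"
  shows "iso_in D Z X (Q Z X s)"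
  unfolding iso_in_def using quot_W_inverse[OF assms] quot_hom[of Z X s]
    hom_rc[of Z s X "Idm T Z" Z] assms by auto

end

section \<open>Equivalences of categories\<close>

lemma iso_inE:
  assumes "iso_in C X Y f"
  obtains g where "f \<in> Hom C X Y" "g \<in> Hom C Y X" "Comp C X Y X g f = Idm C X" "Comp C Y X Y f g = Idm C Y"
  using assms unfolding iso_in_def by blast

lemma (in is_cat) comp_section:
  assumes "X \<in> Obj C" "Y \<in> Obj C" "Z \<in> Obj C" "a \<in> Hom C X Y" "b \<in> Hom C Y X" "f \<in> Hom C Y Z"
    "Comp C Y X Y a b = Idm C Y"
  shows "Comp C Y X Z (Comp C X Y Z f a) b = f"
  by (subst comp_assoc[symmetric]) (use assms in \<open>simp_all add: comp_id\<close>)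

lemma (in is_cat) comp_retraction:
  assumes "X \<in> Obj C" "Y \<in> Obj C" "Z \<in> Obj C" "a \<in> Hom C Y Z" "b \<in> Hom C Z Y" "f \<in> Hom C X Y"
    "Comp C Y Z Y b a = Idm C Y"
  shows "Comp C X Z Y b (Comp C X Y Z a f) = f"
  by (subst comp_assoc) (use assms in \<open>simp_all add: id_comp\<close>)

lemma (in is_cat) iso_cancel_right:
  assumes "X \<in> Obj C" "Y \<in> Obj C" "Z \<in> Obj C" "iso_in C X Y a" "f \<in> Hom C Y Z" "g \<in> Hom C Y Z"
    "Comp C X Y Z f a = Comp C X Y Z g a"
  shows "f = g"
proof -
  obtain b where b: "a \<in> Hom C X Y" "b \<in> Hom C Y X" "Comp C Y X Y a b = Idm C Y"
    using assms(4) by (rule iso_inE)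
  have "Comp C Y X Z (Comp C X Y Z f a) b = f" "Comp C Y X Z (Comp C X Y Z g a) b = g"
    using assms(1-6) b by (auto intro: comp_section)
  then show ?thesis using assms(7) by metis
qed

lemma (in is_cat) iso_cancel_left:
  assumes "X \<in> Obj C" "Y \<in> Obj C" "Z \<in> Obj C" "iso_in C Y Z a" "f \<in> Hom C X Y" "g \<in> Hom C X Y"
    "Comp C X Y Z a f = Comp C X Y Z a g"
  shows "f = g"
proof -
  obtain b where b: "a \<in> Hom C Y Z" "b \<in> Hom C Z Y" "Comp C Y Z Y b a = Idm C Y"
    using assms(4) by (rule iso_inE)
  have "Comp C X Z Y b (Comp C X Y Z a f) = f" "Comp C X Z Y b (Comp C X Y Z a g) = g"
    using assms(1-6) b by (auto intro: comp_retraction)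
  then show ?thesis using assms(7) by metis
qed

lemma full_sub_simps [simp]:
  "Obj (full_sub C S) = Obj C \<inter> S" "Hom (full_sub C S) = Hom C" "Comp (full_sub C S) = Comp C"
  "Idm (full_sub C S) = Idm C"
  by (simp_all add: full_sub_def)

lemma (in is_cat) full_sub_is_cat: "is_cat (full_sub C S)"
  by unfold_locales (auto simp: id_hom comp_hom comp_id id_comp comp_assoc)

lemma (in is_func) full_sub_is_func: "is_func (full_sub C S) D F"
  by (intro is_func.intro is_func_axioms.intro dom.full_sub_is_cat cod.is_cat_axioms)
     (auto simp: obj hom ident comp)

text \<open>The quasi-inverse is chosen: \<open>gO\<close> picks preimages up to the isomorphisms
  \<open>e\<close>; a morphism \<phi> is conjugated by these to \<open>w N M \<phi>\<close> and
  lifted through the bijection on Hom sets. Equations between morphisms of \<open>C\<close> are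
  checked after applying the functor, by \<open>faith\<close>.\<close>

lemma (in is_func) equivalence_if_fully_faithful:
  assumes bij: "\<And>X Y. X \<in> Obj C \<Longrightarrow> Y \<in> Obj C \<Longrightarrow> bij_betw (FM F X Y) (Hom C X Y) (Hom D (FO F X) (FO F Y))"
    and ess: "\<And>N. N \<in> Obj D \<Longrightarrow> \<exists>X\<in>Obj C. \<exists>e. iso_in D (FO F X) N e"
  shows "cat_equivalence C D F"
proof -
  define P where "P N X e e' \<longleftrightarrow> X \<in> Obj C \<and> e \<in> Hom D (FO F X) N \<and> e' \<in> Hom D N (FO F X) \<and>
      Comp D (FO F X) N (FO F X) e' e = Idm D (FO F X) \<and> Comp D N (FO F X) N e e' = Idm D N" for N X e e'
  have "\<exists>X e e'. P N X e e'" if "N \<in> Obj D" for N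
    using ess[OF that] unfolding iso_in_def P_def by blast
  then obtain gO e e' where P: "\<And>N. N \<in> Obj D \<Longrightarrow> P N (gO N) (e N) (e' N)" by metis
  note P = P[unfolded P_def]
  then have g: "\<And>N. N \<in> Obj D \<Longrightarrow> gO N \<in> Obj C"
    and e: "\<And>N. N \<in> Obj D \<Longrightarrow> e N \<in> Hom D (FO F (gO N)) N"
    and e': "\<And>N. N \<in> Obj D \<Longrightarrow> e' N \<in> Hom D N (FO F (gO N))"
    and e'e: "\<And>N. N \<in> Obj D \<Longrightarrow> Comp D (FO F (gO N)) N (FO F (gO N)) (e' N) (e N) = Idm D (FO F (gO N))"
    and ee': "\<And>N. N \<in> Obj D \<Longrightarrow> Comp D N (FO F (gO N)) N (e N) (e' N) = Idm D N"
    using P by auto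
  note [simp] = obj hom g e e' e'e ee' cod.comp_hom dom.comp_hom cod.id_hom dom.id_hom
    cod.comp_id dom.comp_id cod.id_comp dom.id_comp ident
  have e_iso: "iso_in D (FO F (gO N)) N (e N)" if "N \<in> Obj D" for N
    unfolding iso_in_def using that by (auto intro!: bexI[of _ "e' N"])
  define pre where "pre X Y h = inv_into (Hom C X Y) (FM F X Y) h" for X Y h
  have pre_hom [simp]: "pre X Y h \<in> Hom C X Y" and F_pre [simp]: "FM F X Y (pre X Y h) = h"
    if "X \<in> Obj C" "Y \<in> Obj C" "h \<in> Hom D (FO F X) (FO F Y)" for X Y h
    using that bij_betw_imp_surj_on[OF bij[of X Y]] unfolding pre_def
    by (auto intro: inv_into_into f_inv_into_f)
  have faith: "f = f'" if "X \<in> Obj C" "Y \<in> Obj C" "f \<in> Hom C X Y" "f' \<in> Hom C X Y"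
    "FM F X Y f = FM F X Y f'" for X Y f f'
    using bij[of X Y] that by (auto simp: bij_betw_def inj_on_def)
  define w where "w N M \<phi> = Comp D (FO F (gO N)) N (FO F (gO M)) (Comp D N M (FO F (gO M)) (e' M) \<phi>) (e N)" for N M \<phi>
  have w [simp]: "w N M \<phi> \<in> Hom D (FO F (gO N)) (FO F (gO M))"
    if "N \<in> Obj D" "M \<in> Obj D" "\<phi> \<in> Hom D N M" for N M \<phi>
    using that unfolding w_def by simp
  have ew: "Comp D (FO F (gO N)) (FO F (gO M)) M (e M) (w N M \<phi>) = Comp D (FO F (gO N)) N M \<phi> (e N)"
    if "N \<in> Obj D" "M \<in> Obj D" "\<phi> \<in> Hom D N M" for N M \<phi>
    using that unfolding w_def by (simp add: cod.comp_assoc)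
  define G where "G = \<lparr>FO = gO, FM = (\<lambda>N M \<phi>. pre (gO N) (gO M) (w N M \<phi>))\<rparr>"
  have G_func: "is_func D C G"
  proof (intro is_func.intro is_func_axioms.intro cod.is_cat_axioms dom.is_cat_axioms)
    fix X assume "X \<in> Obj D"
    then show "FM G X X (Idm D X) = Idm C (FO G X)"
      by (auto intro!: faith[of "gO X" "gO X"] simp: G_def w_def)
  next
    fix X Y Z f h
    assume h: "X \<in> Obj D" "Y \<in> Obj D" "Z \<in> Obj D" "f \<in> Hom D X Y" "h \<in> Hom D Y Z"
    have "w X Z (Comp D X Y Z h f) = Comp D (FO F (gO X)) (FO F (gO Y)) (FO F (gO Z)) (w Y Z h) (w X Y f)"
    proof (rule cod.iso_cancel_left[of _ _ Z "e Z"])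
      show "Comp D (FO F (gO X)) (FO F (gO Z)) Z (e Z) (w X Z (Comp D X Y Z h f))
        = Comp D (FO F (gO X)) (FO F (gO Z)) Z (e Z)
           (Comp D (FO F (gO X)) (FO F (gO Y)) (FO F (gO Z)) (w Y Z h) (w X Y f))"
        using h ew[of X Z "Comp D X Y Z h f"] ew[of Y Z h] ew[of X Y f]
        by (simp add: cod.comp_assoc[of "FO F (gO X)" "FO F (gO Y)" "FO F (gO Z)" Z])
          (simp add: cod.comp_assoc[symmetric])
    qed (use h e_iso in auto)
    then show "FM G X Z (Comp D X Y Z h f) = Comp C (FO G X) (FO G Y) (FO G Z) (FM G Y Z h) (FM G X Y f)"
      using h by (auto intro!: faith[of "gO X" "gO Z"] simp: G_def comp)
  qed (auto simp: G_def)
  have "naturally_isomorphic D D (comp_func F G) id_func"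
    unfolding naturally_isomorphic_def comp_func_def id_func_def
    by (rule exI[of _ e]) (auto simp: G_def e_iso ew)
  moreover have "naturally_isomorphic C C (comp_func G F) id_func"
  proof -
    define \<eta> where "\<eta> X = pre (gO (FO F X)) X (e (FO F X))" for X
    define \<eta>' where "\<eta>' X = pre X (gO (FO F X)) (e' (FO F X))" for X
    have \<eta> [simp]: "\<eta> X \<in> Hom C (gO (FO F X)) X" "FM F (gO (FO F X)) X (\<eta> X) = e (FO F X)"
      "\<eta>' X \<in> Hom C X (gO (FO F X))" "FM F X (gO (FO F X)) (\<eta>' X) = e' (FO F X)" if "X \<in> Obj C" for X
      using that by (simp_all add: \<eta>_def \<eta>'_def)
    have "iso_in C (gO (FO F X)) X (\<eta> X)" if "X \<in> Obj C" for X
    proof -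
      have "Comp C (gO (FO F X)) X (gO (FO F X)) (\<eta>' X) (\<eta> X) = Idm C (gO (FO F X))"
        by (rule faith[of "gO (FO F X)" "gO (FO F X)"]) (use that in \<open>auto simp: comp\<close>)
      moreover have "Comp C X (gO (FO F X)) X (\<eta> X) (\<eta>' X) = Idm C X"
        by (rule faith[of X X]) (use that in \<open>auto simp: comp\<close>)
      ultimately show ?thesis unfolding iso_in_def using that by (auto intro!: bexI[of _ "\<eta>' X"])
    qed
    moreover have "Comp C (gO (FO F X)) (gO (FO F Y)) Y (\<eta> Y) (pre (gO (FO F X)) (gO (FO F Y)) (w (FO F X) (FO F Y) (FM F X Y f)))
        = Comp C (gO (FO F X)) X Y f (\<eta> X)" if "X \<in> Obj C" "Y \<in> Obj C" "f \<in> Hom C X Y" for X Y f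
      by (rule faith[of "gO (FO F X)" Y]) (use that in \<open>auto simp: comp ew\<close>)
    ultimately show ?thesis
      unfolding naturally_isomorphic_def comp_func_def id_func_def
      by (intro exI[of _ \<eta>]) (auto simp: G_def)
  qed
  ultimately show ?thesis unfolding cat_equivalence_def using G_func is_func_axioms by blast
qed

lemma (in is_cat) iso_sym:
  assumes "iso_in C X Y f" obtains g where "iso_in C Y X g"
  using assms unfolding iso_in_def by blast

text \<open>Conjugation by \<open>a\<close> and \<open>b\<close> identifies the Hom set of
  \<open>X\<close>, \<open>Y\<close> with that of \<open>X'\<close>, \<open>Y'\<close>, compatibly
  with the functor. Full faithfulness has thus to be shown only for representatives of the
  isomorphism classes.\<close>

lemma (in is_func) bij_betw_transfer:
  assumes "S' \<subseteq> Obj C" "\<And>X Y. X \<in> S' \<Longrightarrow> Y \<in> S' \<Longrightarrow> bij_betw (FM F X Y) (Hom C X Y) (Hom D (FO F X) (FO F Y))"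
    and X: "X \<in> Obj C" "X' \<in> S'" "iso_in C X X' a" and Y: "Y \<in> Obj C" "Y' \<in> S'" "iso_in C Y Y' b"
  shows "bij_betw (FM F X Y) (Hom C X Y) (Hom D (FO F X) (FO F Y))"
proof -
  have o: "X' \<in> Obj C" "Y' \<in> Obj C" using assms by auto
  note [simp] = o X(1,2) Y(1,2) obj hom dom.comp_hom cod.comp_hom
  obtain a' where a: "a \<in> Hom C X X'" "a' \<in> Hom C X' X" "Comp C X X' X a' a = Idm C X" "Comp C X' X X' a a' = Idm C X'"
    using X(3) by (rule iso_inE)
  obtain b' where b: "b \<in> Hom C Y Y'" "b' \<in> Hom C Y' Y" "Comp C Y Y' Y b' b = Idm C Y" "Comp C Y' Y Y' b b' = Idm C Y'"
    using Y(3) by (rule iso_inE)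
  note [simp] = a b
  let ?F = "FM F X' Y'"
  have bij: "bij_betw ?F (Hom C X' Y') (Hom D (FO F X') (FO F Y'))" using assms by auto
  define t where "t f = Comp C X' X Y' (Comp C X Y Y' b f) a'" for f
  have t [simp]: "t f \<in> Hom C X' Y'" if "f \<in> Hom C X Y" for f using that unfolding t_def by simp
  have bta: "Comp C X X' Y (Comp C X' Y' Y b' (t f)) a = f" if "f \<in> Hom C X Y" for f
  proof -
    have "Comp C X' Y' Y b' (t f) = Comp C X' X Y (Comp C X Y' Y b' (Comp C X Y Y' b f)) a'"
      using that dom.comp_assoc[of X' X Y' Y a' "Comp C X Y Y' b f" b'] unfolding t_def by simp
    also have "Comp C X Y' Y b' (Comp C X Y Y' b f) = f"
      by (rule dom.comp_retraction) (use that in simp_all)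
    finally have "Comp C X X' Y (Comp C X' Y' Y b' (t f)) a = Comp C X X' Y (Comp C X' X Y f a') a" by simp
    also have "\<dots> = f" by (rule dom.comp_section) (use that in simp_all)
    finally show ?thesis .
  qed
  show ?thesis
  proof (rule bij_betwI')
    fix f g assume fg: "f \<in> Hom C X Y" "g \<in> Hom C X Y"
    show "(FM F X Y f = FM F X Y g) = (f = g)"
    proof
      assume "FM F X Y f = FM F X Y g"
      then have "?F (t f) = ?F (t g)" using fg by (simp add: t_def comp)
      then have "t f = t g" using bij fg by (auto simp: bij_betw_def inj_on_def)
      then show "f = g" using bta fg by metis
    qed simp
  next
    fix f assume "f \<in> Hom C X Y" then show "FM F X Y f \<in> Hom D (FO F X) (FO F Y)" by simp
  next
    fix h assume h: "h \<in> Hom D (FO F X) (FO F Y)"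
    let ?A = "FM F X X' a" and ?A' = "FM F X' X a'" and ?B = "FM F Y Y' b" and ?B' = "FM F Y' Y b'"
    have AA: "Comp D (FO F X) (FO F X') (FO F X) ?A' ?A = Idm D (FO F X)"
      "Comp D (FO F Y) (FO F Y') (FO F Y) ?B' ?B = Idm D (FO F Y)"
      using comp[of X X' X a a'] comp[of Y Y' Y b b'] by (simp_all add: ident)
    let ?k = "Comp D (FO F X') (FO F X) (FO F Y') (Comp D (FO F X) (FO F Y) (FO F Y') ?B h) ?A'"
    have "?k \<in> Hom D (FO F X') (FO F Y')" using h by simp
    then have "?k \<in> ?F ` Hom C X' Y'" by (simp only: bij_betw_imp_surj_on[OF bij])
    then obtain f where f: "f \<in> Hom C X' Y'" "?F f = ?k" by (elim imageE) (rule that, assumption, erule sym)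
    have "FM F X Y (Comp C X X' Y (Comp C X' Y' Y b' f) a)
      = Comp D (FO F X) (FO F X') (FO F Y) (Comp D (FO F X') (FO F Y') (FO F Y) ?B' ?k) ?A"
      using f by (simp add: comp)
    also have "Comp D (FO F X') (FO F Y') (FO F Y) ?B' ?k = Comp D (FO F X') (FO F X) (FO F Y)
        (Comp D (FO F X) (FO F Y') (FO F Y) ?B' (Comp D (FO F X) (FO F Y) (FO F Y') ?B h)) ?A'"
      by (rule cod.comp_assoc) (use h in simp_all)
    also have "Comp D (FO F X) (FO F Y') (FO F Y) ?B' (Comp D (FO F X) (FO F Y) (FO F Y') ?B h) = h"
      by (rule cod.comp_retraction) (use h AA in simp_all)
    also have "Comp D (FO F X) (FO F X') (FO F Y) (Comp D (FO F X') (FO F X) (FO F Y) h ?A') ?A = h"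
      by (rule cod.comp_section) (use h AA in simp_all)
    finally show "\<exists>f\<in>Hom C X Y. h = FM F X Y f"
      using f by (auto intro!: bexI[of _ "Comp C X X' Y (Comp C X' Y' Y b' f) a"])
  qed
qed

section \<open>Functors between localisations\<close>

locale frac_functor = src: fractions T N + tgt: fractions T' N' + is_func T T' F
  for T :: "('o, 'h, 'z) tri_cat_scheme" and N :: "'o set"
    and T' :: "('p, 'q, 'y) tri_cat_scheme" and N' :: "'p set" and F :: "('o, 'h, 'p, 'q) func" +
  assumes W_image: "\<lbrakk>X \<in> Obj T; Y \<in> Obj T; s \<in> cone_in T N X Y\<rbrakk>
    \<Longrightarrow> FM F X Y s \<in> cone_in T' N' (FO F X) (FO F Y)"
begin

abbreviation V where "V \<equiv> verdier_func T' N' F"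

declare obj [simp] hom [simp] W_image [simp]

lemma FO_V [simp]: "FO V = FO F"
  by (simp add: verdier_func_def)

text \<open>The functor on quotients is a union over all roofs in a class. The image of a common
  refinement is a common refinement of the images, by \<open>W_image\<close>, so all of them
  contribute the same class.\<close>

lemma FM_rc:
  assumes "X \<in> Obj T" "Y \<in> Obj T" "Z \<in> Obj T" "s \<in> src.W Z X" "f \<in> Hom T Z Y"
  shows "FM V X Y (src.rc X Y (Z, s, f)) = tgt.rc (FO F X) (FO F Y) (FO F Z, FM F Z X s, FM F Z Y f)"
proof -
  let ?C = "tgt.rc (FO F X) (FO F Y) (FO F Z, FM F Z X s, FM F Z Y f)"
  let ?R = "src.rc X Y (Z, s, f)"
  have all: "tgt.rc (FO F X) (FO F Y) (FO F Z', FM F Z' X s', FM F Z' Y f') = ?C"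
    if h: "(Z', s', f') \<in> ?R" for Z' s' f'
  proof -
    have "((Z, s, f), (Z', s', f')) \<in> roof_rel T N X Y" using h by simp
    then obtain A p q where A: "Z' \<in> Obj T" "s' \<in> src.W Z' X" "f' \<in> Hom T Z' Y"
      "A \<in> Obj T" "p \<in> src.W A Z" "q \<in> src.W A Z'" "src.c A Z X s p = src.c A Z' X s' q" "src.c A Z Y f p = src.c A Z' Y f' q"
      by (rule src.roof_relE[OF _ assms(1,2)]) metis
    have "((FO F Z', FM F Z' X s', FM F Z' Y f'), (FO F Z, FM F Z X s, FM F Z Y f))
        \<in> roof_rel T' N' (FO F X) (FO F Y)"
      by (rule tgt.roof_relI[of _ _ _ _ _ _ _ _ "FO F A" "FM F A Z' q" "FM F A Z p"])
        (use assms A in \<open>auto simp: comp[symmetric]\<close>)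
    then show ?thesis using assms A by (subst tgt.rc_eq_iff) auto
  qed
  have "(\<Union>(Z, s, f)\<in>?R. tgt.rc (FO F X) (FO F Y) (FO F Z, FM F Z X s, FM F Z Y f)) = (\<Union>r\<in>?R. ?C)"
  proof (rule SUP_cong[OF refl])
    fix r assume r: "r \<in> ?R"
    obtain Z' s' f' where r': "r = (Z', s', f')" by (cases r)
    show "(case r of (Z, s, f) \<Rightarrow> tgt.rc (FO F X) (FO F Y) (FO F Z, FM F Z X s, FM F Z Y f)) = ?C"
      unfolding r' prod.case by (rule all) (use r r' in simp)
  qed
  also have "\<dots> = ?C" using src.rc_self[of X Y "(Z, s, f)"] assms by (simp only: UN_constant) auto
  finally show ?thesis unfolding verdier_func_def by simp
qed

lemma FM_quot:
  assumes "X \<in> Obj T" "Y \<in> Obj T" "f \<in> Hom T X Y"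
  shows "FM V X Y (src.Q X Y f) = tgt.Q (FO F X) (FO F Y) (FM F X Y f)"
  unfolding quot_mor_def using FM_rc[of X Y X "Idm T X" f] assms ident by simp

lemma V_is_func: "is_func src.D tgt.D V"
proof (intro is_func.intro is_func_axioms.intro src.verdier_is_cat tgt.verdier_is_cat)
  fix X assume "X \<in> Obj src.D"
  then show "FM V X X (Idm src.D X) = Idm tgt.D (FO V X)"
    using FM_quot[of X X "Idm T X"] ident by simp
next
  fix X Y f assume h: "X \<in> Obj src.D" "Y \<in> Obj src.D" "f \<in> Hom src.D X Y"
  obtain Z s g where f: "f = src.rc X Y (Z, s, g)" "Z \<in> Obj T" "s \<in> src.W Z X" "g \<in> Hom T Z Y"
    by (rule src.hom_rcE[OF h(3)])
  have "FM V X Y f = tgt.rc (FO F X) (FO F Y) (FO F Z, FM F Z X s, FM F Z Y g)"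
    unfolding f(1) by (rule FM_rc) (use f h in auto)
  also have "\<dots> \<in> Hom tgt.D (FO F X) (FO F Y)" by (rule tgt.hom_rc) (use f h in auto)
  finally show "FM V X Y f \<in> Hom tgt.D (FO V X) (FO V Y)" by simp
next
  fix X Y Z f g assume h: "X \<in> Obj src.D" "Y \<in> Obj src.D" "Z \<in> Obj src.D" "f \<in> Hom src.D X Y" "g \<in> Hom src.D Y Z"
  obtain A s f1 where f: "f = src.rc X Y (A, s, f1)" "A \<in> Obj T" "s \<in> src.W A X" "f1 \<in> Hom T A Y"
    by (rule src.hom_rcE[OF h(4)])
  obtain B t g1 where g: "g = src.rc Y Z (B, t, g1)" "B \<in> Obj T" "t \<in> src.W B Y" "g1 \<in> Hom T B Z"
    by (rule src.hom_rcE[OF h(5)])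
  have o: "X \<in> Obj T" "Y \<in> Obj T" "Z \<in> Obj T" using h by auto
  obtain P p q where P: "P \<in> Obj T" "p \<in> src.W P A" "q \<in> Hom T P B" "src.c P A Y f1 p = src.c P B Y t q"
    using src.ore[of A B Y f1 t] f g o by auto
  have "FM V X Z (Comp src.D X Y Z g f) = FM V X Z (src.rc X Z (P, src.c P A X s p, src.c P B Z g1 q))"
    unfolding f(1) g(1) by (subst src.comp_rc[of X Y Z A B P s f1 t g1 p q]) (use f g P o in auto)
  also have "\<dots> = tgt.rc (FO F X) (FO F Z) (FO F P, FM F P X (src.c P A X s p), FM F P Z (src.c P B Z g1 q))"
    by (rule FM_rc) (use f g P o in auto)
  also have "\<dots> = tgt.rc (FO F X) (FO F Z) (FO F P, tgt.c (FO F P) (FO F A) (FO F X) (FM F A X s) (FM F P A p),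
      tgt.c (FO F P) (FO F B) (FO F Z) (FM F B Z g1) (FM F P B q))"
    using f g P o by (simp add: comp)
  also have "\<dots> = Comp tgt.D (FO F X) (FO F Y) (FO F Z) (tgt.rc (FO F Y) (FO F Z) (FO F B, FM F B Y t, FM F B Z g1))
      (tgt.rc (FO F X) (FO F Y) (FO F A, FM F A X s, FM F A Y f1))"
    by (rule tgt.comp_rc[symmetric]) (use f g P o in \<open>auto simp: comp[symmetric]\<close>)
  also have "\<dots> = Comp tgt.D (FO V X) (FO V Y) (FO V Z) (FM V Y Z g) (FM V X Y f)"
    using FM_rc[of X Y A s f1] FM_rc[of Y Z B t g1] f g o by simp
  finally show "FM V X Z (Comp src.D X Y Z g f) = Comp tgt.D (FO V X) (FO V Y) (FO V Z) (FM V Y Z g) (FM V X Y f)" .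
qed (auto)

text \<open>
  In the application \<open>S\<close> is a full subcategory of the source, \<open>S'\<close> consists of objects that are
  simpler representatives of the isomorphism classes of \<open>S\<close>, and \<open>Gam\<close> lifts objects of the target.
\<close>

lemma equivalence_criterion:
  fixes S S' Gam a
  assumes sub: "S' \<subseteq> S" "S \<subseteq> Obj T"
    and W_closed: "\<And>X Z s. X \<in> S \<Longrightarrow> Z \<in> Obj T \<Longrightarrow> s \<in> src.W Z X \<Longrightarrow> Z \<in> S"
    and reflect: "\<And>X. X \<in> S \<Longrightarrow> \<exists>X'\<in>S'. \<exists>q\<in>src.W X X'. \<forall>Y\<in>S'. \<forall>f\<in>Hom T X Y. \<exists>f'\<in>Hom T X' Y. f = src.c X X' Y f' q"
    and conservative: "\<And>X Y f. X \<in> S' \<Longrightarrow> Y \<in> S' \<Longrightarrow> f \<in> Hom T X Y \<Longrightarrow>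
      FM F X Y f \<in> tgt.W (FO F X) (FO F Y) \<Longrightarrow> f \<in> src.W X Y"
    and iso_W: "\<And>X Y f. X \<in> Obj T' \<Longrightarrow> Y \<in> Obj T' \<Longrightarrow> iso_in T' X Y f \<Longrightarrow> f \<in> tgt.W X Y"
    and Gam: "\<And>M. M \<in> Obj T' \<Longrightarrow> Gam M \<in> S'"
    and a_iso: "\<And>M. M \<in> Obj T' \<Longrightarrow> iso_in T' M (FO F (Gam M)) (a M)"
    and lift: "\<And>M X g. M \<in> Obj T' \<Longrightarrow> X \<in> S' \<Longrightarrow> g \<in> Hom T' M (FO F X) \<Longrightarrow>
      \<exists>h\<in>Hom T (Gam M) X. tgt.c M (FO F (Gam M)) (FO F X) (FM F (Gam M) X h) (a M) = g"
    and faithful: "\<And>M X f g. M \<in> Obj T' \<Longrightarrow> X \<in> S' \<Longrightarrow> f \<in> Hom T (Gam M) X \<Longrightarrow> g \<in> Hom T (Gam M) X \<Longrightarrow>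
      FM F (Gam M) X f = FM F (Gam M) X g \<Longrightarrow> src.Q (Gam M) X f = src.Q (Gam M) X g"
  shows "cat_equivalence (full_sub src.D S) tgt.D V"
proof -
  interpret V: is_func src.D tgt.D V by (rule V_is_func)
  have S'O: "X \<in> Obj T" if "X \<in> S'" for X using that sub by auto
  have SO: "X \<in> Obj T" if "X \<in> S" for X using that sub by auto
  have GO [simp]: "Gam M \<in> Obj T" if "M \<in> Obj T'" for M using Gam[OF that] S'O by auto
  have aW: "a M \<in> tgt.W M (FO F (Gam M))" if "M \<in> Obj T'" for M
    using iso_W[OF _ _ a_iso] that by simp
  \<comment> \<open>The image of the lift \<open>h\<close> is \<open>g\<close> composed with the
    inverse of \<open>a M\<close>, hence lies in \<open>W\<close>; \<open>conservative\<close> then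
    puts \<open>h\<close> itself into \<open>W\<close>.\<close>
  have liftW: "\<exists>h\<in>src.W (Gam M) X. tgt.c M (FO F (Gam M)) (FO F X) (FM F (Gam M) X h) (a M) = g"
    if h: "M \<in> Obj T'" "X \<in> S'" "g \<in> tgt.W M (FO F X)" for M X g
  proof -
    obtain h where h': "h \<in> Hom T (Gam M) X" "tgt.c M (FO F (Gam M)) (FO F X) (FM F (Gam M) X h) (a M) = g"
      using lift[of M X g] h by auto
    obtain b where b: "a M \<in> Hom T' M (FO F (Gam M))" "b \<in> Hom T' (FO F (Gam M)) M"
      "tgt.c M (FO F (Gam M)) M b (a M) = Idm T' M"
      "tgt.c (FO F (Gam M)) M (FO F (Gam M)) (a M) b = Idm T' (FO F (Gam M))"
      using a_iso[OF h(1)] by (rule iso_inE)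
    have bW: "b \<in> tgt.W (FO F (Gam M)) M"
      by (rule iso_W) (use h b in \<open>auto simp: iso_in_def\<close>)
    have "tgt.c (FO F (Gam M)) M (FO F X) (tgt.c M (FO F (Gam M)) (FO F X) (FM F (Gam M) X h) (a M)) b
        = FM F (Gam M) X h"
      by (rule tgt.comp_section) (use h h' b S'O in auto)
    then have "FM F (Gam M) X h = tgt.c (FO F (Gam M)) M (FO F X) g b" using h'(2) by metis
    also have "\<dots> \<in> tgt.W (FO F (Gam M)) (FO F X)" by (rule tgt.W_comp) (use h bW S'O in auto)
    finally have "h \<in> src.W (Gam M) X" using conservative[of "Gam M" X h] Gam h h' by auto
    then show ?thesis using h' by blast
  qed
  \<comment> \<open>A roof with apex \<open>M\<close> is rewritten along \<open>a M\<close> over the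
    apex \<open>FO F (Gam M)\<close>, where both legs are images of morphisms out of
    \<open>Gam M\<close>.\<close>
  have full: "\<exists>\<phi>\<in>Hom src.D X Y. FM V X Y \<phi> = \<psi>"
    if h: "X \<in> S'" "Y \<in> S'" "\<psi> \<in> Hom tgt.D (FO F X) (FO F Y)" for X Y \<psi>
  proof -
    obtain M s f where \<psi>: "\<psi> = tgt.rc (FO F X) (FO F Y) (M, s, f)" "M \<in> Obj T'" "s \<in> tgt.W M (FO F X)"
      "f \<in> Hom T' M (FO F Y)" by (rule tgt.hom_rcE[OF h(3)])
    obtain s' where s': "s' \<in> src.W (Gam M) X" "tgt.c M (FO F (Gam M)) (FO F X) (FM F (Gam M) X s') (a M) = s"
      using liftW \<psi> h by metis
    obtain f' where f': "f' \<in> Hom T (Gam M) Y" "tgt.c M (FO F (Gam M)) (FO F Y) (FM F (Gam M) Y f') (a M) = f"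
      using lift \<psi> h by metis
    have "FM V X Y (src.rc X Y (Gam M, s', f'))
        = tgt.rc (FO F X) (FO F Y) (FO F (Gam M), FM F (Gam M) X s', FM F (Gam M) Y f')"
      by (rule FM_rc) (use h s' f' \<psi> S'O in auto)
    also have "\<dots> = tgt.rc (FO F X) (FO F Y) (M, tgt.c M (FO F (Gam M)) (FO F X) (FM F (Gam M) X s') (a M),
        tgt.c M (FO F (Gam M)) (FO F Y) (FM F (Gam M) Y f') (a M))"
      by (rule tgt.rc_refine[symmetric]) (use h s' f' \<psi> S'O aW in auto)
    also have "\<dots> = \<psi>" unfolding s'(2) f'(2) \<psi>(1) ..
    finally show ?thesis using src.hom_rc[of "Gam M" s' X f' Y] s' f' \<psi> by (metis GO)
  qed
  \<comment> \<open>The apex \<open>Z\<close> is only known to lie in \<open>S\<close>. The two maps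
    are moved to its reflection \<open>Z'\<close> and precomposed with a map \<open>w\<close> that
    starts at some \<open>Gam M\<close>, so that \<open>faithful\<close> applies. In the quotient
    \<open>w\<close> is invertible and can be cancelled; composing with \<open>z\<close> leads back
    to \<open>Z\<close>.\<close>
  have faith_Hom: "src.Q Z Y f = src.Q Z Y g"
    if h: "Z \<in> S" "Y \<in> S'" "f \<in> Hom T Z Y" "g \<in> Hom T Z Y" "M \<in> Obj T'" "u \<in> tgt.W M (FO F Z)"
      "tgt.c M (FO F Z) (FO F Y) (FM F Z Y f) u = tgt.c M (FO F Z) (FO F Y) (FM F Z Y g) u" for Z Y f g M u
  proof -
    obtain Z' z where z: "Z' \<in> S'" "z \<in> src.W Z Z'"
      "\<forall>Y\<in>S'. \<forall>f\<in>Hom T Z Y. \<exists>f'\<in>Hom T Z' Y. f = src.c Z Z' Y f' z" using reflect[OF h(1)] by blast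
    obtain f' g' where fg: "f' \<in> Hom T Z' Y" "g' \<in> Hom T Z' Y" "f = src.c Z Z' Y f' z" "g = src.c Z Z' Y g' z"
      using z h(2-4) by metis
    have o [simp]: "Z \<in> Obj T" "Y \<in> Obj T" "Z' \<in> Obj T" using h z S'O SO by auto
    note [simp] = h(5,6) z(2) fg(1,2)
    define v where "v = tgt.c M (FO F Z) (FO F Z') (FM F Z Z' z) u"
    have v [simp]: "v \<in> tgt.W M (FO F Z')" unfolding v_def by simp
    obtain w where w [simp]: "w \<in> src.W (Gam M) Z'" and
      w': "tgt.c M (FO F (Gam M)) (FO F Z') (FM F (Gam M) Z' w) (a M) = v"
      using liftW[OF h(5) z(1) v] by blast
    have k: "FM F (Gam M) Y (src.c (Gam M) Z' Y k w) = tgt.c (FO F (Gam M)) (FO F Z') (FO F Y) (FM F Z' Y k) (FM F (Gam M) Z' w)"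
      "tgt.c M (FO F (Gam M)) (FO F Y) (FM F (Gam M) Y (src.c (Gam M) Z' Y k w)) (a M)
        = tgt.c M (FO F Z) (FO F Y) (FM F Z Y (src.c Z Z' Y k z)) u" if "k \<in> Hom T Z' Y" for k
      using that aW[OF h(5)] w' by (simp_all add: comp tgt.assoc v_def)
    have "tgt.c M (FO F (Gam M)) (FO F Y) (FM F (Gam M) Y (src.c (Gam M) Z' Y f' w)) (a M)
        = tgt.c M (FO F (Gam M)) (FO F Y) (FM F (Gam M) Y (src.c (Gam M) Z' Y g' w)) (a M)"
      unfolding k(2)[OF fg(1)] k(2)[OF fg(2)] using h(7) unfolding fg(3,4) .
    from tgt.iso_cancel_right[OF _ _ _ a_iso[OF h(5)] _ _ this]
    have "FM F (Gam M) Y (src.c (Gam M) Z' Y f' w) = FM F (Gam M) Y (src.c (Gam M) Z' Y g' w)" by simp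
    then have "src.Q (Gam M) Y (src.c (Gam M) Z' Y f' w) = src.Q (Gam M) Y (src.c (Gam M) Z' Y g' w)"
      by (intro faithful) (use h(2,5) in simp_all)
    then have eq: "Comp src.D (Gam M) Z' Y (src.Q Z' Y f') (src.Q (Gam M) Z' w)
        = Comp src.D (Gam M) Z' Y (src.Q Z' Y g') (src.Q (Gam M) Z' w)"
      by (simp only: src.quot_comp o GO h(5) fg w[THEN src.W_hom])
    have Q: "src.Q Z' Y f' \<in> Hom src.D Z' Y" "src.Q Z' Y g' \<in> Hom src.D Z' Y"
      by (rule src.quot_hom; simp)+
    have "src.Q Z' Y f' = src.Q Z' Y g'"
      by (rule is_cat.iso_cancel_right[OF src.verdier_is_cat _ _ _ src.quot_W_iso[OF _ _ w] Q eq])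
         (simp_all only: src.verdier_simps o GO h(5))
    then have "Comp src.D Z Z' Y (src.Q Z' Y f') (src.Q Z Z' z) = Comp src.D Z Z' Y (src.Q Z' Y g') (src.Q Z Z' z)"
      by simp
    then show ?thesis unfolding fg(3,4) by (simp only: src.quot_comp o fg z(2)[THEN src.W_hom])
  qed
  have faith: "\<phi> = \<phi>'"
    if h: "X \<in> S'" "Y \<in> S'" "\<phi> \<in> Hom src.D X Y" "\<phi>' \<in> Hom src.D X Y" "FM V X Y \<phi> = FM V X Y \<phi>'" for X Y \<phi> \<phi>'
  proof -
    have o [simp]: "X \<in> Obj T" "Y \<in> Obj T" using h S'O by auto
    obtain A s f where \<phi>: "\<phi> = src.rc X Y (A, s, f)" and [simp]: "A \<in> Obj T" "s \<in> src.W A X" "f \<in> Hom T A Y"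
      by (rule src.hom_rcE[OF h(3)])
    obtain A' s' f' where \<phi>': "\<phi>' = src.rc X Y (A', s', f')" and [simp]: "A' \<in> Obj T" "s' \<in> src.W A' X" "f' \<in> Hom T A' Y"
      by (rule src.hom_rcE[OF h(4)])
    \<comment> \<open>Both roofs are moved to a common apex with the same left leg \<open>r\<close>,
      so that only the right legs \<open>g\<close> and \<open>g'\<close> remain to be
      compared.\<close>
    obtain Z p q where Z [simp]: "Z \<in> Obj T" "p \<in> src.W Z A" "q \<in> Hom T Z A'" and pq: "src.c Z A X s p = src.c Z A' X s' q"
      using src.ore[of A A' X s s'] by auto
    have "src.c Z A' X s' q \<in> src.W Z X" unfolding pq[symmetric] by (rule src.W_comp) simp_all
    then have q [simp]: "q \<in> src.W Z A'" by (intro src.W_cancel[of Z A' X q s']) simp_all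
    define r where "r = src.c Z A X s p"
    define g where "g = src.c Z A Y f p"
    define g' where "g' = src.c Z A' Y f' q"
    have [simp]: "r \<in> src.W Z X" "g \<in> Hom T Z Y" "g' \<in> Hom T Z Y" by (simp_all add: r_def g_def g'_def)
    have 1: "\<phi> = src.rc X Y (Z, r, g)" unfolding \<phi> r_def g_def by (rule src.rc_refine[symmetric]) simp_all
    have 2: "\<phi>' = src.rc X Y (Z, r, g')" unfolding \<phi>' r_def g'_def pq by (rule src.rc_refine[symmetric]) simp_all
    have "tgt.rc (FO F X) (FO F Y) (FO F Z, FM F Z X r, FM F Z Y g)
       = tgt.rc (FO F X) (FO F Y) (FO F Z, FM F Z X r, FM F Z Y g')"
      using h(5) unfolding 1 2 by (simp only: FM_rc o Z \<open>r \<in> src.W Z X\<close> \<open>g \<in> Hom T Z Y\<close> \<open>g' \<in> Hom T Z Y\<close>)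
    then have "((FO F Z, FM F Z X r, FM F Z Y g), (FO F Z, FM F Z X r, FM F Z Y g')) \<in> roof_rel T' N' (FO F X) (FO F Y)"
      by (subst (asm) tgt.rc_eq_iff) simp_all
    then obtain B b b' where B [simp]: "B \<in> Obj T'" "b \<in> tgt.W B (FO F Z)" "b' \<in> tgt.W B (FO F Z)" and
      B': "tgt.c B (FO F Z) (FO F X) (FM F Z X r) b = tgt.c B (FO F Z) (FO F X) (FM F Z X r) b'"
      "tgt.c B (FO F Z) (FO F Y) (FM F Z Y g) b = tgt.c B (FO F Z) (FO F Y) (FM F Z Y g') b'"
      by (rule tgt.roof_relE) (simp_all)
    \<comment> \<open>\<open>b\<close> and \<open>b'\<close> need not be equal. They agree after
      composition with the image of \<open>r\<close>, which lies in \<open>W\<close>, so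
      \<open>cancel\<close> equalises them.\<close>
    obtain M u where M [simp]: "M \<in> Obj T'" "u \<in> tgt.W M B" and u: "tgt.c M B (FO F Z) b u = tgt.c M B (FO F Z) b' u"
      using tgt.cancel[OF _ _ _ _ _ _ B'(1)] by auto
    have "tgt.c M (FO F Z) (FO F Y) (FM F Z Y g) (tgt.c M B (FO F Z) b u)
       = tgt.c M (FO F Z) (FO F Y) (FM F Z Y g') (tgt.c M B (FO F Z) b' u)"
      by (rule tgt.square_ext) (simp_all add: B')
    then have "src.Q Z Y g = src.Q Z Y g'"
      by (intro faith_Hom[of Z Y g g' M "tgt.c M B (FO F Z) b u"])
         (simp_all add: u[symmetric] W_closed[OF subsetD[OF sub(1) h(1)] _ \<open>r \<in> src.W Z X\<close>] h(2))
    then have "Comp src.D X Z Y (src.Q Z Y g) (src.rc X Z (Z, r, Idm T Z)) = Comp src.D X Z Y (src.Q Z Y g') (src.rc X Z (Z, r, Idm T Z))"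
      by simp
    then show ?thesis unfolding 1 2 by (simp only: src.rc_quot o Z \<open>r \<in> src.W Z X\<close> \<open>g \<in> Hom T Z Y\<close> \<open>g' \<in> Hom T Z Y\<close>)
  qed
  have bij': "bij_betw (FM V X Y) (Hom src.D X Y) (Hom tgt.D (FO V X) (FO V Y))" if "X \<in> S'" "Y \<in> S'" for X Y
  proof (rule bij_betw_imageI)
    show "inj_on (FM V X Y) (Hom src.D X Y)"
      by (rule inj_onI) (rule faith[OF that])
    show "FM V X Y ` Hom src.D X Y = Hom tgt.D (FO V X) (FO V Y)"
    proof (rule equalityI; rule subsetI)
      fix \<psi> assume "\<psi> \<in> FM V X Y ` Hom src.D X Y"
      then obtain \<phi> where "\<phi> \<in> Hom src.D X Y" "\<psi> = FM V X Y \<phi>" by (rule imageE)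
      then show "\<psi> \<in> Hom tgt.D (FO V X) (FO V Y)"
        using V.hom[of X Y \<phi>] S'O[OF that(1)] S'O[OF that(2)] by (simp only: src.verdier_simps)
    next
      fix \<psi> assume "\<psi> \<in> Hom tgt.D (FO V X) (FO V Y)"
      then have "\<psi> \<in> Hom tgt.D (FO F X) (FO F Y)" by (simp only: FO_V)
      from full[OF that this] show "\<psi> \<in> FM V X Y ` Hom src.D X Y" by (elim bexE) (rule image_eqI, erule sym)
    qed
  qed
  have isoS': "\<exists>X'\<in>S'. \<exists>q. iso_in src.D X X' q" if XS: "X \<in> S" for X
  proof -
    obtain X' q where "X' \<in> S'" "q \<in> src.W X X'" using reflect[OF XS] by blast
    then show ?thesis using src.quot_W_iso[of X' X q] S'O SO[OF XS] by blast
  qed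
  have bij: "bij_betw (FM V X Y) (Hom src.D X Y) (Hom tgt.D (FO V X) (FO V Y))" if XY: "X \<in> S" "Y \<in> S" for X Y
  proof -
    obtain X' q where X: "X' \<in> S'" "iso_in src.D X X' q" using isoS'[OF XY(1)] by blast
    obtain Y' r where Y: "Y' \<in> S'" "iso_in src.D Y Y' r" using isoS'[OF XY(2)] by blast
    have "S' \<subseteq> Obj src.D" using sub by auto
    from V.bij_betw_transfer[OF this bij' _ X _ Y] SO[OF XY(1)] SO[OF XY(2)]
    show ?thesis by (simp only: src.verdier_simps)
  qed
  interpret FS: is_func "full_sub src.D S" tgt.D V by (rule V.full_sub_is_func)
  show ?thesis
  proof (rule FS.equivalence_if_fully_faithful)
    fix X Y assume "X \<in> Obj (full_sub src.D S)" "Y \<in> Obj (full_sub src.D S)"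
    then show "bij_betw (FM V X Y) (Hom (full_sub src.D S) X Y) (Hom tgt.D (FO V X) (FO V Y))"
      using bij[of X Y] by (simp only: full_sub_simps Int_iff)
  next
    fix M assume "M \<in> Obj tgt.D"
    then have M: "M \<in> Obj T'" by simp
    have "iso_in tgt.D M (FO F (Gam M)) (tgt.Q M (FO F (Gam M)) (a M))"
      by (rule tgt.quot_W_iso) (use M aW in auto)
    then obtain e where "iso_in tgt.D (FO V (Gam M)) M e" unfolding FO_V by (rule is_cat.iso_sym[OF tgt.verdier_is_cat])
    then show "\<exists>X\<in>Obj (full_sub src.D S). \<exists>e. iso_in tgt.D (FO V X) M e"
      using Gam[OF M] sub by (auto intro!: bexI[of _ "Gam M"])
  qed
qed

end

section \<open>Homotopy classes of closed morphisms\<close>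

context abelian_group
begin

lemma ab_closed [simp]:
  "x \<in> carrier G \<Longrightarrow> y \<in> carrier G \<Longrightarrow> x \<oplus> y \<in> carrier G"
  "x \<in> carrier G \<Longrightarrow> y \<in> carrier G \<Longrightarrow> x \<ominus> y \<in> carrier G"
  "\<zero> \<in> carrier G" "x \<in> carrier G \<Longrightarrow> \<ominus> x \<in> carrier G"
  by auto

lemma ab_simp [simp]:
  "x \<in> carrier G \<Longrightarrow> x \<oplus> \<zero> = x" "x \<in> carrier G \<Longrightarrow> \<zero> \<oplus> x = x" "\<ominus> \<zero> = \<zero>"
  "x \<in> carrier G \<Longrightarrow> \<ominus> (\<ominus> x) = x"
  "x \<in> carrier G \<Longrightarrow> x \<oplus> \<ominus> x = \<zero>" "x \<in> carrier G \<Longrightarrow> \<ominus> x \<oplus> x = \<zero>"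
  "x \<in> carrier G \<Longrightarrow> y \<in> carrier G \<Longrightarrow> x \<oplus> (\<ominus> x \<oplus> y) = y"
  "x \<in> carrier G \<Longrightarrow> y \<in> carrier G \<Longrightarrow> \<ominus> x \<oplus> (x \<oplus> y) = y"
  "x \<in> carrier G \<Longrightarrow> x \<ominus> x = \<zero>" "x \<in> carrier G \<Longrightarrow> x \<ominus> \<zero> = x"
  using add.inv_one by (auto simp: minus_eq r_neg l_neg r_neg1 r_neg2)

lemma ab_ac:
  "x \<ominus> y = x \<oplus> \<ominus> y"
  "x \<in> carrier G \<Longrightarrow> y \<in> carrier G \<Longrightarrow> \<ominus> (x \<oplus> y) = \<ominus> x \<oplus> \<ominus> y"
  "x \<in> carrier G \<Longrightarrow> y \<in> carrier G \<Longrightarrow> z \<in> carrier G \<Longrightarrow> x \<oplus> y \<oplus> z = x \<oplus> (y \<oplus> z)"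
  "x \<in> carrier G \<Longrightarrow> y \<in> carrier G \<Longrightarrow> x \<oplus> y = y \<oplus> x"
  "x \<in> carrier G \<Longrightarrow> y \<in> carrier G \<Longrightarrow> z \<in> carrier G \<Longrightarrow> x \<oplus> (y \<oplus> z) = y \<oplus> (x \<oplus> z)"
  by (simp_all only: minus_eq minus_add a_assoc a_comm a_lcomm)

lemma ab_eq_minus: "\<lbrakk>x \<in> carrier G; y \<in> carrier G\<rbrakk> \<Longrightarrow> x \<ominus> y = \<zero> \<longleftrightarrow> x = y"
  by (metis ab_simp(9) add.inv_equality minus_eq ab_closed(4) ab_simp(4))

lemma ab_neg_eq_0 [simp]: "x \<in> carrier G \<Longrightarrow> \<ominus> x = \<zero> \<longleftrightarrow> x = \<zero>"
  by (metis ab_simp(3,4))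

end

lemmas ab_closed = abelian_group.ab_closed
lemmas ab_simp = abelian_group.ab_simp abelian_group.ab_neg_eq_0
lemmas ab_ac = abelian_group.ab_ac
declare ab_closed [simp] ab_simp [simp]

lemma additive_map:
  assumes "abelian_group G" "abelian_group H" "\<And>x. x \<in> carrier G \<Longrightarrow> f x \<in> carrier H"
    "\<And>x y. x \<in> carrier G \<Longrightarrow> y \<in> carrier G \<Longrightarrow> f (x \<oplus>\<^bsub>G\<^esub> y) = f x \<oplus>\<^bsub>H\<^esub> f y"
  shows "f \<zero>\<^bsub>G\<^esub> = \<zero>\<^bsub>H\<^esub>" "x \<in> carrier G \<Longrightarrow> f (\<ominus>\<^bsub>G\<^esub> x) = \<ominus>\<^bsub>H\<^esub> f x"
    "x \<in> carrier G \<Longrightarrow> y \<in> carrier G \<Longrightarrow> f (x \<ominus>\<^bsub>G\<^esub> y) = f x \<ominus>\<^bsub>H\<^esub> f y"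
proof -
  interpret G: abelian_group G by fact
  interpret H: abelian_group H by fact
  have "f \<zero>\<^bsub>G\<^esub> \<oplus>\<^bsub>H\<^esub> f \<zero>\<^bsub>G\<^esub> = f \<zero>\<^bsub>G\<^esub>" using assms(4)[of "\<zero>\<^bsub>G\<^esub>" "\<zero>\<^bsub>G\<^esub>"] by simp
  then show z: "f \<zero>\<^bsub>G\<^esub> = \<zero>\<^bsub>H\<^esub>" using assms(3) by (metis G.zero_closed H.add.r_cancel_one')
  show n: "f (\<ominus>\<^bsub>G\<^esub> x) = \<ominus>\<^bsub>H\<^esub> f x" if "x \<in> carrier G" for x
    using assms(4)[of "\<ominus>\<^bsub>G\<^esub> x" x] that assms(3) z by (metis G.a_inv_closed G.l_neg H.minus_equality)
  show "f (x \<ominus>\<^bsub>G\<^esub> y) = f x \<ominus>\<^bsub>H\<^esub> f y" if "x \<in> carrier G" "y \<in> carrier G"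
    using that assms(4) n by (simp add: G.minus_eq H.minus_eq)
qed

lemma gsgn_simps [simp]:
  "gsgn G 0 x = x" "gsgn G (- 1) x = \<ominus>\<^bsub>G\<^esub> x" "gsgn G 1 x = \<ominus>\<^bsub>G\<^esub> x" "gsgn G 2 x = x"
  by (simp_all add: gsgn_def)

lemma gsgn_closed [simp]: "abelian_group G \<Longrightarrow> x \<in> carrier G \<Longrightarrow> gsgn G p x \<in> carrier G"
  by (simp add: gsgn_def)

lemma gsgn_gsgn: "abelian_group G \<Longrightarrow> x \<in> carrier G \<Longrightarrow> gsgn G p (gsgn G q x) = gsgn G (p + q) x"
  by (auto simp: gsgn_def)

lemma gsgn_add: "abelian_group G \<Longrightarrow> x \<in> carrier G \<Longrightarrow> y \<in> carrier G \<Longrightarrow>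
    gsgn G p (x \<oplus>\<^bsub>G\<^esub> y) = gsgn G p x \<oplus>\<^bsub>G\<^esub> gsgn G p y"
  by (simp add: gsgn_def ab_ac)

lemma gsgn_zero [simp]: "abelian_group G \<Longrightarrow> gsgn G p \<zero>\<^bsub>G\<^esub> = \<zero>\<^bsub>G\<^esub>"
  by (simp add: gsgn_def)

lemma gsgn_map: "f (\<ominus>\<^bsub>G\<^esub> x) = \<ominus>\<^bsub>H\<^esub> f x \<Longrightarrow> f (gsgn G p x) = gsgn H p (f x)"
  by (simp add: gsgn_def)

context cdg_algebra
begin

abbreviation isM where "isM M \<equiv> cdg_module R A M"

lemma A_module: "module R (agr A i)"
  by (rule graded)

lemma A_grp [simp]: "abelian_group (agr A i)"
  using graded[of i] by (rule module.axioms)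

lemma Mod_module: "isM M \<Longrightarrow> module R (mgr M i)"
  by (rule cdg_module.graded)

lemma Mod_grp [simp]: "isM M \<Longrightarrow> abelian_group (mgr M i)"
  using Mod_module by (rule module.axioms)

lemmas A_closed [simp] = mult_closed one_closed diff_closed curv_closed
lemmas A_simp [simp] = mult_add_left mult_add_right one_left one_right diff_add

lemma A_zero [simp]:
  "b \<in> carrier (agr A j) \<Longrightarrow> amult A i j \<zero>\<^bsub>agr A i\<^esub> b = \<zero>\<^bsub>agr A (i + j)\<^esub>"
  "a \<in> carrier (agr A i) \<Longrightarrow> amult A i j a \<zero>\<^bsub>agr A j\<^esub> = \<zero>\<^bsub>agr A (i + j)\<^esub>"
  "adiff A i \<zero>\<^bsub>agr A i\<^esub> = \<zero>\<^bsub>agr A (i + 1)\<^esub>"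
  by (rule additive_map(1)[of _ _ "\<lambda>a. amult A i j a b" for b], simp_all)
     (rule additive_map(1)[of _ _ "amult A i j a" for a], simp_all,
      rule additive_map(1)[of _ _ "adiff A i"], simp_all)

lemma A_neg [simp]:
  "a \<in> carrier (agr A i) \<Longrightarrow> b \<in> carrier (agr A j) \<Longrightarrow> amult A i j (\<ominus>\<^bsub>agr A i\<^esub> a) b = \<ominus>\<^bsub>agr A (i + j)\<^esub> amult A i j a b"
  "a \<in> carrier (agr A i) \<Longrightarrow> b \<in> carrier (agr A j) \<Longrightarrow> amult A i j a (\<ominus>\<^bsub>agr A j\<^esub> b) = \<ominus>\<^bsub>agr A (i + j)\<^esub> amult A i j a b"
  "a \<in> carrier (agr A i) \<Longrightarrow> adiff A i (\<ominus>\<^bsub>agr A i\<^esub> a) = \<ominus>\<^bsub>agr A (i + 1)\<^esub> adiff A i a"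
  by (rule additive_map(2)[of _ _ "\<lambda>a. amult A i j a b" for b], simp_all)
     (rule additive_map(2)[of _ _ "amult A i j a" for a], simp_all,
      rule additive_map(2)[of _ _ "adiff A i"], simp_all)

text \<open>The Leibniz rule for 1 = 1 1 gives d 1 = d 1 + d 1.\<close>

lemma adiff_one [simp]: "adiff A 0 (aone A) = \<zero>\<^bsub>agr A 1\<^esub>"
proof -
  have 1: "adiff A 0 (aone A) \<in> carrier (agr A 1)" using diff_closed[OF one_closed] by simp
  interpret abelian_group "agr A 1" by simp
  have "adiff A 0 (aone A) = adiff A 0 (aone A) \<oplus>\<^bsub>agr A 1\<^esub> adiff A 0 (aone A)"
    using leibniz[OF one_closed one_closed] 1 one_right[OF 1] one_left[OF 1] by simp
  then show ?thesis using 1 by (metis add.r_cancel_one')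
qed

lemma M_closed [simp]:
  assumes "isM M"
  shows "a \<in> carrier (agr A i) \<Longrightarrow> m \<in> carrier (mgr M j) \<Longrightarrow> mact M i j a m \<in> carrier (mgr M (i + j))"
    "m \<in> carrier (mgr M i) \<Longrightarrow> mdiff M i m \<in> carrier (mgr M (i + 1))"
    "r \<in> carrier R \<Longrightarrow> m \<in> carrier (mgr M i) \<Longrightarrow> r \<odot>\<^bsub>mgr M i\<^esub> m \<in> carrier (mgr M i)"
  using cdg_module.act_closed[OF assms] cdg_module.diff_closed[OF assms]
    module.smult_closed[OF Mod_module[OF assms]] by auto

lemma M_add [simp]:
  assumes "isM M"
  shows "\<lbrakk>a \<in> carrier (agr A i); a' \<in> carrier (agr A i); m \<in> carrier (mgr M j)\<rbrakk>
      \<Longrightarrow> mact M i j (a \<oplus>\<^bsub>agr A i\<^esub> a') m = mact M i j a m \<oplus>\<^bsub>mgr M (i + j)\<^esub> mact M i j a' m"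
    "\<lbrakk>a \<in> carrier (agr A i); m \<in> carrier (mgr M j); m' \<in> carrier (mgr M j)\<rbrakk>
      \<Longrightarrow> mact M i j a (m \<oplus>\<^bsub>mgr M j\<^esub> m') = mact M i j a m \<oplus>\<^bsub>mgr M (i + j)\<^esub> mact M i j a m'"
    "\<lbrakk>m \<in> carrier (mgr M i); m' \<in> carrier (mgr M i)\<rbrakk>
      \<Longrightarrow> mdiff M i (m \<oplus>\<^bsub>mgr M i\<^esub> m') = mdiff M i m \<oplus>\<^bsub>mgr M (i + 1)\<^esub> mdiff M i m'"
    "m \<in> carrier (mgr M i) \<Longrightarrow> mact M 0 i (aone A) m = m"
  using cdg_module.act_add_left[OF assms] cdg_module.act_add_right[OF assms]
    cdg_module.diff_add[OF assms] cdg_module.act_one[OF assms] by auto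

lemma M_zero [simp]:
  assumes "isM M"
  shows "b \<in> carrier (mgr M j) \<Longrightarrow> mact M i j \<zero>\<^bsub>agr A i\<^esub> b = \<zero>\<^bsub>mgr M (i + j)\<^esub>"
    "a \<in> carrier (agr A i) \<Longrightarrow> mact M i j a \<zero>\<^bsub>mgr M j\<^esub> = \<zero>\<^bsub>mgr M (i + j)\<^esub>"
    "mdiff M i \<zero>\<^bsub>mgr M i\<^esub> = \<zero>\<^bsub>mgr M (i + 1)\<^esub>"
  by (rule additive_map(1)[of _ _ "\<lambda>a. mact M i j a b" for b], simp_all add: assms)
     (rule additive_map(1)[of _ _ "mact M i j a" for a], simp_all add: assms,
      rule additive_map(1)[of _ _ "mdiff M i"], simp_all add: assms)

lemma M_neg [simp]:
  assumes "isM M"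
  shows "a \<in> carrier (agr A i) \<Longrightarrow> b \<in> carrier (mgr M j) \<Longrightarrow> mact M i j (\<ominus>\<^bsub>agr A i\<^esub> a) b = \<ominus>\<^bsub>mgr M (i + j)\<^esub> mact M i j a b"
    "a \<in> carrier (agr A i) \<Longrightarrow> b \<in> carrier (mgr M j) \<Longrightarrow> mact M i j a (\<ominus>\<^bsub>mgr M j\<^esub> b) = \<ominus>\<^bsub>mgr M (i + j)\<^esub> mact M i j a b"
    "b \<in> carrier (mgr M i) \<Longrightarrow> mdiff M i (\<ominus>\<^bsub>mgr M i\<^esub> b) = \<ominus>\<^bsub>mgr M (i + 1)\<^esub> mdiff M i b"
  by (rule additive_map(2)[of _ _ "\<lambda>a. mact M i j a b" for b], simp_all add: assms)
     (rule additive_map(2)[of _ _ "mact M i j a" for a], simp_all add: assms,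
      rule additive_map(2)[of _ _ "mdiff M i"], simp_all add: assms)

lemmas M_assoc = cdg_module.act_assoc
lemmas M_leibniz = cdg_module.leibniz
lemmas M_dd = cdg_module.diff_diff

lemma act_gsgn:
  assumes "isM M" "a \<in> carrier (agr A i)" "m \<in> carrier (mgr M j)"
  shows "mact M i j a (gsgn (mgr M j) p m) = gsgn (mgr M (i + j)) p (mact M i j a m)"
  by (rule gsgn_map) (use assms in simp)

lemma diff_gsgn:
  assumes "isM M" "m \<in> carrier (mgr M j)"
  shows "mdiff M j (gsgn (mgr M j) p m) = gsgn (mgr M (j + 1)) p (mdiff M j m)"
  by (rule gsgn_map) (use assms in simp)

lemma ghomI:
  assumes "\<And>i m. m \<in> carrier (mgr M i) \<Longrightarrow> f i m \<in> carrier (mgr N (i + p))"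
    "\<And>i m m'. m \<in> carrier (mgr M i) \<Longrightarrow> m' \<in> carrier (mgr M i) \<Longrightarrow>
        f i (m \<oplus>\<^bsub>mgr M i\<^esub> m') = f i m \<oplus>\<^bsub>mgr N (i + p)\<^esub> f i m'"
    "\<And>i j a m. a \<in> carrier (agr A i) \<Longrightarrow> m \<in> carrier (mgr M j) \<Longrightarrow>
        f (i + j) (mact M i j a m) = gsgn (mgr N (i + j + p)) (p * i) (mact N i (j + p) a (f j m))"
  shows "f \<in> ghom A p M N"
  using assms unfolding ghom_def by blast

lemma ghom_closed [simp]: "f \<in> ghom A p M N \<Longrightarrow> m \<in> carrier (mgr M i) \<Longrightarrow> f i m \<in> carrier (mgr N (i + p))"
  and ghom_add [simp]: "f \<in> ghom A p M N \<Longrightarrow> m \<in> carrier (mgr M i) \<Longrightarrow> m' \<in> carrier (mgr M i) \<Longrightarrow>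
        f i (m \<oplus>\<^bsub>mgr M i\<^esub> m') = f i m \<oplus>\<^bsub>mgr N (i + p)\<^esub> f i m'"
  and ghom_act: "f \<in> ghom A p M N \<Longrightarrow> a \<in> carrier (agr A i) \<Longrightarrow> m \<in> carrier (mgr M j) \<Longrightarrow>
        f (i + j) (mact M i j a m) = gsgn (mgr N (i + j + p)) (p * i) (mact N i (j + p) a (f j m))"
  unfolding ghom_def by blast+

lemma ghom_zero [simp]:
  assumes "f \<in> ghom A p M N" "isM M" "isM N"
  shows "f i \<zero>\<^bsub>mgr M i\<^esub> = \<zero>\<^bsub>mgr N (i + p)\<^esub>"
    "m \<in> carrier (mgr M i) \<Longrightarrow> f i (\<ominus>\<^bsub>mgr M i\<^esub> m) = \<ominus>\<^bsub>mgr N (i + p)\<^esub> f i m"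
    "m \<in> carrier (mgr M i) \<Longrightarrow> m' \<in> carrier (mgr M i) \<Longrightarrow> f i (m \<ominus>\<^bsub>mgr M i\<^esub> m') = f i m \<ominus>\<^bsub>mgr N (i + p)\<^esub> f i m'"
  by (rule additive_map[of _ _ "f i"]; use assms in simp)+

lemma ghom_gsgn:
  assumes "isM M" "isM N" "f \<in> ghom A p M N" "m \<in> carrier (mgr M i)"
  shows "f i (gsgn (mgr M i) s m) = gsgn (mgr N (i + p)) s (f i m)"
  by (rule gsgn_map) (use assms in simp)

lemma ghom_comp:
  assumes "isM L" "isM M" "isM N" "f \<in> ghom A p L M" "g \<in> ghom A q M N"
  shows "(\<lambda>i m. g (i + p) (f i m)) \<in> ghom A (p + q) L N"
proof (rule ghomI, goal_cases)
  case (1 i m) then show ?case using ghom_closed[OF assms(5) ghom_closed[OF assms(4)]] by (simp add: add.assoc)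
next
  case (2 i m m') then show ?case using assms(4,5) by (simp add: add.assoc)
next
  case (3 i j a m)
  have f: "f j m \<in> carrier (mgr M (j + p))" using assms(4) 3 by simp
  have "g (i + j + p) (f (i + j) (mact L i j a m))
      = gsgn (mgr N (i + j + p + q)) (p * i) (g (i + (j + p)) (mact M i (j + p) a (f j m)))"
    using assms 3 f M_closed(1)[OF assms(2) 3(1) f]
      ghom_gsgn[OF assms(2,3,5), of "mact M i (j + p) a (f j m)" "i + (j + p)"]
    by (simp add: ghom_act add.assoc)
  also have "\<dots> = gsgn (mgr N (i + j + (p + q))) ((p + q) * i) (mact N i (j + (p + q)) a (g (j + p) (f j m)))"
    using assms 3 f M_closed(1)[OF assms(3) 3(1) ghom_closed[OF assms(5) f]]
    by (subst ghom_act[OF assms(5)]) (simp_all add: gsgn_gsgn add.assoc distrib_right)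
  finally show ?case .
qed

lemma ghom_zero_map:
  assumes "isM M" "isM N"
  shows "(\<lambda>i m. \<zero>\<^bsub>mgr N (i + p)\<^esub>) \<in> ghom A p M N"
proof -
  have "mact N i (j + p) a (\<zero>\<^bsub>mgr N (j + p)\<^esub>) = \<zero>\<^bsub>mgr N (i + j + p)\<^esub>" if "a \<in> carrier (agr A i)" for i j a
    using that assms by (simp add: add.assoc)
  then show ?thesis by (intro ghomI) (use assms in auto)
qed

lemma ghom_comb:
  assumes M: "isM M" "isM N" and f: "f \<in> ghom A p M N" and g: "g \<in> ghom A p M N"
  shows "(\<lambda>i m. f i m \<oplus>\<^bsub>mgr N (i + p)\<^esub> g i m) \<in> ghom A p M N"
    "(\<lambda>i m. \<ominus>\<^bsub>mgr N (i + p)\<^esub> f i m) \<in> ghom A p M N"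
    "(\<lambda>i m. f i m \<ominus>\<^bsub>mgr N (i + p)\<^esub> g i m) \<in> ghom A p M N"
proof -
  note [simp] = M
  have [simp]: "mact N i (j + p) a (h j m) \<in> carrier (mgr N (i + j + p))"
    if "h \<in> ghom A p M N" "a \<in> carrier (agr A i)" "m \<in> carrier (mgr M j)" for i j a m h
    using M_closed(1)[OF M(2) that(2) ghom_closed[OF that(1,3)]] by (simp add: add.assoc)
  have act: "mact N i (j + p) a x \<oplus>\<^bsub>mgr N (i + j + p)\<^esub> mact N i (j + p) a y = mact N i (j + p) a (x \<oplus>\<^bsub>mgr N (j + p)\<^esub> y)"
    if "a \<in> carrier (agr A i)" "x \<in> carrier (mgr N (j + p))" "y \<in> carrier (mgr N (j + p))" for i j a x y
    using that by (simp add: add.assoc)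
  have n: "(\<lambda>i m. \<ominus>\<^bsub>mgr N (i + p)\<^esub> f i m) \<in> ghom A p M N" if "f \<in> ghom A p M N" for f
    by (rule ghomI) (use that in \<open>auto simp: ab_ac ghom_act gsgn_def add.assoc\<close>)
  from this[OF f] show "(\<lambda>i m. \<ominus>\<^bsub>mgr N (i + p)\<^esub> f i m) \<in> ghom A p M N" .
  have p: "(\<lambda>i m. f i m \<oplus>\<^bsub>mgr N (i + p)\<^esub> g i m) \<in> ghom A p M N" if "g \<in> ghom A p M N" for g
  proof (rule ghomI, goal_cases)
    case (2 i m m')
    have "\<And>x y z w. \<lbrakk>x \<in> carrier (mgr N (i + p)); y \<in> carrier (mgr N (i + p)); z \<in> carrier (mgr N (i + p)); w \<in> carrier (mgr N (i + p))\<rbrakk>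
      \<Longrightarrow> (x \<oplus>\<^bsub>mgr N (i + p)\<^esub> y) \<oplus>\<^bsub>mgr N (i + p)\<^esub> (z \<oplus>\<^bsub>mgr N (i + p)\<^esub> w) = (x \<oplus>\<^bsub>mgr N (i + p)\<^esub> z) \<oplus>\<^bsub>mgr N (i + p)\<^esub> (y \<oplus>\<^bsub>mgr N (i + p)\<^esub> w)"
      by (simp add: ab_ac)
    then show ?case using 2 that f by simp
  next
    case (3 i j a m) then show ?case
      using that f by (simp add: ghom_act gsgn_add[symmetric] act)
  qed (use that f in auto)
  from this[OF g] show "(\<lambda>i m. f i m \<oplus>\<^bsub>mgr N (i + p)\<^esub> g i m) \<in> ghom A p M N" .
  show "(\<lambda>i m. f i m \<ominus>\<^bsub>mgr N (i + p)\<^esub> g i m) \<in> ghom A p M N"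
    using p[OF n[OF g]] unfolding a_minus_def .
qed

lemma closed0_iff:
  assumes M: "isM M" "isM N"
  shows "f \<in> closed0 A M N \<longleftrightarrow> f \<in> ghom A 0 M N \<and>
    (\<forall>i. \<forall>m\<in>carrier (mgr M i). mdiff N i (f i m) = f (i + 1) (mdiff M i m))"
proof -
  have "dhom 0 M N f i m = \<zero>\<^bsub>mgr N (i + 1)\<^esub> \<longleftrightarrow> mdiff N i (f i m) = f (i + 1) (mdiff M i m)"
    if "f \<in> ghom A 0 M N" "m \<in> carrier (mgr M i)" for i m
  proof -
    have "f i m \<in> carrier (mgr N i)" "f (i + 1) (mdiff M i m) \<in> carrier (mgr N (i + 1))"
      using ghom_closed[OF that(1), of m i] ghom_closed[OF that(1), of "mdiff M i m" "i + 1"] that M by auto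
    then show ?thesis using M unfolding dhom_def by (simp add: abelian_group.ab_eq_minus)
  qed
  then show ?thesis unfolding closed0_def by blast
qed

lemma closed0I:
  assumes "isM M" "isM N" "\<And>i m. m \<in> carrier (mgr M i) \<Longrightarrow> f i m \<in> carrier (mgr N i)"
    "\<And>i m m'. m \<in> carrier (mgr M i) \<Longrightarrow> m' \<in> carrier (mgr M i) \<Longrightarrow>
        f i (m \<oplus>\<^bsub>mgr M i\<^esub> m') = f i m \<oplus>\<^bsub>mgr N i\<^esub> f i m'"
    "\<And>i j a m. a \<in> carrier (agr A i) \<Longrightarrow> m \<in> carrier (mgr M j) \<Longrightarrow>
        f (i + j) (mact M i j a m) = mact N i j a (f j m)"
    "\<And>i m. m \<in> carrier (mgr M i) \<Longrightarrow> mdiff N i (f i m) = f (i + 1) (mdiff M i m)"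
  shows "f \<in> closed0 A M N"
  unfolding closed0_iff[OF assms(1,2)] using assms(3-) by (auto intro!: ghomI)

lemma closed0_ghom: "f \<in> closed0 A M N \<Longrightarrow> f \<in> ghom A 0 M N"
  by (simp add: closed0_def)

lemma closed0_closed [simp]: "f \<in> closed0 A M N \<Longrightarrow> m \<in> carrier (mgr M i) \<Longrightarrow> f i m \<in> carrier (mgr N i)"
  using ghom_closed[OF closed0_ghom, of f M N m i] by simp

lemma closed0_add [simp]: "f \<in> closed0 A M N \<Longrightarrow> m \<in> carrier (mgr M i) \<Longrightarrow> m' \<in> carrier (mgr M i) \<Longrightarrow>
    f i (m \<oplus>\<^bsub>mgr M i\<^esub> m') = f i m \<oplus>\<^bsub>mgr N i\<^esub> f i m'"
  using ghom_add[OF closed0_ghom, of f M N m i] by simp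

lemma closed0_act: "f \<in> closed0 A M N \<Longrightarrow> a \<in> carrier (agr A i) \<Longrightarrow> m \<in> carrier (mgr M j) \<Longrightarrow>
    f (i + j) (mact M i j a m) = mact N i j a (f j m)"
  using ghom_act[OF closed0_ghom, of f M N a i m j] by simp

lemma closed0_diff: "f \<in> closed0 A M N \<Longrightarrow> m \<in> carrier (mgr M i) \<Longrightarrow> isM M \<Longrightarrow> isM N \<Longrightarrow>
    f (i + 1) (mdiff M i m) = mdiff N i (f i m)"
  by (simp add: closed0_iff)

lemma closed0_zero [simp]:
  assumes "f \<in> closed0 A M N" "isM M" "isM N"
  shows "f i \<zero>\<^bsub>mgr M i\<^esub> = \<zero>\<^bsub>mgr N i\<^esub>"
    "m \<in> carrier (mgr M i) \<Longrightarrow> f i (\<ominus>\<^bsub>mgr M i\<^esub> m) = \<ominus>\<^bsub>mgr N i\<^esub> f i m"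
    "m \<in> carrier (mgr M i) \<Longrightarrow> m' \<in> carrier (mgr M i) \<Longrightarrow> f i (m \<ominus>\<^bsub>mgr M i\<^esub> m') = f i m \<ominus>\<^bsub>mgr N i\<^esub> f i m'"
  using ghom_zero[OF closed0_ghom[OF assms(1)] assms(2,3), where i = i] by simp_all

lemma closed0_id [simp]: "isM M \<Longrightarrow> (\<lambda>i x. x) \<in> closed0 A M M"
  by (rule closed0I) auto

lemma closed0_comp [simp]:
  assumes "f \<in> closed0 A L M" "g \<in> closed0 A M N" "isM L" "isM M" "isM N"
  shows "(\<lambda>i x. g i (f i x)) \<in> closed0 A L N"
  by (rule closed0I) (use assms in \<open>auto simp: closed0_act closed0_diff\<close>)

lemma closed0_comb:
  assumes "isM M" "isM N" "f \<in> closed0 A M N" "g \<in> closed0 A M N"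
  shows "(\<lambda>i m. f i m \<oplus>\<^bsub>mgr N i\<^esub> g i m) \<in> closed0 A M N"
    "(\<lambda>i m. f i m \<ominus>\<^bsub>mgr N i\<^esub> g i m) \<in> closed0 A M N"
  unfolding closed0_iff[OF assms(1,2)]
  using ghom_comb[OF assms(1,2) closed0_ghom[OF assms(3)] closed0_ghom[OF assms(4)]] assms
  by (auto simp: a_minus_def closed0_diff)

lemma closed0_zero_map [simp]:
  assumes "isM M" "isM N" shows "(\<lambda>i m. \<zero>\<^bsub>mgr N i\<^esub>) \<in> closed0 A M N"
  by (rule closed0I) (use assms in auto)

text \<open>The differential of a map of degree -1: the Koszul sign in \<open>dhom (- 1)\<close>
  cancels against the subtraction, which leaves d h + h d.\<close>

definition bd where "bd M N h i m = mdiff N (i - 1) (h i m) \<oplus>\<^bsub>mgr N i\<^esub> h (i + 1) (mdiff M i m)"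

lemma h_closed: "h \<in> ghom A (- 1) M N \<Longrightarrow> m \<in> carrier (mgr M i) \<Longrightarrow> h i m \<in> carrier (mgr N (i - 1))"
  using ghom_closed[of h "- 1" M N m i] by simp

lemma h_closed' [simp]:
  assumes "h \<in> ghom A (- 1) M N" "m \<in> carrier (mgr M i)" "isM M" "isM N"
  shows "h i m \<in> carrier (mgr N (i - 1))" "mdiff N (i - 1) (h i m) \<in> carrier (mgr N i)"
    "h (i + 1) (mdiff M i m) \<in> carrier (mgr N i)"
  using assms h_closed[of h M N m i] h_closed[of h M N "mdiff M i m" "i + 1"] M_closed(2)[OF assms(4), of "h i m" "i - 1"] by auto

lemma h_act: "h \<in> ghom A (- 1) M N \<Longrightarrow> a \<in> carrier (agr A i) \<Longrightarrow> m \<in> carrier (mgr M j) \<Longrightarrow>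
    h (i + j) (mact M i j a m) = gsgn (mgr N (i + j - 1)) i (mact N i (j - 1) a (h j m))"
  using ghom_act[of h "- 1" M N a i m j] by (simp add: gsgn_def)

lemma bd_closed [simp]: "h \<in> ghom A (- 1) M N \<Longrightarrow> m \<in> carrier (mgr M i) \<Longrightarrow> isM M \<Longrightarrow> isM N \<Longrightarrow> bd M N h i m \<in> carrier (mgr N i)"
  by (simp add: bd_def)

lemma dhom_bd:
  assumes "isM M" "isM N" "h \<in> ghom A (- 1) M N" "m \<in> carrier (mgr M i)"
  shows "dhom (- 1) M N h i m = bd M N h i m"
  unfolding dhom_def bd_def using assms by (simp add: ab_ac(1))

lemma htpy_iff:
  assumes "isM M" "isM N"
  shows "(f, g) \<in> htpy_rel A M N \<longleftrightarrow> f \<in> closed0 A M N \<and> g \<in> closed0 A M N \<and>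
     (\<exists>h\<in>ghom A (- 1) M N. \<forall>i. \<forall>m\<in>carrier (mgr M i). g i m = f i m \<oplus>\<^bsub>mgr N i\<^esub> bd M N h i m)"
  unfolding htpy_rel_def using dhom_bd[OF assms] by (auto intro!: bexI)

lemma htpyI:
  assumes "isM M" "isM N" "f \<in> closed0 A M N" "g \<in> closed0 A M N" "h \<in> ghom A (- 1) M N"
    "\<And>i m. m \<in> carrier (mgr M i) \<Longrightarrow> g i m = f i m \<oplus>\<^bsub>mgr N i\<^esub> bd M N h i m"
  shows "(f, g) \<in> htpy_rel A M N"
  unfolding htpy_iff[OF assms(1,2)] using assms by blast

lemma htpyE:
  assumes "(f, g) \<in> htpy_rel A M N" "isM M" "isM N"
  obtains h where "f \<in> closed0 A M N" "g \<in> closed0 A M N" "h \<in> ghom A (- 1) M N"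
    "\<And>i m. m \<in> carrier (mgr M i) \<Longrightarrow> g i m = f i m \<oplus>\<^bsub>mgr N i\<^esub> bd M N h i m"
  using assms htpy_iff[OF assms(2,3)] by auto

lemma htpy_cong:
  assumes "isM M" "isM N" "f \<in> closed0 A M N" "g \<in> closed0 A M N"
    "\<And>i m. m \<in> carrier (mgr M i) \<Longrightarrow> g i m = f i m"
  shows "(f, g) \<in> htpy_rel A M N"
proof (rule htpyI[OF assms(1-4)])
  show "(\<lambda>i m. \<zero>\<^bsub>mgr N (i - 1)\<^esub>) \<in> ghom A (- 1) M N"
    using ghom_zero_map[OF assms(1,2), of "- 1"] by simp
  show "g i m = f i m \<oplus>\<^bsub>mgr N i\<^esub> bd M N (\<lambda>i m. \<zero>\<^bsub>mgr N (i - 1)\<^esub>) i m" if "m \<in> carrier (mgr M i)" for i m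
    using that assms M_zero(3)[OF assms(2), of "i - 1"] unfolding bd_def by simp
qed

lemma htpy_equiv:
  assumes M [simp]: "isM M" "isM N"
  shows "equiv (closed0 A M N) (htpy_rel A M N)"
proof (rule equivI)
  show "htpy_rel A M N \<subseteq> closed0 A M N \<times> closed0 A M N" unfolding htpy_rel_def by auto
  show "refl_on (closed0 A M N) (htpy_rel A M N)"
    by (rule refl_onI) (auto intro: htpy_cong)
  show "sym (htpy_rel A M N)"
  proof (rule symI)
    fix f g assume "(f, g) \<in> htpy_rel A M N"
    then obtain h where h: "f \<in> closed0 A M N" "g \<in> closed0 A M N" "h \<in> ghom A (- 1) M N"
      "\<And>i m. m \<in> carrier (mgr M i) \<Longrightarrow> g i m = f i m \<oplus>\<^bsub>mgr N i\<^esub> bd M N h i m" by (rule htpyE) auto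
    let ?h = "\<lambda>i m. \<ominus>\<^bsub>mgr N (i - 1)\<^esub> h i m"
    have h': "?h \<in> ghom A (- 1) M N" using ghom_comb(2)[OF M h(3) h(3)] by simp
    show "(g, f) \<in> htpy_rel A M N"
    proof (rule htpyI[OF M h(2,1) h'])
      fix i m assume m: "m \<in> carrier (mgr M i)"
      have "bd M N ?h i m = \<ominus>\<^bsub>mgr N i\<^esub> bd M N h i m"
        using m h M_neg(3)[OF M(2) h_closed[OF h(3) m]] by (simp add: bd_def ab_ac)
      then show "f i m = g i m \<oplus>\<^bsub>mgr N i\<^esub> bd M N ?h i m" using h m by (simp add: ab_ac(3))
    qed
  qed
  show "trans (htpy_rel A M N)"
  proof (rule transI)
    fix f g k assume 1: "(f, g) \<in> htpy_rel A M N" and 2: "(g, k) \<in> htpy_rel A M N"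
    obtain h where h: "f \<in> closed0 A M N" "g \<in> closed0 A M N" "h \<in> ghom A (- 1) M N"
      "\<And>i m. m \<in> carrier (mgr M i) \<Longrightarrow> g i m = f i m \<oplus>\<^bsub>mgr N i\<^esub> bd M N h i m" using 1 by (rule htpyE) auto
    obtain h' where h': "k \<in> closed0 A M N" "h' \<in> ghom A (- 1) M N"
      "\<And>i m. m \<in> carrier (mgr M i) \<Longrightarrow> k i m = g i m \<oplus>\<^bsub>mgr N i\<^esub> bd M N h' i m" using 2 by (rule htpyE) auto
    let ?h = "\<lambda>i m. h i m \<oplus>\<^bsub>mgr N (i - 1)\<^esub> h' i m"
    have h'': "?h \<in> ghom A (- 1) M N" using ghom_comb(1)[OF M h(3) h'(2)] by simp
    show "(f, k) \<in> htpy_rel A M N"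
    proof (rule htpyI[OF M h(1) h'(1) h''])
      fix i m assume m: "m \<in> carrier (mgr M i)"
      have "bd M N ?h i m = bd M N h i m \<oplus>\<^bsub>mgr N i\<^esub> bd M N h' i m"
        using m h h' M_add(3)[OF M(2) h_closed[OF h(3) m] h_closed[OF h'(2) m]] by (simp add: bd_def ab_ac)
      then show "k i m = f i m \<oplus>\<^bsub>mgr N i\<^esub> bd M N ?h i m" using h h' m by (simp add: ab_ac(3))
    qed
  qed
qed

lemma bd_comp:
  assumes "isM L" "isM M" "isM N"
  shows "\<And>h g m i. \<lbrakk>h \<in> ghom A (- 1) L M; g \<in> closed0 A M N; m \<in> carrier (mgr L i)\<rbrakk>
      \<Longrightarrow> bd L N (\<lambda>i m. g (i - 1) (h i m)) i m = g i (bd L M h i m)"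
    "\<And>h g. \<lbrakk>h \<in> ghom A (- 1) L M; g \<in> closed0 A M N\<rbrakk> \<Longrightarrow> (\<lambda>i m. g (i - 1) (h i m)) \<in> ghom A (- 1) L N"
    "\<And>h g m i. \<lbrakk>h \<in> ghom A (- 1) M N; g \<in> closed0 A L M; m \<in> carrier (mgr L i)\<rbrakk>
      \<Longrightarrow> bd L N (\<lambda>i m. h i (g i m)) i m = bd M N h i (g i m)"
    "\<And>h g. \<lbrakk>h \<in> ghom A (- 1) M N; g \<in> closed0 A L M\<rbrakk> \<Longrightarrow> (\<lambda>i m. h i (g i m)) \<in> ghom A (- 1) L N"
proof -
  show "bd L N (\<lambda>i m. g (i - 1) (h i m)) i m = g i (bd L M h i m)"
    if "h \<in> ghom A (- 1) L M" "g \<in> closed0 A M N" "m \<in> carrier (mgr L i)" for h g m i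
    using that assms closed0_diff[of g M N "h i m" "i - 1"] by (simp add: bd_def)
  show "(\<lambda>i m. g (i - 1) (h i m)) \<in> ghom A (- 1) L N" if "h \<in> ghom A (- 1) L M" "g \<in> closed0 A M N" for h g
    using ghom_comp[OF assms that(1) closed0_ghom[OF that(2)]] by simp
  show "bd L N (\<lambda>i m. h i (g i m)) i m = bd M N h i (g i m)"
    if "h \<in> ghom A (- 1) M N" "g \<in> closed0 A L M" "m \<in> carrier (mgr L i)" for h g m i
    using that assms by (simp add: bd_def closed0_diff)
  show "(\<lambda>i m. h i (g i m)) \<in> ghom A (- 1) L N" if "h \<in> ghom A (- 1) M N" "g \<in> closed0 A L M" for h g
    using ghom_comp[OF assms closed0_ghom[OF that(2)] that(1)] by simp
qed

lemma htpy_comp: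
  assumes M [simp]: "isM L" "isM M" "isM N" and f: "(f, f') \<in> htpy_rel A L M" and g: "(g, g') \<in> htpy_rel A M N"
  shows "(\<lambda>i x. g i (f i x), \<lambda>i x. g' i (f' i x)) \<in> htpy_rel A L N"
proof -
  obtain h where h: "f \<in> closed0 A L M" "f' \<in> closed0 A L M" "h \<in> ghom A (- 1) L M"
    "\<And>i m. m \<in> carrier (mgr L i) \<Longrightarrow> f' i m = f i m \<oplus>\<^bsub>mgr M i\<^esub> bd L M h i m" using f by (rule htpyE) auto
  obtain k where k: "g \<in> closed0 A M N" "g' \<in> closed0 A M N" "k \<in> ghom A (- 1) M N"
    "\<And>i m. m \<in> carrier (mgr M i) \<Longrightarrow> g' i m = g i m \<oplus>\<^bsub>mgr N i\<^esub> bd M N k i m" using g by (rule htpyE) auto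
  have "(\<lambda>i x. g i (f i x), \<lambda>i x. g i (f' i x)) \<in> htpy_rel A L N"
    by (rule htpyI[where h = "\<lambda>i m. g (i - 1) (h i m)"])
       (use h k in \<open>simp_all add: bd_comp[OF M]\<close>)
  moreover have "(\<lambda>i x. g i (f' i x), \<lambda>i x. g' i (f' i x)) \<in> htpy_rel A L N"
    by (rule htpyI[where h = "\<lambda>i m. k i (f' i m)"])
       (use h(1-3) k in \<open>simp_all add: bd_comp[OF M]\<close>)
  ultimately show ?thesis using htpy_equiv[OF M(1,3)] by (meson equivE transE)
qed

lemma hcls_eq_iff: "isM M \<Longrightarrow> isM N \<Longrightarrow> f \<in> closed0 A M N \<Longrightarrow> g \<in> closed0 A M N \<Longrightarrow>
    hcls A M N f = hcls A M N g \<longleftrightarrow> (f, g) \<in> htpy_rel A M N"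
  using eq_equiv_class_iff[OF htpy_equiv] by metis

lemma hcls_cong:
  assumes "isM M" "isM N" "f \<in> closed0 A M N" "g \<in> closed0 A M N"
    "\<And>i m. m \<in> carrier (mgr M i) \<Longrightarrow> f i m = g i m"
  shows "hcls A M N f = hcls A M N g"
  using htpy_cong[OF assms(1-4)] assms by (simp add: hcls_eq_iff)

text \<open>The operations of \<open>Hot\<close> are unions over all representatives of a class.
  Once homotopic representatives give the same result, such a union is the result of any one of
  them.\<close>

lemma UN_hcls:
  assumes "isM M" "isM N" "f \<in> closed0 A M N" "\<And>g. (f, g) \<in> htpy_rel A M N \<Longrightarrow> \<Phi> g = \<Phi> f"
  shows "(\<Union>g\<in>hcls A M N f. \<Phi> g) = \<Phi> f"
proof -
  have "f \<in> hcls A M N f" using equiv_class_self[OF htpy_equiv[OF assms(1,2)] assms(3)] .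
  moreover have "(\<Union>g\<in>hcls A M N f. \<Phi> g) = (\<Union>g\<in>hcls A M N f. \<Phi> f)"
    by (rule SUP_cong[OF refl], rule assms(4)) simp
  ultimately show ?thesis by (simp only: UN_constant split: if_split) blast
qed

lemma Hot_simps [simp]:
  "Obj (Hot R A) = {M. isM M}" "Hom (Hot R A) = (\<lambda>M N. closed0 A M N // htpy_rel A M N)"
  "Idm (Hot R A) = (\<lambda>M. hcls A M M (\<lambda>i x. x))"
  "Zerom (Hot R A) = (\<lambda>M N. hcls A M N (\<lambda>i x. \<zero>\<^bsub>mgr N i\<^esub>))" "Sh (Hot R A) = shift_mod"
  by (simp_all add: Hot_def Hot_shift_cat_def shift_cat.extend_def tri_cat.fields_def)

lemma hcls_hom: "f \<in> closed0 A M N \<Longrightarrow> hcls A M N f \<in> Hom (Hot R A) M N"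
  by (auto intro: quotientI)

lemma Hot_homE:
  assumes "F \<in> Hom (Hot R A) M N" obtains f where "f \<in> closed0 A M N" "F = hcls A M N f"
  using assms by (auto elim: quotientE)

lemma Hot_comp:
  assumes M: "isM L" "isM M" "isM N" and f: "f \<in> closed0 A L M" and g: "g \<in> closed0 A M N"
  shows "Comp (Hot R A) L M N (hcls A M N g) (hcls A L M f) = hcls A L N (\<lambda>i x. g i (f i x))"
proof -
  have 1: "hcls A L N (\<lambda>i x. g i (f i x)) = hcls A L N (\<lambda>i x. g' i (f' i x))"
    if "(f, f') \<in> htpy_rel A L M" "(g, g') \<in> htpy_rel A M N" for f f' g g'
    by (rule equiv_class_eq[OF htpy_equiv[OF M(1,3)] htpy_comp[OF M that]])
  have r: "(f, f) \<in> htpy_rel A L M" "(g, g) \<in> htpy_rel A M N" using f g M by (auto intro: htpy_cong)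
  have "Comp (Hot R A) L M N (hcls A M N g) (hcls A L M f)
      = (\<Union>g\<in>hcls A M N g. \<Union>f\<in>hcls A L M f. hcls A L N (\<lambda>i x. g i (f i x)))"
    by (simp add: Hot_def Hot_shift_cat_def shift_cat.extend_def tri_cat.fields_def)
  also have "\<dots> = (\<Union>g\<in>hcls A M N g. hcls A L N (\<lambda>i x. g i (f i x)))"
  proof (rule SUP_cong[OF refl])
    fix g' assume "g' \<in> hcls A M N g"
    then have g': "(g, g') \<in> htpy_rel A M N" by simp
    then have "(g', g') \<in> htpy_rel A M N" using M by (auto elim!: htpyE intro: htpy_cong)
    then show "(\<Union>f\<in>hcls A L M f. hcls A L N (\<lambda>i x. g' i (f i x))) = hcls A L N (\<lambda>i x. g' i (f i x))"
      by (intro UN_hcls M f) (rule 1[symmetric])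
  qed
  also have "\<dots> = hcls A L N (\<lambda>i x. g i (f i x))"
    by (intro UN_hcls M g) (rule 1[symmetric], rule r(1))
  finally show ?thesis .
qed

lemma Hot_is_cat: "is_cat (Hot R A)"
proof
  fix X assume "X \<in> Obj (Hot R A)" then show "Idm (Hot R A) X \<in> Hom (Hot R A) X X"
    using hcls_hom[OF closed0_id] by simp
next
  fix X Y Z f g assume h: "X \<in> Obj (Hot R A)" "Y \<in> Obj (Hot R A)" "Z \<in> Obj (Hot R A)"
    "f \<in> Hom (Hot R A) X Y" "g \<in> Hom (Hot R A) Y Z"
  obtain f' where f': "f' \<in> closed0 A X Y" "f = hcls A X Y f'" by (rule Hot_homE[OF h(4)])
  obtain g' where g': "g' \<in> closed0 A Y Z" "g = hcls A Y Z g'" by (rule Hot_homE[OF h(5)])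
  show "Comp (Hot R A) X Y Z g f \<in> Hom (Hot R A) X Z"
    unfolding f' g' by (subst Hot_comp) (use h f' g' in \<open>auto intro!: quotientI\<close>)
next
  fix X Y f assume h: "X \<in> Obj (Hot R A)" "Y \<in> Obj (Hot R A)" "f \<in> Hom (Hot R A) X Y"
  obtain f' where f': "f' \<in> closed0 A X Y" "f = hcls A X Y f'" by (rule Hot_homE[OF h(3)])
  show "Comp (Hot R A) X X Y f (Idm (Hot R A) X) = f" "Comp (Hot R A) X Y Y (Idm (Hot R A) Y) f = f"
    using h f' by (simp_all add: Hot_comp)
next
  fix X Y Z W f g k assume h: "X \<in> Obj (Hot R A)" "Y \<in> Obj (Hot R A)" "Z \<in> Obj (Hot R A)" "W \<in> Obj (Hot R A)"
    "f \<in> Hom (Hot R A) X Y" "g \<in> Hom (Hot R A) Y Z" "k \<in> Hom (Hot R A) Z W"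
  obtain f' where f': "f' \<in> closed0 A X Y" "f = hcls A X Y f'" by (rule Hot_homE[OF h(5)])
  obtain g' where g': "g' \<in> closed0 A Y Z" "g = hcls A Y Z g'" by (rule Hot_homE[OF h(6)])
  obtain k' where k': "k' \<in> closed0 A Z W" "k = hcls A Z W k'" by (rule Hot_homE[OF h(7)])
  show "Comp (Hot R A) X Z W k (Comp (Hot R A) X Y Z g f) = Comp (Hot R A) X Y W (Comp (Hot R A) Y Z W k g) f"
    using h f' g' k' by (simp add: Hot_comp)
qed

end

section \<open>Constructions with modules\<close>

lemma two_add_int [simp]: "2 + i = i + (2 :: int)"
  by simp

section \<open>Odd shifts and cones\<close>

lemma prod_abelian_group:
  assumes "abelian_group G" "abelian_group H"
    and P: "carrier P = carrier G \<times> carrier H" "\<zero>\<^bsub>P\<^esub> = (\<zero>\<^bsub>G\<^esub>, \<zero>\<^bsub>H\<^esub>)"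
      "add P = (\<lambda>(y, x) (y', x'). (y \<oplus>\<^bsub>G\<^esub> y', x \<oplus>\<^bsub>H\<^esub> x'))"
  shows "abelian_group P" "y \<in> carrier G \<Longrightarrow> x \<in> carrier H \<Longrightarrow> \<ominus>\<^bsub>P\<^esub> (y, x) = (\<ominus>\<^bsub>G\<^esub> y, \<ominus>\<^bsub>H\<^esub> x)"
proof -
  note [simp] = assms
  show P: "abelian_group P"
  proof (rule abelian_groupI, goal_cases)
    case (6 z)
    then obtain y x where "z = (y, x)" "y \<in> carrier G" "x \<in> carrier H" by auto
    then show ?case by (intro bexI[of _ "(\<ominus>\<^bsub>G\<^esub> y, \<ominus>\<^bsub>H\<^esub> x)"]) auto
  qed (auto simp: ab_ac)
  show "\<ominus>\<^bsub>P\<^esub> (y, x) = (\<ominus>\<^bsub>G\<^esub> y, \<ominus>\<^bsub>H\<^esub> x)" if "y \<in> carrier G" "x \<in> carrier H"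
    using that by (intro abelian_group.minus_equality[OF P]) auto
qed

text \<open>The signs are those of an odd shift. It covers the shift \<open>p = 1\<close> and the
  desuspension \<open>p = - 1\<close>, which turns cones into homotopy fibres.\<close>

definition shp :: "int \<Rightarrow> ('r, 'a, 'm) cdg_mod \<Rightarrow> ('r, 'a, 'm) cdg_mod" where
  "shp p M = \<lparr>
     mgr = (\<lambda>i. mgr M (i + p)),
     mact = (\<lambda>i j a m. gsgn (mgr M (i + j + p)) i (mact M i (j + p) a m)),
     mdiff = (\<lambda>i m. \<ominus>\<^bsub>mgr M (i + p + 1)\<^esub> mdiff M (i + p) m)\<rparr>"

lemma shp_simps [simp]:
  "mgr (shp p M) i = mgr M (i + p)"
  "mact (shp p M) i j a m = gsgn (mgr M (i + j + p)) i (mact M i (j + p) a m)"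
  "mdiff (shp p M) i m = \<ominus>\<^bsub>mgr M (i + p + 1)\<^esub> mdiff M (i + p) m"
  by (simp_all add: shp_def)

lemma shift_mod_shp: "shift_mod M = shp 1 M"
  by (simp add: shift_mod_def shp_def add.commute[of 2])

lemma cone_simps [simp]:
  "carrier (mgr (cone_mod M N f) i) = carrier (mgr N i) \<times> carrier (mgr M (i + 1))"
  "\<zero>\<^bsub>mgr (cone_mod M N f) i\<^esub> = (\<zero>\<^bsub>mgr N i\<^esub>, \<zero>\<^bsub>mgr M (i + 1)\<^esub>)"
  "(y, x) \<oplus>\<^bsub>mgr (cone_mod M N f) i\<^esub> (y', x') = (y \<oplus>\<^bsub>mgr N i\<^esub> y', x \<oplus>\<^bsub>mgr M (i + 1)\<^esub> x')"
  "r \<odot>\<^bsub>mgr (cone_mod M N f) i\<^esub> (y, x) = (r \<odot>\<^bsub>mgr N i\<^esub> y, r \<odot>\<^bsub>mgr M (i + 1)\<^esub> x)"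
  "mact (cone_mod M N f) i j a (y, x) = (mact N i j a y, gsgn (mgr M (i + j + 1)) i (mact M i (j + 1) a x))"
  "mdiff (cone_mod M N f) i (y, x)
     = (mdiff N i y \<oplus>\<^bsub>mgr N (i + 1)\<^esub> f (i + 1) x, \<ominus>\<^bsub>mgr M (i + 2)\<^esub> mdiff M (i + 1) x)"
  by (simp_all add: cone_mod_def shift_mod_def)

context cdg_algebra
begin

lemma shp_module:
  assumes M: "isM M" and p: "odd p"
  shows "isM (shp p M)"
proof -
  have n: "\<ominus>\<^bsub>mgr M (i + j)\<^esub> mact M i j a m = mact M i j a (\<ominus>\<^bsub>mgr M j\<^esub> m)"
    if "a \<in> carrier (agr A i)" "m \<in> carrier (mgr M j)" for i j a m using that M by simp
  show ?thesis
  proof (rule cdg_module.intro, goal_cases)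
    case (1 i) show ?case using M by (simp add: Mod_module)
  next
    case (2 a i m j) show ?case using 2 M M_closed(1)[OF M 2(1), of m "j + p"] by (simp add: add.assoc)
  next
    case (3 a i a' m j) then show ?case using M M_closed(1)[OF M 3(1), of m "j + p"] M_closed(1)[OF M 3(2), of m "j + p"]
      by (simp add: gsgn_add add.assoc)
  next
    case (4 a i m j m')
    then show ?case using M M_closed(1)[OF M 4(1), of m "j + p"] M_closed(1)[OF M 4(1), of m' "j + p"]
      by (simp add: gsgn_add add.assoc)
  next
    case (5 r a i m j)
    then show ?case using M M_closed(1)[OF M 5(2), of m "j + p"] cdg_module.act_smult_left[OF M 5(1,2), of m "j + p"]
      module.smult_r_minus[OF Mod_module[OF M] 5(1), of "mact M i (j + p) a m" "i + (j + p)"]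
      by (simp add: gsgn_def add.assoc)
  next
    case (6 r a i m j)
    then show ?case using M M_closed(1)[OF M 6(2), of m "j + p"] cdg_module.act_smult_right[OF M 6(1,2), of m "j + p"]
      module.smult_r_minus[OF Mod_module[OF M] 6(1), of "mact M i (j + p) a m" "i + (j + p)"]
      by (simp add: gsgn_def add.assoc)
  next
    case (7 a i b j m l)
    have *: "mact M j (l + p) b m \<in> carrier (mgr M (j + (l + p)))" using 7 M by simp
    then have "mact M i (j + (l + p)) a (mact M j (l + p) b m) \<in> carrier (mgr M (i + (j + (l + p))))" using 7 M by simp
    then show ?case using 7 M * M_assoc[OF M 7(1,2), of m "l + p"]
        M_neg(2)[OF M 7(1) *]
      by (auto simp: gsgn_def add.assoc)
  next
    case (8 m i) then show ?case using M by simp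
  next
    case (9 m i) then show ?case using M M_closed(2)[OF M, of m "i + p"] by (simp add: add.assoc add.commute[of 1 p])
  next
    case (10 m i m') then show ?case
      using M M_closed(2)[OF M, of m "i + p"] M_closed(2)[OF M, of m' "i + p"]
      by (simp add: ab_ac(2) add.assoc add.commute[of 1 p])
  next
    case (11 a i m j)
    have x: "i + j + 1 + p = i + (j + p) + 1" "i + 1 + j + p = i + (j + p) + 1" "i + j + p = i + (j + p)"
      "i + (j + 1) + p = i + (j + p) + 1" "j + 1 + p = j + p + 1" "i + (j + p + 1) = i + (j + p) + 1"
      "i + 1 + (j + p) = i + (j + p) + 1"
      by simp_all
    have c: "mact M (i + 1) (j + p) (adiff A i a) m \<in> carrier (mgr M (i + (j + p) + 1))"
      "mact M i (j + p) a m \<in> carrier (mgr M (i + (j + p)))" "mdiff M (j + p) m \<in> carrier (mgr M (j + p + 1))"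
      "mact M i (j + p + 1) a (mdiff M (j + p) m) \<in> carrier (mgr M (i + (j + p) + 1))"
      using 11 M M_closed(1)[OF M A_closed(3)[OF 11(1)], of m "j + p"]
        M_closed(1)[OF M 11(1), of "mdiff M (j + p) m" "j + p + 1"] by (simp_all add: x)
    show ?case using 11 M c M_leibniz[OF M 11(1), of m "j + p"] M_neg(2)[OF M 11(1) c(3)]
      by (auto simp: x gsgn_def ab_ac(2))
  next
    case (12 m i)
    have c: "mdiff M (i + p) m \<in> carrier (mgr M (i + p + 1))" using 12 M by simp
    have x: "i + 1 + p = i + p + 1" "2 + i + p = i + p + 2" "i + 2 + p = i + p + 2" by simp_all
    have "mdiff M (i + p + 1) (\<ominus>\<^bsub>mgr M (i + p + 1)\<^esub> mdiff M (i + p) m) = \<ominus>\<^bsub>mgr M (i + p + 2)\<^esub> mdiff M (i + p + 1) (mdiff M (i + p) m)"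
      using M_neg(3)[OF M c] by simp
    then show ?case using 12 M c M_closed(2)[OF M c] M_dd[OF M, of m "i + p"]
      by (simp add: x gsgn_def)
  qed
qed

lemma shift_module: "isM M \<Longrightarrow> isM (shift_mod M)"
  by (simp add: shift_mod_shp shp_module)

lemma cone_module:
  assumes M: "isM M" and N: "isM N" and f: "f \<in> closed0 A M N"
  shows "isM (cone_mod M N f)"
proof -
  let ?C = "cone_mod M N f"
  have S: "isM (shp 1 M)" by (rule shp_module[OF M]) simp
  have grp: "abelian_group (mgr ?C i)" for i
    by (rule prod_abelian_group[of "mgr N i" "mgr M (i + 1)"]) (simp_all add: M N cone_mod_def)
  have neg: "\<ominus>\<^bsub>mgr ?C i\<^esub> (y, x) = (\<ominus>\<^bsub>mgr N i\<^esub> y, \<ominus>\<^bsub>mgr M (i + 1)\<^esub> x)"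
    if "y \<in> carrier (mgr N i)" "x \<in> carrier (mgr M (i + 1))" for i y x
    by (rule prod_abelian_group[of "mgr N i" "mgr M (i + 1)"]) (simp_all add: M N that cone_mod_def)
  have gs: "gsgn (mgr ?C i) s (y, x) = (gsgn (mgr N i) s y, gsgn (mgr M (i + 1)) s x)"
    if "y \<in> carrier (mgr N i)" "x \<in> carrier (mgr M (i + 1))" for i y x s
    using that by (simp add: gsgn_def neg)
  have S': "mact ?C i j a (y, x) = (mact N i j a y, mact (shp 1 M) i j a x)"
    "mdiff ?C i (y, x) = (mdiff N i y \<oplus>\<^bsub>mgr N (i + 1)\<^esub> f (i + 1) x, mdiff (shp 1 M) i x)"
    "(y, x) \<oplus>\<^bsub>mgr ?C i\<^esub> (y', x') = (y \<oplus>\<^bsub>mgr N i\<^esub> y', x \<oplus>\<^bsub>mgr (shp 1 M) i\<^esub> x')"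
    "r \<odot>\<^bsub>mgr ?C i\<^esub> (y, x) = (r \<odot>\<^bsub>mgr N i\<^esub> y, r \<odot>\<^bsub>mgr (shp 1 M) i\<^esub> x)"
    "carrier (mgr ?C i) = carrier (mgr N i) \<times> carrier (mgr (shp 1 M) i)"
    for i j a x y y' x' r by simp_all
  have gs': "gsgn (mgr ?C i) s (y, x) = (gsgn (mgr N i) s y, gsgn (mgr (shp 1 M) i) s x)"
    if "y \<in> carrier (mgr N i)" "x \<in> carrier (mgr (shp 1 M) i)" for i y x s
    using gs that by simp
  \<comment> \<open>Regarded on the shift of \<open>M\<close>, \<open>f\<close> becomes a map of
    degree 1 that anticommutes with the differentials. Hence the mixed terms in the square of the
    cone differential cancel and only the curvature remains.\<close>
  define h where "h i x = f (i + 1) x" for i x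
  have h: "h i x \<in> carrier (mgr N (i + 1))" if "x \<in> carrier (mgr (shp 1 M) i)" for i x
    using that f unfolding h_def by simp
  have h_add: "h i (x \<oplus>\<^bsub>mgr (shp 1 M) i\<^esub> y) = h i x \<oplus>\<^bsub>mgr N (i + 1)\<^esub> h i y"
    if "x \<in> carrier (mgr (shp 1 M) i)" "y \<in> carrier (mgr (shp 1 M) i)" for i x y
    using that f unfolding h_def by simp
  have h_act: "h (i + j) (mact (shp 1 M) i j a x) = gsgn (mgr N (i + j + 1)) i (mact N i (j + 1) a (h j x))"
    if "a \<in> carrier (agr A i)" "x \<in> carrier (mgr (shp 1 M) j)" for i j a x
  proof -
    have "mact M i (j + 1) a x \<in> carrier (mgr M (i + j + 1))" using M_closed(1)[OF M that(1), of x "j + 1"] that by (simp add: add.assoc)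
    then have "f (i + j + 1) (gsgn (mgr M (i + j + 1)) i (mact M i (j + 1) a x))
      = gsgn (mgr N (i + j + 1)) i (f (i + j + 1) (mact M i (j + 1) a x))" using f M N by (intro gsgn_map) simp
    then show ?thesis unfolding h_def using closed0_act[OF f that(1), of x "j + 1"] that by (simp add: add.assoc)
  qed
  have h_d: "h (i + 1) (mdiff (shp 1 M) i x) = \<ominus>\<^bsub>mgr N (i + 2)\<^esub> mdiff N (i + 1) (h i x)"
    if "x \<in> carrier (mgr (shp 1 M) i)" for i x
    using that M N f closed0_diff[OF f, of x "i + 1"] M_closed(2)[OF M, of x "i + 1"] closed0_zero(2)[OF f M N, of "mdiff M (i + 1) x" "i + 2"]
    unfolding h_def by simp
  note C = S'(1,3-5) S'(2)[folded h_def]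
  note [simp del] = cone_simps shp_simps
  show ?thesis
  proof (rule cdg_module.intro, goal_cases)
    case (1 i) show ?case
    proof (rule moduleI[OF base grp], goal_cases)
      case (1 a x) then show ?case using M N S by (auto simp: C)
    qed (use Mod_module[OF N, of i] Mod_module[OF S, of i] in
        \<open>auto simp: C module.smult_l_distr module.smult_r_distr module.smult_assoc1 module.smult_one\<close>)
  next
    case (7 a i b j m l) then show ?case using N S by (auto simp: C M_assoc)
  next
    case (9 m i) then show ?case using N S h by (auto simp: C)
  next
    case (10 m i m') then show ?case using N S h by (auto simp: C h_add ab_ac(3-))
  next
    case (11 a i m j)
    obtain y x where m: "m = (y, x)" and [simp]: "y \<in> carrier (mgr N j)" "x \<in> carrier (mgr (shp 1 M) j)"
      using 11 by (cases m) (auto simp: C)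
    note [simp] = 11(1) N S h
    have e: "i + j + 1 = i + 1 + j" "i + (j + 1) = i + 1 + j" by simp_all
    have c: "mact N i (j + 1) a z \<in> carrier (mgr N (i + 1 + j))" if "z \<in> carrier (mgr N (j + 1))" for z
      using M_closed(1)[OF N 11(1) that] by (simp add: e)
    have c': "mact (shp 1 M) i (j + 1) a z \<in> carrier (mgr (shp 1 M) (i + 1 + j))" if "z \<in> carrier (mgr (shp 1 M) (j + 1))" for z
      using M_closed(1)[OF S 11(1) that] by (simp add: e)
    have d: "mact N i (j + 1) a (mdiff N j y \<oplus>\<^bsub>mgr N (j + 1)\<^esub> h j x)
        = mact N i (j + 1) a (mdiff N j y) \<oplus>\<^bsub>mgr N (i + 1 + j)\<^esub> mact N i (j + 1) a (h j x)"
      using M_add(2)[OF N 11(1), of "mdiff N j y" "j + 1" "h j x"] by (simp add: e)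
    show ?case unfolding m C
      using M_leibniz[OF N 11(1), of y j] M_leibniz[OF S 11(1), of x j]
      by (simp add: C h_act e gs' c c' d gsgn_add ab_ac(3))
  next
    case (12 m i)
    obtain y x where m: "m = (y, x)" and [simp]: "y \<in> carrier (mgr N i)" "x \<in> carrier (mgr (shp 1 M) i)"
      using 12 by (cases m) (auto simp: C)
    note [simp] = N S h
    have "mdiff N (i + 1) (mdiff N i y) \<in> carrier (mgr N (i + 2))" "mdiff N (i + 1) (h i x) \<in> carrier (mgr N (i + 2))"
      using M_closed(2)[OF N, of _ "i + 1"] by (simp_all add: add.assoc)
    moreover have "mdiff N (i + 1) (mdiff N i y \<oplus>\<^bsub>mgr N (i + 1)\<^esub> h i x)
       = mdiff N (i + 1) (mdiff N i y) \<oplus>\<^bsub>mgr N (i + 2)\<^esub> mdiff N (i + 1) (h i x)"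
      using M_add(3)[OF N, of "mdiff N i y" "i + 1" "h i x"] by (simp add: add.assoc)
    ultimately show ?case unfolding m C
      using M_dd[OF N, of y i] M_dd[OF S, of x i]
      by (simp add: C h_d ab_ac(3))
  qed (use M N S M_closed(1)[OF S] in \<open>auto simp: C cdg_module.act_smult_left cdg_module.act_smult_right\<close>)
qed

end

section \<open>Surjections of cdg algebras: semilinear images and restriction of scalars\<close>

locale alg_surj = cdg_algebra R A + tgt: cdg_algebra R' A'
  for R :: "'r ring" and A :: "('r, 'a) cdg_alg" and R' :: "'s ring" and A' :: "('s, 'b) cdg_alg" +
  fixes \<rho> :: "'r \<Rightarrow> 's" and \<theta> :: "int \<Rightarrow> 'a \<Rightarrow> 'b"
  assumes \<rho>_hom: "\<rho> \<in> ring_hom R R'" and \<rho>_surj: "\<rho> ` carrier R = carrier R'"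
    and \<theta>_surj: "\<theta> i ` carrier (agr A i) = carrier (agr A' i)"
    and \<theta>_add: "\<lbrakk>a \<in> carrier (agr A i); b \<in> carrier (agr A i)\<rbrakk>
      \<Longrightarrow> \<theta> i (a \<oplus>\<^bsub>agr A i\<^esub> b) = \<theta> i a \<oplus>\<^bsub>agr A' i\<^esub> \<theta> i b"
    and \<theta>_smult: "\<lbrakk>r \<in> carrier R; a \<in> carrier (agr A i)\<rbrakk> \<Longrightarrow> \<theta> i (r \<odot>\<^bsub>agr A i\<^esub> a) = \<rho> r \<odot>\<^bsub>agr A' i\<^esub> \<theta> i a"
    and \<theta>_mult: "\<lbrakk>a \<in> carrier (agr A i); b \<in> carrier (agr A j)\<rbrakk>
      \<Longrightarrow> \<theta> (i + j) (amult A i j a b) = amult A' i j (\<theta> i a) (\<theta> j b)"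
    and \<theta>_one: "\<theta> 0 (aone A) = aone A'"
    and \<theta>_diff: "a \<in> carrier (agr A i) \<Longrightarrow> \<theta> (i + 1) (adiff A i a) = adiff A' i (\<theta> i a)"
    and \<theta>_curv: "\<theta> 2 (curv A) = curv A'"
begin

lemma \<theta>_closed [simp]: "a \<in> carrier (agr A i) \<Longrightarrow> \<theta> i a \<in> carrier (agr A' i)"
  using \<theta>_surj by blast

lemma \<theta>_obtain:
  assumes "b \<in> carrier (agr A' i)" obtains a where "a \<in> carrier (agr A i)" "b = \<theta> i a"
  using assms \<theta>_surj by blast

text \<open>Every scalar, algebra element and element of \<open>Q\<close> has a preimage, so the
  axioms for \<open>Q\<close> are images of those for \<open>M\<close>. Along the identity of the
  algebra this yields the quotients in \<open>quotient_exists\<close>; along reduction modulo t,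
  with \<open>U\<close> the multiples of t^i, it yields the graded pieces.\<close>

lemma semilinear_image_module:
  assumes M: "isM M"
    and U: "\<And>i. U i \<subseteq> carrier (mgr M i)" "\<And>i. \<zero>\<^bsub>mgr M i\<^esub> \<in> U i"
      "\<And>i x y. x \<in> U i \<Longrightarrow> y \<in> U i \<Longrightarrow> x \<oplus>\<^bsub>mgr M i\<^esub> y \<in> U i" "\<And>i x. x \<in> U i \<Longrightarrow> \<ominus>\<^bsub>mgr M i\<^esub> x \<in> U i"
      "\<And>i r x. r \<in> carrier R \<Longrightarrow> x \<in> U i \<Longrightarrow> r \<odot>\<^bsub>mgr M i\<^esub> x \<in> U i"
      "\<And>i j a x. a \<in> carrier (agr A i) \<Longrightarrow> x \<in> U j \<Longrightarrow> mact M i j a x \<in> U (i + j)"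
      "\<And>i x. x \<in> U i \<Longrightarrow> mdiff M i x \<in> U (i + 1)"
    and \<pi>: "\<And>i. carrier (mgr Q i) = \<pi> i ` U i" "\<And>i. \<pi> i \<zero>\<^bsub>mgr M i\<^esub> = \<zero>\<^bsub>mgr Q i\<^esub>"
      "\<And>i x y. x \<in> U i \<Longrightarrow> y \<in> U i \<Longrightarrow> \<pi> i x \<oplus>\<^bsub>mgr Q i\<^esub> \<pi> i y = \<pi> i (x \<oplus>\<^bsub>mgr M i\<^esub> y)"
      "\<And>i r x. r \<in> carrier R \<Longrightarrow> x \<in> U i \<Longrightarrow> \<rho> r \<odot>\<^bsub>mgr Q i\<^esub> \<pi> i x = \<pi> i (r \<odot>\<^bsub>mgr M i\<^esub> x)"
      "\<And>i j a x. a \<in> carrier (agr A i) \<Longrightarrow> x \<in> U j \<Longrightarrow> mact Q i j (\<theta> i a) (\<pi> j x) = \<pi> (i + j) (mact M i j a x)"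
      "\<And>i x. x \<in> U i \<Longrightarrow> mdiff Q i (\<pi> i x) = \<pi> (i + 1) (mdiff M i x)"
  shows "tgt.isM Q"
proof -
  note [simp] = \<pi>(2)
  have UM: "x \<in> carrier (mgr M i)" if "x \<in> U i" for x i using U(1) that by blast
  have Q: "\<exists>x\<in>U i. q = \<pi> i x" if "q \<in> carrier (mgr Q i)" for q i using that \<pi>(1) by auto
  have TH: "\<exists>a\<in>carrier (agr A i). b = \<theta> i a" if "b \<in> carrier (agr A' i)" for b i using that \<theta>_surj by blast
  have R: "\<exists>a\<in>carrier R. r = \<rho> a" if "r \<in> carrier R'" for r using that \<rho>_surj by auto
  interpret R: cring R by (rule base)
  have \<rho>: "\<rho> a \<oplus>\<^bsub>R'\<^esub> \<rho> b = \<rho> (a \<oplus>\<^bsub>R\<^esub> b)" "\<rho> a \<otimes>\<^bsub>R'\<^esub> \<rho> b = \<rho> (a \<otimes>\<^bsub>R\<^esub> b)" "\<one>\<^bsub>R'\<^esub> = \<rho> \<one>\<^bsub>R\<^esub>"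
    if "a \<in> carrier R" "b \<in> carrier R" for a b
    using that \<rho>_hom by (auto simp: ring_hom_add ring_hom_mult ring_hom_one)
  note mm = module.smult_l_distr module.smult_r_distr module.smult_assoc1 module.smult_one
  have grp: "abelian_group (mgr Q i)" for i
  proof (rule abelian_groupI, goal_cases)
    case (1 x y) then show ?case using U(3) \<pi>(3) by (auto simp: \<pi>(1))
  next
    case 2 show ?case using imageI[OF U(2)[of i], of "\<pi> i"] by (simp add: \<pi>(1))
  next
    case (3 x y z) then show ?case using U(3) M by (auto simp: \<pi>(1) \<pi>(3) ab_ac(3) UM)
  next
    case (4 x y) then show ?case using U(3) M by (auto simp: \<pi>(1) \<pi>(3) UM) (simp add: ab_ac(4) UM)
  next
    case (5 x) then obtain u where u: "u \<in> U i" "x = \<pi> i u" using Q by blast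
    then show ?case using \<pi>(3)[OF U(2) u(1)] M by (simp add: UM)
  next
    case (6 x) then obtain u where u: "u \<in> U i" "x = \<pi> i u" using Q by blast
    then show ?case using U(2,4) M by (intro bexI[of _ "\<pi> i (\<ominus>\<^bsub>mgr M i\<^esub> u)"]) (auto simp: \<pi>(3) \<pi>(1) UM)
  qed
  have neg: "\<ominus>\<^bsub>mgr Q i\<^esub> \<pi> i x = \<pi> i (\<ominus>\<^bsub>mgr M i\<^esub> x)" if "x \<in> U i" for i x
    by (rule abelian_group.minus_equality[OF grp]) (use that U M in \<open>auto simp: \<pi>(1,3) UM\<close>)
  have gs: "gsgn (mgr Q i) s (\<pi> i x) = \<pi> i (gsgn (mgr M i) s x)" if "x \<in> U i" for i x s
    using neg[OF that] by (simp add: gsgn_def)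
  have gU: "gsgn (mgr M i) s x \<in> U i" if "x \<in> U i" for i x s
    using U(4) that by (simp add: gsgn_def)
  show ?thesis
  proof (rule cdg_module.intro, goal_cases)
    case (1 i) show ?case
    proof (rule moduleI[OF tgt.base grp], goal_cases)
      case (1 a x) then show ?case using U(5) \<pi>(4) by (auto simp: \<pi>(1) dest!: R)
    next
      case (2 a b x)
      then obtain a' b' u where h: "a' \<in> carrier R" "a = \<rho> a'" "b' \<in> carrier R" "b = \<rho> b'" "u \<in> U i" "x = \<pi> i u"
        using Q[of x i] R[of a] R[of b] by blast
      show ?case unfolding h(2,4,6) using U(5) M h(1,3,5) by (simp add: \<pi>(3,4) \<rho> UM mm(1)[OF Mod_module])
    next
      case (3 a x y)
      then obtain a' u v where h: "a' \<in> carrier R" "a = \<rho> a'" "v \<in> U i" "y = \<pi> i v" "u \<in> U i" "x = \<pi> i u"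
        using Q[of x i] R[of a] Q[of y i] by blast
      show ?case unfolding h(2,4,6) using U(3,5) M h(1,3,5) by (simp add: \<pi>(3,4) UM mm(2)[OF Mod_module])
    next
      case (4 a b x)
      then obtain a' b' u where h: "a' \<in> carrier R" "a = \<rho> a'" "b' \<in> carrier R" "b = \<rho> b'" "u \<in> U i" "x = \<pi> i u"
        using Q[of x i] R[of a] R[of b] by blast
      show ?case unfolding h(2,4,6) using U(5) M h(1,3,5) by (simp add: \<pi>(4) \<rho> UM mm(3)[OF Mod_module])
    next
      case (5 x)
      then obtain u where h: "u \<in> U i" "x = \<pi> i u" using Q by blast
      show ?case unfolding h(2) using U(5) M h(1) by (simp add: \<pi>(4) \<rho>(3)[OF R.zero_closed R.zero_closed] UM mm(4)[OF Mod_module])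
    qed
  next
    case (2 a i m j)
    then obtain a' u where h: "a' \<in> carrier (agr A i)" "a = \<theta> i a'" "u \<in> U j" "m = \<pi> j u"
      using Q[of m j] TH[of a i] by blast
    show ?case unfolding h(2,4) using U(6) h by (simp add: \<pi>(5) \<pi>(1))
  next
    case (3 a i a' m j)
    then obtain a1 a2 u where h: "a1 \<in> carrier (agr A i)" "a = \<theta> i a1" "a2 \<in> carrier (agr A i)" "a' = \<theta> i a2" "u \<in> U j" "m = \<pi> j u"
      using Q[of m j] TH[of a i] TH[of a' i] by blast
    show ?case unfolding h(2,4,6) using U(6) M h(1,3,5) by (simp add: \<pi>(3,5) \<theta>_add[symmetric] UM)
  next
    case (4 a i m j m')
    then obtain a' u u' where h: "a' \<in> carrier (agr A i)" "a = \<theta> i a'" "u \<in> U j" "m = \<pi> j u" "u' \<in> U j" "m' = \<pi> j u'"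
      using Q[of m j] Q[of m' j] TH[of a i] by blast
    show ?case unfolding h(2,4,6) using U(3,6) M h(1,3,5) by (simp add: \<pi>(3,5) UM)
  next
    case (5 r a i m j)
    then obtain r' a' u where h: "r' \<in> carrier R" "r = \<rho> r'" "a' \<in> carrier (agr A i)" "a = \<theta> i a'" "u \<in> U j" "m = \<pi> j u"
      using Q[of m j] TH[of a i] R[of r] by blast
    show ?case unfolding h(2,4,6) using U(5,6) M h(1,3,5) module.smult_closed[OF A_module h(1,3)]
      by (simp add: \<pi>(4,5) \<theta>_smult[symmetric] UM cdg_module.act_smult_left)
  next
    case (6 r a i m j)
    then obtain r' a' u where h: "r' \<in> carrier R" "r = \<rho> r'" "a' \<in> carrier (agr A i)" "a = \<theta> i a'" "u \<in> U j" "m = \<pi> j u"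
      using Q[of m j] TH[of a i] R[of r] by blast
    show ?case unfolding h(2,4,6) using U(5,6) M h(1,3,5)
      by (simp add: \<pi>(4,5) UM cdg_module.act_smult_right)
  next
    case (7 a i b j m l)
    then obtain a' b' u where h: "a' \<in> carrier (agr A i)" "a = \<theta> i a'" "b' \<in> carrier (agr A j)" "b = \<theta> j b'" "u \<in> U l" "m = \<pi> l u"
      using Q[of m l] TH[of a i] TH[of b j] by blast
    show ?case unfolding h(2,4,6) using U(6) M h(1,3,5)
      by (simp add: \<pi>(5) \<theta>_mult[symmetric] UM M_assoc add.assoc)
  next
    case (8 m i) then obtain u where u: "u \<in> U i" "m = \<pi> i u" using Q by blast
    then show ?case using M \<pi>(5)[OF one_closed u(1)] by (simp add: UM \<theta>_one)
  next
    case (9 m i) then obtain u where u: "u \<in> U i" "m = \<pi> i u" using Q by blast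
    then show ?case using U(7) by (simp add: \<pi>(1,6))
  next
    case (10 m i m') then obtain u u' where u: "u \<in> U i" "m = \<pi> i u" "u' \<in> U i" "m' = \<pi> i u'" using Q by metis
    show ?case unfolding u(2,4) using U(3,7) M u(1,3) by (simp add: \<pi>(3,6) UM)
  next
    case (11 a i m j)
    then obtain a' m' where h: "a' \<in> carrier (agr A i)" "a = \<theta> i a'" "m' \<in> U j" "m = \<pi> j m'"
      using Q[of m j] TH[of a i] by blast
    have u: "mact M (i + 1) j (adiff A i a') m' \<in> U (i + j + 1)" "mact M i (j + 1) a' (mdiff M j m') \<in> U (i + j + 1)"
      using U(6)[of "adiff A i a'" "i + 1" m' j] U(6)[of a' i "mdiff M j m'" "j + 1"] U(7)[OF h(3)] h A_closed(3)[OF h(1)]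
      by (simp_all add: algebra_simps)
    have "mact Q (i + 1) j (\<theta> (i + 1) (adiff A i a')) (\<pi> j m') = \<pi> (i + j + 1) (mact M (i + 1) j (adiff A i a') m')"
      "mact Q i (j + 1) (\<theta> i a') (\<pi> (j + 1) (mdiff M j m')) = \<pi> (i + j + 1) (mact M i (j + 1) a' (mdiff M j m'))"
      using \<pi>(5)[of "adiff A i a'" "i + 1" m' j] \<pi>(5)[of a' i "mdiff M j m'" "j + 1"] U(7)[OF h(3)] h A_closed(3)[OF h(1)]
      by (simp_all add: algebra_simps)
    then show ?case unfolding h(2,4) using h M U(6,7) u gU
      by (simp add: \<pi>(3,5,6) \<theta>_diff[symmetric] gs[OF u(2)] M_leibniz UM)
  next
    case (12 m i) then obtain u where u: "u \<in> U i" "m = \<pi> i u" using Q by blast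
    then show ?case using U(7)[OF u(1)] M \<pi>(5)[OF curv_closed u(1)] \<pi>(6)[OF U(7)[OF u(1)]]
      by (simp add: \<pi>(6) \<theta>_curv M_dd UM)
  qed
qed

text \<open>Restriction of scalars along \<open>\<rho>\<close> and \<open>\<theta>\<close>. In the
  application it makes dg modules over the undeformed algebra available as targets of maps from
  modules over the deformation.\<close>

definition infl :: "('s, 'b, 'm) cdg_mod \<Rightarrow> ('r, 'a, 'm) cdg_mod" where
  "infl N = \<lparr>mgr = (\<lambda>i. \<lparr>carrier = carrier (mgr N i), mult = undefined, one = undefined,
       zero = \<zero>\<^bsub>mgr N i\<^esub>, add = add (mgr N i), smult = (\<lambda>r. smult (mgr N i) (\<rho> r))\<rparr>),
     mact = (\<lambda>i j a. mact N i j (\<theta> i a)), mdiff = mdiff N\<rparr>"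

lemma infl_simps [simp]:
  "carrier (mgr (infl N) i) = carrier (mgr N i)" "\<zero>\<^bsub>mgr (infl N) i\<^esub> = \<zero>\<^bsub>mgr N i\<^esub>"
  "x \<oplus>\<^bsub>mgr (infl N) i\<^esub> y = x \<oplus>\<^bsub>mgr N i\<^esub> y" "r \<odot>\<^bsub>mgr (infl N) i\<^esub> x = \<rho> r \<odot>\<^bsub>mgr N i\<^esub> x"
  "mact (infl N) i j a x = mact N i j (\<theta> i a) x" "mdiff (infl N) i x = mdiff N i x"
  by (simp_all add: infl_def)

lemma infl_neg [simp]: "\<ominus>\<^bsub>mgr (infl N) i\<^esub> x = \<ominus>\<^bsub>mgr N i\<^esub> x" "x \<ominus>\<^bsub>mgr (infl N) i\<^esub> y = x \<ominus>\<^bsub>mgr N i\<^esub> y"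
  by (simp_all add: infl_def a_inv_def a_minus_def m_inv_def)

lemma infl_gsgn [simp]: "gsgn (mgr (infl N) i) p x = gsgn (mgr N i) p x"
  by (simp add: gsgn_def)

lemma infl_module:
  assumes N: "tgt.isM N"
  shows "isM (infl N)"
proof -
  have \<rho> [simp]: "\<rho> a \<in> carrier R'" if "a \<in> carrier R" for a using that \<rho>_surj by auto
  have \<rho>': "\<rho> (a \<oplus>\<^bsub>R\<^esub> b) = \<rho> a \<oplus>\<^bsub>R'\<^esub> \<rho> b" "\<rho> (a \<otimes>\<^bsub>R\<^esub> b) = \<rho> a \<otimes>\<^bsub>R'\<^esub> \<rho> b" "\<rho> \<one>\<^bsub>R\<^esub> = \<one>\<^bsub>R'\<^esub>"
    if "a \<in> carrier R" "b \<in> carrier R" for a b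
    using that \<rho>_hom by (auto simp: ring_hom_add ring_hom_mult ring_hom_one)
  interpret R: cring R by (rule base)
  have m: "module R' (mgr N i)" for i by (rule tgt.Mod_module[OF N])
  note [simp] = N
  show ?thesis
  proof (rule cdg_module.intro, goal_cases)
    case (1 i) show ?case
    proof (rule moduleI[OF base], goal_cases)
      case 1 show ?case
      proof (rule abelian_groupI, goal_cases)
        case (6 x) then show ?case by (auto intro!: bexI[of _ "\<ominus>\<^bsub>mgr N i\<^esub> x"])
      qed (use abelian_groupE[OF tgt.Mod_grp[OF N, of i]] in auto)
    qed (use \<rho>'(3)[OF R.zero_closed R.zero_closed] in
        \<open>simp_all add: \<rho>' module.smult_l_distr[OF m] module.smult_r_distr[OF m] module.smult_assoc1[OF m] module.smult_one[OF m]\<close>)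
  qed (simp_all add: \<theta>_add \<theta>_smult \<theta>_mult \<theta>_one \<theta>_diff \<theta>_curv tgt.M_assoc[OF N] tgt.M_leibniz[OF N] tgt.M_dd[OF N]
      cdg_module.act_smult_left[OF N] cdg_module.act_smult_right[OF N])
qed

text \<open>Surjectivity of \<open>\<theta>\<close> makes restriction of scalars full: linearity
  over the target algebra is tested on the elements \<open>\<theta> i a\<close>.\<close>

lemma infl_ghom: "f \<in> ghom A p (infl M) (infl N) \<longleftrightarrow> f \<in> ghom A' p M N"
proof
  assume f: "f \<in> ghom A p (infl M) (infl N)"
  show "f \<in> ghom A' p M N"
  proof (rule tgt.ghomI, goal_cases)
    case (3 i j a m)
    then obtain a' where "a' \<in> carrier (agr A i)" "a = \<theta> i a'" by (auto elim: \<theta>_obtain)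
    then show ?case using ghom_act[OF f, of a' i m j] 3 by simp
  qed (use ghom_closed[OF f] ghom_add[OF f] in auto)
next
  assume f: "f \<in> ghom A' p M N"
  show "f \<in> ghom A p (infl M) (infl N)"
    by (rule ghomI) (use tgt.ghom_act[OF f] tgt.ghom_closed[OF f] tgt.ghom_add[OF f] in simp_all)
qed

lemma infl_closed0: "tgt.isM M \<Longrightarrow> tgt.isM N \<Longrightarrow> f \<in> closed0 A (infl M) (infl N) \<longleftrightarrow> f \<in> closed0 A' M N"
  by (simp add: closed0_iff tgt.closed0_iff infl_module infl_ghom)

end

section \<open>Submodules, quotients and factorisation of maps\<close>

context cdg_algebra
begin

text \<open>Closure under negatives and scalars follows from closure under the action of multiples
  of the unit; see \<open>submod_neg\<close> and \<open>smult_act\<close>.\<close>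

definition submod where
  "submod M L \<longleftrightarrow> (\<forall>i. L i \<subseteq> carrier (mgr M i) \<and> \<zero>\<^bsub>mgr M i\<^esub> \<in> L i) \<and>
     (\<forall>i. \<forall>x\<in>L i. \<forall>y\<in>L i. x \<oplus>\<^bsub>mgr M i\<^esub> y \<in> L i) \<and>
     (\<forall>i j. \<forall>a\<in>carrier (agr A i). \<forall>x\<in>L j. mact M i j a x \<in> L (i + j)) \<and>
     (\<forall>i. \<forall>x\<in>L i. mdiff M i x \<in> L (i + 1))"

lemma submodI:
  assumes "\<And>i x. x \<in> L i \<Longrightarrow> x \<in> carrier (mgr M i)" "\<And>i. \<zero>\<^bsub>mgr M i\<^esub> \<in> L i"
    "\<And>i x y. x \<in> L i \<Longrightarrow> y \<in> L i \<Longrightarrow> x \<oplus>\<^bsub>mgr M i\<^esub> y \<in> L i"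
    "\<And>i j a x. a \<in> carrier (agr A i) \<Longrightarrow> x \<in> L j \<Longrightarrow> mact M i j a x \<in> L (i + j)"
    "\<And>i x. x \<in> L i \<Longrightarrow> mdiff M i x \<in> L (i + 1)"
  shows "submod M L"
  using assms unfolding submod_def by blast

lemma submodD:
  assumes "submod M L"
  shows "x \<in> L i \<Longrightarrow> x \<in> carrier (mgr M i)" "\<zero>\<^bsub>mgr M i\<^esub> \<in> L i"
    "x \<in> L i \<Longrightarrow> y \<in> L i \<Longrightarrow> x \<oplus>\<^bsub>mgr M i\<^esub> y \<in> L i"
    "a \<in> carrier (agr A i) \<Longrightarrow> x \<in> L j \<Longrightarrow> mact M i j a x \<in> L (i + j)"
    "x \<in> L i \<Longrightarrow> mdiff M i x \<in> L (i + 1)"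
  using assms unfolding submod_def by blast+

lemma smult_act:
  assumes "isM M" "r \<in> carrier R" "x \<in> carrier (mgr M i)"
  shows "r \<odot>\<^bsub>mgr M i\<^esub> x = mact M 0 i (r \<odot>\<^bsub>agr A 0\<^esub> aone A) x"
  using cdg_module.act_smult_left[OF assms(1,2) one_closed assms(3)] assms by simp

lemma submod_neg:
  assumes M: "isM M" and L: "submod M L" and x: "x \<in> L i"
  shows "\<ominus>\<^bsub>mgr M i\<^esub> x \<in> L i"
proof -
  have "mact M 0 i (\<ominus>\<^bsub>agr A 0\<^esub> aone A) x \<in> L i" using submodD(4)[OF L _ x, of "\<ominus>\<^bsub>agr A 0\<^esub> aone A" 0] by simp
  then show ?thesis using M submodD(1)[OF L x] by simp
qed

lemma submod_minus: "isM M \<Longrightarrow> submod M L \<Longrightarrow> x \<in> L i \<Longrightarrow> y \<in> L i \<Longrightarrow> x \<ominus>\<^bsub>mgr M i\<^esub> y \<in> L i"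
  unfolding a_minus_def
  by (rule submodD(3)[of M L x i], assumption+, rule submod_neg[of M L y i], assumption+)

definition surj_map where
  "surj_map M Q f \<longleftrightarrow> f \<in> closed0 A M Q \<and> (\<forall>i. f i ` carrier (mgr M i) = carrier (mgr Q i))"

lemma surj_mapD: "surj_map M Q f \<Longrightarrow> f \<in> closed0 A M Q"
  by (simp add: surj_map_def)

lemma surj_mapE:
  assumes "surj_map M Q f" "y \<in> carrier (mgr Q i)"
  obtains x where "x \<in> carrier (mgr M i)" "y = f i x"
  using assms unfolding surj_map_def by blast

lemma alg_surj_id: "alg_surj R A R A (\<lambda>r. r) (\<lambda>i a. a)"
  by unfold_locales (auto simp: ring_hom_def)

text \<open>The quotient has to live in the universe \<open>'m\<close>, whatever the type of
  \<open>M\<close>. A coset \<open>E i x\<close> is encoded by a chosen element of it, which the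
  injection \<open>\<phi> i\<close> provided by \<open>small\<close> sends into
  \<open>'m\<close>.\<close>

lemma quotient_exists:
  fixes M :: "('r, 'a, 'n) cdg_mod"
  assumes M: "isM M" and L: "submod M L" and small: "\<And>i. carrier (mgr M i) \<lesssim> (UNIV :: 'm set)"
  obtains Q :: "('r, 'a, 'm) cdg_mod" and \<pi> where "isM Q" "surj_map M Q \<pi>"
    "\<And>i x. x \<in> carrier (mgr M i) \<Longrightarrow> \<pi> i x = \<zero>\<^bsub>mgr Q i\<^esub> \<longleftrightarrow> x \<in> L i"
proof -
  have "\<forall>i. \<exists>f :: 'n \<Rightarrow> 'm. inj_on f (carrier (mgr M i))"
    using small unfolding lepoll_def by blast
  then obtain \<phi> :: "int \<Rightarrow> 'n \<Rightarrow> 'm" where \<phi>: "\<And>i. inj_on (\<phi> i) (carrier (mgr M i))" by metis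
  define E where "E i x = {y \<in> carrier (mgr M i). x \<ominus>\<^bsub>mgr M i\<^esub> y \<in> L i}" for i x
  define rep where "rep i x = (SOME y. y \<in> E i x)" for i x
  have E_eq: "E i x = E i y \<longleftrightarrow> x \<ominus>\<^bsub>mgr M i\<^esub> y \<in> L i"
    if "x \<in> carrier (mgr M i)" "y \<in> carrier (mgr M i)" for i x y
  proof
    have "y \<in> E i y" using that submodD(2)[OF L] M by (simp add: E_def)
    moreover assume "E i x = E i y" ultimately show "x \<ominus>\<^bsub>mgr M i\<^esub> y \<in> L i" by (auto simp: E_def)
  next
    note c = that
    assume xy: "x \<ominus>\<^bsub>mgr M i\<^esub> y \<in> L i"
    have "x \<ominus>\<^bsub>mgr M i\<^esub> z \<in> L i \<longleftrightarrow> y \<ominus>\<^bsub>mgr M i\<^esub> z \<in> L i" if z: "z \<in> carrier (mgr M i)" for z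
    proof -
      have "x \<ominus>\<^bsub>mgr M i\<^esub> z = (x \<ominus>\<^bsub>mgr M i\<^esub> y) \<oplus>\<^bsub>mgr M i\<^esub> (y \<ominus>\<^bsub>mgr M i\<^esub> z)"
        "y \<ominus>\<^bsub>mgr M i\<^esub> z = (x \<ominus>\<^bsub>mgr M i\<^esub> z) \<ominus>\<^bsub>mgr M i\<^esub> (x \<ominus>\<^bsub>mgr M i\<^esub> y)"
        using z c M by (simp_all add: ab_ac)
      then show ?thesis using xy submodD(3)[OF L] submod_minus[OF M L] by metis
    qed
    then show "E i x = E i y" by (auto simp: E_def)
  qed
  have rep_E: "rep i x \<in> E i x" if "x \<in> carrier (mgr M i)" for i x
    unfolding rep_def by (rule someI[of _ x]) (use that submodD(2)[OF L] M in \<open>simp add: E_def\<close>)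
  have E_rep: "E i (rep i x) = E i x" if x: "x \<in> carrier (mgr M i)" for i x
    using rep_E[OF x] E_eq[of x i "rep i x"] x by (auto simp: E_def)
  define \<pi> where "\<pi> i x = \<phi> i (rep i x)" for i x
  have \<pi>_eq: "\<pi> i x = \<pi> i y \<longleftrightarrow> x \<ominus>\<^bsub>mgr M i\<^esub> y \<in> L i"
    if "x \<in> carrier (mgr M i)" "y \<in> carrier (mgr M i)" for i x y
  proof -
    have "\<pi> i x = \<pi> i y \<longleftrightarrow> rep i x = rep i y"
      using inj_onD[OF \<phi>[of i], of "rep i x" "rep i y"] rep_E[OF that(1)] rep_E[OF that(2)]
      by (auto simp: \<pi>_def E_def)
    also have "\<dots> \<longleftrightarrow> E i x = E i y"
    proof
      assume "rep i x = rep i y"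
      then show "E i x = E i y" by (subst E_rep[OF that(1), symmetric], subst E_rep[OF that(2), symmetric]) simp
    qed (simp add: rep_def)
    finally show ?thesis using E_eq[OF that] by simp
  qed
  define \<iota> where "\<iota> i y = (SOME x. x \<in> carrier (mgr M i) \<and> \<pi> i x = y)" for i y
  have \<iota>: "\<iota> i (\<pi> i x) \<in> carrier (mgr M i)" "\<pi> i (\<iota> i (\<pi> i x)) = \<pi> i x" if "x \<in> carrier (mgr M i)" for i x
    using someI[of "\<lambda>z. z \<in> carrier (mgr M i) \<and> \<pi> i z = \<pi> i x" x] that unfolding \<iota>_def by auto
  define Q :: "('r, 'a, 'm) cdg_mod" where "Q = \<lparr>mgr = (\<lambda>i. \<lparr>carrier = \<pi> i ` carrier (mgr M i), mult = undefined,
      one = undefined, zero = \<pi> i \<zero>\<^bsub>mgr M i\<^esub>, add = (\<lambda>x y. \<pi> i (\<iota> i x \<oplus>\<^bsub>mgr M i\<^esub> \<iota> i y)),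
      smult = (\<lambda>r x. \<pi> i (r \<odot>\<^bsub>mgr M i\<^esub> \<iota> i x))\<rparr>),
    mact = (\<lambda>i j a x. \<pi> (i + j) (mact M i j a (\<iota> j x))), mdiff = (\<lambda>i x. \<pi> (i + 1) (mdiff M i (\<iota> i x)))\<rparr>"
  have \<iota>L: "\<iota> i (\<pi> i x) \<ominus>\<^bsub>mgr M i\<^esub> x \<in> L i" if "x \<in> carrier (mgr M i)" for i x
    using \<pi>_eq[OF \<iota>(1)[OF that] that] \<iota>(2)[OF that] by simp
  have add: "\<pi> i x \<oplus>\<^bsub>mgr Q i\<^esub> \<pi> i y = \<pi> i (x \<oplus>\<^bsub>mgr M i\<^esub> y)"
    if "x \<in> carrier (mgr M i)" "y \<in> carrier (mgr M i)" for i x y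
  proof -
    let ?x = "\<iota> i (\<pi> i x)" and ?y = "\<iota> i (\<pi> i y)"
    have "(?x \<oplus>\<^bsub>mgr M i\<^esub> ?y) \<ominus>\<^bsub>mgr M i\<^esub> (x \<oplus>\<^bsub>mgr M i\<^esub> y) = (?x \<ominus>\<^bsub>mgr M i\<^esub> x) \<oplus>\<^bsub>mgr M i\<^esub> (?y \<ominus>\<^bsub>mgr M i\<^esub> y)"
      using \<iota>(1) that M by (simp add: ab_ac)
    then have "\<pi> i (?x \<oplus>\<^bsub>mgr M i\<^esub> ?y) = \<pi> i (x \<oplus>\<^bsub>mgr M i\<^esub> y)"
      using \<iota>(1) that M submodD(3)[OF L \<iota>L \<iota>L, of x i y] by (subst \<pi>_eq) simp_all
    then show ?thesis by (simp add: Q_def)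
  qed
  have act: "mact Q i j a (\<pi> j x) = \<pi> (i + j) (mact M i j a x)"
    if "a \<in> carrier (agr A i)" "x \<in> carrier (mgr M j)" for i j a x
  proof -
    have "mact M i j a (\<iota> j (\<pi> j x)) \<ominus>\<^bsub>mgr M (i + j)\<^esub> mact M i j a x = mact M i j a (\<iota> j (\<pi> j x) \<ominus>\<^bsub>mgr M j\<^esub> x)"
      using \<iota>(1)[OF that(2)] that M by (simp add: a_minus_def)
    also have "\<dots> \<in> L (i + j)" by (rule submodD(4)[OF L that(1) \<iota>L[OF that(2)]])
    finally have "\<pi> (i + j) (mact M i j a (\<iota> j (\<pi> j x))) = \<pi> (i + j) (mact M i j a x)"
      using \<iota>(1) that M by (subst \<pi>_eq) simp_all
    then show ?thesis by (simp add: Q_def)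
  qed
  have smult: "r \<odot>\<^bsub>mgr Q i\<^esub> \<pi> i x = \<pi> i (r \<odot>\<^bsub>mgr M i\<^esub> x)" if "r \<in> carrier R" "x \<in> carrier (mgr M i)" for i r x
  proof -
    have "r \<odot>\<^bsub>agr A 0\<^esub> aone A \<in> carrier (agr A 0)" using that module.smult_closed[OF A_module] by simp
    from act[OF this that(2)] show ?thesis using that \<iota>(1)[OF that(2)] M smult_act[OF M that(1)] by (simp add: Q_def)
  qed
  have diff: "mdiff Q i (\<pi> i x) = \<pi> (i + 1) (mdiff M i x)" if "x \<in> carrier (mgr M i)" for i x
  proof -
    have "mdiff M i (\<iota> i (\<pi> i x)) \<ominus>\<^bsub>mgr M (i + 1)\<^esub> mdiff M i x = mdiff M i (\<iota> i (\<pi> i x) \<ominus>\<^bsub>mgr M i\<^esub> x)"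
      using \<iota>(1)[OF that] that M by (simp add: a_minus_def)
    also have "\<dots> \<in> L (i + 1)" by (rule submodD(5)[OF L \<iota>L[OF that]])
    finally have "\<pi> (i + 1) (mdiff M i (\<iota> i (\<pi> i x))) = \<pi> (i + 1) (mdiff M i x)"
      using \<iota>(1) that M by (subst \<pi>_eq) simp_all
    then show ?thesis by (simp add: Q_def)
  qed
  have carr: "carrier (mgr Q i) = \<pi> i ` carrier (mgr M i)" "\<zero>\<^bsub>mgr Q i\<^esub> = \<pi> i \<zero>\<^bsub>mgr M i\<^esub>" for i by (simp_all add: Q_def)
  have Q: "isM Q"
    by (rule alg_surj.semilinear_image_module[OF alg_surj_id M, of "\<lambda>i. carrier (mgr M i)" Q \<pi>])
       (use M in \<open>simp_all add: carr add smult act diff\<close>)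
  have "surj_map M Q \<pi>"
    unfolding surj_map_def by (auto intro!: closed0I M Q simp: carr add act diff)
  moreover have "\<pi> i x = \<zero>\<^bsub>mgr Q i\<^esub> \<longleftrightarrow> x \<in> L i" if "x \<in> carrier (mgr M i)" for i x
    using \<pi>_eq[OF that, of "\<zero>\<^bsub>mgr M i\<^esub>"] that M by (simp add: carr)
  ultimately show thesis using that Q by blast
qed

text \<open>The value on an element of \<open>Q\<close> is that of \<open>f\<close> on a chosen
  preimage; the kernel condition makes it independent of the choice, and the properties of
  \<open>f\<close> descend because \<open>\<pi>\<close> is surjective.\<close>

lemma factor_ghom:
  assumes M: "isM M" "isM Q" "isM N" and \<pi>: "surj_map M Q \<pi>" and f: "f \<in> ghom A p M N"
    and ker: "\<And>i x. x \<in> carrier (mgr M i) \<Longrightarrow> \<pi> i x = \<zero>\<^bsub>mgr Q i\<^esub> \<Longrightarrow> f i x = \<zero>\<^bsub>mgr N (i + p)\<^esub>"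
  obtains g where "g \<in> ghom A p Q N" "\<And>i x. x \<in> carrier (mgr M i) \<Longrightarrow> g i (\<pi> i x) = f i x"
proof -
  note \<pi>' = surj_mapD[OF \<pi>]
  define g where "g i y = f i (SOME x. x \<in> carrier (mgr M i) \<and> \<pi> i x = y)" for i y
  have g: "g i (\<pi> i x) = f i x" if x: "x \<in> carrier (mgr M i)" for i x
  proof -
    define z where "z = (SOME z. z \<in> carrier (mgr M i) \<and> \<pi> i z = \<pi> i x)"
    have z: "z \<in> carrier (mgr M i)" "\<pi> i z = \<pi> i x"
      using someI[of "\<lambda>z. z \<in> carrier (mgr M i) \<and> \<pi> i z = \<pi> i x" x] x unfolding z_def by auto
    have "\<pi> i (z \<ominus>\<^bsub>mgr M i\<^esub> x) = \<zero>\<^bsub>mgr Q i\<^esub>" using z x \<pi>' M by simp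
    then have "f i (z \<ominus>\<^bsub>mgr M i\<^esub> x) = \<zero>\<^bsub>mgr N (i + p)\<^esub>" using ker z x M by simp
    then have "f i z = f i x" using f M z x by (simp add: abelian_group.ab_eq_minus)
    then show ?thesis unfolding g_def z_def .
  qed
  have "g \<in> ghom A p Q N"
  proof (rule ghomI, goal_cases)
    case (1 i m) then show ?case using f by (auto elim!: surj_mapE[OF \<pi>] simp: g)
  next
    case (2 i m m')
    obtain x where x: "x \<in> carrier (mgr M i)" "m = \<pi> i x" by (rule surj_mapE[OF \<pi> 2(1)])
    obtain y where y: "y \<in> carrier (mgr M i)" "m' = \<pi> i y" by (rule surj_mapE[OF \<pi> 2(2)])
    have "m \<oplus>\<^bsub>mgr Q i\<^esub> m' = \<pi> i (x \<oplus>\<^bsub>mgr M i\<^esub> y)" using x y \<pi>' by simp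
    then show ?case using x y f M by (simp add: g)
  next
    case (3 i j a m)
    obtain x where x: "x \<in> carrier (mgr M j)" "m = \<pi> j x" by (rule surj_mapE[OF \<pi> 3(2)])
    have "mact Q i j a m = \<pi> (i + j) (mact M i j a x)" using x closed0_act[OF \<pi>' 3(1)] by simp
    then show ?case using x 3 f M by (simp add: g ghom_act)
  qed
  then show thesis using that g by blast
qed

lemma factor_closed0:
  assumes M: "isM M" "isM Q" "isM N" and \<pi>: "surj_map M Q \<pi>" and f: "f \<in> closed0 A M N"
    and ker: "\<And>i x. x \<in> carrier (mgr M i) \<Longrightarrow> \<pi> i x = \<zero>\<^bsub>mgr Q i\<^esub> \<Longrightarrow> f i x = \<zero>\<^bsub>mgr N i\<^esub>"
  obtains g where "g \<in> closed0 A Q N" "\<And>i x. x \<in> carrier (mgr M i) \<Longrightarrow> g i (\<pi> i x) = f i x"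
proof -
  obtain g where g: "g \<in> ghom A 0 Q N" "\<And>i x. x \<in> carrier (mgr M i) \<Longrightarrow> g i (\<pi> i x) = f i x"
    by (rule factor_ghom[OF M \<pi> closed0_ghom[OF f]]) (use ker in auto)
  have "mdiff N i (g i m) = g (i + 1) (mdiff Q i m)" if m: "m \<in> carrier (mgr Q i)" for i m
  proof -
    obtain x where x: "x \<in> carrier (mgr M i)" "m = \<pi> i x" by (rule surj_mapE[OF \<pi> m])
    then show ?thesis using g(2)[of "mdiff M i x" "i + 1"] closed0_diff[OF surj_mapD[OF \<pi>] x(1) M(1,2)] closed0_diff[OF f x(1) M(1,3)] M
      by (simp add: g)
  qed
  then have "g \<in> closed0 A Q N" using g M by (simp add: closed0_iff)
  then show thesis using that g by blast
qed

text \<open>The quotient by zero is an isomorphic copy inside the universe. Cones and fibres, whose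
  elements are pairs, are brought back to \<open>'m\<close> this way.\<close>

lemma module_copy:
  fixes M :: "('r, 'a, 'n) cdg_mod"
  assumes M: "isM M" and small: "\<And>i. carrier (mgr M i) \<lesssim> (UNIV :: 'm set)"
  obtains Q :: "('r, 'a, 'm) cdg_mod" and \<phi> \<psi> where "isM Q" "\<phi> \<in> closed0 A M Q" "\<psi> \<in> closed0 A Q M"
    "\<And>i x. x \<in> carrier (mgr M i) \<Longrightarrow> \<psi> i (\<phi> i x) = x" "\<And>i y. y \<in> carrier (mgr Q i) \<Longrightarrow> \<phi> i (\<psi> i y) = y"
proof -
  have 0: "submod M (\<lambda>i. {\<zero>\<^bsub>mgr M i\<^esub>})" by (rule submodI) (use M in auto)
  obtain Q :: "('r, 'a, 'm) cdg_mod" and \<phi> where Q: "isM Q" "surj_map M Q \<phi>"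
    "\<And>i x. x \<in> carrier (mgr M i) \<Longrightarrow> \<phi> i x = \<zero>\<^bsub>mgr Q i\<^esub> \<longleftrightarrow> x \<in> {\<zero>\<^bsub>mgr M i\<^esub>}"
    using quotient_exists[OF M 0 small] by blast
  obtain \<psi> where \<psi>: "\<psi> \<in> closed0 A Q M" "\<And>i x. x \<in> carrier (mgr M i) \<Longrightarrow> \<psi> i (\<phi> i x) = x"
    using factor_closed0[OF M Q(1) M Q(2) closed0_id[OF M]] Q(3) by auto
  have "\<phi> i (\<psi> i y) = y" if "y \<in> carrier (mgr Q i)" for i y
    using surj_mapE[OF Q(2) that] \<psi>(2) by metis
  then show thesis using that[OF Q(1) surj_mapD[OF Q(2)] \<psi>] by blast
qed

end

section \<open>Filtration by powers of a central element\<close>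

text \<open>Cancels opposite terms that are separated by one other summand, a situation that sorting
  sums leaves behind.\<close>

lemma (in abelian_group) ab_cancel:
  assumes "x \<in> carrier G" "y \<in> carrier G"
  shows "x \<oplus> (y \<oplus> \<ominus> x) = y" "\<ominus> x \<oplus> (y \<oplus> x) = y"
    "z \<in> carrier G \<Longrightarrow> x \<oplus> (y \<oplus> (\<ominus> x \<oplus> z)) = y \<oplus> z" "z \<in> carrier G \<Longrightarrow> \<ominus> x \<oplus> (y \<oplus> (x \<oplus> z)) = y \<oplus> z"
  using assms by (metis ab_ac(4) ab_ac(5) ab_closed ab_simp(1,5,6,7,8))+

lemmas ab_cancel [simp] = abelian_group.ab_cancel

lemma one_add_int [simp]: "1 + i = i + (1 :: int)"
  by simp

text \<open>
  The elements \<open>tau j\<close> are the powers of a central closed element of degree \<open>0\<close> whose power \<open>n + 1\<close>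
  vanishes and which divides the curvature.  Both the deformation (powers of \<open>t\<close>) and, with \<open>n = 0\<close>,
  the dg algebra itself (powers of \<open>0\<close>) are instances.
\<close>

locale tau_algebra = cdg_algebra R A
  for R :: "'r ring" and A :: "('r, 'a) cdg_alg" +
  fixes tau :: "nat \<Rightarrow> 'a" and n :: nat
  assumes tau_closed [simp]: "tau j \<in> carrier (agr A 0)"
    and tau_0 [simp]: "tau 0 = aone A"
    and tau_add: "amult A 0 0 (tau j) (tau l) = tau (j + l)"
    and tau_central: "a \<in> carrier (agr A i) \<Longrightarrow> amult A 0 i (tau j) a = amult A i 0 a (tau j)"
    and tau_diff: "adiff A 0 (tau j) = \<zero>\<^bsub>agr A 1\<^esub>"
    and tau_last: "tau (Suc n) = \<zero>\<^bsub>agr A 0\<^esub>"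
    and tau_curv: "\<exists>c\<in>carrier (agr A 2). curv A = amult A 0 2 (tau 1) c"
begin

definition T where "T j M i m = mact M 0 i (tau j) m"

definition tp where "tp M j i = T j M i ` carrier (mgr M i)"

text \<open>
  \<open>Zc\<close> and \<open>Bd\<close> are the preimages in \<open>tp M j\<close> of the cycles and boundaries of \<open>tp M j / tp M (Suc j)\<close>;
  \<open>qis j\<close> says that a map induces a bijection on the cohomology of these quotients.
\<close>

definition Zc where "Zc M j i = {x \<in> tp M j i. mdiff M i x \<in> tp M (Suc j) (i + 1)}"

definition Bd where "Bd M j i = {mdiff M (i - 1) y \<oplus>\<^bsub>mgr M i\<^esub> z | y z. y \<in> tp M j (i - 1) \<and> z \<in> tp M (Suc j) i}"

definition acyc where "acyc j M \<longleftrightarrow> (\<forall>i. Zc M j i \<subseteq> Bd M j i)"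

definition qis where
  "qis j M N f \<longleftrightarrow> (\<forall>i. (\<forall>x\<in>Zc M j i. f i x \<in> Bd N j i \<longrightarrow> x \<in> Bd M j i) \<and>
     (\<forall>y\<in>Zc N j i. \<exists>x\<in>Zc M j i. y \<ominus>\<^bsub>mgr N i\<^esub> f i x \<in> Bd N j i))"

lemma T_closed [simp]: "isM M \<Longrightarrow> m \<in> carrier (mgr M i) \<Longrightarrow> T j M i m \<in> carrier (mgr M i)"
  using M_closed(1)[OF _ tau_closed, of M m i] by (simp add: T_def)

lemma T_add [simp]:
  "isM M \<Longrightarrow> m \<in> carrier (mgr M i) \<Longrightarrow> m' \<in> carrier (mgr M i) \<Longrightarrow>
    T j M i (m \<oplus>\<^bsub>mgr M i\<^esub> m') = T j M i m \<oplus>\<^bsub>mgr M i\<^esub> T j M i m'"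
  "isM M \<Longrightarrow> T j M i \<zero>\<^bsub>mgr M i\<^esub> = \<zero>\<^bsub>mgr M i\<^esub>"
  "isM M \<Longrightarrow> m \<in> carrier (mgr M i) \<Longrightarrow> T j M i (\<ominus>\<^bsub>mgr M i\<^esub> m) = \<ominus>\<^bsub>mgr M i\<^esub> T j M i m"
  by (simp_all add: T_def)

lemma T_minus: "isM M \<Longrightarrow> m \<in> carrier (mgr M i) \<Longrightarrow> m' \<in> carrier (mgr M i) \<Longrightarrow>
    T j M i (m \<ominus>\<^bsub>mgr M i\<^esub> m') = T j M i m \<ominus>\<^bsub>mgr M i\<^esub> T j M i m'"
  by (simp add: a_minus_def)

lemma T_0 [simp]: "isM M \<Longrightarrow> m \<in> carrier (mgr M i) \<Longrightarrow> T 0 M i m = m"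
  by (simp add: T_def)

lemma T_last [simp]: "isM M \<Longrightarrow> m \<in> carrier (mgr M i) \<Longrightarrow> T (Suc n) M i m = \<zero>\<^bsub>mgr M i\<^esub>"
  by (simp add: T_def tau_last)

lemma T_T: "isM M \<Longrightarrow> m \<in> carrier (mgr M i) \<Longrightarrow> T j M i (T l M i m) = T (j + l) M i m"
  using M_assoc[of R A M "tau j" 0 "tau l" 0 m i] by (simp add: T_def tau_add)

lemma T_act: "isM M \<Longrightarrow> a \<in> carrier (agr A i) \<Longrightarrow> m \<in> carrier (mgr M l) \<Longrightarrow>
    mact M i l a (T j M l m) = T j M (i + l) (mact M i l a m)"
  using M_assoc[of R A M "tau j" 0 a i m l] M_assoc[of R A M a i "tau j" 0 m l] by (simp add: T_def tau_central)

lemma T_diff: "isM M \<Longrightarrow> m \<in> carrier (mgr M i) \<Longrightarrow> mdiff M i (T j M i m) = T j M (i + 1) (mdiff M i m)"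
  using M_leibniz[of R A M "tau j" 0 m i] M_closed(1)[OF _ tau_closed, of M "mdiff M i m" "i + 1" j]
    M_zero(1)[of M m i 1]
  by (simp add: T_def tau_diff add.commute[of 1])

lemma T_ghom: "f \<in> ghom A p M N \<Longrightarrow> m \<in> carrier (mgr M i) \<Longrightarrow> isM N \<Longrightarrow> f i (T j M i m) = T j N (i + p) (f i m)"
  using ghom_act[of f p M N "tau j" 0 m i] by (simp add: T_def)

lemma tpI: "m \<in> carrier (mgr M i) \<Longrightarrow> x = T j M i m \<Longrightarrow> x \<in> tp M j i"
  by (simp add: tp_def)

lemma tpE: assumes "x \<in> tp M j i" obtains m where "m \<in> carrier (mgr M i)" "x = T j M i m"
  using assms unfolding tp_def by blast

lemma tp_carrier [dest]: "x \<in> tp M j i \<Longrightarrow> isM M \<Longrightarrow> x \<in> carrier (mgr M i)"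
  by (auto elim: tpE)

lemma tp_0 [simp]: "isM M \<Longrightarrow> tp M 0 i = carrier (mgr M i)"
  by (auto simp: tp_def)

lemma tp_last [simp]:
  assumes "isM M" shows "tp M (Suc n) i = {\<zero>\<^bsub>mgr M i\<^esub>}"
proof -
  have "tp M (Suc n) i = (\<lambda>_. \<zero>\<^bsub>mgr M i\<^esub>) ` carrier (mgr M i)"
    unfolding tp_def by (rule image_cong) (use assms in auto)
  then show ?thesis using ab_closed(3)[OF Mod_grp[OF assms], of i] by (auto simp: image_constant_conv)
qed

lemma tp_submod: "isM M \<Longrightarrow> submod M (tp M j)"
proof (rule submodI, goal_cases)
  case (2 i) then show ?case by (intro tpI[of "\<zero>\<^bsub>mgr M i\<^esub>"]) auto
next
  case (3 i x y) then show ?case by (metis T_add(1) ab_closed(1) Mod_grp tpE tpI)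
next
  case (4 i l a x) then show ?case by (metis T_act M_closed(1) tpE tpI)
next
  case (5 i x) then show ?case by (metis T_diff M_closed(2) tpE tpI)
qed auto

lemmas tp_zero = submodD(2)[OF tp_submod] and tp_add = submodD(3)[OF tp_submod]
  and tp_act = submodD(4)[OF tp_submod] and tp_diff = submodD(5)[OF tp_submod]
  and tp_neg = submod_neg[OF _ tp_submod] and tp_minus = submod_minus[OF _ tp_submod]

lemma tp_neg_iff: "isM M \<Longrightarrow> x \<in> carrier (mgr M i) \<Longrightarrow> \<ominus>\<^bsub>mgr M i\<^esub> x \<in> tp M j i \<longleftrightarrow> x \<in> tp M j i"
  by (metis tp_neg ab_simp(4) Mod_grp)

lemma tp_mono:
  assumes "isM M" "j \<le> l" shows "tp M l i \<subseteq> tp M j i"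
proof
  fix x assume "x \<in> tp M l i"
  then obtain m where m: "m \<in> carrier (mgr M i)" "x = T l M i m" by (rule tpE)
  then have "x = T j M i (T (l - j) M i m)" using assms by (simp add: T_T)
  then show "x \<in> tp M j i" using m assms by (intro tpI[of "T (l - j) M i m"]) auto
qed

lemma tp_ghom: "f \<in> ghom A p M N \<Longrightarrow> isM M \<Longrightarrow> isM N \<Longrightarrow> x \<in> tp M j i \<Longrightarrow> f i x \<in> tp N j (i + p)"
  by (metis T_ghom ghom_closed tpE tpI)

lemma tp_closed0: "f \<in> closed0 A M N \<Longrightarrow> isM M \<Longrightarrow> isM N \<Longrightarrow> x \<in> tp M j i \<Longrightarrow> f i x \<in> tp N j i"
  using tp_ghom[OF closed0_ghom, of f M N x j i] by simp

lemma tp_h: "h \<in> ghom A (- 1) M N \<Longrightarrow> isM M \<Longrightarrow> isM N \<Longrightarrow> x \<in> tp M j i \<Longrightarrow> h i x \<in> tp N j (i - 1)"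
  using tp_ghom[of h "- 1" M N x j i] by simp

lemma ZcI: "x \<in> tp M j i \<Longrightarrow> mdiff M i x \<in> tp M (Suc j) (i + 1) \<Longrightarrow> x \<in> Zc M j i"
  by (simp add: Zc_def)

lemma ZcD: "x \<in> Zc M j i \<Longrightarrow> x \<in> tp M j i" "x \<in> Zc M j i \<Longrightarrow> mdiff M i x \<in> tp M (Suc j) (i + 1)"
  by (simp_all add: Zc_def)

lemma Zc_carrier [simp]: "x \<in> Zc M j i \<Longrightarrow> isM M \<Longrightarrow> x \<in> carrier (mgr M i)"
  by (auto dest: ZcD)

lemma BdI: "x = mdiff M (i - 1) y \<oplus>\<^bsub>mgr M i\<^esub> z \<Longrightarrow> y \<in> tp M j (i - 1) \<Longrightarrow> z \<in> tp M (Suc j) i \<Longrightarrow> x \<in> Bd M j i"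
  unfolding Bd_def by blast

lemma BdE:
  assumes "x \<in> Bd M j i"
  obtains y z where "y \<in> tp M j (i - 1)" "z \<in> tp M (Suc j) i" "x = mdiff M (i - 1) y \<oplus>\<^bsub>mgr M i\<^esub> z"
  using assms unfolding Bd_def by blast

lemma d_carrier: "isM M \<Longrightarrow> y \<in> carrier (mgr M (i - 1)) \<Longrightarrow> mdiff M (i - 1) y \<in> carrier (mgr M i)"
  using M_closed(2)[of M y "i - 1"] by simp

lemma Bd_carrier [simp]: "x \<in> Bd M j i \<Longrightarrow> isM M \<Longrightarrow> x \<in> carrier (mgr M i)"
  by (auto elim!: BdE intro!: ab_closed d_carrier)

lemma Bd_tp: "isM M \<Longrightarrow> x \<in> tp M (Suc j) i \<Longrightarrow> x \<in> Bd M j i"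
  by (rule BdI[of x M i "\<zero>\<^bsub>mgr M (i - 1)\<^esub>" x]) (use M_zero(3)[of M "i - 1"] in \<open>auto intro: tp_zero\<close>)

lemma Bd_d: "isM M \<Longrightarrow> y \<in> tp M j (i - 1) \<Longrightarrow> mdiff M (i - 1) y \<in> Bd M j i"
  by (rule BdI[of _ M i y "\<zero>\<^bsub>mgr M i\<^esub>"]) (auto intro: tp_zero simp: d_carrier tp_carrier)

lemma Bd_add:
  assumes M: "isM M" and "x \<in> Bd M j i" "x' \<in> Bd M j i"
  shows "x \<oplus>\<^bsub>mgr M i\<^esub> x' \<in> Bd M j i"
proof -
  obtain y z where 1: "y \<in> tp M j (i - 1)" "z \<in> tp M (Suc j) i" "x = mdiff M (i - 1) y \<oplus>\<^bsub>mgr M i\<^esub> z"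
    using assms(2) by (rule BdE)
  obtain y' z' where 2: "y' \<in> tp M j (i - 1)" "z' \<in> tp M (Suc j) i" "x' = mdiff M (i - 1) y' \<oplus>\<^bsub>mgr M i\<^esub> z'"
    using assms(3) by (rule BdE)
  note c = tp_carrier[OF 1(1) M] tp_carrier[OF 1(2) M] tp_carrier[OF 2(1) M] tp_carrier[OF 2(2) M]
  show ?thesis
    by (rule BdI[of _ M i "y \<oplus>\<^bsub>mgr M (i - 1)\<^esub> y'" "z \<oplus>\<^bsub>mgr M i\<^esub> z'"])
       (use 1 2 c M M_add(3)[OF M c(1,3)] tp_add[OF M 1(1) 2(1)] tp_add[OF M 1(2) 2(2)] in \<open>simp_all add: ab_ac d_carrier\<close>)
qed

lemma Bd_neg:
  assumes M: "isM M" and "x \<in> Bd M j i"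
  shows "\<ominus>\<^bsub>mgr M i\<^esub> x \<in> Bd M j i"
proof -
  obtain y z where 1: "y \<in> tp M j (i - 1)" "z \<in> tp M (Suc j) i" "x = mdiff M (i - 1) y \<oplus>\<^bsub>mgr M i\<^esub> z"
    using assms(2) by (rule BdE)
  note c = tp_carrier[OF 1(1) M] tp_carrier[OF 1(2) M]
  show ?thesis
    by (rule BdI[of _ M i "\<ominus>\<^bsub>mgr M (i - 1)\<^esub> y" "\<ominus>\<^bsub>mgr M i\<^esub> z"])
       (use 1 c M M_neg(3)[OF M c(1)] tp_neg[OF M M 1(1)] tp_neg[OF M M 1(2)] in \<open>simp_all add: ab_ac(2) d_carrier\<close>)
qed

lemma Bd_minus: "isM M \<Longrightarrow> x \<in> Bd M j i \<Longrightarrow> x' \<in> Bd M j i \<Longrightarrow> x \<ominus>\<^bsub>mgr M i\<^esub> x' \<in> Bd M j i"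
  unfolding a_minus_def by (rule Bd_add; (rule Bd_neg)?; assumption)

lemma Bd_cancel:
  assumes M: "isM M" and x: "x \<in> carrier (mgr M i)" and y: "y \<in> Bd M j i" and xy: "x \<ominus>\<^bsub>mgr M i\<^esub> y \<in> Bd M j i"
  shows "x \<in> Bd M j i"
proof -
  have "x = (x \<ominus>\<^bsub>mgr M i\<^esub> y) \<oplus>\<^bsub>mgr M i\<^esub> y" using x Bd_carrier[OF y M] M by (simp add: ab_ac)
  then show ?thesis using Bd_add[OF M xy y] by simp
qed

lemma Zc_minus:
  assumes M: "isM M" and x: "x \<in> Zc M j i" "y \<in> Zc M j i"
  shows "x \<ominus>\<^bsub>mgr M i\<^esub> y \<in> Zc M j i"
proof (rule ZcI)
  show "x \<ominus>\<^bsub>mgr M i\<^esub> y \<in> tp M j i" by (rule tp_minus[OF M M ZcD(1)[OF x(1)] ZcD(1)[OF x(2)]])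
  have "mdiff M i (x \<ominus>\<^bsub>mgr M i\<^esub> y) = mdiff M i x \<ominus>\<^bsub>mgr M (i + 1)\<^esub> mdiff M i y"
    using x M by (simp add: a_minus_def)
  then show "mdiff M i (x \<ominus>\<^bsub>mgr M i\<^esub> y) \<in> tp M (Suc j) (i + 1)" using tp_minus[OF M M ZcD(2)[OF x(1)] ZcD(2)[OF x(2)]] by simp
qed

lemma Zc_closed0:
  assumes "f \<in> closed0 A M N" "isM M" "isM N" "x \<in> Zc M j i" shows "f i x \<in> Zc N j i"
proof (rule ZcI)
  show "f i x \<in> tp N j i" using tp_closed0[OF assms(1-3) ZcD(1)[OF assms(4)]] .
  show "mdiff N i (f i x) \<in> tp N (Suc j) (i + 1)"
    using tp_closed0[OF assms(1-3) ZcD(2)[OF assms(4)]] closed0_diff[OF assms(1) Zc_carrier[OF assms(4,2)] assms(2,3)] by simp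
qed

lemma Bd_closed0:
  assumes f: "f \<in> closed0 A M N" and M: "isM M" "isM N" and x: "x \<in> Bd M j i" shows "f i x \<in> Bd N j i"
proof -
  obtain y z where 1: "y \<in> tp M j (i - 1)" "z \<in> tp M (Suc j) i" "x = mdiff M (i - 1) y \<oplus>\<^bsub>mgr M i\<^esub> z"
    using x by (rule BdE)
  note c = tp_carrier[OF 1(1) M(1)] tp_carrier[OF 1(2) M(1)]
  show ?thesis
    by (rule BdI[of _ N i "f (i - 1) y" "f i z"])
       (use 1 c M f closed0_diff[OF f c(1) M] tp_closed0[OF f M 1(1)] tp_closed0[OF f M 1(2)] in \<open>simp_all add: d_carrier\<close>)
qed

lemma qisI:
  assumes "\<And>i x. x \<in> Zc M j i \<Longrightarrow> f i x \<in> Bd N j i \<Longrightarrow> x \<in> Bd M j i"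
    "\<And>i y. y \<in> Zc N j i \<Longrightarrow> \<exists>x\<in>Zc M j i. y \<ominus>\<^bsub>mgr N i\<^esub> f i x \<in> Bd N j i"
  shows "qis j M N f"
  using assms unfolding qis_def by blast

lemma qisD:
  assumes "qis j M N f"
  shows "x \<in> Zc M j i \<Longrightarrow> f i x \<in> Bd N j i \<Longrightarrow> x \<in> Bd M j i"
    "y \<in> Zc N j i \<Longrightarrow> \<exists>x\<in>Zc M j i. y \<ominus>\<^bsub>mgr N i\<^esub> f i x \<in> Bd N j i"
  using assms unfolding qis_def by blast+

lemma qis_comp:
  assumes M: "isM L" "isM M" "isM N" and f: "f \<in> closed0 A L M" and g: "g \<in> closed0 A M N"
    and qf: "qis j L M f" and qg: "qis j M N g"
  shows "qis j L N (\<lambda>i x. g i (f i x))"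
proof (rule qisI)
  fix i x assume x: "x \<in> Zc L j i" "g i (f i x) \<in> Bd N j i"
  then show "x \<in> Bd L j i" using qisD(1)[OF qf] qisD(1)[OF qg] Zc_closed0[OF f M(1,2)] by blast
next
  fix i y assume y: "y \<in> Zc N j i"
  obtain x where x: "x \<in> Zc M j i" "y \<ominus>\<^bsub>mgr N i\<^esub> g i x \<in> Bd N j i" using qisD(2)[OF qg y] by blast
  obtain w where w: "w \<in> Zc L j i" "x \<ominus>\<^bsub>mgr M i\<^esub> f i w \<in> Bd M j i" using qisD(2)[OF qf x(1)] by blast
  have c: "f i w \<in> carrier (mgr M i)" using f w M by simp
  have "g i x \<ominus>\<^bsub>mgr N i\<^esub> g i (f i w) \<in> Bd N j i"
    using Bd_closed0[OF g M(2,3) w(2)] closed0_zero(3)[OF g M(2,3) Zc_carrier[OF x(1) M(2)] c] by simp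
  moreover have "y \<ominus>\<^bsub>mgr N i\<^esub> g i (f i w) = (y \<ominus>\<^bsub>mgr N i\<^esub> g i x) \<oplus>\<^bsub>mgr N i\<^esub> (g i x \<ominus>\<^bsub>mgr N i\<^esub> g i (f i w))"
    using x y c g M by (simp add: ab_ac)
  ultimately have "y \<ominus>\<^bsub>mgr N i\<^esub> g i (f i w) \<in> Bd N j i"
    using Bd_add[OF M(3) x(2), of "g i x \<ominus>\<^bsub>mgr N i\<^esub> g i (f i w)"] by simp
  then show "\<exists>x\<in>Zc L j i. y \<ominus>\<^bsub>mgr N i\<^esub> g i (f i x) \<in> Bd N j i" using w(1) by blast
qed

text \<open>The half of two-out-of-three that \<open>W_cancel\<close> asks for; injectivity of
  \<open>g\<close> in cohomology pulls the relation back from \<open>N\<close> to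
  \<open>M\<close>.\<close>

lemma qis_cancel:
  assumes M: "isM L" "isM M" "isM N" and f: "f \<in> closed0 A L M" and g: "g \<in> closed0 A M N"
    and qgf: "qis j L N (\<lambda>i x. g i (f i x))" and qg: "qis j M N g"
  shows "qis j L M f"
proof (rule qisI)
  fix i x assume x: "x \<in> Zc L j i" "f i x \<in> Bd M j i"
  then show "x \<in> Bd L j i" using qisD(1)[OF qgf] Bd_closed0[OF g M(2,3)] by blast
next
  fix i y assume y: "y \<in> Zc M j i"
  obtain w where w: "w \<in> Zc L j i" "g i y \<ominus>\<^bsub>mgr N i\<^esub> g i (f i w) \<in> Bd N j i"
    using qisD(2)[OF qgf Zc_closed0[OF g M(2,3) y]] by blast
  have "g i (y \<ominus>\<^bsub>mgr M i\<^esub> f i w) \<in> Bd N j i" using w y f g M by simp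
  then have "y \<ominus>\<^bsub>mgr M i\<^esub> f i w \<in> Bd M j i"
    using qisD(1)[OF qg] Zc_minus[OF M(2) y Zc_closed0[OF f M(1,2) w(1)]] by blast
  then show "\<exists>x\<in>Zc L j i. y \<ominus>\<^bsub>mgr M i\<^esub> f i x \<in> Bd M j i" using w by blast
qed

text \<open>On a cycle of the graded piece the term h d falls into the next filtration step, so what
  remains of d h + h d is a boundary.\<close>

lemma bd_Bd:
  assumes M: "isM M" "isM N" and h: "h \<in> ghom A (- 1) M N" and x: "x \<in> Zc M j i"
  shows "bd M N h i x \<in> Bd N j i"
  unfolding bd_def
  by (rule BdI[OF refl tp_h[OF h M ZcD(1)[OF x]]]) (use tp_h[OF h M ZcD(2)[OF x]] in simp)

lemma htpy_Bd:
  assumes M: "isM M" "isM N" and fg: "(f, g) \<in> htpy_rel A M N" and x: "x \<in> Zc M j i"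
  shows "g i x \<ominus>\<^bsub>mgr N i\<^esub> f i x \<in> Bd N j i"
proof -
  obtain h where h: "f \<in> closed0 A M N" "g \<in> closed0 A M N" "h \<in> ghom A (- 1) M N"
    "\<And>i m. m \<in> carrier (mgr M i) \<Longrightarrow> g i m = f i m \<oplus>\<^bsub>mgr N i\<^esub> bd M N h i m" using fg M by (rule htpyE) auto
  have "g i x \<ominus>\<^bsub>mgr N i\<^esub> f i x = bd M N h i x" using h x M by (simp add: ab_ac)
  then show ?thesis using bd_Bd[OF M h(3) x] by simp
qed

lemma qis_htpy:
  assumes M: "isM M" "isM N" and fg: "(f, g) \<in> htpy_rel A M N" and q: "qis j M N f"
  shows "qis j M N g"
proof -
  have h: "f \<in> closed0 A M N" "g \<in> closed0 A M N" using fg unfolding htpy_rel_def by auto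
  show ?thesis
  proof (rule qisI)
    fix i x assume x: "x \<in> Zc M j i" "g i x \<in> Bd N j i"
    have "f i x = g i x \<ominus>\<^bsub>mgr N i\<^esub> (g i x \<ominus>\<^bsub>mgr N i\<^esub> f i x)" using h x M by (simp add: ab_ac)
    then have "f i x \<in> Bd N j i" using Bd_minus[OF M(2) x(2) htpy_Bd[OF M fg x(1)]] by simp
    then show "x \<in> Bd M j i" using qisD(1)[OF q x(1)] by simp
  next
    fix i y assume y: "y \<in> Zc N j i"
    obtain x where x: "x \<in> Zc M j i" "y \<ominus>\<^bsub>mgr N i\<^esub> f i x \<in> Bd N j i" using qisD(2)[OF q y] by blast
    have "y \<ominus>\<^bsub>mgr N i\<^esub> g i x = (y \<ominus>\<^bsub>mgr N i\<^esub> f i x) \<ominus>\<^bsub>mgr N i\<^esub> (g i x \<ominus>\<^bsub>mgr N i\<^esub> f i x)"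
      using h x y M by (simp add: ab_ac)
    then have "y \<ominus>\<^bsub>mgr N i\<^esub> g i x \<in> Bd N j i"
      using Bd_minus[OF M(2) x(2) htpy_Bd[OF M fg x(1)]] by simp
    then show "\<exists>x\<in>Zc M j i. y \<ominus>\<^bsub>mgr N i\<^esub> g i x \<in> Bd N j i" using x(1) by blast
  qed
qed

lemma qis_iso:
  assumes M: "isM M" "isM N" and f: "f \<in> closed0 A M N" and g: "g \<in> closed0 A N M"
    and gf: "(\<lambda>i x. g i (f i x), \<lambda>i x. x) \<in> htpy_rel A M M" and fg: "(\<lambda>i x. f i (g i x), \<lambda>i x. x) \<in> htpy_rel A N N"
  shows "qis j M N f"
proof (rule qisI)
  fix i x assume x: "x \<in> Zc M j i" "f i x \<in> Bd N j i"
  show "x \<in> Bd M j i"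
    using Bd_cancel[OF M(1) Zc_carrier[OF x(1) M(1)] Bd_closed0[OF g M(2,1) x(2)]] htpy_Bd[OF M(1,1) gf x(1)] by simp
next
  fix i y assume y: "y \<in> Zc N j i"
  then show "\<exists>x\<in>Zc M j i. y \<ominus>\<^bsub>mgr N i\<^esub> f i x \<in> Bd N j i"
    using Zc_closed0[OF g M(2,1) y] htpy_Bd[OF M(2,2) fg y] by blast
qed

lemma qis_strict_iso:
  assumes M: "isM M" "isM N" and f: "f \<in> closed0 A M N" and g: "g \<in> closed0 A N M"
    and gf: "\<And>i x. x \<in> carrier (mgr M i) \<Longrightarrow> g i (f i x) = x"
    and fg: "\<And>i x. x \<in> carrier (mgr N i) \<Longrightarrow> f i (g i x) = x"
  shows "qis j M N f"
  by (rule qis_iso[OF M f g]; rule htpy_cong) (use assms in auto)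

lemma acycD: "acyc j M \<Longrightarrow> x \<in> Zc M j i \<Longrightarrow> x \<in> Bd M j i"
  unfolding acyc_def by blast

text \<open>On the \<open>j\<close>-th graded piece the composite is surjective in cohomology and
  passes through zero. This is the form in which isomorphisms of the quotient category, known only
  through roofs, transport acyclicity.\<close>

lemma acyc_through:
  assumes M: "isM L" "isM M" "isM N" and f: "f \<in> closed0 A L M" and g: "g \<in> closed0 A M N"
    and q: "qis j L N (\<lambda>i x. g i (f i x))" and ac: "acyc j M"
  shows "acyc j N"
  unfolding acyc_def
proof (intro allI subsetI)
  fix i y assume y: "y \<in> Zc N j i"
  obtain x where x: "x \<in> Zc L j i" "y \<ominus>\<^bsub>mgr N i\<^esub> g i (f i x) \<in> Bd N j i" using qisD(2)[OF q y] by blast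
  have "f i x \<in> Bd M j i" using acycD[OF ac Zc_closed0[OF f M(1,2) x(1)]] .
  then show "y \<in> Bd N j i" using Bd_cancel[OF M(3) Zc_carrier[OF y M(3)] Bd_closed0[OF g M(2,3)] x(2)] by simp
qed

lemma acyc_qis:
  assumes M: "isM M" "isM N" and f: "f \<in> closed0 A M N" and q: "qis j M N f"
  shows "acyc j M \<longleftrightarrow> acyc j N"
proof
  assume "acyc j M" then show "acyc j N"
    using acyc_through[OF M(1,1,2) closed0_id[OF M(1)] f] q by simp
next
  assume ac: "acyc j N" then show "acyc j M"
    unfolding acyc_def using qisD(1)[OF q] Zc_closed0[OF f M] acycD by blast
qed

text \<open>A kernel inside \<open>tp M (Suc j)\<close> is invisible in the \<open>j\<close>-th
  graded piece. Surjectivity of \<open>\<pi>\<close> carries each filtration step onto the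
  corresponding one, because the steps are images of multiplication.\<close>

lemma qis_surj:
  assumes M: "isM M" "isM Q" and \<pi>: "surj_map M Q \<pi>"
    and ker: "\<And>i x. x \<in> carrier (mgr M i) \<Longrightarrow> \<pi> i x = \<zero>\<^bsub>mgr Q i\<^esub> \<Longrightarrow> x \<in> tp M (Suc j) i"
  shows "qis j M Q \<pi>"
proof -
  note f = surj_mapD[OF \<pi>]
  have tpQ: "\<exists>x\<in>tp M l i. y = \<pi> i x" if yt: "y \<in> tp Q l i" for y l i
  proof -
    obtain m where m: "m \<in> carrier (mgr Q i)" "y = T l Q i m" using yt by (rule tpE)
    obtain m' where m': "m' \<in> carrier (mgr M i)" "m = \<pi> i m'" by (rule surj_mapE[OF \<pi> m(1)])
    have "y = \<pi> i (T l M i m')" using T_ghom[OF closed0_ghom[OF f] m'(1) M(2), of l] m m' by simp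
    then show ?thesis using m' tpI by metis
  qed
  \<comment> \<open>The kernel lies in \<open>tp M (Suc j)\<close>, so this step of the filtration
    is the full preimage of its counterpart in \<open>Q\<close>.\<close>
  have lift: "x \<in> tp M (Suc j) i" if xt: "x \<in> carrier (mgr M i)" "\<pi> i x \<in> tp Q (Suc j) i" for x i
  proof -
    obtain z where z: "z \<in> tp M (Suc j) i" "\<pi> i x = \<pi> i z" using tpQ[OF xt(2)] by blast
    note zc = tp_carrier[OF z(1) M(1)]
    have "x \<ominus>\<^bsub>mgr M i\<^esub> z \<in> tp M (Suc j) i" by (rule ker) (use xt z zc f M in simp_all)
    moreover have "x = (x \<ominus>\<^bsub>mgr M i\<^esub> z) \<oplus>\<^bsub>mgr M i\<^esub> z" using xt zc M by (simp add: ab_ac)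
    ultimately show ?thesis using tp_add[OF M(1) _ z(1)] by metis
  qed
  show ?thesis
  proof (rule qisI)
    fix i x assume x: "x \<in> Zc M j i" "\<pi> i x \<in> Bd Q j i"
    note xc = Zc_carrier[OF x(1) M(1)]
    obtain y z where 1: "y \<in> tp Q j (i - 1)" "z \<in> tp Q (Suc j) i" "\<pi> i x = mdiff Q (i - 1) y \<oplus>\<^bsub>mgr Q i\<^esub> z"
      using x(2) by (rule BdE)
    obtain y' where y': "y' \<in> tp M j (i - 1)" "y = \<pi> (i - 1) y'" using tpQ[OF 1(1)] by blast
    note yc = tp_carrier[OF y'(1) M(1)] and zc = tp_carrier[OF 1(2) M(2)]
    have dc: "mdiff M (i - 1) y' \<in> carrier (mgr M i)" using d_carrier[OF M(1) yc] .
    have "\<pi> i (x \<ominus>\<^bsub>mgr M i\<^esub> mdiff M (i - 1) y') = z"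
      using closed0_diff[OF f yc M] xc dc f M 1(3) y'(2) zc closed0_closed[OF f dc] by (simp add: ab_ac)
    then have "x \<ominus>\<^bsub>mgr M i\<^esub> mdiff M (i - 1) y' \<in> tp M (Suc j) i"
      using lift[of "x \<ominus>\<^bsub>mgr M i\<^esub> mdiff M (i - 1) y'" i] 1(2) xc dc M by simp
    then show "x \<in> Bd M j i" using Bd_cancel[OF M(1) xc Bd_d[OF M(1) y'(1)] Bd_tp[OF M(1)]] by simp
  next
    fix i y assume y: "y \<in> Zc Q j i"
    obtain x where x: "x \<in> tp M j i" "y = \<pi> i x" using tpQ[OF ZcD(1)[OF y]] by blast
    note xc = tp_carrier[OF x(1) M(1)]
    have "mdiff M i x \<in> tp M (Suc j) (i + 1)"
      using lift[of "mdiff M i x" "i + 1"] ZcD(2)[OF y] closed0_diff[OF f xc M] x xc M by simp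
    then have "x \<in> Zc M j i" using x by (auto intro: ZcI)
    moreover have "y \<ominus>\<^bsub>mgr Q i\<^esub> \<pi> i x \<in> Bd Q j i"
      using x closed0_closed[OF f xc] M Bd_tp[OF M(2) tp_zero[OF M(2)]] by simp
    ultimately show "\<exists>x\<in>Zc M j i. y \<ominus>\<^bsub>mgr Q i\<^esub> \<pi> i x \<in> Bd Q j i" by blast
  qed
qed

lemma acyc_if_tp_zero:
  assumes M: "isM M" and z: "\<And>i x. x \<in> carrier (mgr M i) \<Longrightarrow> T j M i x = \<zero>\<^bsub>mgr M i\<^esub>"
  shows "acyc j M"
proof -
  have "Zc M j i \<subseteq> {\<zero>\<^bsub>mgr M i\<^esub>}" for i using z by (auto dest!: ZcD(1) elim: tpE)
  then show ?thesis unfolding acyc_def using Bd_tp[OF M tp_zero[OF M]] by blast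
qed

section \<open>Graded pieces of shifts and cones\<close>

lemma T_shp [simp]: "T j (shp p M) i x = T j M (i + p) x"
  by (simp add: T_def)

lemma tp_shp [simp]: "tp (shp p M) j i = tp M j (i + p)"
  by (simp add: tp_def)

lemma Zc_shp:
  assumes M: "isM M"
  shows "Zc (shp p M) j i = Zc M j (i + p)"
proof -
    have "\<ominus>\<^bsub>mgr M (i + p + 1)\<^esub> mdiff M (i + p) x \<in> tp M (Suc j) (i + 1 + p) \<longleftrightarrow> mdiff M (i + p) x \<in> tp M (Suc j) (i + p + 1)"
      if "x \<in> tp M j (i + p)" for x
      using tp_neg_iff[OF M M_closed(2)[OF M tp_carrier[OF that M]]] by (simp add: add.assoc add.commute[of 1 p])
    then show ?thesis by (auto simp: Zc_def)
qed

lemma Bd_shp: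
  assumes M: "isM M"
  shows "Bd (shp p M) j i = Bd M j (i + p)"
proof -
    have e: "i - 1 + p = i + p - 1" "i - 1 + p + 1 = i + p" by simp_all
    have 1: "\<ominus>\<^bsub>mgr M (i + p)\<^esub> mdiff M (i + p - 1) y = mdiff M (i + p - 1) (\<ominus>\<^bsub>mgr M (i + p - 1)\<^esub> y)"
      if "y \<in> carrier (mgr M (i + p - 1))" for y
      using M_neg(3)[OF M that] by simp
    have "x \<in> Bd (shp p M) j i" if xt: "x \<in> Bd M j (i + p)" for x
    proof -
      obtain y z where h: "y \<in> tp M j (i + p - 1)" "z \<in> tp M (Suc j) (i + p)" "x = mdiff M (i + p - 1) y \<oplus>\<^bsub>mgr M (i + p)\<^esub> z"
        using xt by (rule BdE)
      then show ?thesis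
        by (intro BdI[of _ _ _ "\<ominus>\<^bsub>mgr M (i + p - 1)\<^esub> y" z])
           (use M tp_neg[OF M M h(1)] 1[of "\<ominus>\<^bsub>mgr M (i + p - 1)\<^esub> y"] tp_carrier[OF h(1) M] in \<open>simp_all add: e\<close>)
    qed
    moreover have "x \<in> Bd M j (i + p)" if xt: "x \<in> Bd (shp p M) j i" for x
    proof -
      obtain y z where h: "y \<in> tp M j (i + p - 1)" "z \<in> tp M (Suc j) (i + p)"
        "x = \<ominus>\<^bsub>mgr M (i + p)\<^esub> mdiff M (i + p - 1) y \<oplus>\<^bsub>mgr M (i + p)\<^esub> z"
        using xt by (rule BdE) (simp add: e)
      then show ?thesis
        by (intro BdI[of _ _ _ "\<ominus>\<^bsub>mgr M (i + p - 1)\<^esub> y" z])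
           (use tp_neg[OF M M h(1)] 1[of y] tp_carrier[OF h(1) M] in simp_all)
    qed
    ultimately show ?thesis by blast
qed

lemma acyc_shp: "isM M \<Longrightarrow> acyc j (shp p M) \<longleftrightarrow> acyc j M"
  unfolding acyc_def Zc_shp Bd_shp by (metis add.commute diff_add_cancel)

lemma qis_shp:
  assumes "isM M" "isM N" "qis j M N f"
  shows "qis j (shp p M) (shp p N) (\<lambda>i. f (i + p))"
  using assms unfolding qis_def by (simp add: Zc_shp Bd_shp)

lemma T_cone [simp]: "T j (cone_mod M N f) i (y, x) = (T j N i y, T j M (i + 1) x)"
  by (simp add: T_def)

lemma tp_cone: "(y, x) \<in> tp (cone_mod M N f) j i \<longleftrightarrow> y \<in> tp N j i \<and> x \<in> tp M j (i + 1)"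
  by (force simp: tp_def image_def)

text \<open>Multiplication by \<open>tau\<close> acts componentwise on the cone, so a graded piece
  of the cone is the cone of the graded pieces. The rest is the long exact sequence, carried out on
  elements that are cycles only up to the next filtration step.\<close>

lemma acyc_cone:
  assumes M: "isM M" "isM N" and f: "f \<in> closed0 A M N"
  shows "acyc j (cone_mod M N f) \<longleftrightarrow> qis j M N f"
proof -
  let ?C = "cone_mod M N f"
  have Z: "(y, x) \<in> Zc ?C j i \<longleftrightarrow> y \<in> tp N j i \<and> x \<in> Zc M j (i + 1) \<and> mdiff N i y \<oplus>\<^bsub>mgr N (i + 1)\<^esub> f (i + 1) x \<in> tp N (Suc j) (i + 1)"
    for y x i
  proof -
    have "\<ominus>\<^bsub>mgr M (i + 2)\<^esub> mdiff M (i + 1) x \<in> tp M (Suc j) (i + 2) \<longleftrightarrow> mdiff M (i + 1) x \<in> tp M (Suc j) (i + 2)"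
      if "x \<in> tp M j (i + 1)"
      using tp_neg_iff[OF M(1) M_closed(2)[OF M(1) tp_carrier[OF that M(1)]]] by simp
    then show ?thesis by (auto simp: Zc_def tp_cone)
  qed
  have BI: "(y, x) \<in> Bd ?C j i"
    if "y0 \<in> tp N j (i - 1)" "x0 \<in> tp M j i" "u \<in> tp N (Suc j) i" "v \<in> tp M (Suc j) (i + 1)"
      "y = mdiff N (i - 1) y0 \<oplus>\<^bsub>mgr N i\<^esub> f i x0 \<oplus>\<^bsub>mgr N i\<^esub> u" "x = \<ominus>\<^bsub>mgr M (i + 1)\<^esub> mdiff M i x0 \<oplus>\<^bsub>mgr M (i + 1)\<^esub> v"
    for y x y0 x0 u v i
    by (rule BdI[of _ _ _ "(y0, x0)" "(u, v)"]) (use that in \<open>simp_all add: tp_cone\<close>)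
  have BE: "\<exists>y0 x0 u v. y0 \<in> tp N j (i - 1) \<and> x0 \<in> tp M j i \<and> u \<in> tp N (Suc j) i \<and> v \<in> tp M (Suc j) (i + 1) \<and>
      y = mdiff N (i - 1) y0 \<oplus>\<^bsub>mgr N i\<^esub> f i x0 \<oplus>\<^bsub>mgr N i\<^esub> u \<and> x = \<ominus>\<^bsub>mgr M (i + 1)\<^esub> mdiff M i x0 \<oplus>\<^bsub>mgr M (i + 1)\<^esub> v"
    if yx: "(y, x) \<in> Bd ?C j i" for y x i
  proof -
    obtain p q where 1: "p \<in> tp ?C j (i - 1)" "q \<in> tp ?C (Suc j) i" "(y, x) = mdiff ?C (i - 1) p \<oplus>\<^bsub>mgr ?C i\<^esub> q"
      using yx by (rule BdE)
    obtain y0 x0 u v where "p = (y0, x0)" "q = (u, v)" by (metis surj_pair)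
    then show ?thesis using 1 by (auto simp: tp_cone)
  qed
  show ?thesis
  proof
    assume ac: "acyc j ?C"
    show "qis j M N f"
    proof (rule qisI)
      fix i x assume x: "x \<in> Zc M j i" "f i x \<in> Bd N j i"
      obtain y z where 1: "y \<in> tp N j (i - 1)" "z \<in> tp N (Suc j) i" "f i x = mdiff N (i - 1) y \<oplus>\<^bsub>mgr N i\<^esub> z"
        using x(2) by (rule BdE)
      note c = tp_carrier[OF 1(1) M(2)] tp_carrier[OF 1(2) M(2)]
      \<comment> \<open>A relation f x = d y + z makes (-y, x) a cycle of the cone; one component of
        a primitive of it bounds \<open>x\<close>.\<close>
      have "(\<ominus>\<^bsub>mgr N (i - 1)\<^esub> y, x) \<in> Zc ?C j (i - 1)"
        using 1 c x(1) M M_neg(3)[OF M(2) c(1)] d_carrier[OF M(2) c(1)] tp_neg[OF M(2,2) 1(1)] unfolding Z by simp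
      from BE[OF acycD[OF ac this]]
      obtain x0 v where h: "x0 \<in> tp M j (i - 1)" "v \<in> tp M (Suc j) i" "x = \<ominus>\<^bsub>mgr M i\<^esub> mdiff M (i - 1) x0 \<oplus>\<^bsub>mgr M i\<^esub> v" by auto
      then show "x \<in> Bd M j i"
        using M_neg(3)[OF M(1) tp_carrier[OF h(1) M(1)]] tp_neg[OF M(1,1) h(1)] by (intro BdI[of x M i "\<ominus>\<^bsub>mgr M (i - 1)\<^esub> x0" v]) simp_all
    next
      fix i y assume y: "y \<in> Zc N j i"
      note yc = Zc_carrier[OF y M(2)]
      \<comment> \<open>A cycle \<open>y\<close> of \<open>N\<close> gives the cycle (y, 0). Its
        primitive contains the element \<open>x0\<close> whose image represents the class of
        \<open>y\<close>.\<close>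
      have "(y, \<zero>\<^bsub>mgr M (i + 1)\<^esub>) \<in> Zc ?C j i"
        unfolding Z using ZcD[OF y] M f yc tp_zero[OF M(1)] M_zero(3)[OF M(1), of "i + 1"] by (auto intro!: ZcI)
      from BE[OF acycD[OF ac this]]
      obtain y0 x0 u v where h: "y0 \<in> tp N j (i - 1)" "x0 \<in> tp M j i" "u \<in> tp N (Suc j) i" "v \<in> tp M (Suc j) (i + 1)"
        "y = mdiff N (i - 1) y0 \<oplus>\<^bsub>mgr N i\<^esub> f i x0 \<oplus>\<^bsub>mgr N i\<^esub> u" "\<zero>\<^bsub>mgr M (i + 1)\<^esub> = \<ominus>\<^bsub>mgr M (i + 1)\<^esub> mdiff M i x0 \<oplus>\<^bsub>mgr M (i + 1)\<^esub> v"
        by blast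
      note c = tp_carrier[OF h(1) M(2)] tp_carrier[OF h(2) M(1)] tp_carrier[OF h(3) M(2)] tp_carrier[OF h(4) M(1)]
      have dc: "mdiff M i x0 \<in> carrier (mgr M (i + 1))" using c M by simp
      have "mdiff M i x0 = mdiff M i x0 \<oplus>\<^bsub>mgr M (i + 1)\<^esub> (\<ominus>\<^bsub>mgr M (i + 1)\<^esub> mdiff M i x0 \<oplus>\<^bsub>mgr M (i + 1)\<^esub> v)"
        unfolding h(6)[symmetric] using dc M by simp
      also have "\<dots> = v" using dc c M by simp
      finally have x0: "x0 \<in> Zc M j i" using h by (auto intro: ZcI)
      have "y \<ominus>\<^bsub>mgr N i\<^esub> f i x0 = mdiff N (i - 1) y0 \<oplus>\<^bsub>mgr N i\<^esub> u"
        using h(5) c f M d_carrier[OF M(2) c(1)] by (simp add: ab_ac)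
      then have "y \<ominus>\<^bsub>mgr N i\<^esub> f i x0 \<in> Bd N j i" using h by (auto intro: BdI)
      then show "\<exists>x\<in>Zc M j i. y \<ominus>\<^bsub>mgr N i\<^esub> f i x \<in> Bd N j i" using x0 by blast
    qed
  next
    assume q: "qis j M N f"
    have "(y, x) \<in> Bd ?C j i" if yx: "(y, x) \<in> Zc ?C j i" for y x i
    proof -
      from yx have y: "y \<in> tp N j i" and x: "x \<in> Zc M j (i + 1)"
        and w: "mdiff N i y \<oplus>\<^bsub>mgr N (i + 1)\<^esub> f (i + 1) x \<in> tp N (Suc j) (i + 1)" unfolding Z by auto
      note yc = tp_carrier[OF y M(2)] and xc = Zc_carrier[OF x M(1)]
      \<comment> \<open>Injectivity in cohomology bounds \<open>x\<close> by some \<open>x0\<close>.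
        Then y + f x0 is a cycle of \<open>N\<close>, which by surjectivity comes from some
        \<open>x2\<close>, and the difference x2 - x0 enters the primitive of (y, x).\<close>
      have "f (i + 1) x \<in> Bd N j (i + 1)"
        by (rule BdI[of _ N "i + 1" "\<ominus>\<^bsub>mgr N i\<^esub> y", OF _ _ w])
           (use yc xc M f tp_neg[OF M(2,2) y] in simp_all)
      then have "x \<in> Bd M j (i + 1)" using qisD(1)[OF q x] by simp
      then obtain x0 x1 where 1: "x0 \<in> tp M j i" "x1 \<in> tp M (Suc j) (i + 1)" "x = mdiff M i x0 \<oplus>\<^bsub>mgr M (i + 1)\<^esub> x1"
        by (auto elim!: BdE)
      note c = tp_carrier[OF 1(1) M(1)] tp_carrier[OF 1(2) M(1)]
      have fc: "f i x0 \<in> carrier (mgr N i)" "f (i + 1) x1 \<in> carrier (mgr N (i + 1))" "f (i + 1) x \<in> carrier (mgr N (i + 1))"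
        using c xc f by simp_all
      have "mdiff N i (y \<oplus>\<^bsub>mgr N i\<^esub> f i x0) = (mdiff N i y \<oplus>\<^bsub>mgr N (i + 1)\<^esub> f (i + 1) x) \<ominus>\<^bsub>mgr N (i + 1)\<^esub> f (i + 1) x1"
        using 1(3) c yc fc f M closed0_diff[OF f c(1) M] by (simp add: ab_ac)
      also have "\<dots> \<in> tp N (Suc j) (i + 1)" by (rule tp_minus[OF M(2,2) w tp_closed0[OF f M 1(2)]])
      finally have "y \<oplus>\<^bsub>mgr N i\<^esub> f i x0 \<in> Zc N j i"
        using tp_add[OF M(2) y tp_closed0[OF f M 1(1)]] by (auto intro: ZcI)
      then obtain x2 where x2: "x2 \<in> Zc M j i" "(y \<oplus>\<^bsub>mgr N i\<^esub> f i x0) \<ominus>\<^bsub>mgr N i\<^esub> f i x2 \<in> Bd N j i"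
        using qisD(2)[OF q] by blast
      obtain y1 u where 2: "y1 \<in> tp N j (i - 1)" "u \<in> tp N (Suc j) i"
        "(y \<oplus>\<^bsub>mgr N i\<^esub> f i x0) \<ominus>\<^bsub>mgr N i\<^esub> f i x2 = mdiff N (i - 1) y1 \<oplus>\<^bsub>mgr N i\<^esub> u" using x2(2) by (rule BdE)
      note c2 = tp_carrier[OF 2(1) M(2)] tp_carrier[OF 2(2) M(2)] Zc_carrier[OF x2(1) M(1)]
      have f2: "f i x2 \<in> carrier (mgr N i)" using c2 f by simp
      have dy: "mdiff N (i - 1) y1 \<in> carrier (mgr N i)" using d_carrier[OF M(2) c2(1)] .
      show ?thesis
      proof (rule BI[of y1 i "x2 \<ominus>\<^bsub>mgr M i\<^esub> x0" u "x1 \<oplus>\<^bsub>mgr M (i + 1)\<^esub> mdiff M i x2"])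
        show "x2 \<ominus>\<^bsub>mgr M i\<^esub> x0 \<in> tp M j i" by (rule tp_minus[OF M(1,1) ZcD(1)[OF x2(1)] 1(1)])
        show "x1 \<oplus>\<^bsub>mgr M (i + 1)\<^esub> mdiff M i x2 \<in> tp M (Suc j) (i + 1)" by (rule tp_add[OF M(1) 1(2) ZcD(2)[OF x2(1)]])
        have "y = ((y \<oplus>\<^bsub>mgr N i\<^esub> f i x0) \<ominus>\<^bsub>mgr N i\<^esub> f i x2) \<oplus>\<^bsub>mgr N i\<^esub> (f i x2 \<ominus>\<^bsub>mgr N i\<^esub> f i x0)"
          using yc fc f2 M by (simp add: ab_ac)
        also have "\<dots> = mdiff N (i - 1) y1 \<oplus>\<^bsub>mgr N i\<^esub> f i (x2 \<ominus>\<^bsub>mgr M i\<^esub> x0) \<oplus>\<^bsub>mgr N i\<^esub> u"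
          unfolding 2(3) using c c2 fc f2 dy f M by (simp add: ab_ac)
        finally show "y = mdiff N (i - 1) y1 \<oplus>\<^bsub>mgr N i\<^esub> f i (x2 \<ominus>\<^bsub>mgr M i\<^esub> x0) \<oplus>\<^bsub>mgr N i\<^esub> u" .
        show "x = \<ominus>\<^bsub>mgr M (i + 1)\<^esub> mdiff M i (x2 \<ominus>\<^bsub>mgr M i\<^esub> x0) \<oplus>\<^bsub>mgr M (i + 1)\<^esub> (x1 \<oplus>\<^bsub>mgr M (i + 1)\<^esub> mdiff M i x2)"
          unfolding 1(3) using c c2 M by (simp add: ab_ac)
      qed (use 2 in auto)
    qed
    then show "acyc j ?C" unfolding acyc_def by (auto simp: subset_iff)
  qed
qed

end

section \<open>Maps of cones, homotopy fibres and the shift functor\<close>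

context cdg_algebra
begin

lemma cone_neg:
  assumes "isM M" "isM N" "y \<in> carrier (mgr N i)" "x \<in> carrier (mgr M (i + 1))"
  shows "\<ominus>\<^bsub>mgr (cone_mod M N f) i\<^esub> (y, x) = (\<ominus>\<^bsub>mgr N i\<^esub> y, \<ominus>\<^bsub>mgr M (i + 1)\<^esub> x)"
  by (rule prod_abelian_group[of "mgr N i" "mgr M (i + 1)"]) (use assms in \<open>simp_all add: cone_mod_def\<close>)

lemma cone_gsgn:
  assumes "isM M" "isM N" "y \<in> carrier (mgr N i)" "x \<in> carrier (mgr M (i + 1))"
  shows "gsgn (mgr (cone_mod M N f) i) s (y, x) = (gsgn (mgr N i) s y, gsgn (mgr M (i + 1)) s x)"
  using cone_neg[OF assms] by (simp add: gsgn_def)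

lemma cone_in_map:
  assumes M: "isM M" "isM N" and f: "f \<in> closed0 A M N"
  shows "(\<lambda>i y. (y, \<zero>\<^bsub>mgr M (i + 1)\<^esub>)) \<in> closed0 A N (cone_mod M N f)"
proof (rule closed0I[OF M(2) cone_module[OF M f]], goal_cases)
  case (3 i j a m) then show ?case using M M_zero(2)[OF M(1) 3(1), of "j + 1"] by (simp add: add.assoc)
next
  case (4 i m) then show ?case using M f M_zero(3)[OF M(1), of "i + 1"] by simp
qed (use M in auto)

lemma cone_out_map:
  assumes M: "isM M" "isM N" and f: "f \<in> closed0 A M N"
  shows "(\<lambda>i. snd) \<in> closed0 A (cone_mod M N f) (shift_mod M)"
  by (rule closed0I[OF cone_module[OF M f] shift_module[OF M(1)]])
     (auto simp: shift_mod_shp)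

text \<open>The homotopy fibre of \<open>f : M \<rightarrow> N\<close>; its elements of degree \<open>i\<close> are pairs in \<open>N\<^sup>i\<^sup>-\<^sup>1 \<times> M\<^sup>i\<close>.\<close>

abbreviation fib where "fib M N f \<equiv> shp (- 1) (cone_mod M N f)"

lemma fib_module: "isM M \<Longrightarrow> isM N \<Longrightarrow> f \<in> closed0 A M N \<Longrightarrow> isM (fib M N f)"
  by (simp add: shp_module cone_module)

lemma fib_act:
  assumes M: "isM M" "isM N" and a: "a \<in> carrier (agr A i)" "y \<in> carrier (mgr N (j - 1))" "x \<in> carrier (mgr M j)"
  shows "mact (fib M N f) i j a (y, x) = (gsgn (mgr N (i + j - 1)) i (mact N i (j - 1) a y), mact M i j a x)"
proof -
  have c: "mact N i (j - 1) a y \<in> carrier (mgr N (i + j - 1))" "mact M i j a x \<in> carrier (mgr M (i + j))"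
    using M_closed(1)[OF M(2) a(1,2)] M_closed(1)[OF M(1) a(1,3)] by (simp_all add: add_diff_eq)
  have "mact (fib M N f) i j a (y, x) = gsgn (mgr (cone_mod M N f) (i + j - 1)) i
      (mact N i (j - 1) a y, gsgn (mgr M (i + j)) i (mact M i j a x))"
    by simp
  also have "\<dots> = (gsgn (mgr N (i + j - 1)) i (mact N i (j - 1) a y), gsgn (mgr M (i + j)) i (gsgn (mgr M (i + j)) i (mact M i j a x)))"
    using c M cone_gsgn[OF M, of "mact N i (j - 1) a y" "i + j - 1" "gsgn (mgr M (i + j)) i (mact M i j a x)" f i] by simp
  finally show ?thesis using c M by (simp add: gsgn_gsgn) (simp add: gsgn_def)
qed

lemma fib_diff:
  assumes M: "isM M" "isM N" and f: "f \<in> closed0 A M N" and a: "y \<in> carrier (mgr N (j - 1))" "x \<in> carrier (mgr M j)"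
  shows "mdiff (fib M N f) j (y, x) = (\<ominus>\<^bsub>mgr N j\<^esub> (mdiff N (j - 1) y \<oplus>\<^bsub>mgr N j\<^esub> f j x), mdiff M j x)"
proof -
  have "mdiff N (j - 1) y \<oplus>\<^bsub>mgr N j\<^esub> f j x \<in> carrier (mgr N j)"
    using M_closed(2)[OF M(2) a(1)] f a M by simp
  then show ?thesis
    using cone_neg[OF M, of _ j "\<ominus>\<^bsub>mgr M (j + 1)\<^esub> mdiff M j x" f] a M by simp
qed

lemma fib_out_map:
  assumes M: "isM M" "isM N" and f: "f \<in> closed0 A M N"
  shows "(\<lambda>i. snd) \<in> closed0 A (fib M N f) M"
proof (rule closed0I[OF fib_module[OF M f] M(1)], goal_cases)
  case (3 i j a m) then show ?case using fib_act[OF M 3(1)] by (auto simp del: shp_simps(2))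
next
  case (4 i m) then show ?case using fib_diff[OF M f] by (auto simp del: shp_simps(3))
qed auto

text \<open>The negative of the projection to the \<open>N\<close>-component is a null-homotopy,
  since the differential of the fibre contains -f in that component.\<close>

lemma fib_null:
  assumes M: "isM M" "isM N" and f: "f \<in> closed0 A M N"
  shows "(\<lambda>i m. \<zero>\<^bsub>mgr N i\<^esub>, \<lambda>i z. f i (snd z)) \<in> htpy_rel A (fib M N f) N"
proof -
  let ?P = "fib M N f"
  have P: "isM ?P" by (rule fib_module[OF M f])
  show ?thesis
  proof (rule htpyI[OF P M(2), where h = "\<lambda>i z. \<ominus>\<^bsub>mgr N (i - 1)\<^esub> fst z"], goal_cases)
    case 1 show ?case using P M by simp
  next
    case 2 show ?case using closed0_comp[OF fib_out_map[OF M f] f P M] .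
  next
    case 3 show ?case
    proof (rule ghomI, goal_cases)
      case (1 i m) then show ?case using M by auto
    next
      case (2 i m m') then show ?case using M by (auto simp: ab_ac(2))
    next
      case (3 i j a m)
      then obtain y x where m: "m = (y, x)" "y \<in> carrier (mgr N (j - 1))" "x \<in> carrier (mgr M j)" by auto
      have "mact N i (j - 1) a y \<in> carrier (mgr N (i + j - 1))" using M_closed(1)[OF M(2) 3(1) m(2)] by (simp add: add_diff_eq)
      then show ?case unfolding m(1) using fib_act[OF M 3(1) m(2,3), of f] M_neg(2)[OF M(2) 3(1) m(2)] M
        by (auto simp: gsgn_def add_diff_eq simp del: shp_simps(2))
    qed
  next
    case (4 i m)
    then obtain y x where m: "m = (y, x)" "y \<in> carrier (mgr N (i - 1))" "x \<in> carrier (mgr M i)" by auto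
    have c: "mdiff N (i - 1) y \<in> carrier (mgr N i)" "f i x \<in> carrier (mgr N i)"
      using M_closed(2)[OF M(2) m(2)] f m by simp_all
    show ?case unfolding m(1) bd_def using fib_diff[OF M f m(2,3)] M_neg(3)[OF M(2) m(2)] c M
      by (simp del: shp_simps(3))
  qed
qed

lemma shift_closed0:
  assumes M: "isM M" "isM N" and f: "f \<in> closed0 A M N"
  shows "(\<lambda>i. f (i + 1)) \<in> closed0 A (shift_mod M) (shift_mod N)"
proof (rule closed0I[OF shift_module[OF M(1)] shift_module[OF M(2)]], goal_cases)
  case (3 i j a m)
  then have m: "m \<in> carrier (mgr M (j + 1))" by (simp add: shift_mod_shp)
  have "f (i + j + 1) (gsgn (mgr M (i + j + 1)) i (mact M i (j + 1) a m))
     = gsgn (mgr N (i + j + 1)) i (f (i + j + 1) (mact M i (j + 1) a m))"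
    using M_closed(1)[OF M(1) 3(1) m] f M by (intro gsgn_map) (simp add: add.assoc)
  then show ?case using closed0_act[OF f 3(1) m] by (simp add: shift_mod_shp add.assoc)
next
  case (4 i m)
  then have m: "m \<in> carrier (mgr M (i + 1))" by (simp add: shift_mod_shp)
  then show ?case using closed0_diff[OF f m M] M_closed(2)[OF M(1) m] closed0_zero(2)[OF f M, of "mdiff M (i + 1) m" "i + 2"]
    by (simp add: shift_mod_shp)
qed (use f in \<open>simp_all add: shift_mod_shp\<close>)

text \<open>The shifted homotopy carries a minus sign because shifting negates the
  differentials.\<close>

lemma shift_htpy:
  assumes M: "isM M" "isM N" and fg: "(f, g) \<in> htpy_rel A M N"
  shows "(\<lambda>i. f (i + 1), \<lambda>i. g (i + 1)) \<in> htpy_rel A (shift_mod M) (shift_mod N)"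
proof -
  obtain h where h: "f \<in> closed0 A M N" "g \<in> closed0 A M N" "h \<in> ghom A (- 1) M N"
    "\<And>i m. m \<in> carrier (mgr M i) \<Longrightarrow> g i m = f i m \<oplus>\<^bsub>mgr N i\<^esub> bd M N h i m" using fg M by (rule htpyE) auto
  have hc: "h (i + 1) m \<in> carrier (mgr N i)" if "m \<in> carrier (mgr M (i + 1))" for i m
    using h_closed[OF h(3) that] by simp
  have hz: "h i (\<ominus>\<^bsub>mgr M i\<^esub> m) = \<ominus>\<^bsub>mgr N (i - 1)\<^esub> h i m" if "m \<in> carrier (mgr M i)" for i m
    using ghom_zero(2)[OF h(3) M that] by simp
  show ?thesis
  proof (rule htpyI[OF shift_module[OF M(1)] shift_module[OF M(2)] shift_closed0[OF M h(1)] shift_closed0[OF M h(2)],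
      where h = "\<lambda>i m. \<ominus>\<^bsub>mgr N i\<^esub> h (i + 1) m"], goal_cases)
    case 1 show ?case
    proof (rule ghomI, goal_cases)
      case (1 i m) then show ?case using hc M by (simp add: shift_mod_shp)
    next
      case (2 i m m') then show ?case using hc M h(3) by (simp add: shift_mod_shp ab_ac(2))
    next
      case (3 i j a m)
      then have m: "m \<in> carrier (mgr M (j + 1))" by (simp add: shift_mod_shp)
      have c: "mact M i (j + 1) a m \<in> carrier (mgr M (i + j + 1))" "mact N i j a (h (j + 1) m) \<in> carrier (mgr N (i + j))"
        using M_closed(1)[OF M(1) 3(1) m] M_closed(1)[OF M(2) 3(1) hc[OF m]] by (simp_all add: add.assoc)
      have e: "h (i + j + 1) (mact M i (j + 1) a m) = gsgn (mgr N (i + j)) i (mact N i j a (h (j + 1) m))"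
        using h_act[OF h(3) 3(1) m] by (simp add: add.assoc)
      show ?case using M e hz[OF c(1)] c M_neg(2)[OF M(2) 3(1) hc[OF m]]
        by (auto simp: shift_mod_shp gsgn_def)
    qed
  next
    case (2 i m)
    then have m: "m \<in> carrier (mgr M (i + 1))" by (simp add: shift_mod_shp)
    have c: "mdiff M (i + 1) m \<in> carrier (mgr M (i + 2))" "mdiff N i (h (i + 1) m) \<in> carrier (mgr N (i + 1))"
      "h (i + 2) (mdiff M (i + 1) m) \<in> carrier (mgr N (i + 1))"
      using m M M_closed(2)[OF M(1) m] hc[of "mdiff M (i + 1) m" "i + 1"] hc[OF m] by simp_all
    have "\<ominus>\<^bsub>mgr N (i + 1)\<^esub> h (i + 2) (\<ominus>\<^bsub>mgr M (i + 2)\<^esub> mdiff M (i + 1) m) = h (i + 2) (mdiff M (i + 1) m)"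
      using hz[OF c(1)] c M by simp
    moreover have "\<ominus>\<^bsub>mgr N (i + 1)\<^esub> mdiff N i (\<ominus>\<^bsub>mgr N i\<^esub> h (i + 1) m) = mdiff N i (h (i + 1) m)"
      using M_neg(3)[OF M(2) hc[OF m]] c M by simp
    ultimately show ?case using h(4)[OF m] by (simp add: bd_def shift_mod_shp)
  qed
qed

lemma Shm_hcls:
  assumes M: "isM M" "isM N" and f: "f \<in> closed0 A M N"
  shows "Shm (Hot R A) M N (hcls A M N f) = hcls A (shift_mod M) (shift_mod N) (\<lambda>i. f (i + 1))"
proof -
  have "Shm (Hot R A) M N (hcls A M N f) = (\<Union>g\<in>hcls A M N f. hcls A (shift_mod M) (shift_mod N) (\<lambda>i. g (i + 1)))"
    by (simp add: Hot_def Hot_shift_cat_def shift_cat.extend_def tri_cat.fields_def)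
  also have "\<dots> = hcls A (shift_mod M) (shift_mod N) (\<lambda>i. f (i + 1))"
    by (rule UN_hcls[OF M f])
       (rule equiv_class_eq[OF htpy_equiv[OF shift_module[OF M(1)] shift_module[OF M(2)]] shift_htpy[OF M], symmetric])
  finally show ?thesis .
qed

definition shift_func where "shift_func = \<lparr>FO = shift_mod, FM = Shm (Hot R A)\<rparr>"

lemma shift_is_func: "is_func (Hot R A) (Hot R A) shift_func"
proof (intro is_func.intro is_func_axioms.intro Hot_is_cat)
  fix X Y Z f g assume h: "X \<in> Obj (Hot R A)" "Y \<in> Obj (Hot R A)" "Z \<in> Obj (Hot R A)"
    "f \<in> Hom (Hot R A) X Y" "g \<in> Hom (Hot R A) Y Z"
  obtain f' where f': "f' \<in> closed0 A X Y" "f = hcls A X Y f'" by (rule Hot_homE[OF h(4)])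
  obtain g' where g': "g' \<in> closed0 A Y Z" "g = hcls A Y Z g'" by (rule Hot_homE[OF h(5)])
  show "FM shift_func X Z (Comp (Hot R A) X Y Z g f)
    = Comp (Hot R A) (FO shift_func X) (FO shift_func Y) (FO shift_func Z) (FM shift_func Y Z g) (FM shift_func X Y f)"
    using h f' g' by (simp add: shift_func_def Hot_comp Shm_hcls shift_closed0 shift_module)
next
  fix X Y f assume h: "X \<in> Obj (Hot R A)" "Y \<in> Obj (Hot R A)" "f \<in> Hom (Hot R A) X Y"
  obtain f' where f': "f' \<in> closed0 A X Y" "f = hcls A X Y f'" by (rule Hot_homE[OF h(3)])
  show "FM shift_func X Y f \<in> Hom (Hot R A) (FO shift_func X) (FO shift_func Y)"
    using h f' hcls_hom[OF shift_closed0] by (simp add: shift_func_def Shm_hcls)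
next
  fix X assume "X \<in> Obj (Hot R A)"
  then show "FM shift_func X X (Idm (Hot R A) X) = Idm (Hot R A) (FO shift_func X)"
    by (simp add: shift_func_def Shm_hcls)
qed (simp add: shift_func_def shift_module)

lemma Dist_Hot: "Dist (Hot R A) = iso_closure (Hot_shift_cat R A) (standard_triangles R A)"
  by (simp add: Hot_def shift_cat.extend_def tri_cat.fields_def)

lemma Hot_shift_cat_simps:
  "Obj (Hot_shift_cat R A) = Obj (Hot R A)" "Hom (Hot_shift_cat R A) = Hom (Hot R A)"
  "Comp (Hot_shift_cat R A) = Comp (Hot R A)" "Idm (Hot_shift_cat R A) = Idm (Hot R A)"
  "Sh (Hot_shift_cat R A) = Sh (Hot R A)" "Shm (Hot_shift_cat R A) = Shm (Hot R A)"
  by (simp_all add: Hot_def Hot_shift_cat_def shift_cat.extend_def tri_cat.fields_def)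

end

text \<open>\<open>Dist\<close> is an isomorphism closure both in \<open>Hot\<close> and in its
  quotients, so even a model triangle belongs to it through an isomorphism with itself.\<close>

lemma triangle_iso_refl:
  assumes "is_cat C" "\<And>X. X \<in> Obj C \<Longrightarrow> Sh C X \<in> Obj C" "\<And>X. X \<in> Obj C \<Longrightarrow> Shm C X X (Idm C X) = Idm C (Sh C X)"
    "triangle_in C t"
  shows "triangle_iso C t t"
proof -
  interpret is_cat C by fact
  obtain X Y Z u v w where t: "t = (X, Y, Z, u, v, w)" by (metis prod_cases6)
  have h: "X \<in> Obj C" "Y \<in> Obj C" "Z \<in> Obj C" "u \<in> Hom C X Y" "v \<in> Hom C Y Z" "w \<in> Hom C Z (Sh C X)"
    using assms(4) by (simp_all add: t triangle_in_def)
  have i: "iso_in C V V (Idm C V)" if "V \<in> Obj C" for V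
    unfolding iso_in_def using that id_hom id_comp by (auto intro!: bexI[of _ "Idm C V"])
  show ?thesis unfolding t triangle_iso_def prod.case
    by (rule exI[of _ "Idm C X"], rule exI[of _ "Idm C Y"], rule exI[of _ "Idm C Z"])
       (use h i assms(2,3) comp_id id_comp in auto)
qed

lemma lepoll_Times_infinite:
  assumes "infinite (UNIV :: 'm set)" "A \<lesssim> (UNIV :: 'm set)" "B \<lesssim> (UNIV :: 'm set)"
  shows "A \<times> B \<lesssim> (UNIV :: 'm set)"
proof -
  have "A \<times> B \<lesssim> (UNIV :: 'm set) \<times> (UNIV :: 'm set)" using assms by (intro times_lepoll_mono)
  also have "(UNIV :: 'm set) \<times> (UNIV :: 'm set) \<approx> (UNIV :: 'm set)"
    using card_of_Times_same_infinite[OF assms(1)] by (simp add: eqpoll_iff_card_of_ordIso)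
  finally show ?thesis .
qed

section \<open>Fibres and triangles inside a fixed universe\<close>

locale tau_universe = tau_algebra R A tau n
  for R :: "'r ring" and A :: "('r, 'a) cdg_alg" and tau n +
  fixes ty :: "'m itself"
  assumes infinite_universe: "infinite (UNIV :: 'm set)"
begin

abbreviation H :: "(('r, 'a, 'm) cdg_mod, (int \<Rightarrow> 'm \<Rightarrow> 'm) set) tri_cat" where "H \<equiv> Hot R A"

definition NN :: "('r, 'a, 'm) cdg_mod set" where "NN = {M. isM M \<and> (\<forall>j\<le>n. acyc j M)}"

lemma small_any [simp]: "(B :: 'm set) \<lesssim> (UNIV :: 'm set)"
  by (rule subset_imp_lepoll) simp

lemma cone_small:
  assumes "\<And>i. carrier (mgr M i) \<lesssim> (UNIV :: 'm set)" "\<And>i. carrier (mgr N i) \<lesssim> (UNIV :: 'm set)"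
  shows "carrier (mgr (cone_mod M N f) i) \<lesssim> (UNIV :: 'm set)"
  using lepoll_Times_infinite[OF infinite_universe assms(2) assms(1)] by simp

text \<open>Refinements of the source of a roof are produced here: the fibre of a map to an acyclic
  module maps to \<open>X\<close> by a quasi-isomorphism, and over it the map to \<open>K\<close> is
  null-homotopic. \<open>K\<close> may live on another type because it will be a cone or a fibre,
  whose elements are pairs; only the fibre is copied into the universe.\<close>

lemma fibre_exists:
  fixes X :: "('r, 'a, 'm) cdg_mod" and K :: "('r, 'a, 'k) cdg_mod"
  assumes M: "isM X" "isM K" and f: "f \<in> closed0 A X K" and K: "\<And>i. carrier (mgr K i) \<lesssim> (UNIV :: 'm set)"
  obtains P :: "('r, 'a, 'm) cdg_mod" and p where "isM P" "p \<in> closed0 A P X"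
    "(\<lambda>i m. \<zero>\<^bsub>mgr K i\<^esub>, \<lambda>i z. f i (p i z)) \<in> htpy_rel A P K"
    "\<And>j. acyc j K \<Longrightarrow> qis j P X p" "\<And>j. qis j X K f \<Longrightarrow> acyc j P"
proof -
  let ?F = "fib X K f"
  have F: "isM ?F" by (rule fib_module[OF M f])
  have sm: "carrier (mgr ?F i) \<lesssim> (UNIV :: 'm set)" for i
    using cone_small[where i = "i - 1", of X K f] K by simp
  obtain P :: "('r, 'a, 'm) cdg_mod" and \<phi> \<psi> where P: "isM P" "\<phi> \<in> closed0 A ?F P" "\<psi> \<in> closed0 A P ?F"
    "\<And>i x. x \<in> carrier (mgr ?F i) \<Longrightarrow> \<psi> i (\<phi> i x) = x" "\<And>i y. y \<in> carrier (mgr P i) \<Longrightarrow> \<phi> i (\<psi> i y) = y"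
    using module_copy[OF F sm] by metis
  define p where "p i z = snd (\<psi> i z)" for i z
  have s: "(\<lambda>i. snd) \<in> closed0 A ?F X" by (rule fib_out_map[OF M f])
  have p: "p \<in> closed0 A P X" using closed0_comp[OF P(3) s P(1) F M(1)] unfolding p_def .
  have n: "(\<lambda>i m. \<zero>\<^bsub>mgr K i\<^esub>, \<lambda>i z. f i (p i z)) \<in> htpy_rel A P K"
    using htpy_comp[OF P(1) F M(2) htpy_cong[OF P(1) F P(3,3)] fib_null[OF M f]] unfolding p_def by simp
  have q\<psi>: "qis j P ?F \<psi>" for j by (rule qis_strict_iso[OF P(1) F P(3,2,5,4)])
  have "qis j P X p" if ac: "acyc j K" for j
  proof -
    have fd: "mdiff ?F i (k, x) = (\<ominus>\<^bsub>mgr K i\<^esub> (mdiff K (i - 1) k \<oplus>\<^bsub>mgr K i\<^esub> f i x), mdiff X i x)"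
      if "k \<in> carrier (mgr K (i - 1))" "x \<in> carrier (mgr X i)" for i k x by (rule fib_diff[OF M f that])
    have tpF: "(k, x) \<in> tp ?F l i \<longleftrightarrow> k \<in> tp K l (i - 1) \<and> x \<in> tp X l i" for k x l i by (simp add: tp_cone)
    \<comment> \<open>The kernel of the projection is a shift of the acyclic \<open>K\<close>. If
      (k, x) is a cycle and x = d y + u, then k + f y is a cycle of \<open>K\<close>; writing it as
      d k1 + v, the pair (-k1, y) bounds (k, x) up to (v, u).\<close>
    have "qis j ?F X (\<lambda>i. snd)"
    proof (rule qisI)
      fix i z assume z: "z \<in> Zc ?F j i" and sz: "snd z \<in> Bd X j i"
      obtain k x where kx: "z = (k, x)" by (cases z)
      have k: "k \<in> tp K j (i - 1)" and x: "x \<in> tp X j i" using ZcD(1)[OF z] unfolding kx tpF by auto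
      note kc = tp_carrier[OF k M(2)] and xc = tp_carrier[OF x M(1)]
      have fx: "f i x \<in> carrier (mgr K i)" and dk: "mdiff K (i - 1) k \<in> carrier (mgr K i)" using f xc d_carrier[OF M(2) kc] by simp_all
      have "\<ominus>\<^bsub>mgr K i\<^esub> (mdiff K (i - 1) k \<oplus>\<^bsub>mgr K i\<^esub> f i x) \<in> tp K (Suc j) i"
        using ZcD(2)[OF z] unfolding kx fd[OF kc xc] tpF by simp
      then have w: "mdiff K (i - 1) k \<oplus>\<^bsub>mgr K i\<^esub> f i x \<in> tp K (Suc j) i"
        using tp_neg_iff[OF M(2)] fx dk M by simp
      obtain y u where 1: "y \<in> tp X j (i - 1)" "u \<in> tp X (Suc j) i" "x = mdiff X (i - 1) y \<oplus>\<^bsub>mgr X i\<^esub> u"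
        using sz unfolding kx by (auto elim: BdE)
      note yc = tp_carrier[OF 1(1) M(1)] and uc = tp_carrier[OF 1(2) M(1)]
      have fy: "f (i - 1) y \<in> carrier (mgr K (i - 1))" "f i u \<in> carrier (mgr K i)" "mdiff X (i - 1) y \<in> carrier (mgr X i)"
        using f yc uc d_carrier[OF M(1) yc] by simp_all
      have fd': "f i (mdiff X (i - 1) y) = mdiff K (i - 1) (f (i - 1) y)" using closed0_diff[OF f yc M] by simp
      have dfy: "mdiff K (i - 1) (f (i - 1) y) \<in> carrier (mgr K i)" using d_carrier[OF M(2) fy(1)] .
      have "mdiff K (i - 1) (k \<oplus>\<^bsub>mgr K (i - 1)\<^esub> f (i - 1) y) = (mdiff K (i - 1) k \<oplus>\<^bsub>mgr K i\<^esub> f i x) \<ominus>\<^bsub>mgr K i\<^esub> f i u"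
        using M_add(3)[OF M(2) kc fy(1)] 1(3) f fy fd' dfy dk M uc by (simp add: ab_ac)
      also have "\<dots> \<in> tp K (Suc j) i" by (rule tp_minus[OF M(2,2) w tp_closed0[OF f M 1(2)]])
      finally have "k \<oplus>\<^bsub>mgr K (i - 1)\<^esub> f (i - 1) y \<in> Zc K j (i - 1)"
        using tp_add[OF M(2) k tp_closed0[OF f M 1(1)]] by (intro ZcI) simp_all
      from acycD[OF ac this] obtain k1 v where 2: "k1 \<in> tp K j (i - 1 - 1)" "v \<in> tp K (Suc j) (i - 1)"
        "k \<oplus>\<^bsub>mgr K (i - 1)\<^esub> f (i - 1) y = mdiff K (i - 1 - 1) k1 \<oplus>\<^bsub>mgr K (i - 1)\<^esub> v" by (rule BdE)
      note k1c = tp_carrier[OF 2(1) M(2)] and vc = tp_carrier[OF 2(2) M(2)]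
      have dk1: "mdiff K (i - 1 - 1) k1 \<in> carrier (mgr K (i - 1))" using d_carrier[OF M(2) k1c] .
      have "k = (k \<oplus>\<^bsub>mgr K (i - 1)\<^esub> f (i - 1) y) \<ominus>\<^bsub>mgr K (i - 1)\<^esub> f (i - 1) y" using kc fy M by (simp add: ab_ac)
      also have "\<dots> = (\<ominus>\<^bsub>mgr K (i - 1)\<^esub> (mdiff K (i - 1 - 1) (\<ominus>\<^bsub>mgr K (i - 1 - 1)\<^esub> k1) \<oplus>\<^bsub>mgr K (i - 1)\<^esub> f (i - 1) y)) \<oplus>\<^bsub>mgr K (i - 1)\<^esub> v"
        unfolding 2(3) using M_neg(3)[OF M(2) k1c] dk1 vc fy M by (simp add: ab_ac)
      finally have k_eq: "k = (\<ominus>\<^bsub>mgr K (i - 1)\<^esub> (mdiff K (i - 1 - 1) (\<ominus>\<^bsub>mgr K (i - 1 - 1)\<^esub> k1) \<oplus>\<^bsub>mgr K (i - 1)\<^esub> f (i - 1) y)) \<oplus>\<^bsub>mgr K (i - 1)\<^esub> v" .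
      show "z \<in> Bd ?F j i" unfolding kx
      proof (rule BdI[of _ _ _ "(\<ominus>\<^bsub>mgr K (i - 1 - 1)\<^esub> k1, y)" "(v, u)"])
        have "\<ominus>\<^bsub>mgr K (i - 1 - 1)\<^esub> k1 \<in> carrier (mgr K (i - 1 - 1))" using k1c M by simp
        from fd[OF this yc] k_eq 1(3)
        show "(k, x) = mdiff ?F (i - 1) (\<ominus>\<^bsub>mgr K (i - 1 - 1)\<^esub> k1, y) \<oplus>\<^bsub>mgr ?F i\<^esub> (v, u)" by (simp del: shp_simps(3))
        show "(\<ominus>\<^bsub>mgr K (i - 1 - 1)\<^esub> k1, y) \<in> tp ?F j (i - 1)" using tp_neg[OF M(2,2) 2(1)] 1(1) unfolding tpF by simp
        show "(v, u) \<in> tp ?F (Suc j) i" using 1 2 unfolding tpF by simp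
      qed
    next
      fix i x assume x: "x \<in> Zc X j i"
      note xc = Zc_carrier[OF x M(1)]
      obtain k v where 1: "k \<in> tp K j (i - 1)" "v \<in> tp K (Suc j) i" "f i x = mdiff K (i - 1) k \<oplus>\<^bsub>mgr K i\<^esub> v"
        using acycD[OF ac Zc_closed0[OF f M x]] by (rule BdE)
      note kc = tp_carrier[OF 1(1) M(2)] and vc = tp_carrier[OF 1(2) M(2)]
      have nk: "\<ominus>\<^bsub>mgr K (i - 1)\<^esub> k \<in> carrier (mgr K (i - 1))" using kc M by simp
      \<comment> \<open>Acyclicity of \<open>K\<close> writes f x = d k + v; with the minus sign
        (-k, x) is a cycle lying over \<open>x\<close>.\<close>
      have "(\<ominus>\<^bsub>mgr K (i - 1)\<^esub> k, x) \<in> Zc ?F j i"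
      proof (rule ZcI)
        show "(\<ominus>\<^bsub>mgr K (i - 1)\<^esub> k, x) \<in> tp ?F j i" using tp_neg[OF M(2,2) 1(1)] ZcD(1)[OF x] unfolding tpF by simp
        have "mdiff ?F i (\<ominus>\<^bsub>mgr K (i - 1)\<^esub> k, x) = (\<ominus>\<^bsub>mgr K i\<^esub> v, mdiff X i x)"
          using fd[OF nk xc] 1(3) M_neg(3)[OF M(2) kc] d_carrier[OF M(2) kc] vc M by simp
        also have "\<dots> \<in> tp ?F (Suc j) (i + 1)" using tp_neg[OF M(2,2) 1(2)] ZcD(2)[OF x] unfolding tpF by simp
        finally show "mdiff ?F i (\<ominus>\<^bsub>mgr K (i - 1)\<^esub> k, x) \<in> tp ?F (Suc j) (i + 1)" .
      qed
      moreover have "x \<ominus>\<^bsub>mgr X i\<^esub> x \<in> Bd X j i" using xc M Bd_tp[OF M(1) tp_zero[OF M(1)]] by simp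
      ultimately show "\<exists>z\<in>Zc ?F j i. x \<ominus>\<^bsub>mgr X i\<^esub> snd z \<in> Bd X j i" by force
    qed
    from qis_comp[OF P(1) F M(1) P(3) s q\<psi> this] show ?thesis unfolding p_def .
  qed
  moreover have "acyc j P" if "qis j X K f" for j
    using that acyc_cone[OF M f, of j] acyc_shp[OF cone_module[OF M f], of j "- 1"] acyc_qis[OF P(1) F P(3) q\<psi>] by simp
  ultimately show thesis using that[OF P(1) p n] by blast
qed

text \<open>Membership in \<open>cone_in\<close> requires a third vertex inside the universe, so the
  cone on pairs is replaced by a copy of it.\<close>

lemma cone_exists:
  fixes M N :: "('r, 'a, 'm) cdg_mod"
  assumes M: "isM M" "isM N" and f: "f \<in> closed0 A M N"
  obtains C v w where "isM C" "(M, N, C, hcls A M N f, v, w) \<in> Dist H"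
    "\<And>j. acyc j C \<longleftrightarrow> qis j M N f"
proof -
  let ?C = "cone_mod M N f"
  have C: "isM ?C" by (rule cone_module[OF M f])
  have sm: "carrier (mgr ?C i) \<lesssim> (UNIV :: 'm set)" for i using cone_small[of M N f] by simp
  obtain P :: "('r, 'a, 'm) cdg_mod" and \<phi> \<psi> where P: "isM P" "\<phi> \<in> closed0 A ?C P" "\<psi> \<in> closed0 A P ?C"
    "\<And>i x. x \<in> carrier (mgr ?C i) \<Longrightarrow> \<psi> i (\<phi> i x) = x" "\<And>i y. y \<in> carrier (mgr P i) \<Longrightarrow> \<phi> i (\<psi> i y) = y"
    using module_copy[OF C sm] by metis
  let ?t = "(M, N, P, hcls A M N f, hcls A N P (\<lambda>i y. \<phi> i (y, \<zero>\<^bsub>mgr M (i + 1)\<^esub>)),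
     hcls A P (shift_mod M) (\<lambda>i z. snd (\<psi> i z)))"
  have st: "?t \<in> standard_triangles R A"
    unfolding standard_triangles_def using M f P by blast
  have "(\<lambda>i y. \<phi> i (y, \<zero>\<^bsub>mgr M (i + 1)\<^esub>)) \<in> closed0 A N P"
    using closed0_comp[OF cone_in_map[OF M f] P(2) M(2) C P(1)] .
  moreover have "(\<lambda>i z. snd (\<psi> i z)) \<in> closed0 A P (shift_mod M)"
    using closed0_comp[OF P(3) cone_out_map[OF M f] P(1) C shift_module[OF M(1)]] .
  ultimately have ti: "triangle_in (Hot_shift_cat R A) ?t"
    using M P(1) f hcls_hom unfolding triangle_in_def prod.case Hot_shift_cat_simps Hot_simps(5) by auto
  have "triangle_iso (Hot_shift_cat R A) ?t ?t"
  proof (rule triangle_iso_refl[OF _ _ _ ti])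
    show "is_cat (Hot_shift_cat R A)" using Hot_is_cat unfolding is_cat_def Hot_shift_cat_simps .
  qed (simp_all add: Hot_shift_cat_simps shift_module Shm_hcls)
  then have "?t \<in> Dist H" using st ti unfolding Dist_Hot iso_closure_def by blast
  moreover have "acyc j P \<longleftrightarrow> qis j M N f" for j
    using acyc_cone[OF M f] acyc_qis[OF P(1) C P(3) qis_strict_iso[OF P(1) C P(3,2,5,4)]] by simp
  ultimately show thesis using that P(1) by blast
qed

end

section \<open>Isomorphisms in the homotopy category and the zero module\<close>

context cdg_algebra
begin

lemma iso_HotE:
  assumes M: "isM M" "isM N" and F: "iso_in (Hot R A) M N F"
  obtains f g where "f \<in> closed0 A M N" "g \<in> closed0 A N M" "F = hcls A M N f"
    "(\<lambda>i x. g i (f i x), \<lambda>i x. x) \<in> htpy_rel A M M" "(\<lambda>i x. f i (g i x), \<lambda>i x. x) \<in> htpy_rel A N N"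
proof -
  obtain G where FG: "F \<in> Hom (Hot R A) M N" "G \<in> Hom (Hot R A) N M"
    "Comp (Hot R A) M N M G F = Idm (Hot R A) M" "Comp (Hot R A) N M N F G = Idm (Hot R A) N"
    using F by (rule iso_inE)
  obtain f where f: "f \<in> closed0 A M N" "F = hcls A M N f" by (rule Hot_homE[OF FG(1)])
  obtain g where g: "g \<in> closed0 A N M" "G = hcls A N M g" by (rule Hot_homE[OF FG(2)])
  have "hcls A M M (\<lambda>i x. g i (f i x)) = hcls A M M (\<lambda>i x. x)"
    using FG(3) f g M by (simp add: Hot_comp)
  then have 1: "(\<lambda>i x. g i (f i x), \<lambda>i x. x) \<in> htpy_rel A M M"
    by (subst (asm) hcls_eq_iff) (use closed0_comp[OF f(1) g(1) M(1,2,1)] M in auto)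
  have "hcls A N N (\<lambda>i x. f i (g i x)) = hcls A N N (\<lambda>i x. x)"
    using FG(4) f g M by (simp add: Hot_comp)
  then have 2: "(\<lambda>i x. f i (g i x), \<lambda>i x. x) \<in> htpy_rel A N N"
    by (subst (asm) hcls_eq_iff) (use closed0_comp[OF g(1) f(1) M(2,1,2)] M in auto)
  show thesis using that f g 1 2 by blast
qed

lemma iso_HotI:
  assumes M: "isM M" "isM N" and f: "f \<in> closed0 A M N" and g: "g \<in> closed0 A N M"
    and gf: "\<And>i x. x \<in> carrier (mgr M i) \<Longrightarrow> g i (f i x) = x" and fg: "\<And>i x. x \<in> carrier (mgr N i) \<Longrightarrow> f i (g i x) = x"
  shows "iso_in (Hot R A) M N (hcls A M N f)"
proof -
  have "hcls A M M (\<lambda>i x. g i (f i x)) = hcls A M M (\<lambda>i x. x)"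
    by (rule hcls_cong) (use M gf closed0_comp[OF f g M(1,2,1)] in auto)
  moreover have "hcls A N N (\<lambda>i x. f i (g i x)) = hcls A N N (\<lambda>i x. x)"
    by (rule hcls_cong) (use M fg closed0_comp[OF g f M(2,1,2)] in auto)
  ultimately show ?thesis unfolding iso_in_def
    using M f g hcls_hom[OF f] hcls_hom[OF g] by (auto simp: Hot_comp intro!: bexI[of _ "hcls A N M g"])
qed

definition zero_mod :: "('r, 'a, 'm) cdg_mod" where
  "zero_mod = \<lparr>mgr = (\<lambda>i. \<lparr>carrier = {undefined}, mult = undefined, one = undefined, zero = undefined,
      add = (\<lambda>x y. undefined), smult = (\<lambda>r x. undefined)\<rparr>), mact = (\<lambda>i j a x. undefined), mdiff = (\<lambda>i x. undefined)\<rparr>"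

lemma zero_module: "isM (zero_mod :: ('r, 'a, 'm) cdg_mod)"
proof -
  have g: "abelian_group (mgr (zero_mod :: ('r, 'a, 'm) cdg_mod) i)" for i
    by (rule abelian_groupI) (auto simp: zero_mod_def)
  have c: "carrier (mgr (zero_mod :: ('r, 'a, 'm) cdg_mod) i) = {undefined}" for i by (simp add: zero_mod_def)
  have "gsgn (mgr (zero_mod :: ('r, 'a, 'm) cdg_mod) i) s undefined = undefined" for i s
    using gsgn_closed[OF g, of undefined i s] by (simp add: c)
  then show ?thesis
    by (intro cdg_module.intro moduleI base g) (auto simp: zero_mod_def)
qed

end

lemma extend_verdier_simps:
  "Obj (verdier_shift_cat T N) = Obj (verdier T N)" "Hom (verdier_shift_cat T N) = Hom (verdier T N)"
  "Comp (verdier_shift_cat T N) = Comp (verdier T N)" "Idm (verdier_shift_cat T N) = Idm (verdier T N)"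
  "Sh (verdier_shift_cat T N) = Sh T"
  by (simp_all add: verdier_def verdier_shift_cat_def shift_cat.extend_def tri_cat.fields_def)

text \<open>The shift of the quotient category is an instance of an induced functor, so its
  behaviour on identities comes from \<open>V_is_func\<close>.\<close>

lemma Shm_verdier: "Shm (verdier_shift_cat T N) = FM (verdier_func T N \<lparr>FO = Sh T, FM = Shm T\<rparr>)"
  by (simp add: verdier_shift_cat_def verdier_func_def)

lemma Dist_verdier: "Dist (verdier T N) = iso_closure (verdier_shift_cat T N)
   {(X, Y, Z, quot_mor T N X Y u, quot_mor T N Y Z v, quot_mor T N Z (Sh T X) w)
         | X Y Z u v w. (X, Y, Z, u, v, w) \<in> Dist T}"
  by (simp add: verdier_def verdier_shift_cat_def shift_cat.extend_def tri_cat.fields_def)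

section \<open>Morphisms with n-acyclic cone and their calculus of fractions\<close>

context tau_universe
begin

text \<open>A distinguished triangle is only isomorphic to a standard one. Isomorphisms of
  \<open>Hot\<close> are quasi-isomorphisms on every graded piece, so acyclicity of the third vertex
  can be read off from the map \<open>f\<close> of the standard triangle.\<close>

lemma dist_HotE:
  fixes M N Z :: "('r, 'a, 'm) cdg_mod"
  assumes d: "(M, N, Z, u, v, w) \<in> Dist H"
  obtains X Y C :: "('r, 'a, 'm) cdg_mod" and f a b c where "isM M" "isM N" "isM Z" "isM X" "isM Y" "isM C" "f \<in> closed0 A X Y"
    "a \<in> closed0 A M X" "b \<in> closed0 A N Y" "c \<in> closed0 A Z C" "\<And>j. acyc j C \<longleftrightarrow> qis j X Y f"
    "\<And>j. qis j M X a" "\<And>j. qis j N Y b" "\<And>j. qis j Z C c" "u \<in> Hom H M N"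
    "Comp H M N Y (hcls A N Y b) u = Comp H M X Y (hcls A X Y f) (hcls A M X a)"
proof -
  obtain t where t: "t \<in> standard_triangles R A" "triangle_in (Hot_shift_cat R A) (M, N, Z, u, v, w)"
    "triangle_iso (Hot_shift_cat R A) (M, N, Z, u, v, w) t"
    using d unfolding Dist_Hot iso_closure_def by blast
  have M: "isM M" "isM N" "isM Z" "u \<in> Hom H M N"
    using t(2) unfolding triangle_in_def prod.case Hot_shift_cat_simps by auto
  obtain X Y C f \<phi> \<psi> where s: "t = (X, Y, C, hcls A X Y f,
        hcls A Y C (\<lambda>i y. \<phi> i (y, \<zero>\<^bsub>mgr X (i + 1)\<^esub>)),
        hcls A C (shift_mod X) (\<lambda>i z. snd (\<psi> i z)))"
     "isM X" "isM Y" "isM C" "f \<in> closed0 A X Y" "\<phi> \<in> closed0 A (cone_mod X Y f) C" "\<psi> \<in> closed0 A C (cone_mod X Y f)"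
     "\<forall>i. \<forall>x\<in>carrier (mgr (cone_mod X Y f) i). \<psi> i (\<phi> i x) = x" "\<forall>i. \<forall>z\<in>carrier (mgr C i). \<phi> i (\<psi> i z) = z"
    using t(1) unfolding standard_triangles_def by blast
  obtain a b c where abc: "iso_in H M X a" "iso_in H N Y b" "iso_in H Z C c"
    "Comp H M N Y b u = Comp H M X Y (hcls A X Y f) a"
    using t(3) unfolding s(1) triangle_iso_def prod.case iso_in_def Hot_shift_cat_simps by blast
  have K: "isM (cone_mod X Y f)" by (rule cone_module[OF s(2,3,5)])
  have ac: "acyc j C \<longleftrightarrow> qis j X Y f" for j
    using acyc_cone[OF s(2,3,5)] acyc_qis[OF s(4) K s(7) qis_strict_iso[OF s(4) K s(7,6)]] s(8,9) by simp
  obtain a' a'' where a: "a' \<in> closed0 A M X" "a'' \<in> closed0 A X M" "a = hcls A M X a'"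
    "(\<lambda>i x. a'' i (a' i x), \<lambda>i x. x) \<in> htpy_rel A M M" "(\<lambda>i x. a' i (a'' i x), \<lambda>i x. x) \<in> htpy_rel A X X"
    by (rule iso_HotE[OF M(1) s(2) abc(1)])
  obtain b' b'' where b: "b' \<in> closed0 A N Y" "b'' \<in> closed0 A Y N" "b = hcls A N Y b'"
    "(\<lambda>i x. b'' i (b' i x), \<lambda>i x. x) \<in> htpy_rel A N N" "(\<lambda>i x. b' i (b'' i x), \<lambda>i x. x) \<in> htpy_rel A Y Y"
    by (rule iso_HotE[OF M(2) s(3) abc(2)])
  obtain c' c'' where c: "c' \<in> closed0 A Z C" "c'' \<in> closed0 A C Z" "c = hcls A Z C c'"
    "(\<lambda>i x. c'' i (c' i x), \<lambda>i x. x) \<in> htpy_rel A Z Z" "(\<lambda>i x. c' i (c'' i x), \<lambda>i x. x) \<in> htpy_rel A C C"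
    by (rule iso_HotE[OF M(3) s(4) abc(3)])
  show thesis
    by (rule that[of X Y C f a' b' c'])
       (use M s(2-5) a b c ac abc(4) qis_iso[OF M(1) s(2) a(1,2,4,5)] qis_iso[OF M(2) s(3) b(1,2,4,5)]
         qis_iso[OF M(3) s(4) c(1,2,4,5)] in \<open>simp_all only: simp_thms\<close>)
qed

text \<open>This turns the class inverted by the quotient into a condition on elements. A given
  third vertex is compared with a standard cone through \<open>dist_HotE\<close>; the square
  obtained there commutes up to homotopy, under which \<open>qis\<close> is invariant. For the
  converse the cone of \<open>f\<close> itself serves.\<close>

lemma cone_in_hcls:
  fixes M N :: "('r, 'a, 'm) cdg_mod"
  assumes M: "isM M" "isM N" and f: "f \<in> closed0 A M N"
  shows "hcls A M N f \<in> cone_in H NN M N \<longleftrightarrow> (\<forall>j\<le>n. qis j M N f)"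
proof
  assume "hcls A M N f \<in> cone_in H NN M N"
  then obtain Z v w where Z: "Z \<in> NN" and d: "(M, N, Z, hcls A M N f, v, w) \<in> Dist H" unfolding cone_in_def by blast
  obtain X Y C :: "('r, 'a, 'm) cdg_mod" and f' a b c where h: "isM M" "isM N" "isM Z" "isM X" "isM Y" "isM C" "f' \<in> closed0 A X Y"
    "a \<in> closed0 A M X" "b \<in> closed0 A N Y" "c \<in> closed0 A Z C" "\<And>j. acyc j C \<longleftrightarrow> qis j X Y f'"
    "\<And>j. qis j M X a" "\<And>j. qis j N Y b" "\<And>j. qis j Z C c" "hcls A M N f \<in> Hom H M N"
    "Comp H M N Y (hcls A N Y b) (hcls A M N f) = Comp H M X Y (hcls A X Y f') (hcls A M X a)"
    by (rule dist_HotE[OF d], rule that)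
  have e: "(\<lambda>i x. f' i (a i x), \<lambda>i x. b i (f i x)) \<in> htpy_rel A M Y"
    using h(16) h(1-10) f hcls_eq_iff[OF h(1,5) closed0_comp[OF h(8,7)] closed0_comp[OF f h(9)]]
    by (simp add: Hot_comp)
  show "\<forall>j\<le>n. qis j M N f"
  proof (intro allI impI)
    fix j assume "j \<le> n"
    then have "acyc j Z" using Z by (simp add: NN_def)
    then have "qis j X Y f'" using acyc_qis[OF h(3,6,10,14)] h(11) by simp
    from qis_comp[OF h(1,4,5,8,7,12) this] have "qis j M Y (\<lambda>i x. f' i (a i x))" .
    from qis_htpy[OF h(1,5) e this] have "qis j M Y (\<lambda>i x. b i (f i x))" .
    from qis_cancel[OF h(1,2,5) f h(9) this h(13)] show "qis j M N f" .
  qed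
next
  assume q: "\<forall>j\<le>n. qis j M N f"
  obtain C v w where C: "isM C" "(M, N, C, hcls A M N f, v, w) \<in> Dist H" "\<And>j. acyc j C \<longleftrightarrow> qis j M N f"
    by (rule cone_exists[OF M f]) blast
  then have "C \<in> NN" using q by (simp add: NN_def)
  then show "hcls A M N f \<in> cone_in H NN M N" unfolding cone_in_def using C hcls_hom[OF f] by blast
qed

lemma cone_inE:
  fixes M N :: "('r, 'a, 'm) cdg_mod"
  assumes "isM M" "isM N" "F \<in> cone_in H NN M N"
  obtains f where "f \<in> closed0 A M N" "F = hcls A M N f" "\<And>j. j \<le> n \<Longrightarrow> qis j M N f"
proof -
  have "F \<in> Hom H M N" using assms(3) unfolding cone_in_def by simp
  then obtain f where f: "f \<in> closed0 A M N" "F = hcls A M N f" by (rule Hot_homE)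
  then show thesis using that cone_in_hcls[OF assms(1,2) f(1)] assms(3) by blast
qed

lemma iso_cone_in:
  fixes M N :: "('r, 'a, 'm) cdg_mod"
  assumes M: "isM M" "isM N" and F: "iso_in H M N F"
  shows "F \<in> cone_in H NN M N"
proof -
  obtain f g where f: "f \<in> closed0 A M N" "g \<in> closed0 A N M" "F = hcls A M N f"
    "(\<lambda>i x. g i (f i x), \<lambda>i x. x) \<in> htpy_rel A M M" "(\<lambda>i x. f i (g i x), \<lambda>i x. x) \<in> htpy_rel A N N"
    by (rule iso_HotE[OF assms])
  then show ?thesis using cone_in_hcls[OF M f(1)] qis_iso[OF M f(1,2,4,5)] by simp
qed

text \<open>\<open>P\<close> is the homotopy fibre of X -> Z -> cone of s. A null-homotopy of the
  map from \<open>P\<close> to the cone is a pair: its component \<open>h2\<close> in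
  \<open>Y\<close> is a closed map that completes the square, and its component \<open>h1\<close> in
  \<open>Z\<close> is the homotopy that makes the square commute. The cone is acyclic on the pieces
  up to n, so P -> X is a quasi-isomorphism there.\<close>

lemma Hot_ore:
  fixes X Y Z :: "('r, 'a, 'm) cdg_mod"
  assumes M: "isM X" "isM Y" "isM Z" and f: "f \<in> closed0 A X Z" and s: "s \<in> closed0 A Y Z" and q: "\<And>j. j \<le> n \<Longrightarrow> qis j Y Z s"
  obtains P :: "('r, 'a, 'm) cdg_mod" and p q where "isM P" "p \<in> closed0 A P X" "q \<in> closed0 A P Y" "\<And>j. j \<le> n \<Longrightarrow> qis j P X p"
    "(\<lambda>i x. f i (p i x), \<lambda>i x. s i (q i x)) \<in> htpy_rel A P Z"
proof -
  let ?K = "cone_mod Y Z s"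
  define \<iota> where "\<iota> = (\<lambda>(i :: int) (y :: 'm). (y, \<zero>\<^bsub>mgr Y (i + 1)\<^esub>))"
  have K: "isM ?K" by (rule cone_module[OF M(2,3) s])
  have \<iota>: "\<iota> \<in> closed0 A Z ?K" unfolding \<iota>_def by (rule cone_in_map[OF M(2,3) s])
  have if': "(\<lambda>i x. \<iota> i (f i x)) \<in> closed0 A X ?K" by (rule closed0_comp[OF f \<iota> M(1,3) K])
  have sm: "carrier (mgr ?K i) \<lesssim> (UNIV :: 'm set)" for i using cone_small[of Y Z s] by simp
  obtain P :: "('r, 'a, 'm) cdg_mod" and p where P: "isM P" "p \<in> closed0 A P X"
    "(\<lambda>i m. \<zero>\<^bsub>mgr ?K i\<^esub>, \<lambda>i z. \<iota> i (f i (p i z))) \<in> htpy_rel A P ?K"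
    "\<And>j. acyc j ?K \<Longrightarrow> qis j P X p"
    by (rule fibre_exists[OF M(1) K if' sm]) blast
  obtain h where h: "h \<in> ghom A (- 1) P ?K"
    "\<And>i m. m \<in> carrier (mgr P i) \<Longrightarrow> \<iota> i (f i (p i m)) = \<zero>\<^bsub>mgr ?K i\<^esub> \<oplus>\<^bsub>mgr ?K i\<^esub> bd P ?K h i m"
    using P(3) P(1) K by (rule htpyE) auto
  define h1 where "h1 i m = fst (h i m)" for i m
  define h2 where "h2 i m = snd (h i m)" for i m
  have hh: "h i m = (h1 i m, h2 i m)" for i m by (simp add: h1_def h2_def)
  have h1: "h1 i m \<in> carrier (mgr Z (i - 1))" and h2: "h2 i m \<in> carrier (mgr Y i)" if "m \<in> carrier (mgr P i)" for i m
    using h_closed[OF h(1) that] by (simp_all add: h1_def h2_def mem_Times_iff)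
  have dm: "mdiff P i m \<in> carrier (mgr P (i + 1))" if "m \<in> carrier (mgr P i)" for i m using that P(1) by simp
  have fp: "f i (p i m) \<in> carrier (mgr Z i)" "s i (h2 i m) \<in> carrier (mgr Z i)" "mdiff Z (i - 1) (h1 i m) \<in> carrier (mgr Z i)"
    "h1 (i + 1) (mdiff P i m) \<in> carrier (mgr Z i)" "mdiff Y i (h2 i m) \<in> carrier (mgr Y (i + 1))"
    "h2 (i + 1) (mdiff P i m) \<in> carrier (mgr Y (i + 1))"
    if m: "m \<in> carrier (mgr P i)" for i m
    using h1[OF m] h1[OF dm[OF m]] h2[OF m] h2[OF dm[OF m]] d_carrier[OF M(3) h1[OF m]] m f s P(2) M by simp_all
  have e: "f i (p i m) = mdiff Z (i - 1) (h1 i m) \<oplus>\<^bsub>mgr Z i\<^esub> s i (h2 i m) \<oplus>\<^bsub>mgr Z i\<^esub> h1 (i + 1) (mdiff P i m)"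
    "\<zero>\<^bsub>mgr Y (i + 1)\<^esub> = \<ominus>\<^bsub>mgr Y (i + 1)\<^esub> mdiff Y i (h2 i m) \<oplus>\<^bsub>mgr Y (i + 1)\<^esub> h2 (i + 1) (mdiff P i m)"
    if m: "m \<in> carrier (mgr P i)" for i m
    using h(2)[OF m] fp[OF m] M unfolding bd_def hh \<iota>_def by simp_all
  have h2d: "h2 (i + 1) (mdiff P i m) = mdiff Y i (h2 i m)" if m: "m \<in> carrier (mgr P i)" for i m
  proof -
    have "mdiff Y i (h2 i m) = mdiff Y i (h2 i m) \<oplus>\<^bsub>mgr Y (i + 1)\<^esub> (\<ominus>\<^bsub>mgr Y (i + 1)\<^esub> mdiff Y i (h2 i m) \<oplus>\<^bsub>mgr Y (i + 1)\<^esub> h2 (i + 1) (mdiff P i m))"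
      unfolding e(2)[OF m, symmetric] using fp[OF m] M by simp
    also have "\<dots> = h2 (i + 1) (mdiff P i m)" using fp[OF m] M by simp
    finally show ?thesis ..
  qed
  have hact: "h1 (i + j) (mact P i j a m) = gsgn (mgr Z (i + j - 1)) i (mact Z i (j - 1) a (h1 j m))"
    "h2 (i + j) (mact P i j a m) = mact Y i j a (h2 j m)"
    if a: "a \<in> carrier (agr A i)" and m: "m \<in> carrier (mgr P j)" for i j a m
  proof -
    have c: "mact Z i (j - 1) a (h1 j m) \<in> carrier (mgr Z (i + j - 1))" "mact Y i j a (h2 j m) \<in> carrier (mgr Y (i + j))"
      using M_closed(1)[OF M(3) a h1[OF m]] M_closed(1)[OF M(2) a h2[OF m]] by (simp_all add: add_diff_eq)
    have "(h1 (i + j) (mact P i j a m), h2 (i + j) (mact P i j a m))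
      = gsgn (mgr ?K (i + j - 1)) i (mact Z i (j - 1) a (h1 j m), gsgn (mgr Y (i + j)) i (mact Y i j a (h2 j m)))"
      using h_act[OF h(1) a m] unfolding hh by simp
    then show "h1 (i + j) (mact P i j a m) = gsgn (mgr Z (i + j - 1)) i (mact Z i (j - 1) a (h1 j m))"
      "h2 (i + j) (mact P i j a m) = mact Y i j a (h2 j m)"
      using cone_gsgn[OF M(2,3), of "mact Z i (j - 1) a (h1 j m)" "i + j - 1" "gsgn (mgr Y (i + j)) i (mact Y i j a (h2 j m))" s i] c M
      by (auto simp: gsgn_def)
  qed
  have hadd: "h1 i (m \<oplus>\<^bsub>mgr P i\<^esub> m') = h1 i m \<oplus>\<^bsub>mgr Z (i - 1)\<^esub> h1 i m'" "h2 i (m \<oplus>\<^bsub>mgr P i\<^esub> m') = h2 i m \<oplus>\<^bsub>mgr Y i\<^esub> h2 i m'"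
    if "m \<in> carrier (mgr P i)" "m' \<in> carrier (mgr P i)" for i m m'
    using ghom_add[OF h(1) that] unfolding hh by simp_all
  have h1g: "h1 \<in> ghom A (- 1) P Z" by (rule ghomI) (use h1 hadd hact(1) in \<open>auto simp: gsgn_def\<close>)
  have h2c: "h2 \<in> closed0 A P Y" by (rule closed0I[OF P(1) M(2)]) (use h2 hadd hact(2) h2d in auto)
  have "(\<lambda>i x. s i (h2 i x), \<lambda>i x. f i (p i x)) \<in> htpy_rel A P Z"
  proof (rule htpyI[OF P(1) M(3) closed0_comp[OF h2c s P(1) M(2,3)] closed0_comp[OF P(2) f P(1) M(1,3)] h1g])
    fix i m assume m: "m \<in> carrier (mgr P i)"
    show "f i (p i m) = s i (h2 i m) \<oplus>\<^bsub>mgr Z i\<^esub> bd P Z h1 i m"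
      unfolding bd_def e(1)[OF m] using fp[OF m] M by (simp add: ab_ac(3-5))
  qed
  then have "(\<lambda>i x. f i (p i x), \<lambda>i x. s i (h2 i x)) \<in> htpy_rel A P Z"
    using htpy_equiv[OF P(1) M(3)] by (meson equivE symE)
  moreover have "qis j P X p" if "j \<le> n" for j using P(4) acyc_cone[OF M(2,3) s] q[OF that] by blast
  ultimately show thesis using that[OF P(1,2) h2c] by blast
qed

lemma htpy_minus:
  assumes M: "isM M" "isM N" and f: "f \<in> closed0 A M N" "g \<in> closed0 A M N"
  shows "(\<lambda>i m. \<zero>\<^bsub>mgr N i\<^esub>, \<lambda>i m. g i m \<ominus>\<^bsub>mgr N i\<^esub> f i m) \<in> htpy_rel A M N \<longleftrightarrow> (f, g) \<in> htpy_rel A M N"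
proof -
  have "g i m \<ominus>\<^bsub>mgr N i\<^esub> f i m = \<zero>\<^bsub>mgr N i\<^esub> \<oplus>\<^bsub>mgr N i\<^esub> bd M N h i m \<longleftrightarrow> g i m = f i m \<oplus>\<^bsub>mgr N i\<^esub> bd M N h i m"
    if "h \<in> ghom A (- 1) M N" "m \<in> carrier (mgr M i)" for h i m
  proof -
    have c: "f i m \<in> carrier (mgr N i)" "g i m \<in> carrier (mgr N i)" "bd M N h i m \<in> carrier (mgr N i)" using f that M by simp_all
    show ?thesis
    proof
      assume "g i m \<ominus>\<^bsub>mgr N i\<^esub> f i m = \<zero>\<^bsub>mgr N i\<^esub> \<oplus>\<^bsub>mgr N i\<^esub> bd M N h i m"
      then have "f i m \<oplus>\<^bsub>mgr N i\<^esub> (g i m \<ominus>\<^bsub>mgr N i\<^esub> f i m) = f i m \<oplus>\<^bsub>mgr N i\<^esub> bd M N h i m" using c M by simp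
      then show "g i m = f i m \<oplus>\<^bsub>mgr N i\<^esub> bd M N h i m" using c M by (simp add: ab_ac(1))
    qed (use c M in \<open>simp add: ab_ac\<close>)
  qed
  then show ?thesis unfolding htpy_iff[OF M] using f closed0_comb(2)[OF M f(2,1)] M by auto
qed

text \<open>The homotopy \<open>h\<close> between s f and s g and the difference d = f - g together
  form a closed map \<open>\<phi>\<close> from \<open>X\<close> to the fibre of \<open>s\<close>,
  whose pieces up to n are acyclic. Over the fibre of \<open>\<phi>\<close> this map is
  null-homotopic, hence so is its second component, the difference.\<close>

lemma Hot_cancel:
  fixes X Y Z :: "('r, 'a, 'm) cdg_mod"
  assumes M: "isM X" "isM Y" "isM Z" and f: "f \<in> closed0 A X Y" and g: "g \<in> closed0 A X Y" and s: "s \<in> closed0 A Y Z"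
    and q: "\<And>j. j \<le> n \<Longrightarrow> qis j Y Z s" and e: "(\<lambda>i x. s i (f i x), \<lambda>i x. s i (g i x)) \<in> htpy_rel A X Z"
  obtains P :: "('r, 'a, 'm) cdg_mod" and p where "isM P" "p \<in> closed0 A P X" "\<And>j. j \<le> n \<Longrightarrow> qis j P X p"
    "(\<lambda>i x. f i (p i x), \<lambda>i x. g i (p i x)) \<in> htpy_rel A P Y"
proof -
  let ?K = "fib Y Z s"
  have K: "isM ?K" by (rule fib_module[OF M(2,3) s])
  have ac: "acyc j ?K" if "j \<le> n" for j
    using acyc_shp[OF cone_module[OF M(2,3) s], of j "- 1"] acyc_cone[OF M(2,3) s] q[OF that] by simp
  obtain h where h: "h \<in> ghom A (- 1) X Z"
    "\<And>i m. m \<in> carrier (mgr X i) \<Longrightarrow> s i (g i m) = s i (f i m) \<oplus>\<^bsub>mgr Z i\<^esub> bd X Z h i m"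
    using e M(1,3) by (rule htpyE) auto
  define d where "d i x = f i x \<ominus>\<^bsub>mgr Y i\<^esub> g i x" for i x
  have d: "d \<in> closed0 A X Y" unfolding d_def by (rule closed0_comb(2)[OF M(1,2) f g])
  have dc: "d i x \<in> carrier (mgr Y i)" if "x \<in> carrier (mgr X i)" for i x using d that by simp
  define \<phi> where "\<phi> i x = (h i x, d i x)" for i x
  have sd: "s i (d i x) = \<ominus>\<^bsub>mgr Z i\<^esub> bd X Z h i x" if x: "x \<in> carrier (mgr X i)" for i x
    using h(2)[OF x] f g s x M h(1) by (simp add: d_def ab_ac)
  have \<phi>: "\<phi> \<in> closed0 A X ?K"
  proof (rule closed0I[OF M(1) K], goal_cases)
    case (1 i m) then show ?case using h_closed[OF h(1)] dc by (simp add: \<phi>_def)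
  next
    case (2 i m m') then show ?case using ghom_add[OF h(1) 2] closed0_add[OF d 2] by (simp add: \<phi>_def)
  next
    case (3 i j a m)
    then show ?case unfolding \<phi>_def using fib_act[OF M(2,3) 3(1) h_closed[OF h(1) 3(2)] dc[OF 3(2)], of s]
        h_act[OF h(1) 3] closed0_act[OF d 3] by (simp del: shp_simps(2))
  next
    case (4 i m)
    have c: "mdiff Z (i - 1) (h i m) \<in> carrier (mgr Z i)" "h (i + 1) (mdiff X i m) \<in> carrier (mgr Z i)"
      using h(1) 4 M by simp_all
    have "\<ominus>\<^bsub>mgr Z i\<^esub> (mdiff Z (i - 1) (h i m) \<oplus>\<^bsub>mgr Z i\<^esub> s i (d i m)) = h (i + 1) (mdiff X i m)"
      unfolding sd[OF 4] bd_def using c M by (simp add: ab_ac)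
    then show ?case unfolding \<phi>_def using fib_diff[OF M(2,3) s h_closed[OF h(1) 4] dc[OF 4]] closed0_diff[OF d 4 M(1,2)]
      by (simp del: shp_simps(3))
  qed
  have sm: "carrier (mgr ?K i) \<lesssim> (UNIV :: 'm set)" for i using cone_small[where i = "i - 1", of Y Z s] by simp
  obtain P :: "('r, 'a, 'm) cdg_mod" and p where P: "isM P" "p \<in> closed0 A P X"
    "(\<lambda>i m. \<zero>\<^bsub>mgr ?K i\<^esub>, \<lambda>i z. \<phi> i (p i z)) \<in> htpy_rel A P ?K" "\<And>j. acyc j ?K \<Longrightarrow> qis j P X p"
    by (rule fibre_exists[OF M(1) K \<phi> sm]) blast
  have o: "(\<lambda>i. snd) \<in> closed0 A ?K Y" by (rule fib_out_map[OF M(2,3) s])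
  have "(\<lambda>i m. snd \<zero>\<^bsub>mgr ?K i\<^esub>, \<lambda>i z. snd (\<phi> i (p i z))) \<in> htpy_rel A P Y"
    using htpy_comp[OF P(1) K M(2) P(3) htpy_cong[OF K M(2) o o]] by simp
  then have "(\<lambda>i m. \<zero>\<^bsub>mgr Y i\<^esub>, \<lambda>i z. f i (p i z) \<ominus>\<^bsub>mgr Y i\<^esub> g i (p i z)) \<in> htpy_rel A P Y"
    by (simp add: \<phi>_def d_def)
  then have "(\<lambda>i z. g i (p i z), \<lambda>i z. f i (p i z)) \<in> htpy_rel A P Y"
    using htpy_minus[OF P(1) M(2) closed0_comp[OF P(2) g P(1) M(1,2)] closed0_comp[OF P(2) f P(1) M(1,2)]] by simp
  then have "(\<lambda>i z. f i (p i z), \<lambda>i z. g i (p i z)) \<in> htpy_rel A P Y"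
    using htpy_equiv[OF P(1) M(2)] by (meson equivE symE)
  then show thesis using that[OF P(1,2)] P(4) ac by blast
qed

lemma H_fractions: "fractions H NN"
proof (intro fractions.intro fractions_axioms.intro Hot_is_cat)
  fix X assume "X \<in> Obj H"
  then show "Idm H X \<in> cone_in H NN X X"
    using cone_in_hcls[of X X "\<lambda>i x. x"] qis_strict_iso[of X X "\<lambda>i x. x" "\<lambda>i x. x"] by simp
next
  fix X Y Z F G assume h: "X \<in> Obj H" "Y \<in> Obj H" "Z \<in> Obj H" "F \<in> cone_in H NN X Y" "G \<in> cone_in H NN Y Z"
  have M: "isM X" "isM Y" "isM Z" using h by auto
  obtain f where f: "f \<in> closed0 A X Y" "F = hcls A X Y f" "\<And>j. j \<le> n \<Longrightarrow> qis j X Y f" by (rule cone_inE[OF M(1,2) h(4)]) blast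
  obtain g where g: "g \<in> closed0 A Y Z" "G = hcls A Y Z g" "\<And>j. j \<le> n \<Longrightarrow> qis j Y Z g" by (rule cone_inE[OF M(2,3) h(5)]) blast
  show "Comp H X Y Z G F \<in> cone_in H NN X Z"
    unfolding f(2) g(2) Hot_comp[OF M f(1) g(1)] cone_in_hcls[OF M(1,3) closed0_comp[OF f(1) g(1) M]]
    using qis_comp[OF M f(1) g(1) f(3) g(3)] by blast
next
  fix X Y Z F G assume h: "X \<in> Obj H" "Y \<in> Obj H" "Z \<in> Obj H" "F \<in> Hom H X Y" "G \<in> cone_in H NN Y Z"
    "Comp H X Y Z G F \<in> cone_in H NN X Z"
  have M: "isM X" "isM Y" "isM Z" using h by auto
  obtain f where f: "f \<in> closed0 A X Y" "F = hcls A X Y f" by (rule Hot_homE[OF h(4)])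
  obtain g where g: "g \<in> closed0 A Y Z" "G = hcls A Y Z g" "\<And>j. j \<le> n \<Longrightarrow> qis j Y Z g" by (rule cone_inE[OF M(2,3) h(5)]) blast
  have "qis j X Z (\<lambda>i x. g i (f i x))" if "j \<le> n" for j
    using h(6) that unfolding f(2) g(2) Hot_comp[OF M f(1) g(1)] cone_in_hcls[OF M(1,3) closed0_comp[OF f(1) g(1) M]] by blast
  then show "F \<in> cone_in H NN X Y"
    unfolding f(2) cone_in_hcls[OF M(1,2) f(1)] using qis_cancel[OF M f(1) g(1) _ g(3)] by blast
next
  fix X Y Z F S assume h: "X \<in> Obj H" "Y \<in> Obj H" "Z \<in> Obj H" "F \<in> Hom H X Z" "S \<in> cone_in H NN Y Z"
  have M: "isM X" "isM Y" "isM Z" using h by auto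
  obtain f where f: "f \<in> closed0 A X Z" "F = hcls A X Z f" by (rule Hot_homE[OF h(4)])
  obtain s where s: "s \<in> closed0 A Y Z" "S = hcls A Y Z s" "\<And>j. j \<le> n \<Longrightarrow> qis j Y Z s" by (rule cone_inE[OF M(2,3) h(5)]) blast
  obtain P :: "('r, 'a, 'm) cdg_mod" and p q where P: "isM P" "p \<in> closed0 A P X" "q \<in> closed0 A P Y" "\<And>j. j \<le> n \<Longrightarrow> qis j P X p"
    "(\<lambda>i x. f i (p i x), \<lambda>i x. s i (q i x)) \<in> htpy_rel A P Z" by (rule Hot_ore[OF M f(1) s(1,3)], assumption, rule that)
  have "hcls A P X p \<in> cone_in H NN P X" using cone_in_hcls[OF P(1) M(1) P(2)] P(4) by blast
  moreover have "Comp H P X Z F (hcls A P X p) = Comp H P Y Z S (hcls A P Y q)"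
    unfolding f(2) s(2) using Hot_comp[OF P(1) M(1,3) P(2) f(1)] Hot_comp[OF P(1) M(2,3) P(3) s(1)]
      equiv_class_eq[OF htpy_equiv[OF P(1) M(3)] P(5)] by simp
  ultimately show "\<exists>P\<in>Obj H. \<exists>p\<in>cone_in H NN P X. \<exists>q\<in>Hom H P Y. Comp H P X Z F p = Comp H P Y Z S q"
    using P(1) hcls_hom[OF P(3)] by (intro bexI[of _ P] bexI[of _ "hcls A P X p"] bexI[of _ "hcls A P Y q"]) simp_all
next
  fix X Y Z F G S assume h: "X \<in> Obj H" "Y \<in> Obj H" "Z \<in> Obj H" "F \<in> Hom H X Y" "G \<in> Hom H X Y" "S \<in> cone_in H NN Y Z"
    "Comp H X Y Z S F = Comp H X Y Z S G"
  have M: "isM X" "isM Y" "isM Z" using h by auto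
  obtain f where f: "f \<in> closed0 A X Y" "F = hcls A X Y f" by (rule Hot_homE[OF h(4)])
  obtain g where g: "g \<in> closed0 A X Y" "G = hcls A X Y g" by (rule Hot_homE[OF h(5)])
  obtain s where s: "s \<in> closed0 A Y Z" "S = hcls A Y Z s" "\<And>j. j \<le> n \<Longrightarrow> qis j Y Z s" by (rule cone_inE[OF M(2,3) h(6)]) blast
  have e: "(\<lambda>i x. s i (f i x), \<lambda>i x. s i (g i x)) \<in> htpy_rel A X Z"
    using h(7) unfolding f(2) g(2) s(2) Hot_comp[OF M f(1) s(1)] Hot_comp[OF M g(1) s(1)]
      hcls_eq_iff[OF M(1,3) closed0_comp[OF f(1) s(1) M] closed0_comp[OF g(1) s(1) M]] .
  obtain P :: "('r, 'a, 'm) cdg_mod" and p where P: "isM P" "p \<in> closed0 A P X" "\<And>j. j \<le> n \<Longrightarrow> qis j P X p"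
    "(\<lambda>i x. f i (p i x), \<lambda>i x. g i (p i x)) \<in> htpy_rel A P Y" by (rule Hot_cancel[OF M f(1) g(1) s(1,3) e], assumption, rule that)
  have "hcls A P X p \<in> cone_in H NN P X" using cone_in_hcls[OF P(1) M(1) P(2)] P(3) by blast
  moreover have "Comp H P X Y F (hcls A P X p) = Comp H P X Y G (hcls A P X p)"
    unfolding f(2) g(2) using Hot_comp[OF P(1) M(1,2) P(2) f(1)] Hot_comp[OF P(1) M(1,2) P(2) g(1)]
      equiv_class_eq[OF htpy_equiv[OF P(1) M(2)] P(4)] by simp
  ultimately show "\<exists>P\<in>Obj H. \<exists>p\<in>cone_in H NN P X. Comp H P X Y F p = Comp H P X Y G p"
    using P(1) by (intro bexI[of _ P] bexI[of _ "hcls A P X p"]) simp_all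
qed

end

section \<open>The semiorthogonal decomposition\<close>

context tau_universe
begin

sublocale fr: fractions H NN by (rule H_fractions)

lemma shift_W_image:
  assumes "X \<in> Obj H" "Y \<in> Obj H" "S \<in> cone_in H NN X Y"
  shows "FM shift_func X Y S \<in> cone_in H NN (FO shift_func X) (FO shift_func Y)"
proof -
  have M: "isM X" "isM Y" using assms by auto
  obtain s where s: "s \<in> closed0 A X Y" "S = hcls A X Y s" "\<And>j. j \<le> n \<Longrightarrow> qis j X Y s"
    by (rule cone_inE[OF M assms(3)], rule that)
  have "qis j (shift_mod X) (shift_mod Y) (\<lambda>i. s (i + 1))" if "j \<le> n" for j
    using qis_shp[OF M s(3)[OF that], of 1] by (simp add: shift_mod_shp)
  then show ?thesis
    using cone_in_hcls[OF shift_module[OF M(1)] shift_module[OF M(2)] shift_closed0[OF M s(1)]] M s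
    by (simp add: shift_func_def Shm_hcls)
qed

sublocale sh: frac_functor H NN H NN shift_func
  by (intro frac_functor.intro H_fractions shift_is_func frac_functor_axioms.intro) (rule shift_W_image)

abbreviation DD where "DD \<equiv> verdier H NN"

lemma Dist_DD:
  assumes t: "(X, Y, Z, u, v, w) \<in> Dist H"
  shows "(X, Y, Z, fr.Q X Y u, fr.Q Y Z v, fr.Q Z (Sh H X) w) \<in> Dist DD"
proof -
  let ?t = "(X, Y, Z, fr.Q X Y u, fr.Q Y Z v, fr.Q Z (Sh H X) w)"
  have "triangle_in (Hot_shift_cat R A) (X, Y, Z, u, v, w)" using t unfolding Dist_Hot iso_closure_def by blast
  then have h: "X \<in> Obj H" "Y \<in> Obj H" "Z \<in> Obj H" "u \<in> Hom H X Y" "v \<in> Hom H Y Z" "w \<in> Hom H Z (Sh H X)"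
    unfolding triangle_in_def prod.case Hot_shift_cat_simps by auto
  have S: "Sh H M \<in> Obj H" if "M \<in> Obj H" for M using that shift_module by simp
  have ti: "triangle_in (verdier_shift_cat H NN) ?t"
    unfolding triangle_in_def prod.case extend_verdier_simps
    using h S[OF h(1)] fr.quot_hom by (simp only: fr.verdier_simps(1) simp_thms)
  have "triangle_iso (verdier_shift_cat H NN) ?t ?t"
  proof (rule triangle_iso_refl[OF _ _ _ ti])
    show "is_cat (verdier_shift_cat H NN)" using fr.verdier_is_cat unfolding is_cat_def extend_verdier_simps .
  next
    fix M assume "M \<in> Obj (verdier_shift_cat H NN)"
    then show "Sh (verdier_shift_cat H NN) M \<in> Obj (verdier_shift_cat H NN)"
      unfolding extend_verdier_simps by (simp only: fr.verdier_simps(1) S)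
  next
    fix M assume "M \<in> Obj (verdier_shift_cat H NN)"
    then have M: "M \<in> Obj H" unfolding extend_verdier_simps by (simp only: fr.verdier_simps(1))
    have [simp]: "FO (verdier_func H NN \<lparr>FO = shift_mod, FM = Shm H\<rparr>) = shift_mod" by (simp add: verdier_func_def)
    then show "Shm (verdier_shift_cat H NN) M M (Idm (verdier_shift_cat H NN) M) = Idm (verdier_shift_cat H NN) (Sh (verdier_shift_cat H NN) M)"
      unfolding extend_verdier_simps Shm_verdier
      using is_func.ident[OF sh.V_is_func, of M] M by (simp only: fr.verdier_simps(1)) (simp add: shift_func_def)
  qed
  then show ?thesis using ti t unfolding Dist_verdier iso_closure_def by blast
qed

lemma W_acyc:
  assumes "isM X" "isM Y" "S \<in> cone_in H NN X Y" "j \<le> n"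
  shows "acyc j X \<longleftrightarrow> acyc j Y"
proof -
  obtain s where "s \<in> closed0 A X Y" "S = hcls A X Y s" "\<And>j. j \<le> n \<Longrightarrow> qis j X Y s"
    by (rule cone_inE[OF assms(1-3)], rule that)
  then show ?thesis using acyc_qis assms by blast
qed

text \<open>Cohomology of a graded piece is not constructed as a functor on the quotient; roofs are
  used instead. Writing \<Phi> and its inverse \<Psi> as roofs, \<Phi> \<Psi> = id yields a
  composite V -> Z -> Y in \<open>W\<close>, where \<open>Z\<close> is the apex of \<Phi> and hence
  acyclic along with \<open>X\<close>. Then \<open>acyc_through\<close> applies.\<close>

lemma iso_DD_acyc:
  assumes M: "isM X" "isM Y" and \<Phi>: "iso_in DD X Y \<Phi>" and j: "j \<le> n" and ac: "acyc j X"
  shows "acyc j Y"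
proof -
  obtain \<Psi> where h: "\<Phi> \<in> Hom DD X Y" "\<Psi> \<in> Hom DD Y X" "Comp DD Y X Y \<Phi> \<Psi> = Idm DD Y"
    using \<Phi> by (rule iso_inE)
  obtain Z s f where 1: "\<Phi> = fr.rc X Y (Z, s, f)" "Z \<in> Obj H" "s \<in> fr.W Z X" "f \<in> Hom H Z Y" by (rule fr.hom_rcE[OF h(1)])
  obtain Z' s' f' where 2: "\<Psi> = fr.rc Y X (Z', s', f')" "Z' \<in> Obj H" "s' \<in> fr.W Z' Y" "f' \<in> Hom H Z' X" by (rule fr.hom_rcE[OF h(2)])
  have o: "X \<in> Obj H" "Y \<in> Obj H" using M by simp_all
  obtain P p q where P: "P \<in> Obj H" "p \<in> fr.W P Z'" "q \<in> Hom H P Z" "fr.c P Z' X f' p = fr.c P Z X s q"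
    using fr.ore[OF 2(2) 1(2) o(1) 2(4) 1(3)] by blast
  have "fr.rc Y Y (P, fr.c P Z' Y s' p, fr.c P Z Y f q) = fr.rc Y Y (Y, Idm H Y, Idm H Y)"
    using h(3) unfolding 1(1) 2(1) fr.comp_rc[OF o(2,1,2) 2(2) 1(2) P(1) 2(3,4) 1(3,4) P(2-4)]
    by (simp only: fr.verdier_simps quot_mor_def)
  moreover have "(P, fr.c P Z' Y s' p, fr.c P Z Y f q) \<in> roofs H NN Y Y" "(Y, Idm H Y, Idm H Y) \<in> roofs H NN Y Y"
    unfolding fr.roof_iff using P 1 2 o fr.W_comp[OF P(1) 2(2) o(2) P(2) 2(3)] fr.comp_hom[OF P(1) 1(2) o(2) P(3) 1(4)] fr.W_id[OF o(2)] fr.id_hom[OF o(2)]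
    by blast+
  ultimately have "((P, fr.c P Z' Y s' p, fr.c P Z Y f q), (Y, Idm H Y, Idm H Y)) \<in> roof_rel H NN Y Y"
    using fr.rc_eq_iff[OF o(2,2)] by blast
  then obtain V r r' where V: "V \<in> Obj H" "r \<in> fr.W V P" "r' \<in> fr.W V Y"
    "fr.c V P Y (fr.c P Z Y f q) r = fr.c V Y Y (Idm H Y) r'"
    by (rule fr.roof_relE[OF _ o(2,2)]) (rule that)
  have "fr.c V Z Y f (fr.c V P Z q r) = r'"
    using V(4) fr.assoc[OF V(1) P(1) 1(2) o(2) fr.W_hom[OF V(2)] P(3) 1(4)] fr.id_comp[OF V(1) o(2) fr.W_hom[OF V(3)]] by metis
  moreover have "fr.c V P Z q r \<in> Hom H V Z" using fr.comp_hom[OF V(1) P(1) 1(2) fr.W_hom[OF V(2)] P(3)] .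
  ultimately obtain g where g: "g \<in> Hom H V Z" "fr.c V Z Y f g \<in> fr.W V Y" using V(3) by metis
  have iM: "isM V" "isM Z" using V(1) 1(2) by simp_all
  obtain f0 where f0: "f0 \<in> closed0 A Z Y" "f = hcls A Z Y f0" by (rule Hot_homE[OF 1(4)])
  obtain g0 where g0: "g0 \<in> closed0 A V Z" "g = hcls A V Z g0" by (rule Hot_homE[OF g(1)])
  have "qis j V Y (\<lambda>i x. f0 i (g0 i x))"
    using g(2) j unfolding f0(2) g0(2) Hot_comp[OF iM M(2) g0(1) f0(1)] cone_in_hcls[OF iM(1) M(2) closed0_comp[OF g0(1) f0(1) iM M(2)]] by blast
  moreover have "acyc j Z" using W_acyc[OF iM(2) M(1) 1(3) j] ac by blast
  ultimately show ?thesis using acyc_through[OF iM M(2) g0(1) f0(1)] by blast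
qed

lemma null_refine:
  fixes X K :: "('r, 'a, 'm) cdg_mod"
  assumes M: "isM X" "isM K" and f: "f \<in> closed0 A X K" and K: "K \<in> NN"
  obtains P :: "('r, 'a, 'm) cdg_mod" and p where "isM P" "p \<in> closed0 A P X" "hcls A P X p \<in> fr.W P X"
    "(\<lambda>i m. \<zero>\<^bsub>mgr K i\<^esub>, \<lambda>i z. f i (p i z)) \<in> htpy_rel A P K"
proof -
  obtain P :: "('r, 'a, 'm) cdg_mod" and p where P: "isM P" "p \<in> closed0 A P X"
    "(\<lambda>i m. \<zero>\<^bsub>mgr K i\<^esub>, \<lambda>i z. f i (p i z)) \<in> htpy_rel A P K" "\<And>j. acyc j K \<Longrightarrow> qis j P X p"
    by (rule fibre_exists[OF M f small_any]) (rule that)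
  have "hcls A P X p \<in> fr.W P X" using cone_in_hcls[OF P(1) M(1) P(2)] P(4) K by (simp add: NN_def)
  then show thesis using that P by blast
qed

text \<open>Over the fibre of \<open>f\<close> the composite is null-homotopic, and the projection
  from that fibre is invertible in the quotient because \<open>K\<close> is n-acyclic.\<close>

lemma quot_factor_zero:
  fixes X K Y :: "('r, 'a, 'm) cdg_mod"
  assumes M: "isM X" "isM K" "isM Y" and f: "f \<in> closed0 A X K" and g: "g \<in> closed0 A K Y" and K: "K \<in> NN"
  shows "fr.Q X Y (hcls A X Y (\<lambda>i x. g i (f i x))) = fr.Q X Y (hcls A X Y (\<lambda>i x. \<zero>\<^bsub>mgr Y i\<^esub>))"
proof -
  obtain P :: "('r, 'a, 'm) cdg_mod" and p where P: "isM P" "p \<in> closed0 A P X" "hcls A P X p \<in> fr.W P X"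
    "(\<lambda>i m. \<zero>\<^bsub>mgr K i\<^esub>, \<lambda>i z. f i (p i z)) \<in> htpy_rel A P K" by (rule null_refine[OF M(1,2) f K])
  have gf: "(\<lambda>i x. g i (f i x)) \<in> closed0 A X Y" by (rule closed0_comp[OF f g M])
  have z: "(\<lambda>i x. \<zero>\<^bsub>mgr Y i\<^esub>) \<in> closed0 A X Y" using M by simp
  have "(\<lambda>i m. g i \<zero>\<^bsub>mgr K i\<^esub>, \<lambda>i z. g i (f i (p i z))) \<in> htpy_rel A P Y"
    using htpy_comp[OF P(1) M(2,3) P(4) htpy_cong[OF M(2,3) g g]] by simp
  then have "(\<lambda>i m. \<zero>\<^bsub>mgr Y i\<^esub>, \<lambda>i z. g i (f i (p i z))) \<in> htpy_rel A P Y"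
    using closed0_zero(1)[OF g M(2,3)] by simp
  from equiv_class_eq[OF htpy_equiv[OF P(1) M(3)] this]
  have "hcls A P Y (\<lambda>i z. g i (f i (p i z))) = hcls A P Y (\<lambda>i m. \<zero>\<^bsub>mgr Y i\<^esub>)" ..
  then have "fr.c P X Y (hcls A X Y (\<lambda>i x. g i (f i x))) (hcls A P X p) = fr.c P X Y (hcls A X Y (\<lambda>i x. \<zero>\<^bsub>mgr Y i\<^esub>)) (hcls A P X p)"
    unfolding Hot_comp[OF P(1) M(1,3) P(2) gf] Hot_comp[OF P(1) M(1,3) P(2) z] .
  then show ?thesis
    by (intro fr.quot_eqI[of X Y _ _ P "hcls A P X p"]) (use M P hcls_hom[OF gf] hcls_hom[OF z] in simp_all)
qed

text \<open>The subcategories of the decomposition in terms of elements; \<open>only_Gr_TT\<close>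
  identifies them with \<open>only_Gr\<close>.\<close>

definition TT where "TT i = {M. isM M \<and> (\<forall>j\<le>n. j \<noteq> i \<longrightarrow> acyc j M)}"

lemma zero_in_DD:
  assumes "X \<in> NN" shows "is_zero DD X"
proof -
  have M: "isM X" using assms by (simp add: NN_def)
  have "fr.Q X X (hcls A X X (\<lambda>i x. x)) = fr.Q X X (hcls A X X (\<lambda>i x. \<zero>\<^bsub>mgr X i\<^esub>))"
    using quot_factor_zero[OF M M M closed0_id[OF M] closed0_id[OF M] assms] by simp
  then show ?thesis unfolding is_zero_def using M by simp
qed

text \<open>For l < j the kernel \<open>tp M j\<close> lies in \<open>tp M (Suc l)\<close>, so these
  pieces are unchanged; the quotient is killed by \<open>tau j\<close>, so the remaining pieces
  vanish.\<close>

lemma truncation_exists: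
  fixes M :: "('r, 'a, 'm) cdg_mod"
  assumes M: "isM M"
  obtains Q :: "('r, 'a, 'm) cdg_mod" and \<pi> where "isM Q" "surj_map M Q \<pi>"
    "\<And>i x. x \<in> carrier (mgr M i) \<Longrightarrow> \<pi> i x = \<zero>\<^bsub>mgr Q i\<^esub> \<longleftrightarrow> x \<in> tp M j i"
    "\<And>l. l < j \<Longrightarrow> qis l M Q \<pi>" "\<And>l. j \<le> l \<Longrightarrow> acyc l Q"
    "\<And>i y. y \<in> carrier (mgr Q i) \<Longrightarrow> T j Q i y = \<zero>\<^bsub>mgr Q i\<^esub>"
proof -
  obtain Q :: "('r, 'a, 'm) cdg_mod" and \<pi> where Q: "isM Q" "surj_map M Q \<pi>"
    "\<And>i x. x \<in> carrier (mgr M i) \<Longrightarrow> \<pi> i x = \<zero>\<^bsub>mgr Q i\<^esub> \<longleftrightarrow> x \<in> tp M j i"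
    by (rule quotient_exists[OF M tp_submod[OF M, of j] small_any]) (rule that)
  have q: "qis l M Q \<pi>" if "l < j" for l
    by (rule qis_surj[OF M Q(1,2)]) (use Q(3) tp_mono[OF M, of "Suc l" j] that in auto)
  have T: "T l Q i y = \<zero>\<^bsub>mgr Q i\<^esub>" if l: "j \<le> l" and y: "y \<in> carrier (mgr Q i)" for l i y
  proof -
    obtain x where x: "x \<in> carrier (mgr M i)" "y = \<pi> i x" by (rule surj_mapE[OF Q(2) y])
    have "T l Q i y = \<pi> i (T l M i x)" using T_ghom[OF closed0_ghom[OF surj_mapD[OF Q(2)]] x(1) Q(1), of l] x by simp
    moreover have "T l M i x \<in> tp M j i" using tp_mono[OF M l, of i] tpI[OF x(1) refl] by blast
    ultimately show ?thesis using Q(3) x(1) M by simp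
  qed
  show thesis by (rule that[OF Q q]) (use T acyc_if_tp_zero[OF Q(1)] in auto)
qed

text \<open>Truncating at i + 1 discards only the pieces above i, and these are acyclic for a module
  of \<open>TT i\<close>. The truncation is therefore inverted in the quotient and supplies a
  representative killed by \<open>tau (Suc i)\<close>.\<close>

lemma truncation_W:
  fixes M Q :: "('r, 'a, 'm) cdg_mod"
  assumes "M \<in> TT i" "isM Q" "surj_map M Q \<pi>" "\<And>l. l < Suc i \<Longrightarrow> qis l M Q \<pi>" "\<And>l. Suc i \<le> l \<Longrightarrow> acyc l Q"
  shows "hcls A M Q \<pi> \<in> fr.W M Q" "Q \<in> TT i"
proof -
  have M: "isM M" "\<And>j. j \<le> n \<Longrightarrow> j \<noteq> i \<Longrightarrow> acyc j M" using assms(1) by (auto simp: TT_def)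
  note \<pi> = surj_mapD[OF assms(3)]
  have both: "qis l M Q \<pi>" if "acyc l M" "acyc l Q" for l
  proof (rule qisI)
    fix i x assume "x \<in> Zc M l i" then show "x \<in> Bd M l i" by (rule acycD[OF that(1)])
  next
    fix i y assume y: "y \<in> Zc Q l i"
    have "\<zero>\<^bsub>mgr M i\<^esub> \<in> Zc M l i" using tp_zero[OF M(1)] M(1) by (intro ZcI) simp_all
    moreover have "y \<ominus>\<^bsub>mgr Q i\<^esub> \<pi> i \<zero>\<^bsub>mgr M i\<^esub> \<in> Bd Q l i"
      using acycD[OF that(2) y] closed0_zero(1)[OF \<pi> M(1) assms(2)] y assms(2) by simp
    ultimately show "\<exists>x\<in>Zc M l i. y \<ominus>\<^bsub>mgr Q i\<^esub> \<pi> i x \<in> Bd Q l i" by blast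
  qed
  have "qis l M Q \<pi>" if "l \<le> n" for l
  proof (cases "l < Suc i")
    case False then show ?thesis using both[of l] M(2)[OF that] assms(5)[of l] by simp
  qed (rule assms(4))
  then show W: "hcls A M Q \<pi> \<in> fr.W M Q" using cone_in_hcls[OF M(1) assms(2) \<pi>] by blast
  show "Q \<in> TT i" unfolding TT_def using W_acyc[OF M(1) assms(2) W] M assms(2) by blast
qed

lemma qis_acyc:
  assumes M: "isM M" "isM N" and f: "f \<in> closed0 A M N" and ac: "acyc j M" "acyc j N"
  shows "qis j M N f"
proof (rule qisI)
  fix i x assume "x \<in> Zc M j i" then show "x \<in> Bd M j i" by (rule acycD[OF ac(1)])
next
  fix i y assume y: "y \<in> Zc N j i"
  have "\<zero>\<^bsub>mgr M i\<^esub> \<in> Zc M j i" using tp_zero[OF M(1)] M(1) by (intro ZcI) simp_all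
  moreover have "y \<ominus>\<^bsub>mgr N i\<^esub> f i \<zero>\<^bsub>mgr M i\<^esub> \<in> Bd N j i"
    using acycD[OF ac(2) y] closed0_zero(1)[OF f M] y M by simp
  ultimately show "\<exists>x\<in>Zc M j i. y \<ominus>\<^bsub>mgr N i\<^esub> f i x \<in> Bd N j i" by blast
qed

text \<open>By \<open>iso_DD_acyc\<close> the triangle may be replaced by the image of one from
  \<open>Hot\<close>, and that one by a standard cone, where a map between acyclic pieces has an
  acyclic cone.\<close>

lemma dist_DD_acyc:
  assumes t: "(X, Y, Z, u, v, w) \<in> Dist DD" and j: "j \<le> n" and ac: "acyc j X" "acyc j Y"
  shows "acyc j Z" "isM Z"
proof -
  obtain X' Y' Z' u' v' w' where t': "(X', Y', Z', u', v', w') \<in> Dist H"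
    and ti: "triangle_in (verdier_shift_cat H NN) (X, Y, Z, u, v, w)"
    and iso: "triangle_iso (verdier_shift_cat H NN) (X, Y, Z, u, v, w) (X', Y', Z', fr.Q X' Y' u', fr.Q Y' Z' v', fr.Q Z' (Sh H X') w')"
    using t unfolding Dist_verdier iso_closure_def by blast
  obtain a b c where abc: "iso_in DD X X' a" "iso_in DD Y Y' b" "iso_in DD Z Z' c"
    using iso unfolding triangle_iso_def prod.case iso_in_def extend_verdier_simps by blast
  have o: "isM X" "isM Y" "isM Z" using ti unfolding triangle_in_def prod.case extend_verdier_simps
    by (simp_all only: fr.verdier_simps(1) Hot_simps(1) mem_Collect_eq)
  show "isM Z" by fact
  obtain M1 M2 C :: "('r, 'a, 'm) cdg_mod" and f a' b' c' where h: "isM X'" "isM Y'" "isM Z'" "isM M1" "isM M2" "isM C"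
    "f \<in> closed0 A M1 M2" "a' \<in> closed0 A X' M1" "b' \<in> closed0 A Y' M2" "c' \<in> closed0 A Z' C" "\<And>j. acyc j C \<longleftrightarrow> qis j M1 M2 f"
    "\<And>j. qis j X' M1 a'" "\<And>j. qis j Y' M2 b'" "\<And>j. qis j Z' C c'"
    by (rule dist_HotE[OF t'], rule that)
  have "acyc j X'" "acyc j Y'" using iso_DD_acyc[OF o(1) h(1) abc(1) j ac(1)] iso_DD_acyc[OF o(2) h(2) abc(2) j ac(2)] .
  then have "acyc j M1" "acyc j M2" using acyc_qis[OF h(1,4,8,12)] acyc_qis[OF h(2,5,9,13)] by blast+
  then have "acyc j C" using h(11) qis_acyc[OF h(4,5,7)] by blast
  then have Z': "acyc j Z'" using acyc_qis[OF h(3,6,10,14)] by blast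
  obtain d where d: "iso_in DD Z' Z d" using abc(3) by (rule is_cat.iso_sym[OF fr.verdier_is_cat])
  show "acyc j Z" by (rule iso_DD_acyc[OF h(3) o(3) d j Z'])
qed

lemma TT_triangulated: "triangulated_sub DD (TT i)"
  unfolding triangulated_sub_def
proof (intro conjI)
  show "TT i \<subseteq> Obj DD" by (auto simp: TT_def)
  have "T j zero_mod i x = \<zero>\<^bsub>mgr zero_mod i\<^esub>" for j i and x :: 'm by (simp add: T_def zero_mod_def)
  then have "zero_mod \<in> NN" unfolding NN_def using zero_module acyc_if_tp_zero[OF zero_module] by blast
  then show "\<exists>X\<in>TT i. is_zero DD X" using zero_in_DD by (auto simp: TT_def NN_def intro!: bexI[of _ zero_mod])
  show "\<forall>X\<in>TT i. \<forall>Y\<in>Obj DD. (\<exists>f. iso_in DD X Y f) \<longrightarrow> Y \<in> TT i"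
  proof (intro ballI impI, elim exE)
    fix X Y f assume h: "X \<in> TT i" "Y \<in> Obj DD" "iso_in DD X Y f"
    have Y: "isM Y" using h(2) by simp
    then show "Y \<in> TT i" using iso_DD_acyc[OF _ Y h(3)] h(1) by (auto simp: TT_def)
  qed
  show "\<forall>X\<in>Obj DD. (Sh DD X \<in> TT i) = (X \<in> TT i)"
    by (auto simp: TT_def shift_mod_shp acyc_shp shp_module)
  show "\<forall>X Y Z u v w. (X, Y, Z, u, v, w) \<in> Dist DD \<longrightarrow> X \<in> TT i \<longrightarrow> Y \<in> TT i \<longrightarrow> Z \<in> TT i"
  proof (intro allI impI)
    fix X Y Z u v w assume h: "(X, Y, Z, u, v, w) \<in> Dist DD" "X \<in> TT i" "Y \<in> TT i"
    have "isM Z" using h(1) unfolding Dist_verdier iso_closure_def triangle_in_def mem_Collect_eq prod.case extend_verdier_simps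
      by (simp only: fr.verdier_simps(1) Hot_simps(1) mem_Collect_eq)
    then show "Z \<in> TT i" using dist_DD_acyc(1)[OF h(1)] h(2,3) by (auto simp: TT_def)
  qed
qed

lemma TT_orthogonal:
  assumes ij: "i < j" "j \<le> n" and X: "X \<in> TT j" and Y: "Y \<in> TT i"
  shows "Hom DD X Y = {Zerom DD X Y}"
proof -
  have M: "isM X" "isM Y" using X Y by (auto simp: TT_def)
  have o: "X \<in> Obj H" "Y \<in> Obj H" using M by simp_all
  have zh: "hcls A M N (\<lambda>i x. \<zero>\<^bsub>mgr N i\<^esub>) \<in> Hom H M N" if "isM M" "isM N" for M N :: "('r, 'a, 'm) cdg_mod"
    by (rule hcls_hom) (use that in simp)
  have "\<Phi> = Zerom DD X Y" if \<Phi>: "\<Phi> \<in> Hom DD X Y" for \<Phi>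
  proof -
    obtain Z s f where 1: "\<Phi> = fr.rc X Y (Z, s, f)" "Z \<in> Obj H" "s \<in> fr.W Z X" "f \<in> Hom H Z Y" by (rule fr.hom_rcE[OF \<Phi>])
    have Z: "isM Z" using 1 by simp
    obtain f0 where f0: "f0 \<in> closed0 A Z Y" "f = hcls A Z Y f0" by (rule Hot_homE[OF 1(4)])
    obtain Y' :: "('r, 'a, 'm) cdg_mod" and y where Y': "isM Y'" "surj_map Y Y' y"
      "\<And>l x. x \<in> carrier (mgr Y l) \<Longrightarrow> y l x = \<zero>\<^bsub>mgr Y' l\<^esub> \<longleftrightarrow> x \<in> tp Y (Suc i) l"
      "\<And>l. l < Suc i \<Longrightarrow> qis l Y Y' y" "\<And>l. Suc i \<le> l \<Longrightarrow> acyc l Y'"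
      by (rule truncation_exists[OF M(2), where j = "Suc i"], rule that)
    obtain Z' :: "('r, 'a, 'm) cdg_mod" and z where Z': "isM Z'" "surj_map Z Z' z"
      "\<And>l x. x \<in> carrier (mgr Z l) \<Longrightarrow> z l x = \<zero>\<^bsub>mgr Z' l\<^esub> \<longleftrightarrow> x \<in> tp Z (Suc i) l"
      "\<And>l. l < Suc i \<Longrightarrow> qis l Z Z' z" "\<And>l. Suc i \<le> l \<Longrightarrow> acyc l Z'"
      by (rule truncation_exists[OF Z, where j = "Suc i"], rule that)
    note y = surj_mapD[OF Y'(2)] and z = surj_mapD[OF Z'(2)]
    have yW: "hcls A Y Y' y \<in> fr.W Y Y'" by (rule truncation_W[OF Y Y'(1,2,4,5)])
    have yf: "(\<lambda>i x. y i (f0 i x)) \<in> closed0 A Z Y'" by (rule closed0_comp[OF f0(1) y Z M(2) Y'(1)])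
    \<comment> \<open>The pieces up to i agree with those of \<open>Z\<close>, hence are acyclic
      like those of \<open>X\<close>, whose exceptional piece is j > i. From i + 1 on the truncation
      has none.\<close>
    have "acyc l Z'" if l: "l \<le> n" for l
    proof (cases "l < Suc i")
      case True
      then have "acyc l X" using X ij l by (auto simp: TT_def)
      then have "acyc l Z" using W_acyc[OF Z M(1) 1(3) l] by blast
      then show ?thesis using acyc_qis[OF Z Z'(1) z Z'(4)[OF True]] by blast
    qed (use Z'(5) in auto)
    then have Z'N: "Z' \<in> NN" using Z'(1) by (simp add: NN_def)
    obtain g where g: "g \<in> closed0 A Z' Y'" "\<And>l x. x \<in> carrier (mgr Z l) \<Longrightarrow> g l (z l x) = y l (f0 l x)"
    proof (rule factor_closed0[OF Z Z'(1) Y'(1) Z'(2) yf])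
      fix l x assume x: "x \<in> carrier (mgr Z l)" "z l x = \<zero>\<^bsub>mgr Z' l\<^esub>"
      then have "f0 l x \<in> tp Y (Suc i) l" using Z'(3) tp_closed0[OF f0(1) Z M(2)] by blast
      then show "y l (f0 l x) = \<zero>\<^bsub>mgr Y' l\<^esub>" using Y'(3) f0(1) x by simp
    qed (rule that)
    have "hcls A Z Y' (\<lambda>i x. y i (f0 i x)) = hcls A Z Y' (\<lambda>i x. g i (z i x))"
      by (rule hcls_cong[OF Z Y'(1) yf closed0_comp[OF z g(1) Z Z'(1) Y'(1)]]) (use g(2) in simp)
    then have Qyf: "fr.Q Z Y' (hcls A Z Y' (\<lambda>i x. y i (f0 i x))) = fr.Q Z Y' (hcls A Z Y' (\<lambda>i x. \<zero>\<^bsub>mgr Y' i\<^esub>))"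
      using quot_factor_zero[OF Z Z'(1) Y'(1) z g(1) Z'N] by simp
    have o': "Y' \<in> Obj H" "Z \<in> Obj H" using Y' Z by simp_all
    have yz: "fr.c Z Y Y' (hcls A Y Y' y) (hcls A Z Y (\<lambda>i x. \<zero>\<^bsub>mgr Y i\<^esub>)) = hcls A Z Y' (\<lambda>i x. \<zero>\<^bsub>mgr Y' i\<^esub>)"
      using Hot_comp[OF Z M(2) Y'(1) closed0_zero_map[OF Z M(2)] y] closed0_zero(1)[OF y M(2) Y'(1)] by simp
    have "Comp DD Z Y Y' (fr.Q Y Y' (hcls A Y Y' y)) (fr.Q Z Y f)
      = Comp DD Z Y Y' (fr.Q Y Y' (hcls A Y Y' y)) (fr.Q Z Y (hcls A Z Y (\<lambda>i x. \<zero>\<^bsub>mgr Y i\<^esub>)))"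
      unfolding fr.quot_comp[OF o'(2) o(2) o'(1) 1(4) fr.W_hom[OF yW]]
        fr.quot_comp[OF o'(2) o(2) o'(1) zh[OF Z M(2)] fr.W_hom[OF yW]] yz
      using Qyf Hot_comp[OF Z M(2) Y'(1) f0(1) y] f0(2) by simp
    \<comment> \<open>So far only the composite of \<open>f\<close> with \<open>y\<close> vanishes.
      As \<open>Y\<close> lies in \<open>TT i\<close>, its truncation map \<open>y\<close> is
      invertible in the quotient and can be cancelled.\<close>
    then have "fr.Q Z Y f = fr.Q Z Y (hcls A Z Y (\<lambda>i x. \<zero>\<^bsub>mgr Y i\<^esub>))"
      by (rule is_cat.iso_cancel_left[OF fr.verdier_is_cat _ _ _ fr.quot_W_iso[OF o'(1) o(2) yW]
            fr.quot_hom[OF o'(2) o(2) 1(4)] fr.quot_hom[OF o'(2) o(2) zh[OF Z M(2)]], rotated 3])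
         (use o o' in \<open>simp_all only: fr.verdier_simps\<close>)
    then have "\<Phi> = fr.rc X Y (Z, s, hcls A Z Y (\<lambda>i x. \<zero>\<^bsub>mgr Y i\<^esub>))"
      unfolding 1(1) fr.rc_quot[OF o o'(2) 1(3,4), symmetric] fr.rc_quot[OF o o'(2) 1(3) zh[OF Z M(2)], symmetric] by simp
    also have "\<dots> = fr.rc X Y (Z, fr.c Z X X (Idm H X) s, fr.c Z X Y (hcls A X Y (\<lambda>i x. \<zero>\<^bsub>mgr Y i\<^esub>)) s)"
    proof -
      obtain s0 where s0: "s0 \<in> closed0 A Z X" "s = hcls A Z X s0" by (rule Hot_homE[OF fr.W_hom[OF 1(3)]])
      then show ?thesis using fr.id_comp[OF o'(2) o(1) fr.W_hom[OF 1(3)]]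
          Hot_comp[OF Z M s0(1) closed0_zero_map[OF M]] by simp
    qed
    also have "\<dots> = fr.rc X Y (X, Idm H X, hcls A X Y (\<lambda>i x. \<zero>\<^bsub>mgr Y i\<^esub>))"
      by (rule fr.rc_refine[OF o o(1) o'(2) fr.W_id[OF o(1)] zh[OF M] 1(3)])
    finally show ?thesis by (simp only: fr.verdier_simps Hot_simps quot_mor_def)
  qed
  moreover have "Zerom DD X Y \<in> Hom DD X Y"
    using fr.quot_hom[OF o zh[OF M]] by (simp only: fr.verdier_simps(5) Hot_simps(4))
  ultimately show ?thesis by blast
qed

lemma filtration_step:
  assumes M: "isM M" and ac: "\<And>j. j < i \<Longrightarrow> j \<le> n \<Longrightarrow> acyc j M"
  obtains P f C v w where "isM P" "\<And>j. j < Suc i \<Longrightarrow> j \<le> n \<Longrightarrow> acyc j P" "C \<in> TT i" "(P, M, C, f, v, w) \<in> Dist DD"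
proof -
  obtain Q :: "('r, 'a, 'm) cdg_mod" and \<pi> where Q: "isM Q" "surj_map M Q \<pi>"
    "\<And>l x. x \<in> carrier (mgr M l) \<Longrightarrow> \<pi> l x = \<zero>\<^bsub>mgr Q l\<^esub> \<longleftrightarrow> x \<in> tp M (Suc i) l"
    "\<And>l. l < Suc i \<Longrightarrow> qis l M Q \<pi>" "\<And>l. Suc i \<le> l \<Longrightarrow> acyc l Q"
    by (rule truncation_exists[OF M, where j = "Suc i"], rule that)
  obtain P :: "('r, 'a, 'm) cdg_mod" and p where P: "isM P" "p \<in> closed0 A P M"
    "(\<lambda>i m. \<zero>\<^bsub>mgr Q i\<^esub>, \<lambda>i z. \<pi> i (p i z)) \<in> htpy_rel A P Q"
    "\<And>j. acyc j Q \<Longrightarrow> qis j P M p" "\<And>j. qis j M Q \<pi> \<Longrightarrow> acyc j P"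
    by (rule fibre_exists[OF M Q(1) surj_mapD[OF Q(2)] small_any], rule that)
  obtain C v w where C: "isM C" "(P, M, C, hcls A P M p, v, w) \<in> Dist H" "\<And>j. acyc j C \<longleftrightarrow> qis j P M p"
    by (rule cone_exists[OF P(1) M P(2)], rule that)
  \<comment> \<open>Below i both \<open>P\<close> and \<open>M\<close> are acyclic; above i the
    truncation \<open>Q\<close> is, so P -> M is a quasi-isomorphism there. Only the i-th piece of
    the cone is left.\<close>
  have "acyc j C" if "j \<le> n" "j \<noteq> i" for j
  proof (cases "j < i")
    case True
    then show ?thesis using C(3) qis_acyc[OF P(1) M P(2)] ac[OF True that(1)] P(5)[OF Q(4)] by simp
  next
    case False then show ?thesis using that C(3) P(4) Q(5)[of j] by simp
  qed
  then have "C \<in> TT i" using C(1) by (simp add: TT_def)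
  then show thesis using that[OF P(1) P(5)[OF Q(4)] _ Dist_DD[OF C(2)]] by blast
qed

theorem tau_semiorthogonal: "semiorthogonal_decomposition DD n TT"
  unfolding semiorthogonal_decomposition_def
proof (intro conjI)
  show "\<forall>i\<le>n. triangulated_sub DD (TT i)" using TT_triangulated by blast
  show "\<forall>i j. i < j \<and> j \<le> n \<longrightarrow> (\<forall>X\<in>TT j. \<forall>Y\<in>TT i. Hom DD X Y = {Zerom DD X Y})"
    using TT_orthogonal by blast
  show "\<forall>X\<in>Obj DD. \<exists>Xs fs. Xs 0 = X \<and> is_zero DD (Xs (n + 1)) \<and>
        (\<forall>i\<le>n. \<exists>Z\<in>TT i. \<exists>v w. (Xs (i + 1), Xs i, Z, fs i, v, w) \<in> Dist DD)"
  proof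
    fix X assume "X \<in> Obj DD"
    then have X: "isM X" by simp
    \<comment> \<open>\<open>good\<close> pins the start of the chain at \<open>X\<close> and
      accumulates acyclicity: the term of index i has acyclic pieces below i, so the one of index n
      + 1 lies in \<open>NN\<close> and is a zero object.\<close>
    define good where "good i M \<longleftrightarrow> isM M \<and> (\<forall>j<i. j \<le> n \<longrightarrow> acyc j M) \<and> (i = 0 \<longrightarrow> M = X)" for i M
    define step where "step i M P \<longleftrightarrow> (\<exists>f. \<exists>C\<in>TT i. \<exists>v w. (P, M, C, f, v, w) \<in> Dist DD)" for i M P
    have "\<exists>Xs. \<forall>i. good i (Xs i) \<and> step i (Xs i) (Xs (Suc i))"
    proof (rule dependent_nat_choice)
      show "\<exists>M. good 0 M" using X by (auto simp: good_def)
      fix M i assume "good i M"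
      then have M: "isM M" "\<And>j. j < i \<Longrightarrow> j \<le> n \<Longrightarrow> acyc j M" by (auto simp: good_def)
      obtain P f C v w where "isM P" "\<And>j. j < Suc i \<Longrightarrow> j \<le> n \<Longrightarrow> acyc j P" "C \<in> TT i" "(P, M, C, f, v, w) \<in> Dist DD"
        by (rule filtration_step[OF M], assumption, assumption, rule that)
      then show "\<exists>P. good (Suc i) P \<and> step i M P" unfolding good_def step_def by blast
    qed
    then obtain Xs where Xs: "\<And>i. good i (Xs i)" "\<And>i. step i (Xs i) (Xs (Suc i))" by blast
    then have "\<forall>i. \<exists>f. \<exists>C\<in>TT i. \<exists>v w. (Xs (Suc i), Xs i, C, f, v, w) \<in> Dist DD" by (simp add: step_def)
    then obtain fs where fs: "\<And>i. \<exists>C\<in>TT i. \<exists>v w. (Xs (Suc i), Xs i, C, fs i, v, w) \<in> Dist DD" by metis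
    have "Xs (Suc n) \<in> NN" using Xs(1)[of "Suc n"] by (auto simp: good_def NN_def)
    then show "\<exists>Xs fs. Xs 0 = X \<and> is_zero DD (Xs (n + 1)) \<and>
        (\<forall>i\<le>n. \<exists>Z\<in>TT i. \<exists>v w. (Xs (i + 1), Xs i, Z, fs i, v, w) \<in> Dist DD)"
      using Xs(1)[of 0] zero_in_DD fs by (intro exI[of _ Xs] exI[of _ fs]) (auto simp: good_def)
  qed
qed

end

section \<open>Free contractible modules\<close>

lemma (in abelian_group) finsum_supset:
  assumes "finite B" "S \<subseteq> B" "\<And>x. x \<in> B - S \<Longrightarrow> g x = \<zero>" "\<And>x. x \<in> B \<Longrightarrow> g x \<in> carrier G"
  shows "finsum G g S = finsum G g B"
  by (rule add.finprod_mono_neutral_cong_left) (use assms in auto)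

lemma finsum_additive_map:
  assumes G: "abelian_group G" "abelian_group K" and f: "\<And>x. x \<in> carrier G \<Longrightarrow> f x \<in> carrier K"
    "\<And>x y. x \<in> carrier G \<Longrightarrow> y \<in> carrier G \<Longrightarrow> f (x \<oplus>\<^bsub>G\<^esub> y) = f x \<oplus>\<^bsub>K\<^esub> f y"
    and S: "finite S" and g: "\<And>x. x \<in> S \<Longrightarrow> g x \<in> carrier G"
  shows "f (finsum G g S) = finsum K (\<lambda>x. f (g x)) S"
proof -
  interpret G: abelian_group G by fact
  interpret K: abelian_group K by fact
  show ?thesis using S g
  proof (induction S rule: finite_induct)
    case empty then show ?case using additive_map(1)[OF G f] by simp
  next
    case (insert x S)
    have "(\<lambda>x. f (g x)) \<in> S \<rightarrow> carrier K" using insert f by auto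
    then show ?case using insert f by (simp add: Pi_def)
  qed
qed

text \<open>A shift without signs, which places the generator e in degree \<open>l\<close>. Elements
  are written as coefficient times generator, so neither the action nor the differential has to pass
  the generator.\<close>

definition regrade :: "int \<Rightarrow> ('r, 'a, 'm) cdg_mod \<Rightarrow> ('r, 'a, 'm) cdg_mod" where
  "regrade l M = \<lparr>mgr = (\<lambda>j. mgr M (j - l)), mact = (\<lambda>i j. mact M i (j - l)), mdiff = (\<lambda>j. mdiff M (j - l))\<rparr>"

lemma regrade_simps [simp]:
  "mgr (regrade l M) j = mgr M (j - l)" "mact (regrade l M) i j = mact M i (j - l)" "mdiff (regrade l M) j = mdiff M (j - l)"
  by (simp_all add: regrade_def)

definition dsum :: "('x \<Rightarrow> ('r, 'a, 'm) cdg_mod) \<Rightarrow> ('r, 'a, 'x \<Rightarrow> 'm) cdg_mod" where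
  "dsum Ms = \<lparr>mgr = (\<lambda>j. \<lparr>
       carrier = {f. (\<forall>x. f x \<in> carrier (mgr (Ms x) j)) \<and> finite {x. f x \<noteq> \<zero>\<^bsub>mgr (Ms x) j\<^esub>}},
       mult = undefined, one = undefined, zero = (\<lambda>x. \<zero>\<^bsub>mgr (Ms x) j\<^esub>),
       add = (\<lambda>f g x. f x \<oplus>\<^bsub>mgr (Ms x) j\<^esub> g x), smult = (\<lambda>r f x. r \<odot>\<^bsub>mgr (Ms x) j\<^esub> f x)\<rparr>),
     mact = (\<lambda>i j a f x. mact (Ms x) i j a (f x)), mdiff = (\<lambda>j f x. mdiff (Ms x) j (f x))\<rparr>"

lemma dsum_simps [simp]:
  "f \<in> carrier (mgr (dsum Ms) j) \<longleftrightarrow> (\<forall>x. f x \<in> carrier (mgr (Ms x) j)) \<and> finite {x. f x \<noteq> \<zero>\<^bsub>mgr (Ms x) j\<^esub>}"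
  "\<zero>\<^bsub>mgr (dsum Ms) j\<^esub> = (\<lambda>x. \<zero>\<^bsub>mgr (Ms x) j\<^esub>)"
  "f \<oplus>\<^bsub>mgr (dsum Ms) j\<^esub> g = (\<lambda>x. f x \<oplus>\<^bsub>mgr (Ms x) j\<^esub> g x)"
  "r \<odot>\<^bsub>mgr (dsum Ms) j\<^esub> f = (\<lambda>x. r \<odot>\<^bsub>mgr (Ms x) j\<^esub> f x)"
  "mact (dsum Ms) i j a f = (\<lambda>x. mact (Ms x) i j a (f x))" "mdiff (dsum Ms) j f = (\<lambda>x. mdiff (Ms x) j (f x))"
  by (simp_all add: dsum_def)

text \<open>
  A pair \<open>(u, v)\<close> stands for \<open>u e + v de\<close> with \<open>e\<close> of degree \<open>0\<close>; since \<open>d(de) = c e\<close> for the curvature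
  \<open>c\<close>, the differential of \<open>v de\<close> contributes \<open>\<plusminus> v c e\<close>.
\<close>

definition gen_mod :: "('r, 'a) cdg_alg \<Rightarrow> ('r, 'a, 'a \<times> 'a) cdg_mod" where
  "gen_mod A = \<lparr>mgr = (\<lambda>p. \<lparr>carrier = carrier (agr A p) \<times> carrier (agr A (p - 1)), mult = undefined, one = undefined,
       zero = (\<zero>\<^bsub>agr A p\<^esub>, \<zero>\<^bsub>agr A (p - 1)\<^esub>),
       add = (\<lambda>(u, v) (u', v'). (u \<oplus>\<^bsub>agr A p\<^esub> u', v \<oplus>\<^bsub>agr A (p - 1)\<^esub> v')),
       smult = (\<lambda>r (u, v). (r \<odot>\<^bsub>agr A p\<^esub> u, r \<odot>\<^bsub>agr A (p - 1)\<^esub> v))\<rparr>),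
     mact = (\<lambda>i p a (u, v). (amult A i p a u, amult A i (p - 1) a v)),
     mdiff = (\<lambda>p (u, v). (adiff A p u \<oplus>\<^bsub>agr A (p + 1)\<^esub> gsgn (agr A (p + 1)) (p - 1) (amult A (p - 1) 2 v (curv A)),
       adiff A (p - 1) v \<oplus>\<^bsub>agr A p\<^esub> gsgn (agr A p) p u))\<rparr>"

lemma gen_mod_simps [simp]:
  "carrier (mgr (gen_mod A) p) = carrier (agr A p) \<times> carrier (agr A (p - 1))"
  "\<zero>\<^bsub>mgr (gen_mod A) p\<^esub> = (\<zero>\<^bsub>agr A p\<^esub>, \<zero>\<^bsub>agr A (p - 1)\<^esub>)"
  "(u, v) \<oplus>\<^bsub>mgr (gen_mod A) p\<^esub> (u', v') = (u \<oplus>\<^bsub>agr A p\<^esub> u', v \<oplus>\<^bsub>agr A (p - 1)\<^esub> v')"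
  "r \<odot>\<^bsub>mgr (gen_mod A) p\<^esub> (u, v) = (r \<odot>\<^bsub>agr A p\<^esub> u, r \<odot>\<^bsub>agr A (p - 1)\<^esub> v)"
  "mact (gen_mod A) i p a (u, v) = (amult A i p a u, amult A i (p - 1) a v)"
  "mdiff (gen_mod A) p (u, v) = (adiff A p u \<oplus>\<^bsub>agr A (p + 1)\<^esub> gsgn (agr A (p + 1)) (p - 1) (amult A (p - 1) 2 v (curv A)),
       adiff A (p - 1) v \<oplus>\<^bsub>agr A p\<^esub> gsgn (agr A p) p u)"
  by (simp_all add: gen_mod_def)

section \<open>Direct sums and the free module on one generator\<close>

context cdg_algebra
begin

lemma regrade_module:
  assumes M: "isM M" shows "isM (regrade l M)"
proof -
  have e: "i + j - l = i + (j - l)" "i + (1 - l) = i - l + 1" for i j by simp_all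
  show ?thesis
    by (rule cdg_module.intro)
       (use M in \<open>simp_all add: Mod_module e cdg_module.act_smult_left cdg_module.act_smult_right M_assoc M_leibniz M_dd gsgn_def\<close>)
qed

lemma dsum_module:
  assumes M: "\<And>x. isM (Ms x)"
  shows "isM (dsum Ms)"
proof -
  note [simp] = M
  have fin: "finite {x. g x \<noteq> \<zero>\<^bsub>mgr (Ms x) k\<^esub>}"
    if "finite {x. f x \<noteq> \<zero>\<^bsub>mgr (Ms x) j\<^esub>}" "\<And>x. f x = \<zero>\<^bsub>mgr (Ms x) j\<^esub> \<Longrightarrow> g x = \<zero>\<^bsub>mgr (Ms x) k\<^esub>" for f g j k
    by (rule finite_subset[OF _ that(1)]) (use that(2) in auto)
  have fin2: "finite {x. f x \<oplus>\<^bsub>mgr (Ms x) j\<^esub> g x \<noteq> \<zero>\<^bsub>mgr (Ms x) j\<^esub>}"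
    if "finite {x. f x \<noteq> \<zero>\<^bsub>mgr (Ms x) j\<^esub>}" "finite {x. g x \<noteq> \<zero>\<^bsub>mgr (Ms x) j\<^esub>}" for f g j
    by (rule finite_subset[OF _ finite_UnI[OF that]]) auto
  have grp: "abelian_group (mgr (dsum Ms) j)" for j
  proof (rule abelian_groupI, goal_cases)
    case (6 f)
    then show ?case by (intro bexI[of _ "\<lambda>x. \<ominus>\<^bsub>mgr (Ms x) j\<^esub> f x"]) (auto intro: fin)
  qed (auto simp: ab_ac(3-) fin2)
  have neg: "\<ominus>\<^bsub>mgr (dsum Ms) j\<^esub> f = (\<lambda>x. \<ominus>\<^bsub>mgr (Ms x) j\<^esub> f x)" if "f \<in> carrier (mgr (dsum Ms) j)" for f j
    by (rule abelian_group.minus_equality[OF grp]) (use that in \<open>auto intro: fin\<close>)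
  have gs: "gsgn (mgr (dsum Ms) j) s f = (\<lambda>x. gsgn (mgr (Ms x) j) s (f x))" if "f \<in> carrier (mgr (dsum Ms) j)" for f j s
    using neg[OF that] by (simp add: gsgn_def)
  have sm: "r \<odot>\<^bsub>mgr (Ms x) i\<^esub> \<zero>\<^bsub>mgr (Ms x) i\<^esub> = \<zero>\<^bsub>mgr (Ms x) i\<^esub>" if "r \<in> carrier R" for r x i
    using module.smult_r_null[OF Mod_module[OF M] that] .
  note mm = module.smult_l_distr[OF Mod_module[OF M]] module.smult_r_distr[OF Mod_module[OF M]]
    module.smult_assoc1[OF Mod_module[OF M]] module.smult_one[OF Mod_module[OF M]]
  show ?thesis
  proof (rule cdg_module.intro, goal_cases)
    case (1 i) show ?case
    proof (rule moduleI[OF base grp], goal_cases)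
      case (1 a x) then show ?case by (auto intro: fin simp: sm)
    qed (auto simp: mm)
  next
    case (2 a i m j) then show ?case by (auto intro: fin)
  next
    case (9 m i) then show ?case by (auto intro: fin)
  next
    case (11 a i f j)
    then have "(\<lambda>x. mact (Ms x) i (j + 1) a (mdiff (Ms x) j (f x))) \<in> carrier (mgr (dsum Ms) (i + j + 1))"
      using M_closed(1)[OF M 11(1), where j = "j + 1"] by (auto intro: fin simp: add.assoc)
    then show ?case using 11 gs by (simp add: M_leibniz[OF M])
  qed (auto simp: cdg_module.act_smult_left[OF M] cdg_module.act_smult_right[OF M] M_assoc[OF M] M_dd[OF M])
qed

lemma gen_mod_module: "isM (gen_mod A)"
proof -
  let ?B = "gen_mod A"
  have grp: "abelian_group (mgr ?B p)" for p
    by (rule prod_abelian_group[of "agr A p" "agr A (p - 1)"]) (simp_all add: gen_mod_def)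
  have neg: "\<ominus>\<^bsub>mgr ?B p\<^esub> (u, v) = (\<ominus>\<^bsub>agr A p\<^esub> u, \<ominus>\<^bsub>agr A (p - 1)\<^esub> v)"
    if "u \<in> carrier (agr A p)" "v \<in> carrier (agr A (p - 1))" for p u v
    by (rule prod_abelian_group[of "agr A p" "agr A (p - 1)"]) (use that in \<open>simp_all add: gen_mod_def\<close>)
  have gs: "gsgn (mgr ?B p) s (u, v) = (gsgn (agr A p) s u, gsgn (agr A (p - 1)) s v)"
    if "u \<in> carrier (agr A p)" "v \<in> carrier (agr A (p - 1))" for p u v s
    using that by (simp add: gsgn_def neg)
  have d1: "adiff A (p - 1) v \<in> carrier (agr A p)" if "v \<in> carrier (agr A (p - 1))" for p v
    using diff_closed[OF that] by simp
  have vc: "amult A (p - 1) 2 v (curv A) \<in> carrier (agr A (p + 1))" if "v \<in> carrier (agr A (p - 1))" for p v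
    using mult_closed[OF that curv_closed] by simp
  note mm = module.smult_l_distr[OF A_module] module.smult_r_distr[OF A_module]
    module.smult_assoc1[OF A_module] module.smult_one[OF A_module]
  have m1: "amult A i (p - 1) a v \<in> carrier (agr A (i + p - 1))" if "a \<in> carrier (agr A i)" "v \<in> carrier (agr A (p - 1))" for i p a v
    using mult_closed[OF that] by (simp add: add_diff_eq)
  show ?thesis
  proof (rule cdg_module.intro, goal_cases)
    case (1 i) show ?case
    proof (rule moduleI[OF base grp], goal_cases)
      case (1 a x) then show ?case using module.smult_closed[OF A_module] by auto
    qed (auto simp: mm)
  next
    case (2 a i m j) then show ?case by (auto simp: m1)
  next
    case (3 a i a' m j) then show ?case by (auto simp: add_diff_eq)
  next
    case (4 a i m j m') then show ?case by (auto simp: add_diff_eq)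
  next
    case (5 r a i m j) then show ?case by (auto simp: mult_smult_left add_diff_eq)
  next
    case (6 r a i m j) then show ?case by (auto simp: mult_smult_right add_diff_eq)
  next
    case (7 a i b j m l) then show ?case by (auto simp: mult_assoc add_diff_eq)
  next
    case (8 m i) then show ?case by auto
  next
    case (9 m p) then show ?case using d1 vc by auto
  next
    case (10 m p m')
    obtain u v where m: "m = (u, v)" "u \<in> carrier (agr A p)" "v \<in> carrier (agr A (p - 1))" using 10 by auto
    obtain u' v' where m': "m' = (u', v')" "u' \<in> carrier (agr A p)" "v' \<in> carrier (agr A (p - 1))" using 10 by auto
    have e: "amult A (p - 1) 2 (v \<oplus>\<^bsub>agr A (p - 1)\<^esub> v') (curv A)
        = amult A (p - 1) 2 v (curv A) \<oplus>\<^bsub>agr A (p + 1)\<^esub> amult A (p - 1) 2 v' (curv A)"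
      using mult_add_left[OF m(3) m'(3) curv_closed] by simp
    have e2: "adiff A (p - 1) (v \<oplus>\<^bsub>agr A (p - 1)\<^esub> v') = adiff A (p - 1) v \<oplus>\<^bsub>agr A p\<^esub> adiff A (p - 1) v'"
      using diff_add[OF m(3) m'(3)] by simp
    show ?case unfolding m(1) m'(1) using m m' d1[OF m(3)] d1[OF m'(3)] vc[OF m(3)] vc[OF m'(3)]
      by (simp add: e e2 gsgn_add ab_ac(3-))
  next
    case (11 a i m p)
    obtain u v where m: "m = (u, v)" "u \<in> carrier (agr A p)" "v \<in> carrier (agr A (p - 1))" using 11 by auto
    have i: "i + p - 1 = i + (p - 1)" "i + p + 1 - 1 = i + p" "i + (p + 1) = i + p + 1" "i + 1 + p = i + p + 1"
      "i + 1 + (p - 1) = i + p" "i + (p - 1) + 1 = i + p" "p + 1 - 1 = p" "i + p - 1 + 2 = i + p + 1" by simp_all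
    have c: "amult A (i + 1) p (adiff A i a) u \<in> carrier (agr A (i + p + 1))" "amult A i (p + 1) a (adiff A p u) \<in> carrier (agr A (i + p + 1))"
      "amult A i (p + 1) a (amult A (p - 1) 2 v (curv A)) \<in> carrier (agr A (i + p + 1))"
      "amult A (i + 1) (p - 1) (adiff A i a) v \<in> carrier (agr A (i + p))" "amult A i p a (adiff A (p - 1) v) \<in> carrier (agr A (i + p))"
      "amult A i p a u \<in> carrier (agr A (i + p))" "amult A i (p - 1) a v \<in> carrier (agr A (i + (p - 1)))"
      using mult_closed[OF diff_closed[OF 11(1)] m(2)] mult_closed[OF 11(1) diff_closed[OF m(2)]]
        mult_closed[OF 11(1) vc[OF m(3)]] mult_closed[OF diff_closed[OF 11(1)] m(3)] mult_closed[OF 11(1) d1[OF m(3)]]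
        mult_closed[OF 11(1) m(2)] mult_closed[OF 11(1) m(3)] by (simp_all only: i)
    have L1: "adiff A (i + p) (amult A i p a u) = amult A (i + 1) p (adiff A i a) u \<oplus>\<^bsub>agr A (i + p + 1)\<^esub> gsgn (agr A (i + p + 1)) i (amult A i (p + 1) a (adiff A p u))"
      using leibniz[OF 11(1) m(2)] .
    have L2: "adiff A (i + (p - 1)) (amult A i (p - 1) a v) = amult A (i + 1) (p - 1) (adiff A i a) v \<oplus>\<^bsub>agr A (i + p)\<^esub> gsgn (agr A (i + p)) i (amult A i p a (adiff A (p - 1) v))"
      using leibniz[OF 11(1) m(3)] by (simp add: i)
    have as: "amult A (i + (p - 1)) 2 (amult A i (p - 1) a v) (curv A) = amult A i (p + 1) a (amult A (p - 1) 2 v (curv A))"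
      using mult_assoc[OF 11(1) m(3) curv_closed] by simp
    have D1: "amult A i (p + 1) a (adiff A p u \<oplus>\<^bsub>agr A (p + 1)\<^esub> gsgn (agr A (p + 1)) (p - 1) (amult A (p - 1) 2 v (curv A)))
      = amult A i (p + 1) a (adiff A p u) \<oplus>\<^bsub>agr A (i + p + 1)\<^esub> gsgn (agr A (i + p + 1)) (p - 1) (amult A i (p + 1) a (amult A (p - 1) 2 v (curv A)))"
      using mult_add_right[OF 11(1) diff_closed[OF m(2)], of "gsgn (agr A (p + 1)) (p - 1) (amult A (p - 1) 2 v (curv A))"]
        A_neg(2)[OF 11(1) vc[OF m(3)]] vc[OF m(3)] by (auto simp: i gsgn_def)
    have D2: "amult A i p a (adiff A (p - 1) v \<oplus>\<^bsub>agr A p\<^esub> gsgn (agr A p) p u)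
      = amult A i p a (adiff A (p - 1) v) \<oplus>\<^bsub>agr A (i + p)\<^esub> gsgn (agr A (i + p)) p (amult A i p a u)"
      using mult_add_right[OF 11(1) d1[OF m(3)], of "gsgn (agr A p) p u"] A_neg(2)[OF 11(1) m(2)] m(2) by (auto simp: gsgn_def)
    have s: "gsgn (agr A k) (i + (p - 1)) x = gsgn (agr A k) i (gsgn (agr A k) (p - 1) x)" "gsgn (agr A k) (i + p) x = gsgn (agr A k) i (gsgn (agr A k) p x)"
      if "x \<in> carrier (agr A k)" for k x
      using that by (simp_all add: gsgn_gsgn)
    have "mdiff ?B (i + p) (mact ?B i p a m) = (
        (amult A (i + 1) p (adiff A i a) u \<oplus>\<^bsub>agr A (i + p + 1)\<^esub> gsgn (agr A (i + p + 1)) i (amult A i (p + 1) a (adiff A p u)))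
          \<oplus>\<^bsub>agr A (i + p + 1)\<^esub> gsgn (agr A (i + p + 1)) i (gsgn (agr A (i + p + 1)) (p - 1) (amult A i (p + 1) a (amult A (p - 1) 2 v (curv A)))),
        (amult A (i + 1) (p - 1) (adiff A i a) v \<oplus>\<^bsub>agr A (i + p)\<^esub> gsgn (agr A (i + p)) i (amult A i p a (adiff A (p - 1) v)))
          \<oplus>\<^bsub>agr A (i + p)\<^esub> gsgn (agr A (i + p)) i (gsgn (agr A (i + p)) p (amult A i p a u)))"
      unfolding m(1) gen_mod_simps i(1) L1 L2 as s[OF c(3)] s[OF c(6)] ..
    moreover have "mact ?B (i + 1) p (adiff A i a) m \<oplus>\<^bsub>mgr ?B (i + p + 1)\<^esub> gsgn (mgr ?B (i + p + 1)) i (mact ?B i (p + 1) a (mdiff ?B p m))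
      = (amult A (i + 1) p (adiff A i a) u \<oplus>\<^bsub>agr A (i + p + 1)\<^esub> gsgn (agr A (i + p + 1)) i (amult A i (p + 1) a (adiff A p u)
          \<oplus>\<^bsub>agr A (i + p + 1)\<^esub> gsgn (agr A (i + p + 1)) (p - 1) (amult A i (p + 1) a (amult A (p - 1) 2 v (curv A)))),
        amult A (i + 1) (p - 1) (adiff A i a) v \<oplus>\<^bsub>agr A (i + p)\<^esub> gsgn (agr A (i + p)) i (amult A i p a (adiff A (p - 1) v)
          \<oplus>\<^bsub>agr A (i + p)\<^esub> gsgn (agr A (i + p)) p (amult A i p a u)))"
      unfolding m(1) gen_mod_simps i(7) D1 D2 using c by (subst gs) (simp_all add: i)
    ultimately show ?case using c by (simp add: gsgn_add ab_ac(3))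
  next
    \<comment> \<open>On u e the square of d of the coefficient is c u - u c, and the relation d(d
      e) = c e restores u c; likewise for v. The mixed terms in the e-component cancel because d c =
      0 gives d(v c) = (d v) c.\<close>
    case (12 m p)
    obtain u v where m: "m = (u, v)" "u \<in> carrier (agr A p)" "v \<in> carrier (agr A (p - 1))" using 12 by auto
    let ?c = "curv A"
    have c: "amult A 2 p ?c u \<in> carrier (agr A (p + 2))" "amult A p 2 u ?c \<in> carrier (agr A (p + 2))"
      "amult A p 2 (adiff A (p - 1) v) ?c \<in> carrier (agr A (p + 2))"
      "amult A 2 (p - 1) ?c v \<in> carrier (agr A (p + 1))" "adiff A p u \<in> carrier (agr A (p + 1))"
      using mult_closed[OF curv_closed m(2)] mult_closed[OF m(2) curv_closed] mult_closed[OF d1[OF m(3)] curv_closed]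
        mult_closed[OF curv_closed m(3)] diff_closed[OF m(2)] by simp_all
    have dd: "adiff A (p + 1) (adiff A p u) = amult A 2 p ?c u \<ominus>\<^bsub>agr A (p + 2)\<^esub> amult A p 2 u ?c"
      "adiff A p (adiff A (p - 1) v) = amult A 2 (p - 1) ?c v \<ominus>\<^bsub>agr A (p + 1)\<^esub> amult A (p - 1) 2 v ?c"
      using diff_diff[OF m(2)] diff_diff[OF m(3)] by simp_all
    have dvc: "adiff A (p + 1) (amult A (p - 1) 2 v ?c) = amult A p 2 (adiff A (p - 1) v) ?c"
      using leibniz[OF m(3) curv_closed] c(3) A_zero(2)[OF m(3), of 3] by (simp add: diff_curv)
    have ng: "adiff A (p + 1) (\<ominus>\<^bsub>agr A (p + 1)\<^esub> amult A (p - 1) 2 v ?c) = \<ominus>\<^bsub>agr A (p + 2)\<^esub> amult A p 2 (adiff A (p - 1) v) ?c"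
      using A_neg(3)[OF vc[OF m(3)]] dvc by simp
    have ad: "adiff A (p + 1) (adiff A p u \<oplus>\<^bsub>agr A (p + 1)\<^esub> x) = adiff A (p + 1) (adiff A p u) \<oplus>\<^bsub>agr A (p + 2)\<^esub> adiff A (p + 1) x"
      if "x \<in> carrier (agr A (p + 1))" for x
      using diff_add[OF c(5) that] by simp
    show ?case unfolding m(1)
      using m c d1[OF m(3)] vc[OF m(3)] diff_add[OF d1[OF m(3)], of u]
      by (cases "even p") (simp_all add: gsgn_def ad ng dvc dd ab_ac)
  qed
qed

end

text \<open>
  \<open>Gm\<close> is free on generators \<open>e\<^sub>x\<close> of degree \<open>dg x\<close> and \<open>d e\<^sub>x\<close>; an element is the finitely supported
  function that sends \<open>x\<close> to the coefficients of \<open>e\<^sub>x\<close> and \<open>d e\<^sub>x\<close>.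
\<close>

locale free_gens = cdg_algebra R A
  for R :: "'r ring" and A :: "('r, 'a) cdg_alg" +
  fixes dg :: "'x \<Rightarrow> int"
begin

definition Gm where "Gm = dsum (\<lambda>x. regrade (dg x) (gen_mod A))"

text \<open>The value on u e + v (d e) of the graded map of degree \<open>P\<close> with e sent to
  \<open>m\<close> and d e to \<open>m'\<close>. The signs come from moving the map past
  coefficients of degree j - l and j - l - 1. \<open>m\<close> and \<open>m'\<close> are
  independent, since e and d e form a basis over the underlying graded algebra.\<close>

definition gev where
  "gev P M l m m' j = (\<lambda>(u, v). gsgn (mgr M (j + P)) (P * (j - l)) (mact M (j - l) (l + P) u m)
     \<oplus>\<^bsub>mgr M (j + P)\<^esub> gsgn (mgr M (j + P)) (P * (j - l - 1)) (mact M (j - l - 1) (l + P + 1) v m'))"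

definition supp where "supp j f = {x. f x \<noteq> \<zero>\<^bsub>mgr (regrade (dg x) (gen_mod A)) j\<^esub>}"

definition ev where
  "ev P M m m' j f = finsum (mgr M (j + P)) (\<lambda>x. gev P M (dg x) (m x) (m' x) j (f x)) (supp j f)"

lemma Gm_module: "isM Gm"
  unfolding Gm_def by (intro dsum_module regrade_module gen_mod_module)

lemma gm: "isM (regrade l (gen_mod A))"
  by (intro regrade_module gen_mod_module)

lemma Gm_carrier: "f \<in> carrier (mgr Gm j) \<longleftrightarrow> (\<forall>x. f x \<in> carrier (mgr (regrade (dg x) (gen_mod A)) j)) \<and> finite (supp j f)"
  by (simp only: Gm_def dsum_simps supp_def)

lemma gev_closed:
  assumes M: "isM M" and m: "m \<in> carrier (mgr M (l + P))" "m' \<in> carrier (mgr M (l + P + 1))"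
    and u: "u \<in> carrier (agr A (j - l))" "v \<in> carrier (agr A (j - l - 1))"
  shows "mact M (j - l) (l + P) u m \<in> carrier (mgr M (j + P))" "mact M (j - l - 1) (l + P + 1) v m' \<in> carrier (mgr M (j + P))"
  using M_closed(1)[OF M u(1) m(1)] M_closed(1)[OF M u(2) m(2)] by (simp_all add: algebra_simps del: one_add_int two_add_int)

lemma gev_ghom:
  assumes M: "isM M" and m: "m \<in> carrier (mgr M (l + P))" "m' \<in> carrier (mgr M (l + P + 1))"
  shows "gev P M l m m' \<in> ghom A P (regrade l (gen_mod A)) M"
proof (rule ghomI, goal_cases)
  case (1 j z) then show ?case using gev_closed[OF M m] M by (auto simp: gev_def)
next
  case (2 j z z')
  obtain u v where z: "z = (u, v)" "u \<in> carrier (agr A (j - l))" "v \<in> carrier (agr A (j - l - 1))" using 2 by auto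
  obtain u' v' where z': "z' = (u', v')" "u' \<in> carrier (agr A (j - l))" "v' \<in> carrier (agr A (j - l - 1))" using 2 by auto
  note c = gev_closed[OF M m z(2,3)] gev_closed[OF M m z'(2,3)]
  have "mact M (j - l) (l + P) (u \<oplus>\<^bsub>agr A (j - l)\<^esub> u') m = mact M (j - l) (l + P) u m \<oplus>\<^bsub>mgr M (j + P)\<^esub> mact M (j - l) (l + P) u' m"
    "mact M (j - l - 1) (l + P + 1) (v \<oplus>\<^bsub>agr A (j - l - 1)\<^esub> v') m' = mact M (j - l - 1) (l + P + 1) v m' \<oplus>\<^bsub>mgr M (j + P)\<^esub> mact M (j - l - 1) (l + P + 1) v' m'"
    using M_add(1)[OF M z(2) z'(2) m(1)] M_add(1)[OF M z(3) z'(3) m(2)] by (simp_all add: algebra_simps del: one_add_int two_add_int)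
  then show ?case unfolding z(1) z'(1) gev_def using c M by (simp add: gsgn_add ab_ac(3-))
next
  case (3 i j a z)
  obtain u v where z: "z = (u, v)" "u \<in> carrier (agr A (j - l))" "v \<in> carrier (agr A (j - l - 1))" using 3 by auto
  note c = gev_closed[OF M m z(2,3)]
  have e: "i + j - l = i + (j - l)" "i + (j - l) - 1 = i + (j - l - 1)" "i + (j + P) = i + j + P" by simp_all
  have as: "mact M (i + (j - l)) (l + P) (amult A i (j - l) a u) m = mact M i (j + P) a (mact M (j - l) (l + P) u m)"
    "mact M (i + (j - l - 1)) (l + P + 1) (amult A i (j - l - 1) a v) m' = mact M i (j + P) a (mact M (j - l - 1) (l + P + 1) v m')"
    using M_assoc[OF M 3(1) z(2) m(1)] M_assoc[OF M 3(1) z(3) m(2)] by (simp_all add: algebra_simps del: one_add_int two_add_int)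
  have c': "mact M i (j + P) a x \<in> carrier (mgr M (i + j + P))" if "x \<in> carrier (mgr M (j + P))" for x
    using M_closed(1)[OF M 3(1) that] by (simp add: e)
  have ag: "mact M i (j + P) a (gsgn (mgr M (j + P)) s x) = gsgn (mgr M (i + j + P)) s (mact M i (j + P) a x)" if "x \<in> carrier (mgr M (j + P))" for x s
    using act_gsgn[OF M 3(1) that] by (simp add: e)
  have aa: "mact M i (j + P) a (x \<oplus>\<^bsub>mgr M (j + P)\<^esub> y) = mact M i (j + P) a x \<oplus>\<^bsub>mgr M (i + j + P)\<^esub> mact M i (j + P) a y"
    if "x \<in> carrier (mgr M (j + P))" "y \<in> carrier (mgr M (j + P))" for x y
    using M_add(2)[OF M 3(1) that] by (simp add: e)
  show ?case unfolding z(1) gev_def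
    using c c'[OF c(1)] c'[OF c(2)] M
    by (simp add: e as ag aa gsgn_add gsgn_gsgn distrib_left)
qed

text \<open>A closed map of degree 0 must send d e to d m. This is consistent with the curvature:
  the relation d(d e) = c e is matched by d(d m) = c m.\<close>

lemma gev_closed0:
  assumes M: "isM M" and m: "m \<in> carrier (mgr M l)"
  shows "gev 0 M l m (mdiff M l m) \<in> closed0 A (regrade l (gen_mod A)) M"
proof -
  have g: "gev 0 M l m (mdiff M l m) \<in> ghom A 0 (regrade l (gen_mod A)) M"
    using gev_ghom[OF M, of m l 0 "mdiff M l m"] m M by simp
  have "mdiff M j (gev 0 M l m (mdiff M l m) j z) = gev 0 M l m (mdiff M l m) (j + 1) (mdiff (regrade l (gen_mod A)) j z)"
    if z: "z \<in> carrier (mgr (regrade l (gen_mod A)) j)" for j z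
  proof -
    define p where "p = j - l"
    have j: "j = p + l" by (simp add: p_def)
    obtain u v where z: "z = (u, v)" "u \<in> carrier (agr A p)" "v \<in> carrier (agr A (p - 1))" using z by (auto simp: p_def)
    have dm: "mdiff M l m \<in> carrier (mgr M (l + 1))" using m M by simp
    have cm: "mact M 2 l (curv A) m \<in> carrier (mgr M (l + 2))" using M_closed(1)[OF M curv_closed m] by simp
    have c: "mact M p l u m \<in> carrier (mgr M (p + l))" "mact M (p - 1) (l + 1) v (mdiff M l m) \<in> carrier (mgr M (p + l))"
      "mact M (p + 1) l (adiff A p u) m \<in> carrier (mgr M (p + l + 1))" "mact M p (l + 1) u (mdiff M l m) \<in> carrier (mgr M (p + l + 1))"
      "mact M p (l + 1) (adiff A (p - 1) v) (mdiff M l m) \<in> carrier (mgr M (p + l + 1))"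
      "mact M (p - 1) (l + 2) v (mact M 2 l (curv A) m) \<in> carrier (mgr M (p + l + 1))"
      using M_closed(1)[OF M z(2) m] M_closed(1)[OF M z(3) dm] M_closed(1)[OF M diff_closed[OF z(2)] m]
        M_closed(1)[OF M z(2) dm] M_closed(1)[OF M _ dm, of "adiff A (p - 1) v" p] diff_closed[OF z(3)] M_closed(1)[OF M z(3) cm]
      by (simp_all add: algebra_simps del: one_add_int two_add_int)
    have c2: "amult A (p - 1) 2 v (curv A) \<in> carrier (agr A (p + 1))" "adiff A (p - 1) v \<in> carrier (agr A p)"
      using mult_closed[OF z(3) curv_closed] diff_closed[OF z(3)] by simp_all
    have 1: "mdiff M (p + l) (mact M p l u m) = mact M (p + 1) l (adiff A p u) m \<oplus>\<^bsub>mgr M (p + l + 1)\<^esub> gsgn (mgr M (p + l + 1)) p (mact M p (l + 1) u (mdiff M l m))"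
      using M_leibniz[OF M z(2) m] .
    have 2: "mdiff M (p + l) (mact M (p - 1) (l + 1) v (mdiff M l m)) = mact M p (l + 1) (adiff A (p - 1) v) (mdiff M l m)
        \<oplus>\<^bsub>mgr M (p + l + 1)\<^esub> gsgn (mgr M (p + l + 1)) (p - 1) (mact M (p - 1) (l + 2) v (mact M 2 l (curv A) m))"
      using M_leibniz[OF M z(3) dm] M_dd[OF M m] by (simp add: algebra_simps del: one_add_int two_add_int)
    have 3: "mact M (p + 1) l (amult A (p - 1) 2 v (curv A)) m = mact M (p - 1) (l + 2) v (mact M 2 l (curv A) m)"
      using M_assoc[OF M z(3) curv_closed m] by (simp add: algebra_simps del: one_add_int two_add_int)
    have 4: "mact M (p + 1) l (adiff A p u \<oplus>\<^bsub>agr A (p + 1)\<^esub> gsgn (agr A (p + 1)) (p - 1) (amult A (p - 1) 2 v (curv A))) m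
      = mact M (p + 1) l (adiff A p u) m \<oplus>\<^bsub>mgr M (p + l + 1)\<^esub> gsgn (mgr M (p + l + 1)) (p - 1) (mact M (p - 1) (l + 2) v (mact M 2 l (curv A) m))"
      using M_add(1)[OF M diff_closed[OF z(2)], of "gsgn (agr A (p + 1)) (p - 1) (amult A (p - 1) 2 v (curv A))" m l] c2 m M 3
        M_neg(1)[OF M c2(1) m] by (auto simp: gsgn_def algebra_simps simp del: one_add_int two_add_int)
    have 5: "mact M p (l + 1) (adiff A (p - 1) v \<oplus>\<^bsub>agr A p\<^esub> gsgn (agr A p) p u) (mdiff M l m)
      = mact M p (l + 1) (adiff A (p - 1) v) (mdiff M l m) \<oplus>\<^bsub>mgr M (p + l + 1)\<^esub> gsgn (mgr M (p + l + 1)) p (mact M p (l + 1) u (mdiff M l m))"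
      using M_add(1)[OF M c2(2) _ dm, of "gsgn (agr A p) p u"] z(2) M_neg(1)[OF M z(2) dm] by (auto simp: gsgn_def algebra_simps simp del: one_add_int two_add_int)
    have 6: "mdiff M (p + l) (mact M p l u m \<oplus>\<^bsub>mgr M (p + l)\<^esub> mact M (p - 1) (l + 1) v (mdiff M l m))
      = mdiff M (p + l) (mact M p l u m) \<oplus>\<^bsub>mgr M (p + l + 1)\<^esub> mdiff M (p + l) (mact M (p - 1) (l + 1) v (mdiff M l m))"
      using c M by simp
    have e: "p + l + 1 - l = p + 1" "p + 1 - 1 = p" by simp_all
    show ?thesis unfolding z(1) j gev_def
      using c M by (simp add: e 6 1 2 4 5) (simp add: ab_ac(3-))
  qed
  then show ?thesis using g closed0_iff[OF gm M] by simp
qed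

text \<open>The sum in \<open>ev\<close> runs over a support that varies with the element. Terms of
  different elements are compared after enlarging to a common finite set.\<close>

lemma ev_supset:
  assumes M: "isM M" and m: "\<And>x. m x \<in> carrier (mgr M (dg x + P))" "\<And>x. m' x \<in> carrier (mgr M (dg x + P + 1))"
    and f: "f \<in> carrier (mgr Gm j)" and S: "finite S" "supp j f \<subseteq> S"
  shows "ev P M m m' j f = finsum (mgr M (j + P)) (\<lambda>x. gev P M (dg x) (m x) (m' x) j (f x)) S"
proof -
  note g = gev_ghom[OF M m]
  show ?thesis unfolding ev_def
  proof (rule abelian_group.finsum_supset[OF Mod_grp[OF M] S])
    fix x assume "x \<in> S - supp j f"
    then show "gev P M (dg x) (m x) (m' x) j (f x) = \<zero>\<^bsub>mgr M (j + P)\<^esub>"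
      using ghom_zero(1)[OF g gm M] by (simp add: supp_def)
  next
    fix x show "gev P M (dg x) (m x) (m' x) j (f x) \<in> carrier (mgr M (j + P))"
      by (rule ghom_closed[OF g]) (use f in \<open>simp only: Gm_carrier\<close>)
  qed
qed

lemma ev_ghom:
  assumes M: "isM M" and m: "\<And>x. m x \<in> carrier (mgr M (dg x + P))" "\<And>x. m' x \<in> carrier (mgr M (dg x + P + 1))"
  shows "ev P M m m' \<in> ghom A P Gm M"
proof -
  note g = gev_ghom[OF M m]
  have gc: "gev P M (dg x) (m x) (m' x) j (f x) \<in> carrier (mgr M (j + P))" if "f \<in> carrier (mgr Gm j)" for f j x
    by (rule ghom_closed[OF g]) (use that in \<open>simp only: Gm_carrier\<close>)
  show ?thesis
  proof (rule ghomI, goal_cases)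
    case (1 j f) then show ?case unfolding ev_def using gc
      by (intro abelian_monoid.finsum_closed abelian_group.axioms(1) Mod_grp M) auto
  next
    case (2 j f f')
    interpret G: abelian_group "mgr M (j + P)" by (rule Mod_grp[OF M])
    let ?S = "supp j f \<union> supp j f'"
    have S: "finite ?S" using 2 by (simp only: Gm_carrier) simp
    have ff: "f \<oplus>\<^bsub>mgr Gm j\<^esub> f' \<in> carrier (mgr Gm j)" using 2 Gm_module by simp
    have s: "supp j (f \<oplus>\<^bsub>mgr Gm j\<^esub> f') \<subseteq> ?S" using Mod_grp[OF gm] by (auto simp add: supp_def Gm_def simp del: regrade_simps gen_mod_simps)
    have "ev P M m m' j (f \<oplus>\<^bsub>mgr Gm j\<^esub> f') = (\<Oplus>\<^bsub>mgr M (j + P)\<^esub>x\<in>?S. gev P M (dg x) (m x) (m' x) j ((f \<oplus>\<^bsub>mgr Gm j\<^esub> f') x))"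
      by (rule ev_supset[OF M m ff S s])
    also have "\<dots> = (\<Oplus>\<^bsub>mgr M (j + P)\<^esub>x\<in>?S. gev P M (dg x) (m x) (m' x) j (f x) \<oplus>\<^bsub>mgr M (j + P)\<^esub> gev P M (dg x) (m x) (m' x) j (f' x))"
    proof (rule G.finsum_cong'[OF refl])
      fix x
      have "f x \<in> carrier (mgr (regrade (dg x) (gen_mod A)) j)" "f' x \<in> carrier (mgr (regrade (dg x) (gen_mod A)) j)"
        using 2 unfolding Gm_carrier by blast+
      from ghom_add[OF g this] show "gev P M (dg x) (m x) (m' x) j ((f \<oplus>\<^bsub>mgr Gm j\<^esub> f') x)
         = gev P M (dg x) (m x) (m' x) j (f x) \<oplus>\<^bsub>mgr M (j + P)\<^esub> gev P M (dg x) (m x) (m' x) j (f' x)"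
        unfolding Gm_def dsum_simps .
    qed (use gc 2 in auto)
    also have "\<dots> = (\<Oplus>\<^bsub>mgr M (j + P)\<^esub>x\<in>?S. gev P M (dg x) (m x) (m' x) j (f x)) \<oplus>\<^bsub>mgr M (j + P)\<^esub> (\<Oplus>\<^bsub>mgr M (j + P)\<^esub>x\<in>?S. gev P M (dg x) (m x) (m' x) j (f' x))"
      by (rule G.finsum_addf) (use gc 2 in auto)
    also have "\<dots> = ev P M m m' j f \<oplus>\<^bsub>mgr M (j + P)\<^esub> ev P M m m' j f'"
      using ev_supset[OF M m 2(1) S] ev_supset[OF M m 2(2) S] by simp
    finally show ?case .
  next
    case (3 i j a f)
    have S: "finite (supp j f)" using 3 by (simp only: Gm_carrier)
    have af: "mact Gm i j a f \<in> carrier (mgr Gm (i + j))" using 3 Gm_module by simp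
    have s: "supp (i + j) (mact Gm i j a f) \<subseteq> supp j f" using M_zero(2)[OF gm 3(1)]
      by (auto simp add: supp_def Gm_def simp del: regrade_simps gen_mod_simps)
    have fc: "f x \<in> carrier (mgr (regrade (dg x) (gen_mod A)) j)" for x using 3(2) unfolding Gm_carrier by blast
    have "ev P M m m' (i + j) (mact Gm i j a f) = (\<Oplus>\<^bsub>mgr M (i + j + P)\<^esub>x\<in>supp j f. gev P M (dg x) (m x) (m' x) (i + j) (mact Gm i j a f x))"
      by (rule ev_supset[OF M m af S s])
    also have "\<dots> = (\<Oplus>\<^bsub>mgr M (i + j + P)\<^esub>x\<in>supp j f. gsgn (mgr M (i + j + P)) (P * i) (mact M i (j + P) a (gev P M (dg x) (m x) (m' x) j (f x))))"
      unfolding Gm_def dsum_simps ghom_act[OF g 3(1) fc] ..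
    also have "\<dots> = gsgn (mgr M (i + j + P)) (P * i) (mact M i (j + P) a (ev P M m m' j f))"
      unfolding ev_def
    proof (rule finsum_additive_map[OF Mod_grp[OF M] Mod_grp[OF M] _ _ S, symmetric])
      show "gsgn (mgr M (i + j + P)) (P * i) (mact M i (j + P) a x) \<in> carrier (mgr M (i + j + P))" if "x \<in> carrier (mgr M (j + P))" for x
        using M_closed(1)[OF M 3(1) that] M by (simp add: add.assoc)
      show "gsgn (mgr M (i + j + P)) (P * i) (mact M i (j + P) a (x \<oplus>\<^bsub>mgr M (j + P)\<^esub> y))
        = gsgn (mgr M (i + j + P)) (P * i) (mact M i (j + P) a x) \<oplus>\<^bsub>mgr M (i + j + P)\<^esub> gsgn (mgr M (i + j + P)) (P * i) (mact M i (j + P) a y)"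
        if "x \<in> carrier (mgr M (j + P))" "y \<in> carrier (mgr M (j + P))" for x y
        using M_closed(1)[OF M 3(1) that(1)] M_closed(1)[OF M 3(1) that(2)] M_add(2)[OF M 3(1) that] M by (simp add: gsgn_add add.assoc)
    qed (use gc 3 in auto)
    finally show ?case .
  qed
qed

lemma ev_closed0:
  assumes M: "isM M" and m: "\<And>x. m x \<in> carrier (mgr M (dg x))"
  shows "ev 0 M m (\<lambda>x. mdiff M (dg x) (m x)) \<in> closed0 A Gm M"
proof -
  let ?m' = "\<lambda>x. mdiff M (dg x) (m x)"
  have m0: "\<And>x. m x \<in> carrier (mgr M (dg x + 0))" "\<And>x. ?m' x \<in> carrier (mgr M (dg x + 0 + 1))" using m M by simp_all
  note g = gev_ghom[OF M m0] and gc0 = gev_closed0[OF M m]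
  have "mdiff M j (ev 0 M m ?m' j f) = ev 0 M m ?m' (j + 1) (mdiff Gm j f)" if f: "f \<in> carrier (mgr Gm j)" for j f
  proof -
    have S: "finite (supp j f)" using f by (simp only: Gm_carrier)
    have fc: "f x \<in> carrier (mgr (regrade (dg x) (gen_mod A)) j)" for x using f unfolding Gm_carrier by blast
    have df: "mdiff Gm j f \<in> carrier (mgr Gm (j + 1))" using f Gm_module by simp
    have s: "supp (j + 1) (mdiff Gm j f) \<subseteq> supp j f" using M_zero(3)[OF gm]
      by (auto simp add: supp_def Gm_def simp del: regrade_simps gen_mod_simps)
    have "mdiff M j (ev 0 M m ?m' j f) = (\<Oplus>\<^bsub>mgr M (j + 1)\<^esub>x\<in>supp j f. mdiff M j (gev 0 M (dg x) (m x) (?m' x) j (f x)))"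
      unfolding ev_def by (subst finsum_additive_map[OF Mod_grp[OF M, of j] Mod_grp[OF M, of "j + 1"], of "mdiff M j", OF _ _ S, symmetric])
        (use M ghom_closed[OF g fc] in simp_all)
    also have "\<dots> = (\<Oplus>\<^bsub>mgr M (j + 1)\<^esub>x\<in>supp j f. gev 0 M (dg x) (m x) (?m' x) (j + 1) (mdiff Gm j f x))"
      unfolding Gm_def dsum_simps closed0_diff[OF gc0 fc gm M] ..
    also have "\<dots> = ev 0 M m ?m' (j + 1) (mdiff Gm j f)"
      using ev_supset[OF M m0 df S s] by simp
    finally show ?thesis .
  qed
  then show ?thesis using ev_ghom[OF M m0] closed0_iff[OF Gm_module M] by simp
qed

text \<open>Following an evaluation by a graded-linear map only changes the values on the
  generators. Two maps out of the free module can thus be compared there.\<close>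

lemma ev_comp:
  assumes M: "isM M" "isM N" and m: "\<And>x. m x \<in> carrier (mgr M (dg x + P))" "\<And>x. m' x \<in> carrier (mgr M (dg x + P + 1))"
    and k: "k \<in> ghom A q M N" and f: "f \<in> carrier (mgr Gm j)"
  shows "k (j + P) (ev P M m m' j f) = ev (P + q) N (\<lambda>x. k (dg x + P) (m x)) (\<lambda>x. k (dg x + P + 1) (m' x)) j f"
proof -
  note g = gev_ghom[OF M(1) m]
  have S: "finite (supp j f)" using f by (simp only: Gm_carrier)
  have fc: "f x \<in> carrier (mgr (regrade (dg x) (gen_mod A)) j)" for x using f unfolding Gm_carrier by blast
  have t: "k (j + P) (gev P M (dg x) (m x) (m' x) j (f x)) = gev (P + q) N (dg x) (k (dg x + P) (m x)) (k (dg x + P + 1) (m' x)) j (f x)" for x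
  proof -
    obtain u v where z: "f x = (u, v)" "u \<in> carrier (agr A (j - dg x))" "v \<in> carrier (agr A (j - dg x - 1))" using fc[of x] by auto
    note c = gev_closed[OF M(1) m(1)[of x] m(2)[of x] z(2,3)]
    have km: "k (dg x + P) (m x) \<in> carrier (mgr N (dg x + (P + q)))" "k (dg x + P + 1) (m' x) \<in> carrier (mgr N (dg x + (P + q) + 1))"
      using ghom_closed[OF k m(1)[of x]] ghom_closed[OF k m(2)[of x]] by (simp_all add: algebra_simps del: one_add_int two_add_int)
    note c' = gev_closed[OF M(2) km z(2,3)]
    have 1: "k (j + P) (mact M (j - dg x) (dg x + P) u (m x)) = gsgn (mgr N (j + (P + q))) (q * (j - dg x)) (mact N (j - dg x) (dg x + (P + q)) u (k (dg x + P) (m x)))"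
      "k (j + P) (mact M (j - dg x - 1) (dg x + P + 1) v (m' x)) = gsgn (mgr N (j + (P + q))) (q * (j - dg x - 1)) (mact N (j - dg x - 1) (dg x + (P + q) + 1) v (k (dg x + P + 1) (m' x)))"
      using ghom_act[OF k z(2) m(1)[of x]] ghom_act[OF k z(3) m(2)[of x]] by (simp_all add: algebra_simps del: one_add_int two_add_int)
    have gs: "k (j + P) (gsgn (mgr M (j + P)) s y) = gsgn (mgr N (j + (P + q))) s (k (j + P) y)" if "y \<in> carrier (mgr M (j + P))" for s y
      using ghom_gsgn[OF M k that] by (simp add: add.assoc)
    have ad: "k (j + P) (y \<oplus>\<^bsub>mgr M (j + P)\<^esub> y') = k (j + P) y \<oplus>\<^bsub>mgr N (j + (P + q))\<^esub> k (j + P) y'"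
      if "y \<in> carrier (mgr M (j + P))" "y' \<in> carrier (mgr M (j + P))" for y y' using ghom_add[OF k that] by (simp add: add.assoc)
    show ?thesis unfolding z(1) gev_def prod.case using c c' M
      by (simp add: ad gs 1 gsgn_gsgn distrib_right)
  qed
  have kc: "k (j + P) y \<in> carrier (mgr N (j + (P + q)))" if "y \<in> carrier (mgr M (j + P))" for y using ghom_closed[OF k that] by (simp add: add.assoc)
  have ka: "k (j + P) (y \<oplus>\<^bsub>mgr M (j + P)\<^esub> y') = k (j + P) y \<oplus>\<^bsub>mgr N (j + (P + q))\<^esub> k (j + P) y'"
    if "y \<in> carrier (mgr M (j + P))" "y' \<in> carrier (mgr M (j + P))" for y y' using ghom_add[OF k that] by (simp add: add.assoc)
  show ?thesis unfolding ev_def t[symmetric]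
    by (rule finsum_additive_map[OF Mod_grp[OF M(1)] Mod_grp[OF M(2)] kc ka S ghom_closed[OF g fc]])
qed

definition gen where "gen x = (\<lambda>y. if y = x then (aone A, \<zero>\<^bsub>agr A (- 1)\<^esub>) else \<zero>\<^bsub>mgr (regrade (dg y) (gen_mod A)) (dg x)\<^esub>)"

lemma gen_carrier: "gen x \<in> carrier (mgr Gm (dg x))"
proof -
  have "supp (dg x) (gen x) \<subseteq> {x}" by (auto simp: supp_def gen_def)
  then have "finite (supp (dg x) (gen x))" by (rule finite_subset) simp
  moreover have "gen x y \<in> carrier (mgr (regrade (dg y) (gen_mod A)) (dg x))" for y by (auto simp: gen_def)
  ultimately show ?thesis unfolding Gm_carrier by blast
qed

lemma ev_gen:
  assumes M: "isM M" and m: "\<And>x. m x \<in> carrier (mgr M (dg x))" "\<And>x. m' x \<in> carrier (mgr M (dg x + 1))"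
  shows "ev 0 M m m' (dg x) (gen x) = m x"
proof -
  have s: "supp (dg x) (gen x) \<subseteq> {x}" by (auto simp: supp_def gen_def)
  have m0: "\<And>x. m x \<in> carrier (mgr M (dg x + 0))" "\<And>x. m' x \<in> carrier (mgr M (dg x + 0 + 1))" using m by simp_all
  interpret G: abelian_group "mgr M (dg x)" by (rule Mod_grp[OF M])
  have g: "gev 0 M (dg x) (m x) (m' x) (dg x) (gen x x) = m x"
    using m[of x] M M_zero(1)[OF M m(2)[of x], of "- 1"] by (simp add: gev_def gen_def)
  show ?thesis using ev_supset[OF M m0 gen_carrier _ s] g m[of x] by simp
qed

text \<open>The contraction determined by e -> 0 and d e -> e; the sign is that of a map of degree
  -1 passing the coefficient of d e, which has degree j - dg x - 1.\<close>

definition contr where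
  "contr j f = (\<lambda>x. (gsgn (agr A (j - dg x - 1)) (j - dg x - 1) (snd (f x)), \<zero>\<^bsub>agr A (j - dg x - 2)\<^esub>))"

lemma contr_ghom: "contr \<in> ghom A (- 1) Gm Gm"
proof -
  have sup: "supp (j - 1) (contr j f) \<subseteq> supp j f" for j f
    by (auto simp: supp_def contr_def algebra_simps simp del: one_add_int two_add_int)
  show ?thesis
  proof (rule ghomI, goal_cases)
    case (1 j f)
    then have "finite (supp (j - 1) (contr j f))" using finite_subset[OF sup[of j f]] by (simp only: Gm_carrier)
    then show ?case using 1 unfolding Gm_carrier by (auto simp: contr_def mem_Times_iff algebra_simps simp del: one_add_int two_add_int)
  next
    case (2 j f f')
    then have c: "f x \<in> carrier (mgr (regrade (dg x) (gen_mod A)) j)" "f' x \<in> carrier (mgr (regrade (dg x) (gen_mod A)) j)" for x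
      unfolding Gm_carrier by blast+
    show ?case
    proof (rule ext)
      fix x
      obtain u v where z: "f x = (u, v)" "u \<in> carrier (agr A (j - dg x))" "v \<in> carrier (agr A (j - dg x - 1))" using c(1)[of x] by auto
      obtain u' v' where z': "f' x = (u', v')" "u' \<in> carrier (agr A (j - dg x))" "v' \<in> carrier (agr A (j - dg x - 1))" using c(2)[of x] by auto
      have e: "j - 1 - dg x = j - dg x - 1" "j - dg x - 1 - 1 = j - dg x - 2" by simp_all
      show "contr j (f \<oplus>\<^bsub>mgr Gm j\<^esub> f') x = (contr j f \<oplus>\<^bsub>mgr Gm (j + - 1)\<^esub> contr j f') x"
        unfolding Gm_def using z z' by (simp add: contr_def e gsgn_add)
    qed
  next
    case (3 i j a f)
    then have c: "f x \<in> carrier (mgr (regrade (dg x) (gen_mod A)) j)" for x unfolding Gm_carrier by blast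
    have hc: "contr j f \<in> carrier (mgr Gm (j - 1))"
      using 3 sup[of j f] finite_subset[of "supp (j - 1) (contr j f)" "supp j f"] unfolding Gm_carrier
      by (auto simp: contr_def mem_Times_iff algebra_simps simp del: one_add_int two_add_int)
    show ?case
    proof (rule ext)
      fix x
      obtain u v where z: "f x = (u, v)" "u \<in> carrier (agr A (j - dg x))" "v \<in> carrier (agr A (j - dg x - 1))" using c[of x] by auto
      define q where "q = j - dg x - 1"
      have e: "i + j - dg x - 1 = i + q" "j - dg x = q + 1" "i + j - dg x = i + q + 1" "j - 1 - dg x = q" "i + q + 1 - 2 = i + (q - 1)"
        "i + j + - 1 - dg x = i + q" "q + 1 - 2 = q - 1" "i + q + 1 - 1 = i + q" "q + 1 - 1 = q" "i + j - 1 - dg x = i + q" "i + q - 1 = i + (q - 1)" by (simp_all add: q_def)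
      have v: "v \<in> carrier (agr A q)" using z by (simp add: q_def)
      have av: "amult A i q a v \<in> carrier (agr A (i + q))" using mult_closed[OF 3(1) v] .
      have act: "mact Gm i (j - 1) a (contr j f) \<in> carrier (mgr Gm (i + j - 1))" using M_closed(1)[OF Gm_module 3(1) hc] by (simp add: add_diff_eq)
      have gs: "gsgn (mgr Gm (i + j - 1)) i y x = gsgn (mgr (regrade (dg x) (gen_mod A)) (i + j - 1)) i (y x)"
        if "y \<in> carrier (mgr Gm (i + j - 1))" for y
      proof -
        have "(\<ominus>\<^bsub>mgr Gm (i + j - 1)\<^esub> y) x = \<ominus>\<^bsub>mgr (regrade (dg x) (gen_mod A)) (i + j - 1)\<^esub> (y x)"
        proof (rule additive_map(2)[OF Mod_grp[OF Gm_module] Mod_grp[OF gm], of "i + j - 1" "\<lambda>y. y x" "dg x" "i + j - 1" y])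
          show "y x \<in> carrier (mgr (regrade (dg x) (gen_mod A)) (i + j - 1))" if "y \<in> carrier (mgr Gm (i + j - 1))" for y
            using that unfolding Gm_carrier by blast
          show "(y \<oplus>\<^bsub>mgr Gm (i + j - 1)\<^esub> z) x = y x \<oplus>\<^bsub>mgr (regrade (dg x) (gen_mod A)) (i + j - 1)\<^esub> z x" for y z
            by (simp only: Gm_def dsum_simps)
        qed (rule that)
        then show ?thesis by (simp add: gsgn_def)
      qed
      have gB: "gsgn (mgr (gen_mod A) (i + q)) i (u, \<zero>\<^bsub>agr A (i + (q - 1))\<^esub>) = (gsgn (agr A (i + q)) i u, \<zero>\<^bsub>agr A (i + (q - 1))\<^esub>)"
        if "u \<in> carrier (agr A (i + q))" for u
      proof -
        have "\<ominus>\<^bsub>mgr (gen_mod A) (i + q)\<^esub> (u, \<zero>\<^bsub>agr A (i + (q - 1))\<^esub>) = (\<ominus>\<^bsub>agr A (i + q)\<^esub> u, \<ominus>\<^bsub>agr A (i + q - 1)\<^esub> \<zero>\<^bsub>agr A (i + (q - 1))\<^esub>)"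
          by (rule prod_abelian_group(2)[of "agr A (i + q)" "agr A (i + q - 1)"]) (use that in \<open>simp_all add: gen_mod_def e(11)\<close>)
        then show ?thesis by (simp add: gsgn_def e(11))
      qed
      have sv: "amult A i q a (gsgn (agr A q) q v) = gsgn (agr A (i + q)) q (amult A i q a v)"
        using A_neg(2)[OF 3(1) v] by (simp add: gsgn_def)
      have "contr (i + j) (mact Gm i j a f) x = (gsgn (agr A (i + q)) (i + q) (amult A i q a v), \<zero>\<^bsub>agr A (i + (q - 1))\<^esub>)"
        unfolding contr_def Gm_def by (simp add: z(1) e)
      moreover have "mact Gm i (j - 1) a (contr j f) x = (gsgn (agr A (i + q)) q (amult A i q a v), \<zero>\<^bsub>agr A (i + (q - 1))\<^esub>)"
        unfolding contr_def Gm_def by (simp add: z(1) e sv 3(1))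
      ultimately show "contr (i + j) (mact Gm i j a f) x = gsgn (mgr Gm (i + j + - 1)) (- 1 * i) (mact Gm i (j + - 1) a (contr j f)) x"
        using gs[OF act] gB[of "gsgn (agr A (i + q)) q (amult A i q a v)"] av by (simp add: e gsgn_gsgn) (simp add: gsgn_def)
    qed
  qed
qed

text \<open>For d h + h d: on e the term h(d e) returns e; on d e the term d(h(d e)) returns d e,
  while h(d(d e)) = h(c e) = 0.\<close>

lemma contr_id:
  assumes f: "f \<in> carrier (mgr Gm j)"
  shows "bd Gm Gm contr j f = f"
proof (rule ext)
  fix x
  have c: "f x \<in> carrier (mgr (regrade (dg x) (gen_mod A)) j)" using f unfolding Gm_carrier by blast
  obtain u v where z: "f x = (u, v)" "u \<in> carrier (agr A (j - dg x))" "v \<in> carrier (agr A (j - dg x - 1))" using c by auto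
  define q where "q = j - dg x"
  have e: "j - dg x = q" "j - 1 - dg x = q - 1" "j + 1 - dg x = q + 1" "q - 1 - 1 = q - 2" "q + 1 - 2 = q - 1" "q + 1 - 1 = q" "q - 1 + 1 = q" by (simp_all add: q_def)
  have uv: "u \<in> carrier (agr A q)" "v \<in> carrier (agr A (q - 1))" using z by (simp_all add: q_def)
  have dv: "adiff A (q - 1) v \<in> carrier (agr A q)" using diff_closed[OF uv(2)] by simp
  have dn: "adiff A (q - 1) (\<ominus>\<^bsub>agr A (q - 1)\<^esub> v) = \<ominus>\<^bsub>agr A q\<^esub> adiff A (q - 1) v" using A_neg(3)[OF uv(2)] by simp
  have z2: "amult A (q - 2) 2 \<zero>\<^bsub>agr A (q - 2)\<^esub> (curv A) = \<zero>\<^bsub>agr A q\<^esub>" using A_zero(1)[OF curv_closed, of "q - 2"] by simp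
  have z3: "adiff A (q - 2) \<zero>\<^bsub>agr A (q - 2)\<^esub> = \<zero>\<^bsub>agr A (q - 1)\<^esub>" using A_zero(3)[of "q - 2"] by simp
  show "bd Gm Gm contr j f x = f x"
    unfolding bd_def Gm_def using uv dv
    by (simp add: contr_def z(1) e) (cases "even q"; simp add: gsgn_def e dn z2 z3 ab_ac(2-))
qed

end

section \<open>Size of free modules\<close>

lemma UN_small:
  fixes C :: "'x \<Rightarrow> 'c set"
  assumes "infinite (UNIV :: 'm set)" "(UNIV :: 'x set) \<lesssim> (UNIV :: 'm set)" "\<And>x. C x \<lesssim> (UNIV :: 'm set)"
  shows "(\<Union>x. C x) \<lesssim> (UNIV :: 'm set)"
proof -
  have "\<forall>x. \<exists>g :: 'm \<Rightarrow> 'c. C x \<subseteq> g ` UNIV" using assms(3) by (simp add: lepoll_iff)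
  then obtain g :: "'x \<Rightarrow> 'm \<Rightarrow> 'c" where "\<And>x. C x \<subseteq> g x ` UNIV" by metis
  then have "(\<Union>x. C x) \<subseteq> (\<lambda>(x, v). g x v) ` (UNIV \<times> UNIV)" by fast
  then have "(\<Union>x. C x) \<lesssim> (UNIV :: 'x set) \<times> (UNIV :: 'm set)" by (rule subset_image_lepoll)
  also have "\<dots> \<lesssim> (UNIV :: 'm set)" by (rule lepoll_Times_infinite[OF assms(1,2)]) simp
  finally show ?thesis .
qed

text \<open>Finite subsets are images of lists. Lists of a fixed length fit because an infinite
  universe absorbs pairs, and a countable union of such sets still fits.\<close>

lemma Fpow_small:
  assumes inf: "infinite (UNIV :: 'm set)" and A: "A \<lesssim> (UNIV :: 'm set)"
  shows "Fpow A \<lesssim> (UNIV :: 'm set)"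
proof -
  obtain f :: "_ \<Rightarrow> 'm" where "inj_on f A" using A by (auto simp: lepoll_def)
  then have "Fpow A \<lesssim> Fpow (UNIV :: 'm set)"
    unfolding lepoll_def using inj_on_image_Fpow image_Fpow_mono[of f A UNIV] by blast
  also have "Fpow (UNIV :: 'm set) \<lesssim> (\<Union>l. {xs :: 'm list. length xs = l})"
    by (rule subset_image_lepoll[of _ set]) (use finite_list in \<open>fastforce simp: Fpow_def\<close>)
  also have "\<dots> \<lesssim> (UNIV :: 'm set)"
  proof (rule UN_small[OF inf])
    show "(UNIV :: nat set) \<lesssim> (UNIV :: 'm set)" using inf by (simp add: infinite_le_lepoll)
    show "{xs :: 'm list. length xs = l} \<lesssim> (UNIV :: 'm set)" for l
    proof (induction l)
      case 0
      have "{xs :: 'm list. length xs = 0} \<subseteq> (\<lambda>x. []) ` UNIV" by auto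
      then show ?case by (rule subset_image_lepoll)
    next
      case (Suc l)
      have "{xs :: 'm list. length xs = Suc l} \<subseteq> (\<lambda>(x, xs). x # xs) ` (UNIV \<times> {xs. length xs = l})"
        by (auto simp: length_Suc_conv)
      then have "{xs :: 'm list. length xs = Suc l} \<lesssim> (UNIV :: 'm set) \<times> {xs :: 'm list. length xs = l}"
        by (rule subset_image_lepoll)
      also have "\<dots> \<lesssim> (UNIV :: 'm set)" by (rule lepoll_Times_infinite[OF inf _ Suc]) simp
      finally show ?case .
    qed
  qed
  finally show ?thesis .
qed

lemma int_small: "infinite (UNIV :: 'm set) \<Longrightarrow> (UNIV :: int set) \<lesssim> (UNIV :: 'm set)"
proof -
  assume "infinite (UNIV :: 'm set)"
  then have "(UNIV :: nat set) \<lesssim> (UNIV :: 'm set)" by (simp add: infinite_le_lepoll)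
  moreover have "(UNIV :: int set) \<lesssim> (UNIV :: nat set)" unfolding lepoll_def using inj_to_nat by auto
  ultimately show ?thesis using lepoll_trans by blast
qed

text \<open>An extensional function on a finite set differs from \<open>undefined\<close> at
  finitely many arguments only, so it is encoded by a finite graph. \<open>dsum_small\<close> treats
  finite supports the same way.\<close>

lemma PiE_small:
  assumes inf: "infinite (UNIV :: 'm set)" and C: "C \<lesssim> (UNIV :: 'm set)"
  shows "({..n :: nat} \<rightarrow>\<^sub>E C) \<lesssim> (UNIV :: 'm set)"
proof -
  have "({..n} \<rightarrow>\<^sub>E C) \<subseteq> {f. f ` {..n} \<subseteq> C \<and> {x. f x \<noteq> undefined} \<subseteq> {..n} \<and> finite {x. f x \<noteq> undefined}}"
    by (auto simp: PiE_def extensional_def intro: finite_subset[of _ "{..n}"])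
  then have "({..n} \<rightarrow>\<^sub>E C) \<lesssim> {f. f ` {..n} \<subseteq> C \<and> {x. f x \<noteq> undefined} \<subseteq> {..n} \<and> finite {x. f x \<noteq> undefined}}"
    by (rule subset_imp_lepoll)
  also have "\<dots> \<lesssim> Fpow ({..n} \<times> C)" by (rule lepoll_restricted_funspace)
  also have "\<dots> \<lesssim> (UNIV :: 'm set)"
  proof (intro Fpow_small[OF inf] lepoll_Times_infinite[OF inf] C)
    have "{..n} \<lesssim> (UNIV :: nat set)" by (rule subset_imp_lepoll) simp
    then show "{..n} \<lesssim> (UNIV :: 'm set)" using inf lepoll_trans by (auto simp: infinite_le_lepoll)
  qed
  finally show ?thesis .
qed

lemma dsum_small:
  fixes Ms :: "'x \<Rightarrow> ('r, 'a, 'c) cdg_mod"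
  assumes inf: "infinite (UNIV :: 'm set)" and x: "(UNIV :: 'x set) \<lesssim> (UNIV :: 'm set)"
    and C: "\<And>x. carrier (mgr (Ms x) j) \<lesssim> (UNIV :: 'm set)"
  shows "carrier (mgr (dsum Ms) j) \<lesssim> (UNIV :: 'm set)"
proof -
  let ?B = "\<Union>x. carrier (mgr (Ms x) j)" and ?z = "\<lambda>x. \<zero>\<^bsub>mgr (Ms x) j\<^esub>"
  have "carrier (mgr (dsum Ms) j) \<subseteq> {f. f ` UNIV \<subseteq> ?B \<and> {x. f x \<noteq> ?z x} \<subseteq> UNIV \<and> finite {x. f x \<noteq> ?z x}}"
    by auto
  then have "carrier (mgr (dsum Ms) j) \<lesssim> {f. f ` UNIV \<subseteq> ?B \<and> {x. f x \<noteq> ?z x} \<subseteq> UNIV \<and> finite {x. f x \<noteq> ?z x}}"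
    by (rule subset_imp_lepoll)
  also have "\<dots> \<lesssim> Fpow ((UNIV :: 'x set) \<times> ?B)" by (rule lepoll_restricted_funspace)
  also have "\<dots> \<lesssim> (UNIV :: 'm set)"
    by (intro Fpow_small[OF inf] lepoll_Times_infinite[OF inf] UN_small[OF inf] x C)
  finally show ?thesis .
qed

lemma (in free_gens) Gm_small:
  assumes inf: "infinite (UNIV :: 'm set)" and x: "(UNIV :: 'x set) \<lesssim> (UNIV :: 'm set)"
    and C: "\<And>i. carrier (agr A i) \<lesssim> (UNIV :: 'm set)"
  shows "carrier (mgr Gm j) \<lesssim> (UNIV :: 'm set)"
  unfolding Gm_def by (rule dsum_small[OF inf x]) (simp add: lepoll_Times_infinite[OF inf] C)

section \<open>Boundaries of homotopies and contractible modules\<close>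

context cdg_algebra
begin

lemma bd_add:
  assumes M: "isM M" "isM N" and h: "h \<in> ghom A (- 1) M N" "h' \<in> ghom A (- 1) M N" and m: "m \<in> carrier (mgr M i)"
  shows "bd M N (\<lambda>i m. h i m \<oplus>\<^bsub>mgr N (i - 1)\<^esub> h' i m) i m = bd M N h i m \<oplus>\<^bsub>mgr N i\<^esub> bd M N h' i m"
proof -
  have "mdiff N (i - 1) (h i m \<oplus>\<^bsub>mgr N (i - 1)\<^esub> h' i m) = mdiff N (i - 1) (h i m) \<oplus>\<^bsub>mgr N i\<^esub> mdiff N (i - 1) (h' i m)"
    using M_add(3)[OF M(2) h_closed[OF h(1) m] h_closed[OF h(2) m]] by simp
  then show ?thesis unfolding bd_def using h_closed'[OF h(1) m M] h_closed'[OF h(2) m M] M by (simp add: ab_ac(3-))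
qed

text \<open>In d(d h + h d) and (d h + h d) d the terms d h d agree, and the curvature terms c h and
  h c agree because the curvature has even degree.\<close>

lemma bd_closed0:
  assumes M: "isM M" "isM N" and h: "h \<in> ghom A (- 1) M N"
  shows "bd M N h \<in> closed0 A M N"
proof (rule closed0I[OF M])
  fix i m assume "m \<in> carrier (mgr M i)" then show "bd M N h i m \<in> carrier (mgr N i)" using h M by simp
next
  fix i m m' assume m: "m \<in> carrier (mgr M i)" "m' \<in> carrier (mgr M i)"
  have "h i (m \<oplus>\<^bsub>mgr M i\<^esub> m') = h i m \<oplus>\<^bsub>mgr N (i - 1)\<^esub> h i m'" using ghom_add[OF h m] by simp
  moreover have "mdiff N (i - 1) (h i m \<oplus>\<^bsub>mgr N (i - 1)\<^esub> h i m') = mdiff N (i - 1) (h i m) \<oplus>\<^bsub>mgr N i\<^esub> mdiff N (i - 1) (h i m')"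
    using M_add(3)[OF M(2) h_closed[OF h m(1)] h_closed[OF h m(2)]] by simp
  moreover have "h (i + 1) (mdiff M i m \<oplus>\<^bsub>mgr M (i + 1)\<^esub> mdiff M i m') = h (i + 1) (mdiff M i m) \<oplus>\<^bsub>mgr N i\<^esub> h (i + 1) (mdiff M i m')"
    using ghom_add[OF h, of "mdiff M i m" "i + 1" "mdiff M i m'"] m M by simp
  ultimately show "bd M N h i (m \<oplus>\<^bsub>mgr M i\<^esub> m') = bd M N h i m \<oplus>\<^bsub>mgr N i\<^esub> bd M N h i m'"
    unfolding bd_def using h_closed'[OF h m(1) M] h_closed'[OF h m(2) M] m M by (simp add: ab_ac(3-))
next
  fix i j a m assume a: "a \<in> carrier (agr A i)" and m: "m \<in> carrier (mgr M j)"
  let ?G = "mgr N (i + j)"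
  note hc = h_closed'[OF h m M]
  have c: "mact N (i + 1) (j - 1) (adiff A i a) (h j m) \<in> carrier ?G" "mact N i j a (mdiff N (j - 1) (h j m)) \<in> carrier ?G"
    "mact N i j a (h (j + 1) (mdiff M j m)) \<in> carrier ?G"
    using M_closed(1)[OF M(2) diff_closed[OF a] hc(1)] M_closed(1)[OF M(2) a hc(2)] M_closed(1)[OF M(2) a hc(3)] by simp_all
  have ix: "i + 1 + j = i + j + 1" "i + (j + 1) = i + j + 1" "i + 1 + j - 1 = i + j" "i + (j + 1) - 1 = i + j" "i + j + 1 - 1 = i + j" "i + 1 + (j - 1) = i + j"
    "j + 1 - 1 = j" by simp_all
  have ac: "mact N i (j - 1) a (h j m) \<in> carrier (mgr N (i + j - 1))" using M_closed(1)[OF M(2) a hc(1)] by (simp add: add_diff_eq)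
  have L: "mdiff N (i + j - 1) (mact N i (j - 1) a (h j m)) = mact N (i + 1) (j - 1) (adiff A i a) (h j m)
      \<oplus>\<^bsub>?G\<^esub> gsgn ?G i (mact N i j a (mdiff N (j - 1) (h j m)))"
    using M_leibniz[OF M(2) a hc(1)] by (simp add: add_diff_eq)
  have 1: "mdiff N (i + j - 1) (h (i + j) (mact M i j a m)) = gsgn ?G i (mact N (i + 1) (j - 1) (adiff A i a) (h j m))
      \<oplus>\<^bsub>?G\<^esub> mact N i j a (mdiff N (j - 1) (h j m))"
    unfolding h_act[OF h a m] using diff_gsgn[OF M(2) ac, of i] L c M by (simp add: gsgn_add gsgn_gsgn) (simp add: gsgn_def)
  have dm: "mdiff M j m \<in> carrier (mgr M (j + 1))" using m M by simp
  have s: "h (i + j + 1) (mact M (i + 1) j (adiff A i a) m) = gsgn ?G (i + 1) (mact N (i + 1) (j - 1) (adiff A i a) (h j m))"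
    "h (i + j + 1) (mact M i (j + 1) a (mdiff M j m)) = gsgn ?G i (mact N i j a (h (j + 1) (mdiff M j m)))"
    using h_act[OF h diff_closed[OF a] m] h_act[OF h a dm] by (simp_all only: ix)
  have x: "mact M (i + 1) j (adiff A i a) m \<in> carrier (mgr M (i + j + 1))" "mact M i (j + 1) a (mdiff M j m) \<in> carrier (mgr M (i + j + 1))"
    using M_closed(1)[OF M(1) diff_closed[OF a] m] M_closed(1)[OF M(1) a dm] by (simp_all only: ix)
  have 2: "h (i + j + 1) (mdiff M (i + j) (mact M i j a m)) = gsgn ?G (i + 1) (mact N (i + 1) (j - 1) (adiff A i a) (h j m))
      \<oplus>\<^bsub>?G\<^esub> mact N i j a (h (j + 1) (mdiff M j m))"
    unfolding M_leibniz[OF M(1) a m]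
    using ghom_add[OF h x(1), of "gsgn (mgr M (i + j + 1)) i (mact M i (j + 1) a (mdiff M j m))"] ghom_gsgn[OF M h x(2), of i] x s c M
    by (simp add: gsgn_gsgn) (simp add: gsgn_def)
  show "bd M N h (i + j) (mact M i j a m) = mact N i j a (bd M N h j m)"
    unfolding bd_def 1 2 using M_add(2)[OF M(2) a hc(2,3)] c M
    by (cases "even i") (simp_all add: gsgn_def ab_ac(3-))
next
  fix i m assume m: "m \<in> carrier (mgr M i)"
  note hc = h_closed'[OF h m M]
  have dm: "mdiff M i m \<in> carrier (mgr M (i + 1))" using m M by simp
  have 1: "mdiff N i (mdiff N (i - 1) (h i m)) = mact N 2 (i - 1) (curv A) (h i m)" using M_dd[OF M(2) hc(1)] by simp
  have 2: "h (i + 2) (mdiff M (i + 1) (mdiff M i m)) = mact N 2 (i - 1) (curv A) (h i m)"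
    using h_act[OF h curv_closed m] M_dd[OF M(1) m] by simp
  have 3: "mact N 2 (i - 1) (curv A) (h i m) \<in> carrier (mgr N (i + 1))" using M_closed(1)[OF M(2) curv_closed hc(1)] by simp
  show "mdiff N i (bd M N h i m) = bd M N h (i + 1) (mdiff M i m)"
    unfolding bd_def using M_add(3)[OF M(2) hc(2,3)] 1 2
      ab_ac(4)[OF Mod_grp[OF M(2)] 3, of "mdiff N i (h (i + 1) (mdiff M i m))"] M_closed(2)[OF M(2) hc(3)] by simp
qed

lemma closed0_cong:
  assumes M: "isM M" "isM N" and g: "g \<in> closed0 A M N" and f: "\<And>i m. m \<in> carrier (mgr M i) \<Longrightarrow> f i m = g i m"
  shows "f \<in> closed0 A M N"
  by (rule closed0I[OF M]) (use M g closed0_act[OF g] closed0_diff[OF g] in \<open>simp_all add: f\<close>)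

end

lemma (in tau_algebra) acyc_contractible:
  assumes M: "isM M" and h: "h \<in> ghom A (- 1) M M" "\<And>i x. x \<in> carrier (mgr M i) \<Longrightarrow> bd M M h i x = x"
  shows "acyc j M"
  unfolding acyc_def
proof (intro allI subsetI)
  fix i x assume x: "x \<in> Zc M j i"
  show "x \<in> Bd M j i" using bd_Bd[OF M M h(1) x] h(2)[OF Zc_carrier[OF x M]] by simp
qed

section \<open>Truncated polynomials\<close>

lemma trunc_poly_simps:
  "carrier (trunc_poly k n) = {..n} \<rightarrow>\<^sub>E carrier k" "\<one>\<^bsub>trunc_poly k n\<^esub> = (\<lambda>l\<in>{..n}. if l = 0 then \<one>\<^bsub>k\<^esub> else \<zero>\<^bsub>k\<^esub>)"
  "p \<otimes>\<^bsub>trunc_poly k n\<^esub> q = (\<lambda>l\<in>{..n}. \<Oplus>\<^bsub>k\<^esub>i\<in>{..l}. p i \<otimes>\<^bsub>k\<^esub> q (l - i))" "\<zero>\<^bsub>trunc_poly k n\<^esub> = (\<lambda>l\<in>{..n}. \<zero>\<^bsub>k\<^esub>)"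
  "p \<oplus>\<^bsub>trunc_poly k n\<^esub> q = (\<lambda>l\<in>{..n}. p l \<oplus>\<^bsub>k\<^esub> q l)"
  by (simp_all add: trunc_poly_def)

lemma trunc_mod_simps:
  "carrier (trunc_mod n M) = {..n} \<rightarrow>\<^sub>E carrier M" "\<zero>\<^bsub>trunc_mod n M\<^esub> = (\<lambda>l\<in>{..n}. \<zero>\<^bsub>M\<^esub>)"
  "x \<oplus>\<^bsub>trunc_mod n M\<^esub> y = (\<lambda>l\<in>{..n}. x l \<oplus>\<^bsub>M\<^esub> y l)"
  "r \<odot>\<^bsub>trunc_mod n M\<^esub> x = (\<lambda>l\<in>{..n}. \<Oplus>\<^bsub>M\<^esub>i\<in>{..l}. r i \<odot>\<^bsub>M\<^esub> x (l - i))"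
  by (simp_all add: trunc_mod_def)

lemma tvar_closed: "cring k \<Longrightarrow> tvar k n \<in> carrier (trunc_poly k n)"
  by (auto simp: tvar_def trunc_poly_simps cring.cring_simprules)

lemma tvar_pow:
  assumes k: "cring k"
  shows "tvar k n [^]\<^bsub>trunc_poly k n\<^esub> (j :: nat) = (\<lambda>l\<in>{..n}. if l = j then \<one>\<^bsub>k\<^esub> else \<zero>\<^bsub>k\<^esub>)"
proof (induction j)
  case 0 then show ?case by (simp add: trunc_poly_simps)
next
  case (Suc j)
  interpret k: cring k by fact
  have "(\<Oplus>\<^bsub>k\<^esub>i\<in>{..l}. (if i = j then \<one>\<^bsub>k\<^esub> else \<zero>\<^bsub>k\<^esub>) \<otimes>\<^bsub>k\<^esub> (if l - i = 1 then \<one>\<^bsub>k\<^esub> else \<zero>\<^bsub>k\<^esub>)) = (if l = Suc j then \<one>\<^bsub>k\<^esub> else \<zero>\<^bsub>k\<^esub>)" for l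
  proof (cases "j \<le> l")
    case True
    have "(\<Oplus>\<^bsub>k\<^esub>i\<in>{..l}. (if i = j then \<one>\<^bsub>k\<^esub> else \<zero>\<^bsub>k\<^esub>) \<otimes>\<^bsub>k\<^esub> (if l - i = 1 then \<one>\<^bsub>k\<^esub> else \<zero>\<^bsub>k\<^esub>)) = (\<Oplus>\<^bsub>k\<^esub>i\<in>{..l}. if j = i then (if l - i = 1 then \<one>\<^bsub>k\<^esub> else \<zero>\<^bsub>k\<^esub>) else \<zero>\<^bsub>k\<^esub>)"
      by (rule k.finsum_cong') auto
    also have "\<dots> = (if l - j = 1 then \<one>\<^bsub>k\<^esub> else \<zero>\<^bsub>k\<^esub>)"
      using k.finsum_singleton[of j "{..l}" "\<lambda>i. if l - i = 1 then \<one>\<^bsub>k\<^esub> else \<zero>\<^bsub>k\<^esub>"] True by simp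
    finally show ?thesis using True by auto
  next
    case False
    have "(\<Oplus>\<^bsub>k\<^esub>i\<in>{..l}. (if i = j then \<one>\<^bsub>k\<^esub> else \<zero>\<^bsub>k\<^esub>) \<otimes>\<^bsub>k\<^esub> (if l - i = 1 then \<one>\<^bsub>k\<^esub> else \<zero>\<^bsub>k\<^esub>)) = (\<Oplus>\<^bsub>k\<^esub>i\<in>{..l}. \<zero>\<^bsub>k\<^esub>)"
      by (rule k.finsum_cong') (use False in auto)
    then show ?thesis using False by simp
  qed
  moreover have tv: "tvar k n i = (if i = 1 then \<one>\<^bsub>k\<^esub> else \<zero>\<^bsub>k\<^esub>)" if "i \<le> n" for i
    using that by (simp add: tvar_def)
  moreover have "(\<Oplus>\<^bsub>k\<^esub>i\<in>{..l}. (tvar k n [^]\<^bsub>trunc_poly k n\<^esub> j) i \<otimes>\<^bsub>k\<^esub> tvar k n (l - i))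
      = (\<Oplus>\<^bsub>k\<^esub>i\<in>{..l}. (if i = j then \<one>\<^bsub>k\<^esub> else \<zero>\<^bsub>k\<^esub>) \<otimes>\<^bsub>k\<^esub> (if l - i = 1 then \<one>\<^bsub>k\<^esub> else \<zero>\<^bsub>k\<^esub>))" if "l \<le> n" for l
    by (rule k.finsum_cong') (use that tv in \<open>auto simp: Suc.IH\<close>)
  ultimately show ?case by (auto simp: trunc_poly_simps(3))
qed

lemma tvar_pow_smult:
  assumes k: "cring k" and M: "module k M" and x: "x \<in> carrier (trunc_mod n M)" and l: "l \<le> n"
  shows "((tvar k n [^]\<^bsub>trunc_poly k n\<^esub> (j :: nat)) \<odot>\<^bsub>trunc_mod n M\<^esub> x) l = (if j \<le> l then x (l - j) else \<zero>\<^bsub>M\<^esub>)"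
proof -
  interpret module k M by fact
  have xc: "x i \<in> carrier M" if "i \<le> n" for i using x that by (auto simp: trunc_mod_simps)
  have 1: "((tvar k n [^]\<^bsub>trunc_poly k n\<^esub> j) \<odot>\<^bsub>trunc_mod n M\<^esub> x) l
      = (\<Oplus>\<^bsub>M\<^esub>i\<in>{..l}. (if i = j then \<one>\<^bsub>k\<^esub> else \<zero>\<^bsub>k\<^esub>) \<odot>\<^bsub>M\<^esub> x (l - i))"
    unfolding trunc_mod_simps using l by (auto intro!: M.finsum_cong' simp: tvar_pow[OF k] xc)
  show ?thesis
  proof (cases "j \<le> l")
    case True
    have "(\<Oplus>\<^bsub>M\<^esub>i\<in>{..l}. (if i = j then \<one>\<^bsub>k\<^esub> else \<zero>\<^bsub>k\<^esub>) \<odot>\<^bsub>M\<^esub> x (l - i)) = (\<Oplus>\<^bsub>M\<^esub>i\<in>{..l}. if j = i then x (l - i) else \<zero>\<^bsub>M\<^esub>)"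
      by (rule M.finsum_cong') (use l xc in auto)
    also have "\<dots> = x (l - j)"
      using M.finsum_singleton[of j "{..l}" "\<lambda>i. x (l - i)"] True l xc by simp
    finally show ?thesis using True 1 by simp
  next
    case False
    have "(\<Oplus>\<^bsub>M\<^esub>i\<in>{..l}. (if i = j then \<one>\<^bsub>k\<^esub> else \<zero>\<^bsub>k\<^esub>) \<odot>\<^bsub>M\<^esub> x (l - i)) = (\<Oplus>\<^bsub>M\<^esub>i\<in>{..l}. \<zero>\<^bsub>M\<^esub>)"
      by (rule M.finsum_cong') (use False l xc in auto)
    then show ?thesis using False 1 by simp
  qed
qed

lemma trunc_smult_0:
  assumes M: "module k M" and r: "r 0 \<in> carrier k" and x: "x 0 \<in> carrier M"
  shows "(r \<odot>\<^bsub>trunc_mod n M\<^esub> x) 0 = r 0 \<odot>\<^bsub>M\<^esub> x 0"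
proof -
  interpret module k M by fact
  show ?thesis using M.finsum_insert[of "{}" 0 "\<lambda>i. r i \<odot>\<^bsub>M\<^esub> x (0 - i)"] r x by (simp add: trunc_mod_simps)
qed

section \<open>The filtration of a deformation\<close>

text \<open>\<open>inf\<close> lets the universe absorb pairs and finitely supported functions, and
  \<open>large\<close> makes room for the graded pieces of the algebra. Together they keep the free
  module on all pairs of a degree and an element inside \<open>'m\<close>.\<close>

locale deformation_universe = cdg_deformation k A n A\<^sub>n
  for k :: "'k ring" and A :: "('k, 'a) cdg_alg" and n A\<^sub>n +
  fixes ty :: "'m itself"
  assumes dg: "dg_algebra k A" and inf: "infinite (UNIV :: 'm set)" and large: "\<And>i. carrier (agr A i) \<lesssim> (UNIV :: 'm set)"
begin

abbreviation Rn where "Rn \<equiv> trunc_poly k n"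

definition tpow where "tpow j = (tvar k n [^]\<^bsub>Rn\<^esub> (j :: nat)) \<odot>\<^bsub>agr A\<^sub>n 0\<^esub> aone A\<^sub>n"

text \<open>The powers of zero, starting with the unit: with \<open>n = 0\<close> the filtration of
  a module over \<open>A\<close> has one piece, the module itself.\<close>

definition t0 where "t0 j = (if j = (0 :: nat) then aone A else \<zero>\<^bsub>agr A 0\<^esub>)"

lemma base_alg: "cdg_algebra k A" and curv_base: "curv A = \<zero>\<^bsub>agr A 2\<^esub>"
  using dg by (auto simp: dg_algebra_def)

lemma kring: "cring k"
  using base_alg by (rule cdg_algebra.base)

lemma An_simps:
  "carrier (agr A\<^sub>n i) = {..n} \<rightarrow>\<^sub>E carrier (agr A i)" "\<zero>\<^bsub>agr A\<^sub>n i\<^esub> = (\<lambda>l\<in>{..n}. \<zero>\<^bsub>agr A i\<^esub>)"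
  "x \<oplus>\<^bsub>agr A\<^sub>n i\<^esub> y = (\<lambda>l\<in>{..n}. x l \<oplus>\<^bsub>agr A i\<^esub> y l)"
  by (simp_all add: underlying trunc_mod_simps)

lemma tvar_pow_closed: "tvar k n [^]\<^bsub>Rn\<^esub> (j :: nat) \<in> carrier Rn"
  using tvar_closed[OF kring] base by (intro monoid.nat_pow_closed) (auto intro: cring.axioms ring.axioms comm_monoid.axioms simp: cring_def ring_def)

lemma tpow_smult:
  assumes "isM M" "m \<in> carrier (mgr M i)"
  shows "mact M 0 i (tpow j) m = (tvar k n [^]\<^bsub>Rn\<^esub> j) \<odot>\<^bsub>mgr M i\<^esub> m"
  using smult_act[OF assms(1) tvar_pow_closed assms(2)] by (simp add: tpow_def)

lemma tpow_mult:
  assumes "a \<in> carrier (agr A\<^sub>n i)"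
  shows "amult A\<^sub>n 0 i (tpow j) a = (tvar k n [^]\<^bsub>Rn\<^esub> j) \<odot>\<^bsub>agr A\<^sub>n i\<^esub> a"
    "amult A\<^sub>n i 0 a (tpow j) = (tvar k n [^]\<^bsub>Rn\<^esub> j) \<odot>\<^bsub>agr A\<^sub>n i\<^esub> a"
  using assms tvar_pow_closed by (simp_all add: tpow_def mult_smult_left mult_smult_right)

lemma smult_coeff:
  assumes "a \<in> carrier (agr A\<^sub>n i)" "l \<le> n"
  shows "((tvar k n [^]\<^bsub>Rn\<^esub> (j :: nat)) \<odot>\<^bsub>agr A\<^sub>n i\<^esub> a) l = (if j \<le> l then a (l - j) else \<zero>\<^bsub>agr A i\<^esub>)"
  using tvar_pow_smult[OF kring cdg_algebra.A_module[OF base_alg], of a n i l j] assms by (simp add: underlying)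

text \<open>Dividing by t moves the coefficients down by one place; the top coefficient of the
  quotient is free and set to zero. This is applied to the curvature and to differences of two lifts
  of an element of \<open>A\<close>.\<close>

lemma zero_reduction:
  assumes a: "a \<in> carrier (agr A\<^sub>n i)" "a 0 = \<zero>\<^bsub>agr A i\<^esub>"
  obtains b where "b \<in> carrier (agr A\<^sub>n i)" "a = amult A\<^sub>n 0 i (tpow 1) b"
proof -
  define b where "b = (\<lambda>l\<in>{..n}. if l < n then a (Suc l) else \<zero>\<^bsub>agr A i\<^esub>)"
  have b: "b \<in> carrier (agr A\<^sub>n i)"
    using a(1) abelian_group.ab_closed(3)[OF cdg_algebra.A_grp[OF base_alg], of i] unfolding b_def An_simps by (auto simp: Pi_iff)
  have "amult A\<^sub>n 0 i (tpow 1) b \<in> carrier (agr A\<^sub>n i)"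
    unfolding tpow_mult(1)[OF b] using module.smult_closed[OF A_module tvar_pow_closed b] .
  then have e: "amult A\<^sub>n 0 i (tpow 1) b \<in> extensional {..n}" "a \<in> extensional {..n}" using a by (auto simp: An_simps PiE_def)
  have "a l = amult A\<^sub>n 0 i (tpow 1) b l" if "l \<in> {..n}" for l
    unfolding tpow_mult(1)[OF b] using smult_coeff[OF b, of l 1] that a(2) by (cases l) (auto simp: b_def)
  then show thesis using that[OF b] extensionalityI[OF e(2,1)] by blast
qed

lemma tpow_tau: "tau_algebra Rn A\<^sub>n tpow n"
proof -
  interpret Rn: cring Rn by (rule base)
  note sm = module.smult_closed[OF A_module tvar_pow_closed]
  have closed: "tpow j \<in> carrier (agr A\<^sub>n 0)" for j unfolding tpow_def using sm by simp
  show ?thesis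
  proof unfold_locales
    show "tpow j \<in> carrier (agr A\<^sub>n 0)" for j by (rule closed)
    show "tpow 0 = aone A\<^sub>n" using module.smult_one[OF A_module one_closed] by (simp add: tpow_def)
    show "amult A\<^sub>n 0 0 (tpow j) (tpow l) = tpow (j + l)" for j l
      unfolding tpow_mult(1)[OF closed]
      using module.smult_assoc1[OF A_module tvar_pow_closed[of j] tvar_pow_closed[of l] one_closed] Rn.nat_pow_mult[OF tvar_closed[OF kring], of j l]
      by (simp add: tpow_def)
    show "amult A\<^sub>n 0 i (tpow j) a = amult A\<^sub>n i 0 a (tpow j)" if "a \<in> carrier (agr A\<^sub>n i)" for a i j
      using tpow_mult[OF that] by simp
    show "adiff A\<^sub>n 0 (tpow j) = \<zero>\<^bsub>agr A\<^sub>n 1\<^esub>" for j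
      unfolding tpow_def diff_smult[OF tvar_pow_closed one_closed] adiff_one
      using module.smult_r_null[OF A_module tvar_pow_closed] by simp
    have "tvar k n [^]\<^bsub>Rn\<^esub> Suc n = \<zero>\<^bsub>Rn\<^esub>" unfolding tvar_pow[OF kring] by (auto simp: trunc_poly_simps)
    then show "tpow (Suc n) = \<zero>\<^bsub>agr A\<^sub>n 0\<^esub>" using module.smult_l_null[OF A_module one_closed] by (simp add: tpow_def)
    \<comment> \<open>The curvature reduces to that of the dg algebra \<open>A\<close>, which is
      zero, so it is divisible by t. This is why d squares to zero on the graded pieces.\<close>
    show "\<exists>c\<in>carrier (agr A\<^sub>n 2). curv A\<^sub>n = amult A\<^sub>n 0 2 (tpow 1) c"
      by (rule zero_reduction[OF curv_closed]) (use red_curv curv_base in auto)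
  qed
qed

sublocale tau_universe Rn A\<^sub>n tpow n ty
  by (intro tau_universe.intro tau_universe_axioms.intro tpow_tau inf)

lemma t0_tau: "tau_algebra k A t0 0"
proof -
  interpret b: cdg_algebra k A by (rule base_alg)
  show ?thesis by unfold_locales (use b.curv_closed curv_base in \<open>auto simp: t0_def intro: b.curv_closed\<close>)
qed

text \<open>The general theory a second time, for the dg algebra itself. Here \<open>b.NN\<close>
  consists of the acyclic modules, by \<open>acyclics_NN\<close>, and the quotient is D(A).\<close>

sublocale b: tau_universe k A t0 0 ty
  by (intro tau_universe.intro tau_universe_axioms.intro t0_tau inf)

lemma const_0 [simp]: "const_poly n z a 0 = a"
  by (simp add: const_poly_def)

lemma const_closed: "a \<in> carrier (agr A i) \<Longrightarrow> const_poly n \<zero>\<^bsub>agr A i\<^esub> a \<in> carrier (agr A\<^sub>n i)"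
  "r \<in> carrier k \<Longrightarrow> const_poly n \<zero>\<^bsub>k\<^esub> r \<in> carrier Rn"
  using kring by (auto simp: const_poly_def An_simps trunc_poly_simps cring.cring_simprules)

sublocale red: alg_surj Rn A\<^sub>n k A "\<lambda>r. r 0" "\<lambda>i a. a 0"
proof unfold_locales
  interpret k: cring k by (rule kring)
  show "(\<lambda>r. r 0) \<in> ring_hom Rn k"
  proof (rule ring_hom_memI)
    fix x y assume h: "x \<in> carrier Rn" "y \<in> carrier Rn"
    have c: "x 0 \<in> carrier k" "y 0 \<in> carrier k" using h by (auto simp: trunc_poly_simps)
    show "(x \<otimes>\<^bsub>Rn\<^esub> y) 0 = x 0 \<otimes>\<^bsub>k\<^esub> y 0" using k.finsum_insert[of "{}" 0 "\<lambda>i. x i \<otimes>\<^bsub>k\<^esub> y (0 - i)"] c by (simp add: trunc_poly_simps)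
  qed (auto simp: trunc_poly_simps)
  show "(\<lambda>r. r 0) ` carrier Rn = carrier k"
  proof (intro equalityI subsetI)
    fix r assume "r \<in> carrier k"
    then show "r \<in> (\<lambda>r. r 0) ` carrier Rn" using const_closed(2)[of r] by (intro image_eqI[of _ _ "const_poly n \<zero>\<^bsub>k\<^esub> r"]) simp_all
  qed (auto simp: trunc_poly_simps)
  show "(\<lambda>a. a 0) ` carrier (agr A\<^sub>n i) = carrier (agr A i)" for i
  proof (intro equalityI subsetI)
    fix a assume "a \<in> carrier (agr A i)"
    then show "a \<in> (\<lambda>a. a 0) ` carrier (agr A\<^sub>n i)"
      using const_closed(1)[of a i] by (intro image_eqI[of _ _ "const_poly n \<zero>\<^bsub>agr A i\<^esub> a"]) simp_all
  qed (auto simp: An_simps)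
  show "(r \<odot>\<^bsub>agr A\<^sub>n i\<^esub> a) 0 = r 0 \<odot>\<^bsub>agr A i\<^esub> a 0" if "r \<in> carrier Rn" "a \<in> carrier (agr A\<^sub>n i)" for r a i
    unfolding underlying by (rule trunc_smult_0[OF b.A_module]) (use that in \<open>auto simp: trunc_poly_simps An_simps\<close>)
qed (simp_all add: An_simps(3) red_mult red_one red_diff red_curv)

lemma T_smult: "isM M \<Longrightarrow> m \<in> carrier (mgr M i) \<Longrightarrow> T j M i m = (tvar k n [^]\<^bsub>Rn\<^esub> j) \<odot>\<^bsub>mgr M i\<^esub> m"
  by (simp add: T_def tpow_smult)

lemma tpart_tp: "isM M \<Longrightarrow> tpart k n M j i = tp M j i"
  unfolding tpart_def tp_def by (intro image_cong refl) (simp add: T_smult)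

text \<open>The difference of the two lifts is divisible by t by \<open>zero_reduction\<close>, and
  it acts on a multiple of t^i. Therefore the operations of a graded piece do not depend on the
  lift.\<close>

lemma reduction_act:
  assumes M: "isM M" and a: "a \<in> carrier (agr A\<^sub>n l)" "a' \<in> carrier (agr A\<^sub>n l)" "a 0 = a' 0" and x: "x \<in> tp M i j"
  shows "mact M l j a x \<ominus>\<^bsub>mgr M (l + j)\<^esub> mact M l j a' x \<in> tp M (Suc i) (l + j)"
proof -
  have c: "a 0 \<in> carrier (agr A l)" "a' 0 \<in> carrier (agr A l)" using a(1,2) by (auto simp: An_simps)
  have neg: "\<ominus>\<^bsub>agr A\<^sub>n l\<^esub> a' \<in> carrier (agr A\<^sub>n l)" using a by simp
  have d: "a \<oplus>\<^bsub>agr A\<^sub>n l\<^esub> \<ominus>\<^bsub>agr A\<^sub>n l\<^esub> a' \<in> carrier (agr A\<^sub>n l)" using a by simp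
  have "(\<ominus>\<^bsub>agr A\<^sub>n l\<^esub> a') 0 = \<ominus>\<^bsub>agr A l\<^esub> (a' 0)"
    by (rule additive_map(2)[OF A_grp b.A_grp, of l "\<lambda>a. a 0" l a']) (use a in \<open>auto simp: An_simps\<close>)
  then have z: "(a \<oplus>\<^bsub>agr A\<^sub>n l\<^esub> \<ominus>\<^bsub>agr A\<^sub>n l\<^esub> a') 0 = \<zero>\<^bsub>agr A l\<^esub>" using a(3) c by (simp add: An_simps(3))
  obtain b where b: "b \<in> carrier (agr A\<^sub>n l)" "a \<oplus>\<^bsub>agr A\<^sub>n l\<^esub> \<ominus>\<^bsub>agr A\<^sub>n l\<^esub> a' = amult A\<^sub>n 0 l (tpow 1) b"
    by (rule zero_reduction[OF d z])
  obtain m where m: "m \<in> carrier (mgr M j)" "x = T i M j m" using x by (rule tpE)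
  note xc = tp_carrier[OF x M]
  have bm: "mact M l j b m \<in> carrier (mgr M (l + j))" using b m M by simp
  have "mact M l j a x \<ominus>\<^bsub>mgr M (l + j)\<^esub> mact M l j a' x = mact M l j (a \<oplus>\<^bsub>agr A\<^sub>n l\<^esub> \<ominus>\<^bsub>agr A\<^sub>n l\<^esub> a') x"
    using a xc M by (simp add: a_minus_def)
  also have "\<dots> = T 1 M (l + j) (mact M l j b x)"
    unfolding b(2) T_def using M_assoc[OF M tau_closed b(1) xc, of 1] by simp
  also have "\<dots> = T (1 + i) M (l + j) (mact M l j b m)"
    unfolding m(2) using T_act[OF M b(1) m(1), of i] T_T[OF M bm, of 1 i] by simp
  finally show ?thesis using tpI[OF bm] by simp
qed

lemma b_tp: "b.isM N \<Longrightarrow> b.tp N 0 j = carrier (mgr N j)" "b.isM N \<Longrightarrow> b.tp N (Suc 0) j = {\<zero>\<^bsub>mgr N j\<^esub>}"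
  by simp_all

lemma b_Zc: "b.isM N \<Longrightarrow> x \<in> b.Zc N 0 j \<longleftrightarrow> x \<in> carrier (mgr N j) \<and> mdiff N j x = \<zero>\<^bsub>mgr N (j + 1)\<^esub>"
  by (simp add: b.Zc_def b_tp)

lemma b_Bd: "b.isM N \<Longrightarrow> x \<in> b.Bd N 0 j \<longleftrightarrow> (\<exists>y\<in>carrier (mgr N (j - 1)). x = mdiff N (j - 1) y)"
proof -
  assume N: "b.isM N"
  have "mdiff N (j - 1) y \<oplus>\<^bsub>mgr N j\<^esub> \<zero>\<^bsub>mgr N j\<^esub> = mdiff N (j - 1) y" if "y \<in> carrier (mgr N (j - 1))" for y
    using b.d_carrier[OF N that] N by simp
  then show ?thesis unfolding b.Bd_def b_tp[OF N] by force
qed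

lemma b_acyc: "b.isM N \<Longrightarrow> b.acyc 0 N \<longleftrightarrow> acyclic_mod N"
  unfolding b.acyc_def acyclic_mod_def subset_iff by (auto simp: b_Zc b_Bd)

lemma acyclics_NN: "acyclics k A = b.NN"
  by (auto simp: acyclics_def b.NN_def b_acyc)

section \<open>The associated graded modules\<close>

definition cl where "cl i M j x = tpart k n M (i + 1) j +>\<^bsub>mgr M j\<^esub> x"

definition GR where "GR i M = FO (Gr_Hot k A n i) M"

text \<open>
  \<open>gq i M\<close> sends \<open>m\<close> to the class of \<open>t\<^sup>i m\<close>; as a map of modules over the deformation it exhibits
  the inflated graded piece as a quotient of \<open>M\<close>.
\<close>

definition gq where "gq i M j m = coset_rep (cl i M j (T i M j m))"

lemma tp_subgroup:
  assumes M: "isM M" shows "abelian_subgroup (tp M i j) (mgr M j)"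
proof -
  interpret abelian_group "mgr M j" using M by simp
  have "subgroup (tp M i j) (add_monoid (mgr M j))"
  proof (rule add.subgroupI)
    show "tp M i j \<subseteq> carrier (mgr M j)" using M by auto
    show "tp M i j \<noteq> {}" using tp_zero[OF M] by blast
    show "\<ominus>\<^bsub>mgr M j\<^esub> x \<in> tp M i j" if "x \<in> tp M i j" for x
      using that tp_neg_iff[OF M tp_carrier[OF that M]] by simp
  qed (use tp_add[OF M] in auto)
  then show ?thesis by (intro abelian_subgroupI3 additive_subgroupI abelian_group_axioms)
qed

lemma cl_iff:
  assumes M: "isM M" and x: "x \<in> carrier (mgr M j)"
  shows "y \<in> cl i M j x \<longleftrightarrow> y \<in> carrier (mgr M j) \<and> y \<ominus>\<^bsub>mgr M j\<^esub> x \<in> tp M (Suc i) j"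
proof -
  have "y \<in> cl i M j x \<longleftrightarrow> (\<exists>h\<in>tp M (Suc i) j. y = h \<oplus>\<^bsub>mgr M j\<^esub> x)"
    using tpart_tp[OF M] by (auto simp: cl_def a_r_coset_def r_coset_def)
  moreover have "h \<oplus>\<^bsub>mgr M j\<^esub> x \<ominus>\<^bsub>mgr M j\<^esub> x = h" if "h \<in> tp M (Suc i) j" for h
    using tp_carrier[OF that M] x M by (simp add: ab_ac)
  moreover have "y = (y \<ominus>\<^bsub>mgr M j\<^esub> x) \<oplus>\<^bsub>mgr M j\<^esub> x" if "y \<in> carrier (mgr M j)"
    using that x M by (simp add: ab_ac)
  moreover have "h \<oplus>\<^bsub>mgr M j\<^esub> x \<in> carrier (mgr M j)" if "h \<in> tp M (Suc i) j" for h
    using tp_carrier[OF that M] x M by simp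
  ultimately show ?thesis by metis
qed

lemma cl_self: "isM M \<Longrightarrow> x \<in> carrier (mgr M j) \<Longrightarrow> x \<in> cl i M j x"
  using tp_zero by (simp add: cl_iff)

lemma cl_eq_iff:
  assumes M: "isM M" and x: "x \<in> carrier (mgr M j)" "y \<in> carrier (mgr M j)"
  shows "cl i M j x = cl i M j y \<longleftrightarrow> x \<ominus>\<^bsub>mgr M j\<^esub> y \<in> tp M (Suc i) j"
proof
  assume "cl i M j x = cl i M j y"
  then show "x \<ominus>\<^bsub>mgr M j\<^esub> y \<in> tp M (Suc i) j" using cl_self[OF M x(1), of i] cl_iff[OF M x(2)] by blast
next
  assume xy: "x \<ominus>\<^bsub>mgr M j\<^esub> y \<in> tp M (Suc i) j"
  have "z \<ominus>\<^bsub>mgr M j\<^esub> x \<in> tp M (Suc i) j \<longleftrightarrow> z \<ominus>\<^bsub>mgr M j\<^esub> y \<in> tp M (Suc i) j" if z: "z \<in> carrier (mgr M j)" for z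
  proof -
    have "z \<ominus>\<^bsub>mgr M j\<^esub> y = (z \<ominus>\<^bsub>mgr M j\<^esub> x) \<oplus>\<^bsub>mgr M j\<^esub> (x \<ominus>\<^bsub>mgr M j\<^esub> y)"
      "z \<ominus>\<^bsub>mgr M j\<^esub> x = (z \<ominus>\<^bsub>mgr M j\<^esub> y) \<ominus>\<^bsub>mgr M j\<^esub> (x \<ominus>\<^bsub>mgr M j\<^esub> y)"
      using z x M by (simp_all add: ab_ac)
    then show ?thesis using xy tp_add[OF M] submod_minus[OF M tp_submod[OF M]] by metis
  qed
  then show "cl i M j x = cl i M j y" using cl_iff[OF M x(1)] cl_iff[OF M x(2)] by blast
qed

text \<open>The operations of \<open>Gr_mod\<close> are unions over the elements of a coset. If
  \<open>g\<close> respects differences and maps the next filtration step to the next filtration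
  step, all elements contribute the same coset.\<close>

lemma UN_cl:
  assumes M: "isM M" "isM N" and x: "x \<in> carrier (mgr M j)" and g: "\<And>x. x \<in> carrier (mgr M j) \<Longrightarrow> g x \<in> carrier (mgr N l)"
    "\<And>x y. x \<in> carrier (mgr M j) \<Longrightarrow> y \<in> carrier (mgr M j) \<Longrightarrow> g (x \<ominus>\<^bsub>mgr M j\<^esub> y) = g x \<ominus>\<^bsub>mgr N l\<^esub> g y"
    "\<And>x. x \<in> tp M (Suc i) j \<Longrightarrow> g x \<in> tp N (Suc i) l"
  shows "(\<Union>y\<in>cl i M j x. tpart k n N (i + 1) l +>\<^bsub>mgr N l\<^esub> g y) = cl i N l (g x)"
proof -
  have "tpart k n N (i + 1) l +>\<^bsub>mgr N l\<^esub> g y = cl i N l (g x)" if "y \<in> cl i M j x" for y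
  proof -
    have y: "y \<in> carrier (mgr M j)" "y \<ominus>\<^bsub>mgr M j\<^esub> x \<in> tp M (Suc i) j" using that cl_iff[OF M(1) x] by blast+
    then have "g y \<ominus>\<^bsub>mgr N l\<^esub> g x \<in> tp N (Suc i) l" using g(2)[OF y(1) x] g(3) by metis
    then show ?thesis using cl_eq_iff[OF M(2) g(1)[OF y(1)] g(1)[OF x]] unfolding cl_def by blast
  qed
  then show ?thesis using cl_self[OF M(1) x, of i] by blast
qed

lemma Gr_mod_simps:
  assumes M: "isM M"
  shows "carrier (mgr (Gr_mod k A n i M) j) = cl i M j ` tp M i j" "\<zero>\<^bsub>mgr (Gr_mod k A n i M) j\<^esub> = cl i M j \<zero>\<^bsub>mgr M j\<^esub>"
    "x \<in> carrier (mgr M j) \<Longrightarrow> y \<in> carrier (mgr M j) \<Longrightarrow>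
      cl i M j x \<oplus>\<^bsub>mgr (Gr_mod k A n i M) j\<^esub> cl i M j y = cl i M j (x \<oplus>\<^bsub>mgr M j\<^esub> y)"
    "r \<in> carrier k \<Longrightarrow> x \<in> carrier (mgr M j) \<Longrightarrow>
      r \<odot>\<^bsub>mgr (Gr_mod k A n i M) j\<^esub> cl i M j x = cl i M j (const_poly n \<zero>\<^bsub>k\<^esub> r \<odot>\<^bsub>mgr M j\<^esub> x)"
    "a \<in> carrier (agr A l) \<Longrightarrow> x \<in> carrier (mgr M j) \<Longrightarrow>
      mact (Gr_mod k A n i M) l j a (cl i M j x) = cl i M (l + j) (mact M l j (const_poly n \<zero>\<^bsub>agr A l\<^esub> a) x)"
    "x \<in> carrier (mgr M j) \<Longrightarrow> mdiff (Gr_mod k A n i M) j (cl i M j x) = cl i M (j + 1) (mdiff M j x)"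
proof -
  show "carrier (mgr (Gr_mod k A n i M) j) = cl i M j ` tp M i j"
    by (simp add: Gr_mod_def cl_def tpart_tp[OF M])
  interpret abelian_subgroup "tp M (Suc i) j" "mgr M j" by (rule tp_subgroup[OF M])
  show "\<zero>\<^bsub>mgr (Gr_mod k A n i M) j\<^esub> = cl i M j \<zero>\<^bsub>mgr M j\<^esub>"
    using a_rcos_const[OF tp_zero[OF M]] by (simp add: Gr_mod_def cl_def tpart_tp[OF M])
  show "cl i M j x \<oplus>\<^bsub>mgr (Gr_mod k A n i M) j\<^esub> cl i M j y = cl i M j (x \<oplus>\<^bsub>mgr M j\<^esub> y)"
    if "x \<in> carrier (mgr M j)" "y \<in> carrier (mgr M j)"
    using a_rcos_sum[OF that] by (simp add: Gr_mod_def cl_def tpart_tp[OF M])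
  show act: "mact (Gr_mod k A n i M) l j a (cl i M j x) = cl i M (l + j) (mact M l j (const_poly n \<zero>\<^bsub>agr A l\<^esub> a) x)"
    if a: "a \<in> carrier (agr A l)" and x: "x \<in> carrier (mgr M j)" for a l
    unfolding Gr_mod_def cdg_mod.simps
    by (rule UN_cl[OF M M x]) (use const_closed(1)[OF a] M submodD(4)[OF tp_submod[OF M]] in \<open>simp_all add: a_minus_def\<close>)
  show "r \<odot>\<^bsub>mgr (Gr_mod k A n i M) j\<^esub> cl i M j x = cl i M j (const_poly n \<zero>\<^bsub>k\<^esub> r \<odot>\<^bsub>mgr M j\<^esub> x)"
    if r: "r \<in> carrier k" and x: "x \<in> carrier (mgr M j)"
  proof -
    have "const_poly n \<zero>\<^bsub>k\<^esub> r \<odot>\<^bsub>agr A\<^sub>n 0\<^esub> aone A\<^sub>n \<in> carrier (agr A\<^sub>n 0)"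
      using module.smult_closed[OF A_module const_closed(2)[OF r] one_closed] .
    moreover note sm = smult_act[OF M const_closed(2)[OF r]]
    ultimately show ?thesis unfolding Gr_mod_def cdg_mod.simps module.simps
      by (intro UN_cl[OF M M x]) (use M submodD(4)[OF tp_submod[OF M], where i = 0] M_closed(1)[OF M, where i = 0 and j = j] tp_carrier in \<open>auto simp: sm a_minus_def\<close>)
  qed
  show "mdiff (Gr_mod k A n i M) j (cl i M j x) = cl i M (j + 1) (mdiff M j x)" if x: "x \<in> carrier (mgr M j)"
    unfolding Gr_mod_def cdg_mod.simps
    by (rule UN_cl[OF M M x]) (use M submodD(5)[OF tp_submod[OF M]] in \<open>simp_all add: a_minus_def\<close>)
qed

lemma cl_rep:
  assumes M: "isM M" and x: "x \<in> carrier (mgr M j)"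
  shows "coset_rep (cl i M j x) \<in> carrier (mgr M j)" "cl i M j (coset_rep (cl i M j x)) = cl i M j x"
proof -
  have "coset_rep (cl i M j x) \<in> cl i M j x" unfolding coset_rep_def using cl_self[OF M x] by (rule someI)
  then show "coset_rep (cl i M j x) \<in> carrier (mgr M j)" "cl i M j (coset_rep (cl i M j x)) = cl i M j x"
    using cl_iff[OF M x] cl_eq_iff[OF M _ x] by blast+
qed

lemma inv_rep:
  assumes M: "isM M" and x: "x \<in> tp M i j"
  shows "inv_into (carrier (mgr (Gr_mod k A n i M) j)) coset_rep (coset_rep (cl i M j x)) = cl i M j x"
proof (rule inv_into_f_f)
  show "inj_on coset_rep (carrier (mgr (Gr_mod k A n i M) j))"
    unfolding Gr_mod_simps(1)[OF M] by (rule inj_on_inverseI[of _ "cl i M j"]) (use cl_rep(2)[OF M] M in auto)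
qed (use x Gr_mod_simps(1)[OF M] in blast)

text \<open>Formulas on representatives of cosets. Scalars and algebra elements enter through
  arbitrary lifts \<open>r\<close> and \<open>a\<close> and not just through constant ones, which is
  the form that \<open>semilinear_image_module\<close> asks for.\<close>

lemma GR_simps:
  fixes i
  assumes M: "isM M"
  defines "\<pi> \<equiv> \<lambda>j x. coset_rep (cl i M j x)"
  shows "carrier (mgr (GR i M) j) = \<pi> j ` tp M i j" "\<zero>\<^bsub>mgr (GR i M) j\<^esub> = \<pi> j \<zero>\<^bsub>mgr M j\<^esub>"
    "x \<in> tp M i j \<Longrightarrow> y \<in> tp M i j \<Longrightarrow> \<pi> j x \<oplus>\<^bsub>mgr (GR i M) j\<^esub> \<pi> j y = \<pi> j (x \<oplus>\<^bsub>mgr M j\<^esub> y)"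
    "r \<in> carrier Rn \<Longrightarrow> x \<in> tp M i j \<Longrightarrow> r 0 \<odot>\<^bsub>mgr (GR i M) j\<^esub> \<pi> j x = \<pi> j (r \<odot>\<^bsub>mgr M j\<^esub> x)"
    "a \<in> carrier (agr A\<^sub>n l) \<Longrightarrow> x \<in> tp M i j \<Longrightarrow> mact (GR i M) l j (a 0) (\<pi> j x) = \<pi> (l + j) (mact M l j a x)"
    "x \<in> tp M i j \<Longrightarrow> mdiff (GR i M) j (\<pi> j x) = \<pi> (j + 1) (mdiff M j x)"
proof -
  have G: "GR i M = transport coset_rep (Gr_mod k A n i M)" by (simp add: GR_def Gr_Hot_def Let_def)
  note iv = inv_rep[OF M, unfolded Gr_mod_simps(1)[OF M]]
  note tc = tp_carrier[OF _ M]
  have a0: "a 0 \<in> carrier (agr A l)" if "a \<in> carrier (agr A\<^sub>n l)" for a l using that by (auto simp: An_simps)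
  show "carrier (mgr (GR i M) j) = \<pi> j ` tp M i j" "\<zero>\<^bsub>mgr (GR i M) j\<^esub> = \<pi> j \<zero>\<^bsub>mgr M j\<^esub>"
    by (simp_all add: G transport_def Let_def Gr_mod_simps[OF M] \<pi>_def image_image)
  show "\<pi> j x \<oplus>\<^bsub>mgr (GR i M) j\<^esub> \<pi> j y = \<pi> j (x \<oplus>\<^bsub>mgr M j\<^esub> y)" if "x \<in> tp M i j" "y \<in> tp M i j"
    using that by (simp add: G transport_def Let_def Gr_mod_simps[OF M] \<pi>_def iv tc)
  show act: "mact (GR i M) l j (a 0) (\<pi> j x) = \<pi> (l + j) (mact M l j a x)" if a: "a \<in> carrier (agr A\<^sub>n l)" and x: "x \<in> tp M i j" for a l
  proof -
    note c = const_closed(1)[OF a0[OF a]]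
    have "cl i M (l + j) (mact M l j (const_poly n \<zero>\<^bsub>agr A l\<^esub> (a 0)) x) = cl i M (l + j) (mact M l j a x)"
      by (subst cl_eq_iff[OF M]) (use reduction_act[OF M c a _ x] M_closed(1)[OF M c tc[OF x]] M_closed(1)[OF M a tc[OF x]] in simp_all)
    then show ?thesis using a0[OF a] x tc[OF x] by (simp add: G transport_def Let_def Gr_mod_simps[OF M] \<pi>_def iv)
  qed
  show "r 0 \<odot>\<^bsub>mgr (GR i M) j\<^esub> \<pi> j x = \<pi> j (r \<odot>\<^bsub>mgr M j\<^esub> x)" if r: "r \<in> carrier Rn" and x: "x \<in> tp M i j"
  proof -
    have r0: "r 0 \<in> carrier k" using r by (auto simp: trunc_poly_simps)
    let ?c = "const_poly n \<zero>\<^bsub>k\<^esub> (r 0)"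
    note sm = smult_act[OF M r tc[OF x]] smult_act[OF M const_closed(2)[OF r0] tc[OF x]]
    have c: "r \<odot>\<^bsub>agr A\<^sub>n 0\<^esub> aone A\<^sub>n \<in> carrier (agr A\<^sub>n 0)" "?c \<odot>\<^bsub>agr A\<^sub>n 0\<^esub> aone A\<^sub>n \<in> carrier (agr A\<^sub>n 0)"
      using module.smult_closed[OF A_module _ one_closed] r const_closed(2)[OF r0] by blast+
    have "(r \<odot>\<^bsub>agr A\<^sub>n 0\<^esub> aone A\<^sub>n) 0 = (?c \<odot>\<^bsub>agr A\<^sub>n 0\<^esub> aone A\<^sub>n) 0"
      using red.\<theta>_smult[OF r one_closed] red.\<theta>_smult[OF const_closed(2)[OF r0] one_closed] by simp
    then have "?c \<odot>\<^bsub>mgr M j\<^esub> x \<ominus>\<^bsub>mgr M j\<^esub> r \<odot>\<^bsub>mgr M j\<^esub> x \<in> tp M (Suc i) j"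
      using reduction_act[OF M c(2,1) _ x] sm by simp
    then have "cl i M j (?c \<odot>\<^bsub>mgr M j\<^esub> x) = cl i M j (r \<odot>\<^bsub>mgr M j\<^esub> x)"
      by (subst cl_eq_iff[OF M]) (use M_closed(3)[OF M r tc[OF x]] M_closed(3)[OF M const_closed(2)[OF r0] tc[OF x]] in simp_all)
    then show ?thesis using r0 x tc[OF x] by (simp add: G transport_def Let_def Gr_mod_simps[OF M] \<pi>_def iv)
  qed
  show "mdiff (GR i M) j (\<pi> j x) = \<pi> (j + 1) (mdiff M j x)" if "x \<in> tp M i j"
    using that by (simp add: G transport_def Let_def Gr_mod_simps[OF M] \<pi>_def iv tc)
qed

lemma GR_module:
  assumes M: "isM M" shows "b.isM (GR i M)"
proof -
  note s = submodD[OF tp_submod[OF M, of i]]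
  have sm: "r \<odot>\<^bsub>mgr M j\<^esub> x \<in> tp M i j" if "r \<in> carrier Rn" "x \<in> tp M i j" for r x j
    using s(4)[OF module.smult_closed[OF A_module that(1) one_closed] that(2)] smult_act[OF M that(1) s(1)[OF that(2)]] by simp
  show ?thesis
    by (rule red.semilinear_image_module[OF M, of "tp M i" "GR i M" "\<lambda>j x. coset_rep (cl i M j x)"])
       (use s sm submod_neg[OF M tp_submod[OF M]] GR_simps[OF M] in auto)
qed

lemma gq_surj: assumes M: "isM M" shows "surj_map M (red.infl (GR i M)) (gq i M)"
proof -
  note T = tpI[OF _ refl, of _ M _ i] and s = GR_simps[OF M, where i = i]
  have "gq i M \<in> closed0 A\<^sub>n M (red.infl (GR i M))"
    by (rule closed0I[OF M red.infl_module[OF GR_module[OF M]]])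
       (use M s(3)[OF T T] s(5)[OF _ T] s(6)[OF T] T_act[OF M] T_diff[OF M] in \<open>auto simp: gq_def s(1) intro!: imageI T\<close>)
  moreover have "gq i M j ` carrier (mgr M j) = carrier (mgr (red.infl (GR i M)) j)" for j
    by (auto simp: s(1) gq_def tp_def)
  ultimately show ?thesis by (simp add: surj_map_def)
qed

lemma gq_zero_iff:
  assumes M: "isM M" and m: "m \<in> carrier (mgr M j)"
  shows "gq i M j m = \<zero>\<^bsub>mgr (GR i M) j\<^esub> \<longleftrightarrow> T i M j m \<in> tp M (Suc i) j"
proof -
  have z: "\<zero>\<^bsub>mgr M j\<^esub> \<in> carrier (mgr M j)" "T i M j m \<in> carrier (mgr M j)" using M m by simp_all
  have "gq i M j m = \<zero>\<^bsub>mgr (GR i M) j\<^esub> \<longleftrightarrow> cl i M j (T i M j m) = cl i M j \<zero>\<^bsub>mgr M j\<^esub>"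
    unfolding gq_def GR_simps(2)[OF M] using cl_rep(2)[OF M z(1)] cl_rep(2)[OF M z(2)] by metis
  also have "\<dots> \<longleftrightarrow> T i M j m \<in> tp M (Suc i) j" using cl_eq_iff[OF M z(2,1)] z M by simp
  finally show ?thesis .
qed

lemma acyclic_Gr: assumes M: "isM M" shows "acyclic_mod (Gr_mod k A n i M) \<longleftrightarrow> acyc i M"
proof -
  have dc: "mdiff M (j - 1) y \<in> carrier (mgr M j)" if "y \<in> tp M i (j - 1)" for y j using d_carrier[OF M tp_carrier[OF that M]] .
  have 1: "mdiff (Gr_mod k A n i M) j (cl i M j x) = \<zero>\<^bsub>mgr (Gr_mod k A n i M) (j + 1)\<^esub> \<longleftrightarrow> x \<in> Zc M i j" if x: "x \<in> tp M i j" for x j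
    using Gr_mod_simps(2,6)[OF M] cl_eq_iff[OF M, of "mdiff M j x" "j + 1" "\<zero>\<^bsub>mgr M (j + 1)\<^esub>" i] tp_carrier[OF x M] x M by (simp add: Zc_def)
  have 2: "(\<exists>y\<in>carrier (mgr (Gr_mod k A n i M) (j - 1)). mdiff (Gr_mod k A n i M) (j - 1) y = cl i M j x) \<longleftrightarrow> x \<in> Bd M i j" if x: "x \<in> tp M i j" for x j
  proof -
    note xc = tp_carrier[OF x M]
    have "(\<exists>y\<in>carrier (mgr (Gr_mod k A n i M) (j - 1)). mdiff (Gr_mod k A n i M) (j - 1) y = cl i M j x)
        \<longleftrightarrow> (\<exists>y\<in>tp M i (j - 1). cl i M j x = cl i M j (mdiff M (j - 1) y))"
      unfolding Gr_mod_simps(1)[OF M] using Gr_mod_simps(6)[OF M tp_carrier[OF _ M], of _ i "j - 1" i] by auto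
    also have "\<dots> \<longleftrightarrow> (\<exists>y\<in>tp M i (j - 1). x \<ominus>\<^bsub>mgr M j\<^esub> mdiff M (j - 1) y \<in> tp M (Suc i) j)"
      using cl_eq_iff[OF M xc dc] by blast
    also have "\<dots> \<longleftrightarrow> x \<in> Bd M i j"
    proof
      assume "\<exists>y\<in>tp M i (j - 1). x \<ominus>\<^bsub>mgr M j\<^esub> mdiff M (j - 1) y \<in> tp M (Suc i) j"
      then show "x \<in> Bd M i j" using Bd_cancel[OF M xc Bd_d[OF M] Bd_tp[OF M]] by blast
    next
      assume "x \<in> Bd M i j"
      then obtain y z where yz: "y \<in> tp M i (j - 1)" "z \<in> tp M (Suc i) j" "x = mdiff M (j - 1) y \<oplus>\<^bsub>mgr M j\<^esub> z" by (rule BdE)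
      then have "x \<ominus>\<^bsub>mgr M j\<^esub> mdiff M (j - 1) y = z" using dc[OF yz(1)] tp_carrier[OF yz(2) M] M by (simp add: ab_ac)
      then show "\<exists>y\<in>tp M i (j - 1). x \<ominus>\<^bsub>mgr M j\<^esub> mdiff M (j - 1) y \<in> tp M (Suc i) j" using yz by blast
    qed
    finally show ?thesis .
  qed
  have "acyclic_mod (Gr_mod k A n i M) \<longleftrightarrow> (\<forall>j. \<forall>x\<in>tp M i j. x \<in> Zc M i j \<longrightarrow> x \<in> Bd M i j)"
    unfolding acyclic_mod_def using 1 2 by (simp add: Gr_mod_simps(1)[OF M])
  also have "\<dots> \<longleftrightarrow> acyc i M" unfolding acyc_def using ZcD(1)[of _ M i] by blast
  finally show ?thesis .
qed

end

section \<open>Maps induced on graded pieces and the functor \<open>Gr_Hot\<close>\<close>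

context deformation_universe
begin

lemma GR_E:
  assumes "isM M" "x \<in> carrier (mgr (GR i M) j)"
  obtains m where "m \<in> carrier (mgr M j)" "x = gq i M j m"
proof -
  have "x \<in> carrier (mgr (red.infl (GR i M)) j)" using assms(2) by simp
  from surj_mapE[OF gq_surj[OF assms(1)] this] that show thesis by blast
qed

lemma GR_infl: "isM M \<Longrightarrow> isM (red.infl (GR i M))"
  by (intro red.infl_module GR_module)

lemma gq_closed0: "isM M \<Longrightarrow> gq i M \<in> closed0 A\<^sub>n M (red.infl (GR i M))"
  by (rule surj_mapD[OF gq_surj])

lemma gq_diff:
  assumes "isM M" "m \<in> carrier (mgr M j)"
  shows "mdiff (GR i M) j (gq i M j m) = gq i M (j + 1) (mdiff M j m)"
  using closed0_diff[OF gq_closed0[OF assms(1)] assms(2,1) GR_infl[OF assms(1)], of i] by simp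

lemma gq_closed [simp]: "isM M \<Longrightarrow> m \<in> carrier (mgr M j) \<Longrightarrow> gq i M j m \<in> carrier (mgr (GR i M) j)"
  using closed0_closed[OF gq_closed0] by fastforce

lemma gq_minus:
  assumes "isM M" "m \<in> carrier (mgr M j)" "m' \<in> carrier (mgr M j)"
  shows "gq i M j (m \<ominus>\<^bsub>mgr M j\<^esub> m') = gq i M j m \<ominus>\<^bsub>mgr (GR i M) j\<^esub> gq i M j m'"
  using closed0_zero(3)[OF gq_closed0[OF assms(1)] assms(1) GR_infl[OF assms(1)] assms(2,3)] by simp

text \<open>The kernel of \<open>gq i M\<close> is the condition that t^i m be a multiple of
  t^(i+1). Graded-linear maps of any degree commute with t and preserve the filtration, so they
  respect it.\<close>

lemma induced_ker:
  assumes M: "isM M" "isM N" and f: "f \<in> ghom A\<^sub>n p M N" and m: "m \<in> carrier (mgr M j)" and z: "gq i M j m = \<zero>\<^bsub>mgr (GR i M) j\<^esub>"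
  shows "gq i N (j + p) (f j m) = \<zero>\<^bsub>mgr (GR i N) (j + p)\<^esub>"
proof -
  have "f j (T i M j m) \<in> tp N (Suc i) (j + p)"
    using tp_ghom[OF f M] gq_zero_iff[OF M(1) m] z by blast
  then show ?thesis using gq_zero_iff[OF M(2) ghom_closed[OF f m]] T_ghom[OF f m M(2)] by simp
qed

lemma induced_ghom:
  assumes M: "isM M" "isM N" and f: "f \<in> ghom A\<^sub>n p M N"
  obtains g where "g \<in> ghom A p (GR i M) (GR i N)" "\<And>j m. m \<in> carrier (mgr M j) \<Longrightarrow> g j (gq i M j m) = gq i N (j + p) (f j m)"
proof -
  have c: "(\<lambda>j m. gq i N (j + p) (f j m)) \<in> ghom A\<^sub>n p M (red.infl (GR i N))"
    using ghom_comp[OF M GR_infl[OF M(2)] f closed0_ghom[OF gq_closed0[OF M(2)]]] by simp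
  have ker: "gq i N (j + p) (f j m) = \<zero>\<^bsub>mgr (red.infl (GR i N)) (j + p)\<^esub>"
    if "m \<in> carrier (mgr M j)" "gq i M j m = \<zero>\<^bsub>mgr (red.infl (GR i M)) j\<^esub>" for j m
    using induced_ker[OF M f that(1)] that(2) by simp
  obtain g where "g \<in> ghom A\<^sub>n p (red.infl (GR i M)) (red.infl (GR i N))"
    "\<And>j m. m \<in> carrier (mgr M j) \<Longrightarrow> g j (gq i M j m) = gq i N (j + p) (f j m)"
    by (rule factor_ghom[OF M(1) GR_infl[OF M(1)] GR_infl[OF M(2)] gq_surj[OF M(1), of i] c], rule ker, assumption, assumption, rule that)
  then show thesis using that red.infl_ghom by blast
qed

text \<open>The map that \<open>Gr_Hot\<close> attaches to a single closed representative
  \<open>f\<close>, named so that independence of the homotopy class can be stated.\<close>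

definition Gm_map where
  "Gm_map i M N f = (\<lambda>j x. coset_rep (Gr_map k n i N f j (inv_into (carrier (mgr (Gr_mod k A n i M) j)) coset_rep x)))"

lemma Gm_map_gq:
  assumes M: "isM M" "isM N" and f: "f \<in> closed0 A\<^sub>n M N" and m: "m \<in> carrier (mgr M j)"
  shows "Gm_map i M N f j (gq i M j m) = gq i N j (f j m)"
proof -
  have "Gr_map k n i N f j (cl i M j (T i M j m)) = cl i N j (f j (T i M j m))"
    unfolding Gr_map_def by (rule UN_cl[OF M]) (use f m M tp_closed0[OF f M] in simp_all)
  then show ?thesis
    unfolding Gm_map_def gq_def inv_rep[OF M(1) tpI[OF m refl]] using T_ghom[OF closed0_ghom[OF f] m M(2)] by simp
qed

lemma Gm_map_closed0:
  assumes M: "isM M" "isM N" and f: "f \<in> closed0 A\<^sub>n M N"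
  shows "Gm_map i M N f \<in> closed0 A (GR i M) (GR i N)"
proof -
  have c: "(\<lambda>j m. gq i N j (f j m)) \<in> closed0 A\<^sub>n M (red.infl (GR i N))"
    by (rule closed0_comp[OF f gq_closed0[OF M(2)] M GR_infl[OF M(2)]])
  have ker: "gq i N j (f j m) = \<zero>\<^bsub>mgr (red.infl (GR i N)) j\<^esub>"
    if "m \<in> carrier (mgr M j)" "gq i M j m = \<zero>\<^bsub>mgr (red.infl (GR i M)) j\<^esub>" for j m
    using induced_ker[OF M closed0_ghom[OF f] that(1), of i] that(2) by simp
  obtain g where g: "g \<in> closed0 A\<^sub>n (red.infl (GR i M)) (red.infl (GR i N))"
    "\<And>j m. m \<in> carrier (mgr M j) \<Longrightarrow> g j (gq i M j m) = gq i N j (f j m)"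
    by (rule factor_closed0[OF M(1) GR_infl[OF M(1)] GR_infl[OF M(2)] gq_surj[OF M(1), of i] c], rule ker, assumption, assumption, rule that)
  have "g \<in> closed0 A (GR i M) (GR i N)" using g(1) red.infl_closed0[OF GR_module[OF M(1)] GR_module[OF M(2)]] by blast
  then show ?thesis
    by (rule b.closed0_cong[OF GR_module[OF M(1)] GR_module[OF M(2)]]) (auto elim!: GR_E[OF M(1)] simp: Gm_map_gq[OF M f] g(2))
qed

lemma Gm_map_htpy:
  assumes M: "isM M" "isM N" and h: "(f, f') \<in> htpy_rel A\<^sub>n M N"
  shows "(Gm_map i M N f, Gm_map i M N f') \<in> htpy_rel A (GR i M) (GR i N)"
proof -
  obtain h where h: "f \<in> closed0 A\<^sub>n M N" "f' \<in> closed0 A\<^sub>n M N" "h \<in> ghom A\<^sub>n (- 1) M N"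
    "\<And>i m. m \<in> carrier (mgr M i) \<Longrightarrow> f' i m = f i m \<oplus>\<^bsub>mgr N i\<^esub> bd M N h i m"
    by (rule htpyE[OF h M], rule that)
  obtain g where g: "g \<in> ghom A (- 1) (GR i M) (GR i N)"
    "\<And>j m. m \<in> carrier (mgr M j) \<Longrightarrow> g j (gq i M j m) = gq i N (j + - 1) (h j m)"
    by (rule induced_ghom[OF M h(3)], rule that)
  show ?thesis
  proof (rule b.htpyI[OF GR_module[OF M(1)] GR_module[OF M(2)] Gm_map_closed0[OF M h(1)] Gm_map_closed0[OF M h(2)] g(1)])
    fix j x assume "x \<in> carrier (mgr (GR i M) j)"
    then obtain m where m: "m \<in> carrier (mgr M j)" "x = gq i M j m" by (rule GR_E[OF M(1)])
    have dm: "mdiff M j m \<in> carrier (mgr M (j + 1))" using m M by simp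
    note hc = h_closed'[OF h(3) m(1) M]
    have "b.bd (GR i M) (GR i N) g j x = gq i N j (bd M N h j m)"
      unfolding b.bd_def bd_def m(2) gq_diff[OF M(1) m(1)] g(2)[OF m(1)] g(2)[OF dm]
      using gq_diff[OF M(2) hc(1), of i] closed0_add[OF gq_closed0[OF M(2)] hc(2,3), of i] by simp
    then show "Gm_map i M N f' j x = Gm_map i M N f j x \<oplus>\<^bsub>mgr (GR i N) j\<^esub> b.bd (GR i M) (GR i N) g j x"
      unfolding m(2) Gm_map_gq[OF M h(1) m(1)] Gm_map_gq[OF M h(2) m(1)] h(4)[OF m(1)]
      using closed0_add[OF gq_closed0[OF M(2)] closed0_closed[OF h(1) m(1)] bd_closed[OF h(3) m(1) M], of i] by simp
  qed
qed

lemma Gr_Hot_simps: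
  fixes M N :: "('k, 'a, 'm) def_mod"
  shows "FO (Gr_Hot k A n i) = GR i"
    "isM M \<Longrightarrow> isM N \<Longrightarrow> f \<in> closed0 A\<^sub>n M N \<Longrightarrow>
      FM (Gr_Hot k A n i) M N (hcls A\<^sub>n M N f) = hcls A (GR i M) (GR i N) (Gm_map i M N f)"
proof -
  show FO: "FO (Gr_Hot k A n i) = GR i" by (rule ext) (simp add: GR_def)
  assume M: "isM M" "isM N" and f: "f \<in> closed0 A\<^sub>n M N"
  have "FM (Gr_Hot k A n i) M N (hcls A\<^sub>n M N f) = (\<Union>f\<in>hcls A\<^sub>n M N f. hcls A (GR i M) (GR i N) (Gm_map i M N f))"
    by (simp add: Gr_Hot_def GR_def Let_def Gm_map_def)
  also have "\<dots> = hcls A (GR i M) (GR i N) (Gm_map i M N f)"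
  proof (rule UN_hcls[OF M f])
    fix g assume fg: "(f, g) \<in> htpy_rel A\<^sub>n M N"
    show "hcls A (GR i M) (GR i N) (Gm_map i M N g) = hcls A (GR i M) (GR i N) (Gm_map i M N f)"
      using equiv_class_eq[OF b.htpy_equiv[OF GR_module[OF M(1)] GR_module[OF M(2)]] Gm_map_htpy[OF M fg]] by simp
  qed
  finally show "FM (Gr_Hot k A n i) M N (hcls A\<^sub>n M N f) = hcls A (GR i M) (GR i N) (Gm_map i M N f)" .
qed

lemma Gr_Hot_is_func: "is_func H b.H (Gr_Hot k A n i)"
proof (intro is_func.intro is_func_axioms.intro Hot_is_cat b.Hot_is_cat)
  fix X assume "X \<in> Obj H"
  then show "FO (Gr_Hot k A n i) X \<in> Obj b.H" by (simp add: Gr_Hot_simps(1) GR_module)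
next
  fix X Y F assume h: "X \<in> Obj H" "Y \<in> Obj H" "F \<in> Hom H X Y"
  then have M: "isM X" "isM Y" by simp_all
  obtain f where f: "f \<in> closed0 A\<^sub>n X Y" "F = hcls A\<^sub>n X Y f" by (rule Hot_homE[OF h(3)])
  show "FM (Gr_Hot k A n i) X Y F \<in> Hom b.H (FO (Gr_Hot k A n i) X) (FO (Gr_Hot k A n i) Y)"
    unfolding f(2) Gr_Hot_simps(1) Gr_Hot_simps(2)[OF M f(1)] by (rule b.hcls_hom[OF Gm_map_closed0[OF M f(1)]])
next
  fix X assume "X \<in> Obj H"
  then have M: "isM X" by simp
  note i = closed0_id[OF M]
  have "hcls A (GR i X) (GR i X) (Gm_map i X X (\<lambda>i x. x)) = hcls A (GR i X) (GR i X) (\<lambda>i x. x)"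
    by (rule b.hcls_cong[OF GR_module[OF M] GR_module[OF M] Gm_map_closed0[OF M M i] b.closed0_id[OF GR_module[OF M]]])
       (auto elim!: GR_E[OF M] simp: Gm_map_gq[OF M M i])
  then show "FM (Gr_Hot k A n i) X X (Idm H X) = Idm b.H (FO (Gr_Hot k A n i) X)"
    using Gr_Hot_simps(2)[OF M M i] by (simp add: Gr_Hot_simps(1))
next
  fix X Y Z F G assume h: "X \<in> Obj H" "Y \<in> Obj H" "Z \<in> Obj H" "F \<in> Hom H X Y" "G \<in> Hom H Y Z"
  then have M: "isM X" "isM Y" "isM Z" by simp_all
  obtain f where f: "f \<in> closed0 A\<^sub>n X Y" "F = hcls A\<^sub>n X Y f" by (rule Hot_homE[OF h(4)])
  obtain g where g: "g \<in> closed0 A\<^sub>n Y Z" "G = hcls A\<^sub>n Y Z g" by (rule Hot_homE[OF h(5)])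
  note gf = closed0_comp[OF f(1) g(1) M]
  note G = GR_module[OF M(1), of i] GR_module[OF M(2), of i] GR_module[OF M(3), of i]
  note Gf = Gm_map_closed0[OF M(1,2) f(1), of i] and Gg = Gm_map_closed0[OF M(2,3) g(1), of i]
  have "hcls A (GR i X) (GR i Z) (Gm_map i X Z (\<lambda>i x. g i (f i x)))
     = hcls A (GR i X) (GR i Z) (\<lambda>j x. Gm_map i Y Z g j (Gm_map i X Y f j x))"
    by (rule b.hcls_cong[OF G(1,3) Gm_map_closed0[OF M(1,3) gf] b.closed0_comp[OF Gf Gg G]])
       (auto elim!: GR_E[OF M(1)] simp: Gm_map_gq[OF M(1,3) gf] Gm_map_gq[OF M(1,2) f(1)] Gm_map_gq[OF M(2,3) g(1)] closed0_closed[OF f(1)])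
  then show "FM (Gr_Hot k A n i) X Z (Comp H X Y Z G F)
      = Comp b.H (FO (Gr_Hot k A n i) X) (FO (Gr_Hot k A n i) Y) (FO (Gr_Hot k A n i) Z) (FM (Gr_Hot k A n i) Y Z G) (FM (Gr_Hot k A n i) X Y F)"
    unfolding f(2) g(2) Hot_comp[OF M f(1) g(1)] Gr_Hot_simps(1) Gr_Hot_simps(2)[OF M(1,3) gf] Gr_Hot_simps(2)[OF M(1,2) f(1)]
      Gr_Hot_simps(2)[OF M(2,3) g(1)] b.Hot_comp[OF G Gf Gg] .
qed

lemma gq_Zc:
  assumes M: "isM M" and m: "m \<in> carrier (mgr M j)"
  shows "gq i M j m \<in> b.Zc (GR i M) 0 j \<longleftrightarrow> T i M j m \<in> Zc M i j"
  unfolding b_Zc[OF GR_module[OF M]] gq_diff[OF M m] Zc_def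
  using gq_zero_iff[OF M, of "mdiff M j m" "j + 1" i] T_diff[OF M m, of i] tpI[OF m refl, of i] m M by simp

lemma gq_Bd:
  assumes M: "isM M" and m: "m \<in> carrier (mgr M j)"
  shows "gq i M j m \<in> b.Bd (GR i M) 0 j \<longleftrightarrow> T i M j m \<in> Bd M i j"
proof -
  have y: "gq i M j m = mdiff (GR i M) (j - 1) (gq i M (j - 1) y) \<longleftrightarrow> T i M j m \<ominus>\<^bsub>mgr M j\<^esub> mdiff M (j - 1) (T i M (j - 1) y) \<in> tp M (Suc i) j"
    if y: "y \<in> carrier (mgr M (j - 1))" for y
  proof -
    note dy = d_carrier[OF M y]
    have "gq i M j m = mdiff (GR i M) (j - 1) (gq i M (j - 1) y) \<longleftrightarrow> gq i M j (m \<ominus>\<^bsub>mgr M j\<^esub> mdiff M (j - 1) y) = \<zero>\<^bsub>mgr (GR i M) j\<^esub>"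
      unfolding gq_minus[OF M m dy] using gq_diff[OF M y, of i] abelian_group.ab_eq_minus[OF b.Mod_grp[OF GR_module[OF M]] gq_closed[OF M m] gq_closed[OF M dy]]
      by simp
    also have "\<dots> \<longleftrightarrow> T i M j m \<ominus>\<^bsub>mgr M j\<^esub> T i M j (mdiff M (j - 1) y) \<in> tp M (Suc i) j"
      using gq_zero_iff[OF M, of "m \<ominus>\<^bsub>mgr M j\<^esub> mdiff M (j - 1) y" j i] m dy M T_minus[OF M m dy, of i] by simp
    finally show ?thesis using T_diff[OF M y, of i] by simp
  qed
  have "gq i M j m \<in> b.Bd (GR i M) 0 j \<longleftrightarrow> (\<exists>y\<in>carrier (mgr M (j - 1)). gq i M j m = mdiff (GR i M) (j - 1) (gq i M (j - 1) y))"
    unfolding b_Bd[OF GR_module[OF M]] using GR_E[OF M] gq_closed[OF M] by metis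
  also have "\<dots> \<longleftrightarrow> (\<exists>y\<in>carrier (mgr M (j - 1)). T i M j m \<ominus>\<^bsub>mgr M j\<^esub> mdiff M (j - 1) (T i M (j - 1) y) \<in> tp M (Suc i) j)"
    using y by blast
  also have "\<dots> \<longleftrightarrow> T i M j m \<in> Bd M i j"
  proof
    assume "\<exists>y\<in>carrier (mgr M (j - 1)). T i M j m \<ominus>\<^bsub>mgr M j\<^esub> mdiff M (j - 1) (T i M (j - 1) y) \<in> tp M (Suc i) j"
    then show "T i M j m \<in> Bd M i j" using Bd_cancel[OF M T_closed[OF M m] Bd_d[OF M tpI[OF _ refl]] Bd_tp[OF M]] by blast
  next
    assume "T i M j m \<in> Bd M i j"
    then obtain y z where yz: "y \<in> tp M i (j - 1)" "z \<in> tp M (Suc i) j" "T i M j m = mdiff M (j - 1) y \<oplus>\<^bsub>mgr M j\<^esub> z" by (rule BdE)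
    have "T i M j m \<ominus>\<^bsub>mgr M j\<^esub> mdiff M (j - 1) y = z"
      unfolding yz(3) using d_carrier[OF M tp_carrier[OF yz(1) M]] tp_carrier[OF yz(2) M] M by (simp add: ab_ac)
    then show "\<exists>y\<in>carrier (mgr M (j - 1)). T i M j m \<ominus>\<^bsub>mgr M j\<^esub> mdiff M (j - 1) (T i M (j - 1) y) \<in> tp M (Suc i) j"
      using yz(1,2) by (auto elim!: tpE[of y])
  qed
  finally show ?thesis .
qed

lemma gq_Zc_ball:
  assumes M: "isM M"
  shows "(\<forall>x\<in>b.Zc (GR i M) 0 j. P x) \<longleftrightarrow> (\<forall>m\<in>carrier (mgr M j). gq i M j m \<in> b.Zc (GR i M) 0 j \<longrightarrow> P (gq i M j m))" (is ?A)
    "(\<exists>x\<in>b.Zc (GR i M) 0 j. P x) \<longleftrightarrow> (\<exists>m\<in>carrier (mgr M j). gq i M j m \<in> b.Zc (GR i M) 0 j \<and> P (gq i M j m))" (is ?B)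
proof -
  have "\<exists>m\<in>carrier (mgr M j). x = gq i M j m" if "x \<in> b.Zc (GR i M) 0 j" for x
    using GR_E[OF M b.Zc_carrier[OF that GR_module[OF M]]] by blast
  then show ?A ?B by blast+
qed

text \<open>Through \<open>gq\<close> the cycles and boundaries of \<open>GR i M\<close> correspond
  to \<open>Zc M i\<close> and \<open>Bd M i\<close>. The equivalence is used in both directions:
  the functor preserves the inverted maps, and on suitable modules it detects them.\<close>

lemma qis_Gm_map:
  assumes M: "isM M" "isM N" and f: "f \<in> closed0 A\<^sub>n M N"
  shows "b.qis 0 (GR i M) (GR i N) (Gm_map i M N f) \<longleftrightarrow> qis i M N f"
proof -
  note Tf = T_ghom[OF closed0_ghom[OF f] _ M(2), simplified]
  have 1: "(\<forall>x\<in>b.Zc (GR i M) 0 j. Gm_map i M N f j x \<in> b.Bd (GR i N) 0 j \<longrightarrow> x \<in> b.Bd (GR i M) 0 j)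
      \<longleftrightarrow> (\<forall>x\<in>Zc M i j. f j x \<in> Bd N i j \<longrightarrow> x \<in> Bd M i j)" (is "?L \<longleftrightarrow> ?R") for j
  proof -
    have "?L \<longleftrightarrow> (\<forall>m\<in>carrier (mgr M j). gq i M j m \<in> b.Zc (GR i M) 0 j \<longrightarrow> Gm_map i M N f j (gq i M j m) \<in> b.Bd (GR i N) 0 j \<longrightarrow> gq i M j m \<in> b.Bd (GR i M) 0 j)"
      by (rule gq_Zc_ball(1)[OF M(1)])
    also have "\<dots> \<longleftrightarrow> (\<forall>m\<in>carrier (mgr M j). T i M j m \<in> Zc M i j \<longrightarrow> f j (T i M j m) \<in> Bd N i j \<longrightarrow> T i M j m \<in> Bd M i j)"
      by (intro ball_cong refl) (simp add: gq_Zc[OF M(1)] gq_Bd[OF M(1)] Gm_map_gq[OF M f] gq_Bd[OF M(2) closed0_closed[OF f]] Tf)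
    also have "\<dots> \<longleftrightarrow> ?R" using ZcD(1)[of _ M i j] by (auto elim!: tpE)
    finally show ?thesis .
  qed
  have mi: "gq i N j y \<ominus>\<^bsub>mgr (GR i N) j\<^esub> Gm_map i M N f j (gq i M j m) \<in> b.Bd (GR i N) 0 j \<longleftrightarrow> T i N j y \<ominus>\<^bsub>mgr N j\<^esub> f j (T i M j m) \<in> Bd N i j"
    if "y \<in> carrier (mgr N j)" "m \<in> carrier (mgr M j)" for y m j
  proof -
    note fm = closed0_closed[OF f that(2)]
    have "y \<ominus>\<^bsub>mgr N j\<^esub> f j m \<in> carrier (mgr N j)" using that fm M by simp
    from gq_Bd[OF M(2) this, of i] show ?thesis
      unfolding gq_minus[OF M(2) that(1) fm] Gm_map_gq[OF M f that(2)] T_minus[OF M(2) that(1) fm] Tf[OF that(2)] .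
  qed
  have 2: "(\<forall>y\<in>b.Zc (GR i N) 0 j. \<exists>x\<in>b.Zc (GR i M) 0 j. y \<ominus>\<^bsub>mgr (GR i N) j\<^esub> Gm_map i M N f j x \<in> b.Bd (GR i N) 0 j)
      \<longleftrightarrow> (\<forall>y\<in>Zc N i j. \<exists>x\<in>Zc M i j. y \<ominus>\<^bsub>mgr N j\<^esub> f j x \<in> Bd N i j)" (is "?L \<longleftrightarrow> ?R") for j
  proof -
    have "?L \<longleftrightarrow> (\<forall>y\<in>carrier (mgr N j). gq i N j y \<in> b.Zc (GR i N) 0 j \<longrightarrow> (\<exists>m\<in>carrier (mgr M j). gq i M j m \<in> b.Zc (GR i M) 0 j \<and>
        gq i N j y \<ominus>\<^bsub>mgr (GR i N) j\<^esub> Gm_map i M N f j (gq i M j m) \<in> b.Bd (GR i N) 0 j))"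
      unfolding gq_Zc_ball(1)[OF M(2)] gq_Zc_ball(2)[OF M(1)] ..
    also have "\<dots> \<longleftrightarrow> (\<forall>y\<in>carrier (mgr N j). T i N j y \<in> Zc N i j \<longrightarrow> (\<exists>m\<in>carrier (mgr M j). T i M j m \<in> Zc M i j \<and>
        T i N j y \<ominus>\<^bsub>mgr N j\<^esub> f j (T i M j m) \<in> Bd N i j))"
      by (intro ball_cong refl) (simp add: gq_Zc[OF M(1)] gq_Zc[OF M(2)] mi cong: bex_cong)
    also have "\<dots> \<longleftrightarrow> ?R"
    proof (intro iffI ballI impI)
      fix y assume h: "\<forall>y\<in>carrier (mgr N j). T i N j y \<in> Zc N i j \<longrightarrow> (\<exists>m\<in>carrier (mgr M j). T i M j m \<in> Zc M i j \<and>
        T i N j y \<ominus>\<^bsub>mgr N j\<^esub> f j (T i M j m) \<in> Bd N i j)" and y: "y \<in> Zc N i j"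
      obtain y' where "y' \<in> carrier (mgr N j)" "y = T i N j y'" using ZcD(1)[OF y] by (rule tpE)
      then show "\<exists>x\<in>Zc M i j. y \<ominus>\<^bsub>mgr N j\<^esub> f j x \<in> Bd N i j" using h y by blast
    next
      fix y assume h: "\<forall>y\<in>Zc N i j. \<exists>x\<in>Zc M i j. y \<ominus>\<^bsub>mgr N j\<^esub> f j x \<in> Bd N i j" and y: "T i N j y \<in> Zc N i j"
      obtain x where x: "x \<in> Zc M i j" "T i N j y \<ominus>\<^bsub>mgr N j\<^esub> f j x \<in> Bd N i j" using h y by blast
      obtain m where "m \<in> carrier (mgr M j)" "x = T i M j m" using ZcD(1)[OF x(1)] by (rule tpE)
      then show "\<exists>m\<in>carrier (mgr M j). T i M j m \<in> Zc M i j \<and> T i N j y \<ominus>\<^bsub>mgr N j\<^esub> f j (T i M j m) \<in> Bd N i j" using x by blast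
    qed
    finally show ?thesis .
  qed
  show ?thesis unfolding b.qis_def qis_def 1 2 ..
qed

lemma Gr_frac_functor:
  assumes i: "i \<le> n"
  shows "frac_functor H NN b.H b.NN (Gr_Hot k A n i)"
proof (intro frac_functor.intro frac_functor_axioms.intro H_fractions b.H_fractions Gr_Hot_is_func)
  fix X Y S assume h: "X \<in> Obj H" "Y \<in> Obj H" "S \<in> cone_in H NN X Y"
  then have M: "isM X" "isM Y" by simp_all
  obtain s where s: "s \<in> closed0 A\<^sub>n X Y" "S = hcls A\<^sub>n X Y s" "\<And>j. j \<le> n \<Longrightarrow> qis j X Y s"
    by (rule cone_inE[OF M h(3)], rule that)
  show "FM (Gr_Hot k A n i) X Y S \<in> cone_in b.H b.NN (FO (Gr_Hot k A n i) X) (FO (Gr_Hot k A n i) Y)"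
    unfolding s(2) Gr_Hot_simps(1) Gr_Hot_simps(2)[OF M s(1)]
    using b.cone_in_hcls[OF GR_module[OF M(1)] GR_module[OF M(2)] Gm_map_closed0[OF M s(1)]] qis_Gm_map[OF M s(1)] s(3)[OF i] by simp
qed

end

section \<open>A left inverse of the graded piece functor\<close>

context deformation_universe
begin

text \<open>One generator for every pair of a degree and an element of the universe. The index set
  does not depend on a module, so the same free module surjects onto every dg module
  \<open>N\<close>.\<close>

sublocale fg: free_gens Rn A\<^sub>n "fst :: int \<times> 'm \<Rightarrow> int"
  by (intro free_gens.intro cdg_algebra_axioms)

lemma fg_small: "carrier (mgr fg.Gm j) \<lesssim> (UNIV :: 'm set)"
proof (rule fg.Gm_small[OF inf])
  have "(UNIV :: int set) \<times> (UNIV :: 'm set) \<lesssim> (UNIV :: 'm set)"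
    by (rule lepoll_Times_infinite[OF inf int_small[OF inf]]) simp
  then show "(UNIV :: (int \<times> 'm) set) \<lesssim> (UNIV :: 'm set)" by simp
  show "carrier (agr A\<^sub>n i) \<lesssim> (UNIV :: 'm set)" for i
    unfolding An_simps by (rule PiE_small[OF inf large])
qed

text \<open>The image of the generator e indexed by (j, y): it is \<open>y\<close>, or zero if
  \<open>y\<close> is not an element of \<open>N\<close> in degree j.\<close>

definition nn where "nn N x = (if snd x \<in> carrier (mgr N (fst x)) then snd x else \<zero>\<^bsub>mgr N (fst x)\<^esub>)"

definition eps where "eps N = fg.ev 0 (red.infl N) (nn N) (\<lambda>x. mdiff (red.infl N) (fst x) (nn N x))"

lemma nn_closed [simp]: "b.isM N \<Longrightarrow> nn N x \<in> carrier (mgr N (fst x))"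
  by (simp add: nn_def)

lemma eps_surj: assumes N: "b.isM N" shows "surj_map fg.Gm (red.infl N) (eps N)"
proof -
  note I = red.infl_module[OF N]
  have m: "nn N x \<in> carrier (mgr (red.infl N) (fst x))" for x using N by simp
  have c: "eps N \<in> closed0 A\<^sub>n fg.Gm (red.infl N)" unfolding eps_def by (rule fg.ev_closed0[OF I m])
  have "\<exists>g\<in>carrier (mgr fg.Gm j). y = eps N j g" if y: "y \<in> carrier (mgr N j)" for y j
  proof -
    have nn: "nn N (j, y) = y" using y by (simp add: nn_def)
    have "eps N j (fg.gen (j, y)) = y"
      using fg.ev_gen[OF I m, of "\<lambda>x. mdiff (red.infl N) (fst x) (nn N x)" "(j, y)"] m I N y by (simp add: eps_def nn)
    then show ?thesis using fg.gen_carrier[of "(j, y)"] by (intro bexI[of _ "fg.gen (j, y)"]) simp_all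
  qed
  then have "eps N j ` carrier (mgr fg.Gm j) = carrier (mgr (red.infl N) j)" for j
    using closed0_closed[OF c, of _ j] by fastforce
  then show ?thesis using c by (simp add: surj_map_def)
qed

lemma eps_closed0: "b.isM N \<Longrightarrow> eps N \<in> closed0 A\<^sub>n fg.Gm (red.infl N)"
  by (rule surj_mapD[OF eps_surj])

text \<open>\<open>eps N\<close> sees only the constant coefficients of an element of the free
  module, as t acts by zero on an inflated module. Freeness makes t^i g = 0 a condition on
  coefficients, which forces the constant ones to vanish.\<close>

lemma eps_T_zero:
  assumes N: "b.isM N" and i: "i \<le> n" and g: "g \<in> carrier (mgr fg.Gm j)" and T: "T i fg.Gm j g = \<zero>\<^bsub>mgr fg.Gm j\<^esub>"
  shows "eps N j g = \<zero>\<^bsub>mgr N j\<^esub>"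
proof -
  \<comment> \<open>The coefficient of index i of t^i a is the constant coefficient of
    \<open>a\<close>; it is visible because i <= n.\<close>
  have red0: "a 0 = \<zero>\<^bsub>agr A l\<^esub>" if a: "a \<in> carrier (agr A\<^sub>n l)" and z: "amult A\<^sub>n 0 l (tpow i) a = \<zero>\<^bsub>agr A\<^sub>n l\<^esub>" for a l
    using smult_coeff[OF a i, of i] z unfolding tpow_mult(1)[OF a] using i by (simp add: An_simps)
  have "fg.gev 0 (red.infl N) (fst x) (nn N x) (mdiff (red.infl N) (fst x) (nn N x)) j (g x) = \<zero>\<^bsub>mgr N j\<^esub>" for x
  proof -
    have "g x \<in> carrier (mgr (regrade (fst x) (gen_mod A\<^sub>n)) j)" using g unfolding fg.Gm_carrier by blast
    then obtain u v where uv: "g x = (u, v)" "u \<in> carrier (agr A\<^sub>n (j - fst x))" "v \<in> carrier (agr A\<^sub>n (j - fst x - 1))" by auto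
    have "T i fg.Gm j g x = \<zero>\<^bsub>mgr fg.Gm j\<^esub> x" using T by simp
    then have "u 0 = \<zero>\<^bsub>agr A (j - fst x)\<^esub>" "v 0 = \<zero>\<^bsub>agr A (j - fst x - 1)\<^esub>"
      using red0[OF uv(2)] red0[OF uv(3)] unfolding T_def fg.Gm_def by (simp_all add: uv(1))
    then show ?thesis
      using b.M_zero(1)[OF N nn_closed[OF N, of x], of "j - fst x"] b.M_zero(1)[OF N b.M_closed(2)[OF N nn_closed[OF N, of x]], of "j - fst x - 1"] N
      by (simp add: fg.gev_def uv(1))
  qed
  then have "eps N j g = (\<Oplus>\<^bsub>mgr (red.infl N) j\<^esub>x\<in>fg.supp j g. \<zero>\<^bsub>mgr (red.infl N) j\<^esub>)"
    unfolding eps_def fg.ev_def using red.infl_module[OF N] by (simp add: red.infl_simps(2) del: red.infl_simps(1))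
  also have "\<dots> = \<zero>\<^bsub>mgr (red.infl N) j\<^esub>"
    by (rule abelian_monoid.finsum_zero) (use Mod_grp[OF red.infl_module[OF N]] abelian_group_def in blast)
  finally show ?thesis by simp
qed

definition Lc where "Lc i N j = T i fg.Gm j ` {g \<in> carrier (mgr fg.Gm j). eps N j g = \<zero>\<^bsub>mgr N j\<^esub>}"

lemma LcE:
  assumes "x \<in> Lc i N j" obtains g where "g \<in> carrier (mgr fg.Gm j)" "eps N j g = \<zero>\<^bsub>mgr N j\<^esub>" "x = T i fg.Gm j g"
  using assms unfolding Lc_def by blast

lemma LcI: "g \<in> carrier (mgr fg.Gm j) \<Longrightarrow> eps N j g = \<zero>\<^bsub>mgr N j\<^esub> \<Longrightarrow> x = T i fg.Gm j g \<Longrightarrow> x \<in> Lc i N j"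
  unfolding Lc_def by blast

text \<open>A priori t^i g could equal t^i g' with only g' in the kernel of \<open>eps N\<close>;
  \<open>eps_T_zero\<close>, applied to the difference, excludes this. Hence the multiples of t^i
  modulo \<open>Lc i N\<close> form a copy of \<open>N\<close>.\<close>

lemma T_Lc_iff:
  assumes N: "b.isM N" and i: "i \<le> n" and g: "g \<in> carrier (mgr fg.Gm j)"
  shows "T i fg.Gm j g \<in> Lc i N j \<longleftrightarrow> eps N j g = \<zero>\<^bsub>mgr N j\<^esub>"
proof
  note G = fg.Gm_module and I = red.infl_module[OF N] and e = eps_closed0[OF N]
  assume "T i fg.Gm j g \<in> Lc i N j"
  then obtain g' where g': "g' \<in> carrier (mgr fg.Gm j)" "eps N j g' = \<zero>\<^bsub>mgr N j\<^esub>" "T i fg.Gm j g = T i fg.Gm j g'" by (rule LcE)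
  have "eps N j (g \<ominus>\<^bsub>mgr fg.Gm j\<^esub> g') = \<zero>\<^bsub>mgr N j\<^esub>"
    by (rule eps_T_zero[OF N i]) (use g g' G T_minus[OF G g g'(1), of i] in simp_all)
  then show "eps N j g = \<zero>\<^bsub>mgr N j\<^esub>"
    using closed0_zero(3)[OF e G I g g'(1)] g'(2) closed0_closed[OF e g] N by simp
qed (use g LcI in blast)

lemma Lc_submod: assumes N: "b.isM N" shows "submod fg.Gm (Lc i N)"
proof (rule submodI)
  note G = fg.Gm_module and I = red.infl_module[OF N] and e = eps_closed0[OF N]
  show "x \<in> carrier (mgr fg.Gm j)" if "x \<in> Lc i N j" for j x
    using that by (rule LcE) (use T_closed[OF G] in blast)
  show "\<zero>\<^bsub>mgr fg.Gm j\<^esub> \<in> Lc i N j" for j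
    by (rule LcI[of "\<zero>\<^bsub>mgr fg.Gm j\<^esub>"])
       (use abelian_group.ab_closed(3)[OF Mod_grp[OF G]] closed0_zero(1)[OF e G I] M_zero(2)[OF G tau_closed, of j i] in \<open>simp_all only: T_def red.infl_simps add_0\<close>)
  show "x \<oplus>\<^bsub>mgr fg.Gm j\<^esub> y \<in> Lc i N j" if xy: "x \<in> Lc i N j" "y \<in> Lc i N j" for j x y
  proof -
    obtain g where g: "g \<in> carrier (mgr fg.Gm j)" "eps N j g = \<zero>\<^bsub>mgr N j\<^esub>" "x = T i fg.Gm j g" using xy(1) by (rule LcE)
    obtain g' where g': "g' \<in> carrier (mgr fg.Gm j)" "eps N j g' = \<zero>\<^bsub>mgr N j\<^esub>" "y = T i fg.Gm j g'" using xy(2) by (rule LcE)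
    show ?thesis
      by (rule LcI[of "g \<oplus>\<^bsub>mgr fg.Gm j\<^esub> g'"])
         (use g g' abelian_group.ab_closed(1)[OF Mod_grp[OF G] g(1) g'(1)] closed0_add[OF e g(1) g'(1)] T_add(1)[OF G g(1) g'(1), of i] N in simp_all)
  qed
  show "mact fg.Gm l j a x \<in> Lc i N (l + j)" if a: "a \<in> carrier (agr A\<^sub>n l)" and x: "x \<in> Lc i N j" for l j a x
  proof -
    obtain g where g: "g \<in> carrier (mgr fg.Gm j)" "eps N j g = \<zero>\<^bsub>mgr N j\<^esub>" "x = T i fg.Gm j g" using x by (rule LcE)
    show ?thesis
      by (rule LcI[of "mact fg.Gm l j a g"])
         (use g M_closed(1)[OF G a g(1)] closed0_act[OF e a g(1)] T_act[OF G a g(1), of i] N red.\<theta>_closed[OF a] in simp_all)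
  qed
  show "mdiff fg.Gm j x \<in> Lc i N (j + 1)" if x: "x \<in> Lc i N j" for j x
  proof -
    obtain g where g: "g \<in> carrier (mgr fg.Gm j)" "eps N j g = \<zero>\<^bsub>mgr N j\<^esub>" "x = T i fg.Gm j g" using x by (rule LcE)
    show ?thesis
      by (rule LcI[of "mdiff fg.Gm j g"])
         (use g M_closed(2)[OF G g(1)] closed0_diff[OF e g(1) G I] T_diff[OF G g(1), of i] N in simp_all)
  qed
qed

text \<open>The quotient \<Gamma> of the overview together with its projection, given by a property
  because it is chosen inside the universe. \<open>Lc i N\<close> is t^i times the kernel of
  \<open>eps N\<close>.\<close>

definition presents :: "nat \<Rightarrow> ('k, 'a, 'm) cdg_mod \<Rightarrow> ('k, 'a, 'm) def_mod \<Rightarrow> (int \<Rightarrow> (int \<times> 'm \<Rightarrow> (nat \<Rightarrow> 'a) \<times> (nat \<Rightarrow> 'a)) \<Rightarrow> 'm) \<Rightarrow> bool" where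
  "presents i N \<Gamma> \<pi> \<longleftrightarrow> b.isM N \<and> i \<le> n \<and> isM \<Gamma> \<and> surj_map fg.Gm \<Gamma> \<pi> \<and>
     (\<forall>j. \<forall>g\<in>carrier (mgr fg.Gm j). \<pi> j g = \<zero>\<^bsub>mgr \<Gamma> j\<^esub> \<longleftrightarrow> g \<in> Lc i N j)"

lemma presents_exists:
  assumes N: "b.isM N" and i: "i \<le> n"
  shows "\<exists>\<Gamma> \<pi>. presents i N \<Gamma> \<pi>"
proof -
  obtain \<Gamma> :: "('k, 'a, 'm) def_mod" and \<pi> where "isM \<Gamma>" "surj_map fg.Gm \<Gamma> \<pi>"
    "\<And>j x. x \<in> carrier (mgr fg.Gm j) \<Longrightarrow> \<pi> j x = \<zero>\<^bsub>mgr \<Gamma> j\<^esub> \<longleftrightarrow> x \<in> Lc i N j"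
    by (rule quotient_exists[OF fg.Gm_module Lc_submod[OF N, of i] fg_small], rule that)
  then show ?thesis unfolding presents_def using assms by blast
qed

lemma presentsD:
  assumes "presents i N \<Gamma> \<pi>"
  shows "b.isM N" "i \<le> n" "isM \<Gamma>" "surj_map fg.Gm \<Gamma> \<pi>"
    "g \<in> carrier (mgr fg.Gm j) \<Longrightarrow> \<pi> j g = \<zero>\<^bsub>mgr \<Gamma> j\<^esub> \<longleftrightarrow> g \<in> Lc i N j"
  using assms unfolding presents_def by blast+

text \<open>t acts by zero on the inflated \<open>N\<close>, so every positive power of t maps the
  free module into the kernel of \<open>eps N\<close>. Hence t^(i+1) G is contained in
  \<open>Lc i N\<close>.\<close>

lemma presents_T:
  assumes p: "presents i N \<Gamma> \<pi>" and l: "Suc i \<le> l" and y: "y \<in> carrier (mgr \<Gamma> j)"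
  shows "T l \<Gamma> j y = \<zero>\<^bsub>mgr \<Gamma> j\<^esub>"
proof -
  note N = presentsD(1)[OF p] and \<Gamma> = presentsD(3)[OF p] and \<pi> = presentsD(4)[OF p] and G = fg.Gm_module
  obtain g where g: "g \<in> carrier (mgr fg.Gm j)" "y = \<pi> j g" by (rule surj_mapE[OF \<pi> y])
  obtain q where q: "l = i + Suc q" using l by (metis add_Suc_right le_Suc_ex add_Suc)
  have Tg: "T (Suc q) fg.Gm j g \<in> carrier (mgr fg.Gm j)" using T_closed[OF G g(1)] .
  have "tpow (Suc q) 0 = \<zero>\<^bsub>agr A 0\<^esub>"
    using smult_coeff[OF one_closed, of 0 "Suc q"] by (simp add: tpow_def)
  then have "eps N j (T (Suc q) fg.Gm j g) = \<zero>\<^bsub>mgr N j\<^esub>"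
    using T_ghom[OF closed0_ghom[OF eps_closed0[OF N]] g(1) red.infl_module[OF N], of "Suc q"]
      closed0_closed[OF eps_closed0[OF N] g(1)] b.M_zero(1)[OF N, of "eps N j g" j 0] by (simp add: T_def)
  then have "T l fg.Gm j g \<in> Lc i N j"
    using T_T[OF G g(1), of i "Suc q"] by (intro LcI[OF Tg]) (simp_all add: q)
  then have "\<pi> j (T l fg.Gm j g) = \<zero>\<^bsub>mgr \<Gamma> j\<^esub>" using presentsD(5)[OF p T_closed[OF G g(1)]] by blast
  then show ?thesis using T_ghom[OF closed0_ghom[OF surj_mapD[OF \<pi>]] g(1) \<Gamma>, of l] g(2) by simp
qed

lemma presents_TT:
  assumes p: "presents i N \<Gamma> \<pi>" shows "\<Gamma> \<in> TT i"
proof -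
  note \<Gamma> = presentsD(3)[OF p] and \<pi> = presentsD(4)[OF p] and G = fg.Gm_module
  have "acyc j \<Gamma>" if j: "j \<noteq> i" for j
  proof (cases "j < i")
    case True
    have ker: "x \<in> tp fg.Gm (Suc j) l" if x: "x \<in> carrier (mgr fg.Gm l)" "\<pi> l x = \<zero>\<^bsub>mgr \<Gamma> l\<^esub>" for x l
    proof -
      obtain g where g: "g \<in> carrier (mgr fg.Gm l)" "x = T i fg.Gm l g"
        using presentsD(5)[OF p x(1)] x(2) by (auto elim: LcE)
      have "tp fg.Gm i l \<subseteq> tp fg.Gm (Suc j) l" by (rule tp_mono[OF G]) (use True in simp)
      then show ?thesis using tpI[OF g] by blast
    qed
    have "acyc j fg.Gm" by (rule acyc_contractible[OF G fg.contr_ghom fg.contr_id])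
    then show ?thesis using acyc_qis[OF G \<Gamma> surj_mapD[OF \<pi>] qis_surj[OF G \<Gamma> \<pi> ker]] by blast
  next
    case False
    then have l: "Suc i \<le> j" using j by simp
    show ?thesis by (rule acyc_if_tp_zero[OF \<Gamma> presents_T[OF p l]])
  qed
  then show ?thesis using \<Gamma> by (simp add: TT_def)
qed

text \<open>\<open>eps N\<close> and the composite of \<open>\<pi>\<close> with
  \<open>gq i \<Gamma>\<close> are surjections from the free module with the same kernel: as t^(i+1)
  \<Gamma> = 0, the composite kills \<open>g\<close> exactly when t^i g lies in
  \<open>Lc i N\<close>, and \<open>T_Lc_iff\<close> applies.\<close>

lemma presents_iso:
  assumes p: "presents i N \<Gamma> \<pi>"
  obtains a where "a \<in> closed0 A N (GR i \<Gamma>)" "iso_in b.H N (GR i \<Gamma>) (hcls A N (GR i \<Gamma>) a)"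
    "\<And>j g. g \<in> carrier (mgr fg.Gm j) \<Longrightarrow> a j (eps N j g) = gq i \<Gamma> j (\<pi> j g)"
proof -
  note N = presentsD(1)[OF p] and i = presentsD(2)[OF p] and \<Gamma> = presentsD(3)[OF p] and \<pi> = presentsD(4)[OF p] and G = fg.Gm_module
  note I = red.infl_module[OF N] and E = eps_surj[OF N] and IG = GR_infl[OF \<Gamma>, of i] and \<pi>c = surj_mapD[OF \<pi>]
  have S: "surj_map fg.Gm (red.infl (GR i \<Gamma>)) (\<lambda>j g. gq i \<Gamma> j (\<pi> j g))"
  proof -
    have "(\<lambda>g. gq i \<Gamma> j (\<pi> j g)) ` carrier (mgr fg.Gm j) = gq i \<Gamma> j ` \<pi> j ` carrier (mgr fg.Gm j)" for j by blast
    then show ?thesis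
      using closed0_comp[OF \<pi>c gq_closed0[OF \<Gamma>] G \<Gamma> IG] \<pi> gq_surj[OF \<Gamma>, of i] unfolding surj_map_def by simp
  qed
  have ker: "gq i \<Gamma> j (\<pi> j g) = \<zero>\<^bsub>mgr (red.infl (GR i \<Gamma>)) j\<^esub> \<longleftrightarrow> eps N j g = \<zero>\<^bsub>mgr (red.infl N) j\<^esub>"
    if g: "g \<in> carrier (mgr fg.Gm j)" for j g
  proof -
    have t: "x \<in> tp \<Gamma> (Suc i) j \<longleftrightarrow> x = \<zero>\<^bsub>mgr \<Gamma> j\<^esub>" for x
      using presents_T[OF p order_refl, of _ j] tp_zero[OF \<Gamma>] by (auto elim!: tpE)
    have "gq i \<Gamma> j (\<pi> j g) = \<zero>\<^bsub>mgr (GR i \<Gamma>) j\<^esub> \<longleftrightarrow> \<pi> j (T i fg.Gm j g) = \<zero>\<^bsub>mgr \<Gamma> j\<^esub>"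
      using gq_zero_iff[OF \<Gamma> closed0_closed[OF \<pi>c g], of i] T_ghom[OF closed0_ghom[OF \<pi>c] g \<Gamma>, of i] t by simp
    then show ?thesis using presentsD(5)[OF p T_closed[OF G g]] T_Lc_iff[OF N i g] by simp
  qed
  obtain a where a: "a \<in> closed0 A\<^sub>n (red.infl N) (red.infl (GR i \<Gamma>))"
    "\<And>j g. g \<in> carrier (mgr fg.Gm j) \<Longrightarrow> a j (eps N j g) = gq i \<Gamma> j (\<pi> j g)"
    by (rule factor_closed0[OF G I IG E surj_mapD[OF S]], subst ker, assumption, assumption, rule that)
  obtain a' where a': "a' \<in> closed0 A\<^sub>n (red.infl (GR i \<Gamma>)) (red.infl N)"
    "\<And>j g. g \<in> carrier (mgr fg.Gm j) \<Longrightarrow> a' j (gq i \<Gamma> j (\<pi> j g)) = eps N j g"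
    by (rule factor_closed0[OF G IG I S surj_mapD[OF E]], subst (asm) ker, assumption, assumption, rule that)
  note GM = GR_module[OF \<Gamma>, of i]
  have ac: "a \<in> closed0 A N (GR i \<Gamma>)" "a' \<in> closed0 A (GR i \<Gamma>) N"
    using a(1) a'(1) red.infl_closed0 N GM by blast+
  have "a' j (a j x) = x" if "x \<in> carrier (mgr N j)" for j x
  proof -
    have "x \<in> carrier (mgr (red.infl N) j)" using that by simp
    then obtain g where "g \<in> carrier (mgr fg.Gm j)" "x = eps N j g" by (rule surj_mapE[OF E])
    then show ?thesis using a(2) a'(2) by simp
  qed
  moreover have "a j (a' j x) = x" if "x \<in> carrier (mgr (GR i \<Gamma>) j)" for j x
  proof -
    have "x \<in> carrier (mgr (red.infl (GR i \<Gamma>)) j)" using that by simp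
    then obtain g where "g \<in> carrier (mgr fg.Gm j)" "x = gq i \<Gamma> j (\<pi> j g)" by (rule surj_mapE[OF S])
    then show ?thesis using a(2) a'(2) by simp
  qed
  ultimately have "iso_in b.H N (GR i \<Gamma>) (hcls A N (GR i \<Gamma>) a)" by (rule b.iso_HotI[OF N GM ac])
  then show thesis using that[OF ac(1)] a(2) by blast
qed

text \<open>A map out of \<open>N\<close> lifts once lifts \<open>m\<close> and \<open>m'\<close> of the images of the generators are chosen.\<close>

lemma presents_lift:
  assumes p: "presents i N \<Gamma> \<pi>" and Y: "isM Y" "\<And>j y. y \<in> carrier (mgr Y j) \<Longrightarrow> T (Suc i) Y j y = \<zero>\<^bsub>mgr Y j\<^esub>"
    and h: "h \<in> ghom A q N (GR i Y)"
    and m: "\<And>x. m x \<in> carrier (mgr Y (fst x + q))" "\<And>x. m' x \<in> carrier (mgr Y (fst x + q + 1))"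
    and gm: "\<And>x. gq i Y (fst x + q) (m x) = h (fst x) (nn N x)"
      "\<And>x. gq i Y (fst x + q + 1) (m' x) = h (fst x + 1) (mdiff N (fst x) (nn N x))"
  shows "\<And>j g. g \<in> carrier (mgr fg.Gm j) \<Longrightarrow> gq i Y (j + q) (fg.ev q Y m m' j g) = h j (eps N j g)"
    "\<And>j g. g \<in> carrier (mgr fg.Gm j) \<Longrightarrow> \<pi> j g = \<zero>\<^bsub>mgr \<Gamma> j\<^esub> \<Longrightarrow> fg.ev q Y m m' j g = \<zero>\<^bsub>mgr Y (j + q)\<^esub>"
proof -
  note N = presentsD(1)[OF p] and G = fg.Gm_module
  note I = red.infl_module[OF N] and IG = GR_infl[OF Y(1), of i]
  have h': "h \<in> ghom A\<^sub>n q (red.infl N) (red.infl (GR i Y))" using h by (simp add: red.infl_ghom)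
  have nI: "nn N x \<in> carrier (mgr (red.infl N) (fst x + 0))" "mdiff (red.infl N) (fst x) (nn N x) \<in> carrier (mgr (red.infl N) (fst x + 0 + 1))" for x
    using N by simp_all
  \<comment> \<open>Both sides are maps out of the free module. By \<open>ev_comp\<close> they agree
    once they agree on the generators, which is \<open>gm\<close>.\<close>
  show A: "gq i Y (j + q) (fg.ev q Y m m' j g) = h j (eps N j g)" if g: "g \<in> carrier (mgr fg.Gm j)" for j g
    using fg.ev_comp[OF Y(1) IG m closed0_ghom[OF gq_closed0[OF Y(1)]] g] fg.ev_comp[OF I IG nI h' g] by (simp add: gm eps_def)
  note e = fg.ev_ghom[OF Y(1) m]
  \<comment> \<open>Such a \<open>g\<close> is t^i g' with g' in the kernel of \<open>eps N\<close>.
    The value at g' has trivial class in the i-th piece, so t^i times it lies in t^(i+1) Y =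
    0.\<close>
  show "fg.ev q Y m m' j g = \<zero>\<^bsub>mgr Y (j + q)\<^esub>" if g: "g \<in> carrier (mgr fg.Gm j)" and z: "\<pi> j g = \<zero>\<^bsub>mgr \<Gamma> j\<^esub>" for j g
  proof -
    obtain g' where g': "g' \<in> carrier (mgr fg.Gm j)" "eps N j g' = \<zero>\<^bsub>mgr N j\<^esub>" "g = T i fg.Gm j g'"
      using presentsD(5)[OF p g] z by (auto elim: LcE)
    have "gq i Y (j + q) (fg.ev q Y m m' j g') = \<zero>\<^bsub>mgr (GR i Y) (j + q)\<^esub>"
      using A[OF g'(1)] b.ghom_zero(1)[OF h N GR_module[OF Y(1)]] g'(2) by simp
    then have "T i Y (j + q) (fg.ev q Y m m' j g') \<in> tp Y (Suc i) (j + q)"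
      using gq_zero_iff[OF Y(1) ghom_closed[OF e g'(1)]] by blast
    then have "T i Y (j + q) (fg.ev q Y m m' j g') = \<zero>\<^bsub>mgr Y (j + q)\<^esub>" using Y(2) by (auto elim!: tpE)
    then show ?thesis using T_ghom[OF e g'(1) Y(1), of i] g'(3) by simp
  qed
qed

text \<open>Lifts \<open>m\<close> are chosen for the generators e alone; taking d m as the value on
  d e keeps the map closed.\<close>

lemma presents_lift0:
  assumes p: "presents i N \<Gamma> \<pi>" and Y: "isM Y" "\<And>j y. y \<in> carrier (mgr Y j) \<Longrightarrow> T (Suc i) Y j y = \<zero>\<^bsub>mgr Y j\<^esub>"
    and h: "h \<in> closed0 A N (GR i Y)"
  obtains f where "f \<in> closed0 A\<^sub>n \<Gamma> Y" "\<And>j g. g \<in> carrier (mgr fg.Gm j) \<Longrightarrow> gq i Y j (f j (\<pi> j g)) = h j (eps N j g)"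
proof -
  note N = presentsD(1)[OF p] and \<Gamma> = presentsD(3)[OF p] and \<pi> = presentsD(4)[OF p] and G = fg.Gm_module
  have "\<exists>m\<in>carrier (mgr Y (fst x)). gq i Y (fst x) m = h (fst x) (nn N x)" for x
    using GR_E[OF Y(1) b.closed0_closed[OF h nn_closed[OF N]]] by metis
  then obtain m where m: "\<And>x. m x \<in> carrier (mgr Y (fst x))" "\<And>x. gq i Y (fst x) (m x) = h (fst x) (nn N x)" by metis
  let ?m' = "\<lambda>x. mdiff Y (fst x) (m x)"
  have m0: "\<And>x. m x \<in> carrier (mgr Y (fst x + 0))" "\<And>x. ?m' x \<in> carrier (mgr Y (fst x + 0 + 1))"
    "\<And>x. gq i Y (fst x + 0) (m x) = h (fst x) (nn N x)"
    "\<And>x. gq i Y (fst x + 0 + 1) (?m' x) = h (fst x + 1) (mdiff N (fst x) (nn N x))"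
    using m Y(1) gq_diff[OF Y(1) m(1), symmetric] b.closed0_diff[OF h nn_closed[OF N] N GR_module[OF Y(1)]] by simp_all
  note l = presents_lift[OF p Y b.closed0_ghom[OF h] m0]
  have e: "fg.ev 0 Y m ?m' \<in> closed0 A\<^sub>n fg.Gm Y" by (rule fg.ev_closed0[OF Y(1) m(1)])
  obtain f where f: "f \<in> closed0 A\<^sub>n \<Gamma> Y" "\<And>j g. g \<in> carrier (mgr fg.Gm j) \<Longrightarrow> f j (\<pi> j g) = fg.ev 0 Y m ?m' j g"
    by (rule factor_closed0[OF G \<Gamma> Y(1) \<pi> e], use l(2) in simp, rule that)
  show thesis by (rule that[OF f(1)]) (use f(2) l(1) in simp)
qed

lemma presents_lift_htpy:
  assumes p: "presents i N \<Gamma> \<pi>" and Y: "isM Y" "\<And>j y. y \<in> carrier (mgr Y j) \<Longrightarrow> T (Suc i) Y j y = \<zero>\<^bsub>mgr Y j\<^esub>"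
    and h: "h \<in> ghom A (- 1) N (GR i Y)"
  obtains f where "f \<in> ghom A\<^sub>n (- 1) \<Gamma> Y" "\<And>j g. g \<in> carrier (mgr fg.Gm j) \<Longrightarrow> gq i Y (j - 1) (f j (\<pi> j g)) = h j (eps N j g)"
proof -
  note N = presentsD(1)[OF p] and \<Gamma> = presentsD(3)[OF p] and \<pi> = presentsD(4)[OF p] and G = fg.Gm_module
  have "\<exists>m\<in>carrier (mgr Y (fst x + - 1)). gq i Y (fst x + - 1) m = h (fst x) (nn N x)" for x
    using GR_E[OF Y(1) b.ghom_closed[OF h nn_closed[OF N]]] by metis
  then obtain m where m: "\<And>x. m x \<in> carrier (mgr Y (fst x + - 1))" "\<And>x. gq i Y (fst x + - 1) (m x) = h (fst x) (nn N x)" by metis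
  have "\<exists>m\<in>carrier (mgr Y (fst x + - 1 + 1)). gq i Y (fst x + - 1 + 1) m = h (fst x + 1) (mdiff N (fst x) (nn N x))" for x
  proof -
    have "h (fst x + 1) (mdiff N (fst x) (nn N x)) \<in> carrier (mgr (GR i Y) (fst x + - 1 + 1))"
      using b.h_closed'(3)[OF h nn_closed[OF N] N GR_module[OF Y(1)]] by simp
    then show ?thesis using GR_E[OF Y(1)] by metis
  qed
  then obtain m' where m': "\<And>x. m' x \<in> carrier (mgr Y (fst x + - 1 + 1))"
    "\<And>x. gq i Y (fst x + - 1 + 1) (m' x) = h (fst x + 1) (mdiff N (fst x) (nn N x))" by metis
  note l = presents_lift[OF p Y h m(1) m'(1) m(2) m'(2)]
  note e = fg.ev_ghom[OF Y(1) m(1) m'(1)]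
  obtain f where f: "f \<in> ghom A\<^sub>n (- 1) \<Gamma> Y" "\<And>j g. g \<in> carrier (mgr fg.Gm j) \<Longrightarrow> f j (\<pi> j g) = fg.ev (- 1) Y m m' j g"
    by (rule factor_ghom[OF G \<Gamma> Y(1) \<pi> e]) (use l(2) in simp, rule that)
  show thesis by (rule that[OF f(1)]) (use f(2) l(1) in simp)
qed

end

section \<open>Full faithfulness on the i-th subcategory and the equivalence with D(A)\<close>

context deformation_universe
begin

text \<open>Being killed by t^(i+1) is a condition on the module and not on its isomorphism class in
  the quotient, but \<open>presents_lift\<close> relies on it. By \<open>SS_reflect\<close> every
  object of \<open>TT i\<close> is isomorphic in the quotient to one of these.\<close>

definition SS where "SS i = {X \<in> TT i. \<forall>j. \<forall>y\<in>carrier (mgr X j). T (Suc i) X j y = \<zero>\<^bsub>mgr X j\<^esub>}"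

lemma SS_D: assumes "X \<in> SS i" shows "X \<in> TT i" "isM X" "y \<in> carrier (mgr X j) \<Longrightarrow> T (Suc i) X j y = \<zero>\<^bsub>mgr X j\<^esub>"
  using assms unfolding SS_def TT_def by blast+

text \<open>Closed maps to a module killed by t^(i+1) factor strictly through the truncation of
  their source, before any passage to homotopy classes. The truncation is inverted in the quotient
  by \<open>truncation_W\<close>.\<close>

lemma SS_reflect:
  assumes X: "X \<in> TT i"
  shows "\<exists>X'\<in>SS i. \<exists>q\<in>fr.W X X'. \<forall>Y\<in>SS i. \<forall>f\<in>Hom H X Y. \<exists>f'\<in>Hom H X' Y. f = fr.c X X' Y f' q"
proof -
  have M: "isM X" using X by (simp add: TT_def)
  obtain Q :: "('k, 'a, 'm) def_mod" and \<pi> where Q: "isM Q" "surj_map X Q \<pi>"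
    "\<And>j x. x \<in> carrier (mgr X j) \<Longrightarrow> \<pi> j x = \<zero>\<^bsub>mgr Q j\<^esub> \<longleftrightarrow> x \<in> tp X (Suc i) j"
    "\<And>l. l < Suc i \<Longrightarrow> qis l X Q \<pi>" "\<And>l. Suc i \<le> l \<Longrightarrow> acyc l Q"
    "\<And>j y. y \<in> carrier (mgr Q j) \<Longrightarrow> T (Suc i) Q j y = \<zero>\<^bsub>mgr Q j\<^esub>"
    by (rule truncation_exists[OF M, of "Suc i"], rule that)
  note W = truncation_W[OF X Q(1,2,4,5)] and \<pi> = surj_mapD[OF Q(2)]
  have "\<exists>f'\<in>Hom H Q Y. F = fr.c X Q Y f' (hcls A\<^sub>n X Q \<pi>)" if Y: "Y \<in> SS i" and F: "F \<in> Hom H X Y" for Y F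
  proof -
    obtain f where f: "f \<in> closed0 A\<^sub>n X Y" "F = hcls A\<^sub>n X Y f" by (rule Hot_homE[OF F])
    have ker: "f j x = \<zero>\<^bsub>mgr Y j\<^esub>" if x: "x \<in> carrier (mgr X j)" "\<pi> j x = \<zero>\<^bsub>mgr Q j\<^esub>" for j x
    proof -
      obtain m where m: "m \<in> carrier (mgr X j)" "x = T (Suc i) X j m" using x Q(3)[OF x(1)] by (auto elim: tpE)
      then show ?thesis using T_ghom[OF closed0_ghom[OF f(1)] m(1) SS_D(2)[OF Y], of "Suc i"] SS_D(3)[OF Y closed0_closed[OF f(1) m(1)]] by simp
    qed
    obtain g where g: "g \<in> closed0 A\<^sub>n Q Y" "\<And>j x. x \<in> carrier (mgr X j) \<Longrightarrow> g j (\<pi> j x) = f j x"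
      by (rule factor_closed0[OF M Q(1) SS_D(2)[OF Y] Q(2) f(1)], rule ker, assumption, assumption, rule that)
    have "fr.c X Q Y (hcls A\<^sub>n Q Y g) (hcls A\<^sub>n X Q \<pi>) = hcls A\<^sub>n X Y f"
      unfolding Hot_comp[OF M Q(1) SS_D(2)[OF Y] \<pi> g(1)]
      by (rule hcls_cong[OF M SS_D(2)[OF Y] closed0_comp[OF \<pi> g(1) M Q(1) SS_D(2)[OF Y]] f(1)]) (rule g(2))
    then show ?thesis using hcls_hom[OF g(1)] f(2) by metis
  qed
  moreover have "Q \<in> SS i" unfolding SS_def using W(2) Q(6) by blast
  ultimately show ?thesis using W(1) by blast
qed

text \<open>Source and target have acyclic pieces away from i, so only the i-th piece has to be
  tested, and \<open>qis_Gm_map\<close> reads it off from the image under the functor.\<close>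

lemma SS_conservative:
  assumes X: "X \<in> SS i" "Y \<in> SS i" and F: "F \<in> Hom H X Y"
    and W: "FM (Gr_Hot k A n i) X Y F \<in> b.fr.W (GR i X) (GR i Y)"
  shows "F \<in> fr.W X Y"
proof -
  note M = SS_D(2)[OF X(1)] SS_D(2)[OF X(2)]
  obtain f where f: "f \<in> closed0 A\<^sub>n X Y" "F = hcls A\<^sub>n X Y f" by (rule Hot_homE[OF F])
  have i: "qis i X Y f"
    using W qis_Gm_map[OF M f(1)] unfolding f(2) Gr_Hot_simps(2)[OF M f(1)]
      b.cone_in_hcls[OF GR_module[OF M(1)] GR_module[OF M(2)] Gm_map_closed0[OF M f(1)]] by blast
  have "qis j X Y f" if "j \<le> n" for j
  proof (cases "j = i")
    case False
    then have "acyc j X" "acyc j Y" using SS_D(1)[OF X(1)] SS_D(1)[OF X(2)] that by (simp_all add: TT_def)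
    then show ?thesis by (rule qis_acyc[OF M f(1)])
  qed (use i in simp)
  then show ?thesis unfolding f(2) using cone_in_hcls[OF M f(1)] by blast
qed

text \<open>
  If the induced maps are homotopic, lift the homotopy; the remaining difference vanishes on the
  multiples of \<open>tpow i\<close>, hence factors through an acyclic module.
\<close>

lemma presents_faithful:
  assumes p: "presents i N \<Gamma> \<pi>" and Y: "Y \<in> SS i"
    and f: "f \<in> closed0 A\<^sub>n \<Gamma> Y" "g \<in> closed0 A\<^sub>n \<Gamma> Y"
    and eq: "(Gm_map i \<Gamma> Y f, Gm_map i \<Gamma> Y g) \<in> htpy_rel A (GR i \<Gamma>) (GR i Y)"
  shows "fr.Q \<Gamma> Y (hcls A\<^sub>n \<Gamma> Y f) = fr.Q \<Gamma> Y (hcls A\<^sub>n \<Gamma> Y g)"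
proof -
  note N = presentsD(1)[OF p] and \<Gamma> = presentsD(3)[OF p] and \<pi> = presentsD(4)[OF p]
  note M = SS_D(2)[OF Y] and G = GR_module[OF \<Gamma>, of i] GR_module[OF SS_D(2)[OF Y], of i]
  obtain h where h: "h \<in> ghom A (- 1) (GR i \<Gamma>) (GR i Y)"
    "\<And>j x. x \<in> carrier (mgr (GR i \<Gamma>) j) \<Longrightarrow> Gm_map i \<Gamma> Y g j x = Gm_map i \<Gamma> Y f j x \<oplus>\<^bsub>mgr (GR i Y) j\<^esub> b.bd (GR i \<Gamma>) (GR i Y) h j x"
    by (rule b.htpyE[OF eq G], rule that)
  obtain a where a: "a \<in> closed0 A N (GR i \<Gamma>)" "\<And>j g. g \<in> carrier (mgr fg.Gm j) \<Longrightarrow> a j (eps N j g) = gq i \<Gamma> j (\<pi> j g)"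
    by (rule presents_iso[OF p], rule that)
  obtain k where k: "k \<in> ghom A\<^sub>n (- 1) \<Gamma> Y" "\<And>j g. g \<in> carrier (mgr fg.Gm j) \<Longrightarrow> gq i Y (j - 1) (k j (\<pi> j g)) = h j (a j (eps N j g))"
    by (rule presents_lift_htpy[OF p M SS_D(3)[OF Y] b.bd_comp(4)[OF N G h(1) a(1)]], assumption, rule that)
  have kh: "gq i Y (j - 1) (k j x) = h j (gq i \<Gamma> j x)" if "x \<in> carrier (mgr \<Gamma> j)" for j x
    using surj_mapE[OF \<pi> that] k(2) a(2) by metis
  \<comment> \<open>\<open>k\<close> covers the given homotopy only on the i-th piece. The
    difference \<delta> that remains is invisible there: \<open>gq i Y\<close> kills it.\<close>
  define \<delta> where "\<delta> j x = (g j x \<ominus>\<^bsub>mgr Y j\<^esub> f j x) \<ominus>\<^bsub>mgr Y j\<^esub> bd \<Gamma> Y k j x" for j x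
  have \<delta>: "\<delta> \<in> closed0 A\<^sub>n \<Gamma> Y"
    unfolding \<delta>_def by (rule closed0_comb(2)[OF \<Gamma> M closed0_comb(2)[OF \<Gamma> M f(2,1)] bd_closed0[OF \<Gamma> M k(1)]])
  have \<delta>0: "gq i Y j (\<delta> j x) = \<zero>\<^bsub>mgr (GR i Y) j\<^esub>" if x: "x \<in> carrier (mgr \<Gamma> j)" for j x
  proof -
    note c = closed0_closed[OF f(1) x] closed0_closed[OF f(2) x] bd_closed[OF k(1) x \<Gamma> M]
    have dx: "mdiff \<Gamma> j x \<in> carrier (mgr \<Gamma> (j + 1))" using x \<Gamma> by simp
    note hc = h_closed'[OF k(1) x \<Gamma> M]
    have "gq i Y j (bd \<Gamma> Y k j x) = b.bd (GR i \<Gamma>) (GR i Y) h j (gq i \<Gamma> j x)"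
      unfolding b.bd_def bd_def gq_diff[OF \<Gamma> x] kh[OF x, symmetric] kh[OF dx, symmetric]
      using gq_diff[OF M hc(1), of i] closed0_add[OF gq_closed0[OF M] hc(2,3), of i] by simp
    moreover have "gq i Y j (g j x) = gq i Y j (f j x) \<oplus>\<^bsub>mgr (GR i Y) j\<^esub> b.bd (GR i \<Gamma>) (GR i Y) h j (gq i \<Gamma> j x)"
      using h(2)[OF gq_closed[OF \<Gamma> x]] Gm_map_gq[OF \<Gamma> M f(1) x, of i] Gm_map_gq[OF \<Gamma> M f(2) x, of i] by simp
    moreover have "g j x \<ominus>\<^bsub>mgr Y j\<^esub> f j x \<in> carrier (mgr Y j)" using c M by simp
    ultimately show ?thesis
      unfolding \<delta>_def using c gq_closed[OF M c(1), of i] gq_closed[OF M c(3), of i] G(2)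
      by (simp add: gq_minus[OF M] ab_ac)
  qed
  obtain Q :: "('k, 'a, 'm) def_mod" and \<tau> where Q: "isM Q" "surj_map \<Gamma> Q \<tau>"
    "\<And>j x. x \<in> carrier (mgr \<Gamma> j) \<Longrightarrow> \<tau> j x = \<zero>\<^bsub>mgr Q j\<^esub> \<longleftrightarrow> x \<in> tp \<Gamma> i j"
    "\<And>l. l < i \<Longrightarrow> qis l \<Gamma> Q \<tau>" "\<And>l. i \<le> l \<Longrightarrow> acyc l Q"
    by (rule truncation_exists[OF \<Gamma>, of i], rule that)
  note \<tau> = surj_mapD[OF Q(2)]
  \<comment> \<open>\<open>Q\<close> is \<Gamma> modulo t^i: its pieces below i are those of
    \<Gamma>, which are acyclic, and from i on the pieces vanish.\<close>
  have "acyc l Q" if "l \<le> n" for l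
  proof (cases "l < i")
    case True
    then have "acyc l \<Gamma>" using presents_TT[OF p] that by (simp add: TT_def)
    then show ?thesis using acyc_qis[OF \<Gamma> Q(1) \<tau> Q(4)[OF True]] by blast
  qed (use Q(5) in simp)
  then have QN: "Q \<in> NN" using Q(1) by (simp add: NN_def)
  have ker: "\<delta> j x = \<zero>\<^bsub>mgr Y j\<^esub>" if x: "x \<in> carrier (mgr \<Gamma> j)" "\<tau> j x = \<zero>\<^bsub>mgr Q j\<^esub>" for j x
  proof -
    obtain m where m: "m \<in> carrier (mgr \<Gamma> j)" "x = T i \<Gamma> j m" using x Q(3)[OF x(1)] by (auto elim: tpE)
    have "T i Y j (\<delta> j m) \<in> tp Y (Suc i) j" using \<delta>0[OF m(1)] gq_zero_iff[OF M closed0_closed[OF \<delta> m(1)]] by blast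
    then have "T i Y j (\<delta> j m) = \<zero>\<^bsub>mgr Y j\<^esub>" using SS_D(3)[OF Y] by (auto elim!: tpE)
    then show ?thesis using T_ghom[OF closed0_ghom[OF \<delta>] m(1) M, of i] m(2) by simp
  qed
  obtain \<delta>' where \<delta>': "\<delta>' \<in> closed0 A\<^sub>n Q Y" "\<And>j x. x \<in> carrier (mgr \<Gamma> j) \<Longrightarrow> \<delta>' j (\<tau> j x) = \<delta> j x"
    by (rule factor_closed0[OF \<Gamma> Q(1) M Q(2) \<delta>], rule ker, assumption, assumption, rule that)
  obtain P :: "('k, 'a, 'm) def_mod" and s where P: "isM P" "s \<in> closed0 A\<^sub>n P \<Gamma>" "hcls A\<^sub>n P \<Gamma> s \<in> fr.W P \<Gamma>"
    "(\<lambda>i m. \<zero>\<^bsub>mgr Q i\<^esub>, \<lambda>i z. \<tau> i (s i z)) \<in> htpy_rel A\<^sub>n P Q"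
    by (rule null_refine[OF \<Gamma> Q(1) \<tau> QN], rule that)
  obtain u where u: "u \<in> ghom A\<^sub>n (- 1) P Q" "\<And>j z. z \<in> carrier (mgr P j) \<Longrightarrow> \<tau> j (s j z) = \<zero>\<^bsub>mgr Q j\<^esub> \<oplus>\<^bsub>mgr Q j\<^esub> bd P Q u j z"
    by (rule htpyE[OF P(4,1) Q(1)], rule that)
  note k1 = bd_comp(4)[OF P(1) \<Gamma> M k(1) P(2)] and k2 = bd_comp(2)[OF P(1) Q(1) M u(1) \<delta>'(1)]
  \<comment> \<open>Over \<open>P\<close> the projection to \<open>Q\<close> is null-homotopic by
    \<open>u\<close>. As \<delta> factors through \<open>Q\<close> as \<delta>', composing \<delta>'
    with \<open>u\<close> makes \<delta> null-homotopic over \<open>P\<close>, and adding this to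
    \<open>k\<close> gives a homotopy from \<open>f\<close> to \<open>g\<close>.\<close>
  define w where "w j z = k j (s j z) \<oplus>\<^bsub>mgr Y (j - 1)\<^esub> \<delta>' (j - 1) (u j z)" for j z
  have w: "w \<in> ghom A\<^sub>n (- 1) P Y" unfolding w_def using ghom_comb(1)[OF P(1) M k1 k2] by simp
  note fs = closed0_comp[OF P(2) f(1) P(1) \<Gamma> M] and gs = closed0_comp[OF P(2) f(2) P(1) \<Gamma> M]
  have "(\<lambda>j z. f j (s j z), \<lambda>j z. g j (s j z)) \<in> htpy_rel A\<^sub>n P Y"
  proof (rule htpyI[OF P(1) M fs gs w])
    fix j z assume z: "z \<in> carrier (mgr P j)"
    note sz = closed0_closed[OF P(2) z]
    note c = closed0_closed[OF f(1) sz] closed0_closed[OF f(2) sz] bd_closed[OF k(1) sz \<Gamma> M]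
    have "bd P Q u j z \<in> carrier (mgr Q j)" using bd_closed[OF u(1) z P(1) Q(1)] .
    then have "\<delta>' j (bd P Q u j z) = \<delta> j (s j z)" using u(2)[OF z] \<delta>'(2)[OF sz] Q(1) by simp
    then have "bd P Y w j z = bd \<Gamma> Y k j (s j z) \<oplus>\<^bsub>mgr Y j\<^esub> \<delta> j (s j z)"
      unfolding w_def bd_add[OF P(1) M k1 k2 z] bd_comp(3)[OF P(1) \<Gamma> M k(1) P(2) z] bd_comp(1)[OF P(1) Q(1) M u(1) \<delta>'(1) z] by simp
    then show "g j (s j z) = f j (s j z) \<oplus>\<^bsub>mgr Y j\<^esub> bd P Y w j z"
      using c M by (simp add: \<delta>_def ab_ac)
  qed
  then have "fr.c P \<Gamma> Y (hcls A\<^sub>n \<Gamma> Y f) (hcls A\<^sub>n P \<Gamma> s) = fr.c P \<Gamma> Y (hcls A\<^sub>n \<Gamma> Y g) (hcls A\<^sub>n P \<Gamma> s)"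
    unfolding Hot_comp[OF P(1) \<Gamma> M P(2) f(1)] Hot_comp[OF P(1) \<Gamma> M P(2) f(2)]
    using hcls_eq_iff[OF P(1) M fs gs] by blast
  then show ?thesis
    by (intro fr.quot_eqI[of \<Gamma> Y _ _ P "hcls A\<^sub>n P \<Gamma> s"]) (use M \<Gamma> P hcls_hom[OF f(1)] hcls_hom[OF f(2)] in simp_all)
qed

lemma Gr_equivalence:
  assumes i: "i \<le> n"
  shows "cat_equivalence (full_sub DD (TT i)) (verdier b.H b.NN) (verdier_func b.H b.NN (Gr_Hot k A n i))"
proof -
  interpret gr: frac_functor H NN b.H b.NN "Gr_Hot k A n i" by (rule Gr_frac_functor[OF i])
  \<comment> \<open>The criterion asks for \<open>Gam\<close> only on objects, so the presentations
    of different modules may be chosen independently.\<close>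
  obtain \<Gamma> \<pi> where p: "\<And>N. b.isM N \<Longrightarrow> presents i N (\<Gamma> N) (\<pi> N)" using presents_exists[OF _ i] by metis
  have "\<forall>N. b.isM N \<longrightarrow> (\<exists>a. a \<in> closed0 A N (GR i (\<Gamma> N)) \<and> iso_in b.H N (GR i (\<Gamma> N)) (hcls A N (GR i (\<Gamma> N)) a) \<and>
      (\<forall>j. \<forall>g\<in>carrier (mgr fg.Gm j). a j (eps N j g) = gq i (\<Gamma> N) j (\<pi> N j g)))"
  proof (intro allI impI)
    fix N :: "('k, 'a, 'm) cdg_mod" assume N: "b.isM N"
    show "\<exists>a. a \<in> closed0 A N (GR i (\<Gamma> N)) \<and> iso_in b.H N (GR i (\<Gamma> N)) (hcls A N (GR i (\<Gamma> N)) a) \<and>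
      (\<forall>j. \<forall>g\<in>carrier (mgr fg.Gm j). a j (eps N j g) = gq i (\<Gamma> N) j (\<pi> N j g))"
      by (rule presents_iso[OF p[OF N]]) blast
  qed
  then obtain a where a: "\<And>N. b.isM N \<Longrightarrow> a N \<in> closed0 A N (GR i (\<Gamma> N))"
    "\<And>N. b.isM N \<Longrightarrow> iso_in b.H N (GR i (\<Gamma> N)) (hcls A N (GR i (\<Gamma> N)) (a N))"
    "\<And>N j g. b.isM N \<Longrightarrow> g \<in> carrier (mgr fg.Gm j) \<Longrightarrow> a N j (eps N j g) = gq i (\<Gamma> N) j (\<pi> N j g)"
    by metis
  show ?thesis
  proof (rule gr.equivalence_criterion[of "SS i" "TT i" \<Gamma> "\<lambda>N. hcls A N (GR i (\<Gamma> N)) (a N)"], unfold Gr_Hot_simps(1))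
    show "SS i \<subseteq> TT i" "TT i \<subseteq> Obj H" by (auto simp: SS_def TT_def)
    show "Z \<in> TT i" if h: "X \<in> TT i" "Z \<in> Obj H" "s \<in> fr.W Z X" for X Z s
    proof -
      have M: "isM X" "isM Z" using h by (simp_all add: TT_def)
      show ?thesis unfolding TT_def using W_acyc[OF M(2,1) h(3)] M h(1) by (auto simp: TT_def)
    qed
    show "\<exists>X'\<in>SS i. \<exists>q\<in>fr.W X X'. \<forall>Y\<in>SS i. \<forall>f\<in>Hom H X Y. \<exists>f'\<in>Hom H X' Y. f = fr.c X X' Y f' q" if "X \<in> TT i" for X
      by (rule SS_reflect[OF that])
    show "f \<in> fr.W X Y" if "X \<in> SS i" "Y \<in> SS i" "f \<in> Hom H X Y" "FM (Gr_Hot k A n i) X Y f \<in> b.fr.W (GR i X) (GR i Y)" for X Y f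
      by (rule SS_conservative[OF that])
    show "f \<in> b.fr.W X Y" if "X \<in> Obj b.H" "Y \<in> Obj b.H" "iso_in b.H X Y f" for X Y f
      by (rule b.iso_cone_in) (use that in simp_all)
    show "\<Gamma> N \<in> SS i" if "N \<in> Obj b.H" for N
    proof -
      have N: "b.isM N" using that by simp
      show ?thesis unfolding SS_def using presents_TT[OF p[OF N]] presents_T[OF p[OF N] order_refl] by blast
    qed
    show "iso_in b.H N (GR i (\<Gamma> N)) (hcls A N (GR i (\<Gamma> N)) (a N))" if "N \<in> Obj b.H" for N
      using a(2) that by simp
    show "\<exists>h\<in>Hom H (\<Gamma> N) Y. b.fr.c N (GR i (\<Gamma> N)) (GR i Y) (FM (Gr_Hot k A n i) (\<Gamma> N) Y h) (hcls A N (GR i (\<Gamma> N)) (a N)) = g"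
      if h: "N \<in> Obj b.H" "Y \<in> SS i" "g \<in> Hom b.H N (GR i Y)" for N Y g
    proof -
      have N: "b.isM N" using h(1) by simp
      note M = SS_D(2)[OF h(2)] and GM = presentsD(3)[OF p[OF N]]
      obtain g0 where g0: "g0 \<in> closed0 A N (GR i Y)" "g = hcls A N (GR i Y) g0" by (rule b.Hot_homE[OF h(3)])
      obtain f where f: "f \<in> closed0 A\<^sub>n (\<Gamma> N) Y" "\<And>j x. x \<in> carrier (mgr fg.Gm j) \<Longrightarrow> gq i Y j (f j (\<pi> N j x)) = g0 j (eps N j x)"
        by (rule presents_lift0[OF p[OF N] M SS_D(3)[OF h(2)] g0(1)], assumption, rule that)
      note Gf = Gm_map_closed0[OF GM M f(1), of i] and G = GR_module[OF GM, of i] GR_module[OF M, of i]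
      have "Gm_map i (\<Gamma> N) Y f j (a N j x) = g0 j x" if x: "x \<in> carrier (mgr N j)" for j x
      proof -
        have "x \<in> carrier (mgr (red.infl N) j)" using x by simp
        then obtain z where z: "z \<in> carrier (mgr fg.Gm j)" "x = eps N j z" by (rule surj_mapE[OF eps_surj[OF N]])
        show ?thesis unfolding z(2) a(3)[OF N z(1)]
          using Gm_map_gq[OF GM M f(1) closed0_closed[OF surj_mapD[OF presentsD(4)[OF p[OF N]]] z(1)]] f(2)[OF z(1)] by simp
      qed
      then have "hcls A N (GR i Y) (\<lambda>j x. Gm_map i (\<Gamma> N) Y f j (a N j x)) = g"
        unfolding g0(2) by (intro b.hcls_cong[OF N G(2) b.closed0_comp[OF a(1)[OF N] Gf N G] g0(1)])
      then have "b.fr.c N (GR i (\<Gamma> N)) (GR i Y) (FM (Gr_Hot k A n i) (\<Gamma> N) Y (hcls A\<^sub>n (\<Gamma> N) Y f)) (hcls A N (GR i (\<Gamma> N)) (a N)) = g"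
        unfolding Gr_Hot_simps(2)[OF GM M f(1)] b.Hot_comp[OF N G a(1)[OF N] Gf] .
      then show ?thesis using hcls_hom[OF f(1)] by blast
    qed
    show "fr.Q (\<Gamma> N) Y F = fr.Q (\<Gamma> N) Y F'"
      if h: "N \<in> Obj b.H" "Y \<in> SS i" "F \<in> Hom H (\<Gamma> N) Y" "F' \<in> Hom H (\<Gamma> N) Y"
        "FM (Gr_Hot k A n i) (\<Gamma> N) Y F = FM (Gr_Hot k A n i) (\<Gamma> N) Y F'" for N Y F F'
    proof -
      have N: "b.isM N" using h(1) by simp
      note M = SS_D(2)[OF h(2)] and GM = presentsD(3)[OF p[OF N]]
      obtain f where f: "f \<in> closed0 A\<^sub>n (\<Gamma> N) Y" "F = hcls A\<^sub>n (\<Gamma> N) Y f" by (rule Hot_homE[OF h(3)])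
      obtain f' where f': "f' \<in> closed0 A\<^sub>n (\<Gamma> N) Y" "F' = hcls A\<^sub>n (\<Gamma> N) Y f'" by (rule Hot_homE[OF h(4)])
      have "(Gm_map i (\<Gamma> N) Y f, Gm_map i (\<Gamma> N) Y f') \<in> htpy_rel A (GR i (\<Gamma> N)) (GR i Y)"
        using h(5) unfolding f(2) f'(2) Gr_Hot_simps(2)[OF GM M f(1)] Gr_Hot_simps(2)[OF GM M f'(1)]
          b.hcls_eq_iff[OF GR_module[OF GM] GR_module[OF M] Gm_map_closed0[OF GM M f(1)] Gm_map_closed0[OF GM M f'(1)]] .
      then show ?thesis unfolding f(2) f'(2) by (rule presents_faithful[OF p[OF N] h(2) f(1) f'(1)])
    qed
  qed
qed

lemma n_acyclics_NN: "n_acyclics k A n A\<^sub>n = NN"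
  by (auto simp: n_acyclics_def NN_def acyclic_Gr)

lemma nDer_DD: "nDer k A n A\<^sub>n = DD"
  by (simp add: nDer_def n_acyclics_NN)

lemma only_Gr_TT: "(only_Gr k A n A\<^sub>n :: nat \<Rightarrow> ('k, 'a, 'm) def_mod set) = TT"
  by (rule ext) (auto simp: only_Gr_def TT_def nDer_DD acyclic_Gr)

end

theorem theorem6p7:
  fixes k :: "'k ring" and A :: "('k, 'a) cdg_alg" and n :: nat
    and A\<^sub>n :: "(nat \<Rightarrow> 'k, nat \<Rightarrow> 'a) cdg_alg"
    and D\<^sub>n :: "(('k, 'a, 'm) def_mod, (nat \<Rightarrow> 'k, nat \<Rightarrow> 'a, 'm) der_hom) tri_cat"
  assumes "cring k"
    and "dg_algebra k A"
    and "cdg_deformation k A n A\<^sub>n"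
    and universe_infinite: "infinite (UNIV :: 'm set)"
    and universe_large: "\<And>i. carrier (agr A i) \<lesssim> (UNIV :: 'm set)"
  defines "D\<^sub>n \<equiv> nDer k A n A\<^sub>n"
  shows "semiorthogonal_decomposition D\<^sub>n n (only_Gr k A n A\<^sub>n) \<and>
    (\<forall>i\<le>n. cat_equivalence (full_sub D\<^sub>n (only_Gr k A n A\<^sub>n i))
       (Der k A :: (('k, 'a, 'm) cdg_mod, ('k, 'a, 'm) der_hom) tri_cat) (Gr k A n i))"
proof -
  interpret deformation_universe k A n A\<^sub>n "TYPE('m)"
    by (intro deformation_universe.intro deformation_universe_axioms.intro) fact+
  show ?thesis
    unfolding D\<^sub>n_def nDer_DD only_Gr_TT Der_def Gr_def acyclics_NN
    using tau_semiorthogonal Gr_equivalence by blast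
qed

end
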